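(* Let $(M,\Pi)\stackrel{\phi}{\to}(B,\pi)$ be an NCI system of rank $r$ with compact fibers. Let $V$ be an open subset of $B$ and suppose that $\mathfrak G$ is an angle foliation on $\phi^{-1}(V)$ which is defined by local angle variables $\theta=(\theta_1,\dots,\theta_r)$ on $\phi^{-1}(V)$. Then: (1) $D_\theta$ is an integrable distribution of rank $r$ on $V$. (2) $D_\theta$ and $L_\theta$ are independent of the choice of local angle variables $\theta$ defining $\mathfrak G$. Therefore, $\mathfrak G$ defines an $r$-dimensional foliation $\mathfrak T_{\mathfrak G}$ of $V$ (with tangent distribution $D_\theta$) and a lattice bundle $L_{\mathfrak G}=L_\theta$ on $V$.
   Context: All manifolds and objects are smooth and real. For a Poisson manifold $(M,\Pi)$ write $\{f,g\}=\Pi(df,dg)$; the Hamiltonian vector field $X_h$ is given by $X_h(g)=\{g,h\}$, and $\Pi^\sharp:T^*M\to TM$ is the induced bundle map, with $\Pi^\sharp(dh)=-X_h$. For an $\mathbb R/\mathbb Z$-valued function $\theta$, $d\theta$ is an ordinary 1-form and $X_\theta:=-\Pi^\sharp(d\theta)$. A (local) first integral of a foliation is a (locally defined) function constant on its leaves. An abstract NCI system of rank $r$ on $(M,\Pi)$ is an $r$-dimensional foliation $\mathfrak F$ of $M$ whose tangent bundle is spanned by Hamiltonian vector fields of local first integrals: each $m\in M$ has a neighborhood on which there are first integrals $f_1,\dots,f_r$ of $\mathfrak F$ such that $X_{f_1},\dots,X_{f_r}$ span $T\mathfrak F$ at every point. An NCI system $(M,\Pi)\stackrel{\phi}{\to}(B,\pi)$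 of rank $r$ is such an abstract NCI system whose leaf space $B$ is a smooth Hausdorff manifold; $\phi:M\to B$ is the quotient map, a surjective submersion whose fibers are the (connected) leaves of $\mathfrak F$, and $\pi$ is the unique Poisson structure on $B$ making $\phi$ a Poisson map. It has compact fibers if all fibers of $\phi$ are compact. Action lattice sheaf. The action bundle $E\to B$ is the rank $r$ vector bundle with fiber $E_b=\operatorname{Ker}(\pi_b^\sharp)/\{\xi\in T_b^*B\mid \Pi_m^\sharp(\phi^*\xi)=0\}$ ($m\in\phi^{-1}(b)$ arbitrary); its sheaf of sections is $\operatorname{Ker}\pi^\sharp/\operatorname{Ker}(\Pi^\sharp\circ\phi^* )$. For $\alpha\in E_b$ the action vector field on $\phi^{-1}(b)$ is $X_\alpha(m)=\Pi_m^\sharp(\phi^*\alpha)$; for a section $e$ of $E$ over $V$, $X_e$ is the vector field on $\phi^{-1}(V)$ restricting to $X_{e(b)}$ on each $\phi^{-1}(b)$. $L_b:=\{\alpha\in E_b\mid \text{the time 1 flow of }X_\alpha\text{ is the identity}\}$ is a lattice in $E_b$; these form a bundle $L\to B$ with fiber $\mathbb Z^r$, and $\mathcal L_B$ is its sheaf of local sections. A trivialization of $\mathcal L_B(V)$ is an $r$-tuple of sections over $V$ whose values at each $b\in V$ form a $\mathbb Z$-basis of $L_b$. Angle variables and foliations. For a trivialization $(e_1,\dots,e_r)$ of $\mathcal L_B(V)$, an $r$-tuple $\theta=(\theta_1,\dots,\theta_r)$ of $\mathbb R/\mathbb Z$-valued functions on $\phi^{-1}(V)$ is a set of local angle variables adapted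 to it if $\{\theta_i,\theta_j\}=0$ and $X_{e_i}(\theta_j)=\delta_{i,j}$ for all $i,j$. Its level sets define a foliation $\mathfrak G_\theta$ of $\phi^{-1}(V)$; $\theta$ defines $\mathfrak G$ if $\mathfrak G=\mathfrak G_\theta$. A foliation $\mathfrak G$ of $\phi^{-1}(V)$ is an angle foliation if (1) it is transverse to the fibers of $\phi$ (complementary: $T_mM=T_m\mathfrak G\oplus\ker d_m\phi$); (2) it is invariant under the flow of the action vector field of any element of $\mathcal L_B(V)$; (3) it is coisotropic, i.e. $\Pi^\sharp((T\mathfrak G)^\circ)\subset T\mathfrak G$. Given local angle variables $\theta$, each $X_{\theta_i}$ is $\phi$-related to a unique vector field $Y_{\theta_i}=\phi_*X_{\theta_i}$ on $V$; $D_\theta$ is the (a priori singular) distribution on $V$ spanned by $Y_{\theta_1},\dots,Y_{\theta_r}$, and $L_\theta\subset D_\theta$ is the (a priori singular) lattice subbundle generated over $\mathbb Z$ by $Y_{\theta_1},\dots,Y_{\theta_r}$ at each point. *)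

theory Defs
  imports "HOL-Analysis.Analysis" "HOL-Library.Disjoint_Sets"
begin

section \<open>Smooth maps between Euclidean spaces\<close>

text \<open>On an open subset of a Euclidean space, \<open>Ck_on k S f\<close> says that all iterated directional
  derivatives of \<open>f\<close> of order at most \<open>k\<close> exist and are continuous on \<open>S\<close>.\<close>

primrec Ck_on :: "nat \<Rightarrow> 'e::euclidean_space set \<Rightarrow> ('e \<Rightarrow> 'g::real_normed_vector) \<Rightarrow> bool" where
  "Ck_on 0 S f \<longleftrightarrow> continuous_on S f"
| "Ck_on (Suc k) S f \<longleftrightarrow> (\<forall>x\<in>S. f differentiable (at x)) \<and>
     (\<forall>v. Ck_on k S (\<lambda>x. frechet_derivative f (at x) v))"

definition smooth_on :: "'e::euclidean_space set \<Rightarrow> ('e \<Rightarrow> 'g::real_normed_vector) \<Rightarrow> bool" where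
  "smooth_on S f \<longleftrightarrow> (\<forall>k. Ck_on k S f)"


section \<open>Smooth manifolds\<close>

text \<open>A manifold is a Hausdorff second countable type \<open>'a\<close> together with a smooth atlas \<open>A\<close> with
  values in a Euclidean space \<open>'e\<close>; its dimension is \<open>DIM('e)\<close>. A chart is a pair
  of its domain and its coordinate map.\<close>

type_synonym ('a, 'e) chart = "'a set \<times> ('a \<Rightarrow> 'e)"

definition chart_inv :: "('a, 'e) chart \<Rightarrow> 'e \<Rightarrow> 'a" where
  "chart_inv c = inv_into (fst c) (snd c)"

definition is_chart :: "('a::topological_space, 'e::euclidean_space) chart \<Rightarrow> bool" where
  "is_chart c \<longleftrightarrow> open (fst c) \<and> open (snd c ` fst c) \<and>
     homeomorphism (fst c) (snd c ` fst c) (snd c) (chart_inv c)"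

definition compatible_charts ::
  "('a, 'e::euclidean_space) chart \<Rightarrow> ('a, 'e) chart \<Rightarrow> bool" where
  "compatible_charts c c' \<longleftrightarrow>
     smooth_on (snd c ` (fst c \<inter> fst c')) (snd c' \<circ> chart_inv c) \<and>
     smooth_on (snd c' ` (fst c \<inter> fst c')) (snd c \<circ> chart_inv c')"

definition smooth_atlas ::
  "('a::{t2_space,second_countable_topology}, 'e::euclidean_space) chart set \<Rightarrow> bool" where
  "smooth_atlas A \<longleftrightarrow> (\<forall>c\<in>A. is_chart c) \<and> (\<forall>c\<in>A. \<forall>c'\<in>A. compatible_charts c c') \<and>
     (\<Union>c\<in>A. fst c) = UNIV"

text \<open>Charts of the maximal atlas containing \<open>A\<close>.\<close>

definition smooth_chart ::
  "('a::topological_space, 'e::euclidean_space) chart set \<Rightarrow> ('a, 'e) chart \<Rightarrow> bool" where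
  "smooth_chart A c \<longleftrightarrow> is_chart c \<and> (\<forall>c'\<in>A. compatible_charts c c')"

text \<open>Every point \<open>p\<close> has a preferred chart, and the tangent space at \<open>p\<close> is identified with the
  model space \<open>'e\<close> by means of that chart. Accordingly, the cotangent space at \<open>p\<close> is the type
  of linear functionals on \<open>'e\<close>, and a vector field is a function \<open>'a \<Rightarrow> 'e\<close>, which need not be
  continuous as such a function when it is a smooth vector field.\<close>

definition chart_at :: "('a, 'e) chart set \<Rightarrow> 'a \<Rightarrow> ('a, 'e) chart" where
  "chart_at A p = (SOME c. c \<in> A \<and> p \<in> fst c)"

type_synonym 'e covector = "'e \<Rightarrow>\<^sub>L real"

definition smooth_fun ::
  "('a, 'e::euclidean_space) chart set \<Rightarrow> 'a set \<Rightarrow> ('a \<Rightarrow> 'g::real_normed_vector) \<Rightarrow> bool" where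
  "smooth_fun A W f \<longleftrightarrow> (\<forall>c\<in>A. smooth_on (snd c ` (fst c \<inter> W)) (f \<circ> chart_inv c))"

definition tangent_map ::
  "('a, 'e::euclidean_space) chart set \<Rightarrow> ('a \<Rightarrow> 'g::real_normed_vector) \<Rightarrow> 'a \<Rightarrow> 'e \<Rightarrow> 'g" where
  "tangent_map A f p =
     frechet_derivative (f \<circ> chart_inv (chart_at A p)) (at (snd (chart_at A p) p))"

definition differential ::
  "('a, 'e::euclidean_space) chart set \<Rightarrow> ('a \<Rightarrow> real) \<Rightarrow> 'a \<Rightarrow> 'e covector" where
  "differential A f p = Blinfun (tangent_map A f p)"

definition smooth_map ::
  "('a::topological_space, 'e::euclidean_space) chart set \<Rightarrow>
   ('b::topological_space, 'f::euclidean_space) chart set \<Rightarrow> ('a \<Rightarrow> 'b) \<Rightarrow> bool" where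
  "smooth_map A A' \<phi> \<longleftrightarrow> continuous_on UNIV \<phi> \<and>
     (\<forall>c\<in>A'. smooth_fun A (\<phi> -` fst c) (snd c \<circ> \<phi>))"

definition map_differential ::
  "('a, 'e::euclidean_space) chart set \<Rightarrow> ('b, 'f::euclidean_space) chart set \<Rightarrow>
   ('a \<Rightarrow> 'b) \<Rightarrow> 'a \<Rightarrow> 'e \<Rightarrow> 'f" where
  "map_differential A A' \<phi> p = tangent_map A (snd (chart_at A' (\<phi> p)) \<circ> \<phi>) p"

definition pullback ::
  "('a, 'e::euclidean_space) chart set \<Rightarrow> ('b, 'f::euclidean_space) chart set \<Rightarrow>
   ('a \<Rightarrow> 'b) \<Rightarrow> 'a \<Rightarrow> 'f covector \<Rightarrow> 'e covector" where
  "pullback A A' \<phi> p \<xi> = Blinfun (\<lambda>v. blinfun_apply \<xi> (map_differential A A' \<phi> p v))"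

definition submersion ::
  "('a::topological_space, 'e::euclidean_space) chart set \<Rightarrow>
   ('b::topological_space, 'f::euclidean_space) chart set \<Rightarrow> ('a \<Rightarrow> 'b) \<Rightarrow> bool" where
  "submersion A A' \<phi> \<longleftrightarrow> smooth_map A A' \<phi> \<and> (\<forall>p. surj (map_differential A A' \<phi> p))"

definition smooth_vector_field ::
  "('a::topological_space, 'e::euclidean_space) chart set \<Rightarrow> 'a set \<Rightarrow> ('a \<Rightarrow> 'e) \<Rightarrow> bool" where
  "smooth_vector_field A V X \<longleftrightarrow> (\<forall>W f. open W \<and> W \<subseteq> V \<and> smooth_fun A W f \<longrightarrow>
     smooth_fun A W (\<lambda>p. blinfun_apply (differential A f p) (X p)))"

definition smooth_one_form ::
  "('a::topological_space, 'e::euclidean_space) chart set \<Rightarrow> 'a set \<Rightarrow> ('a \<Rightarrow> 'e covector) \<Rightarrow> bool" where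
  "smooth_one_form A V \<alpha> \<longleftrightarrow> (\<forall>W X. open W \<and> W \<subseteq> V \<and> smooth_vector_field A W X \<longrightarrow>
     smooth_fun A W (\<lambda>p. blinfun_apply (\<alpha> p) (X p)))"

definition has_velocity ::
  "('a::topological_space, 'e::euclidean_space) chart set \<Rightarrow> (real \<Rightarrow> 'a) \<Rightarrow> 'e \<Rightarrow> real \<Rightarrow> bool" where
  "has_velocity A \<gamma> v t \<longleftrightarrow> continuous (at t) \<gamma> \<and>
     ((snd (chart_at A (\<gamma> t)) \<circ> \<gamma>) has_vector_derivative v) (at t)"

text \<open>\<open>\<Phi>\<close> is the flow on \<open>S\<close>, defined for all times, of a vector field that is tangent to \<open>S\<close>.\<close>

definition complete_flow ::
  "('a::topological_space, 'e::euclidean_space) chart set \<Rightarrow> 'a set \<Rightarrow> ('a \<Rightarrow> 'e) \<Rightarrow>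
   (real \<Rightarrow> 'a \<Rightarrow> 'a) \<Rightarrow> bool" where
  "complete_flow A S X \<Phi> \<longleftrightarrow> (\<forall>p\<in>S. \<Phi> 0 p = p \<and>
     (\<forall>t. \<Phi> t p \<in> S \<and> has_velocity A (\<lambda>s. \<Phi> s p) (X (\<Phi> t p)) t))"


section \<open>Functions with values in \<open>\<real>/\<int>\<close>\<close>

quotient_type circle = real / "\<lambda>x y. x - y \<in> \<int>"
proof (rule equivpI)
  show "reflp (\<lambda>x y. x - y \<in> (\<int> :: real set))"
    by (simp add: reflp_def)
  show "symp (\<lambda>x y. x - y \<in> (\<int> :: real set))"
    by (auto simp: symp_def) (metis Ints_minus minus_diff_eq)
  show "transp (\<lambda>x y. x - y \<in> (\<int> :: real set))"
    by (auto simp: transp_def) (metis Ints_add diff_add_cancel add_diff_eq)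
qed

lift_definition to_circle :: "real \<Rightarrow> circle" is "\<lambda>x. x" .

definition local_lift ::
  "('a::topological_space, 'e::euclidean_space) chart set \<Rightarrow> 'a set \<Rightarrow> ('a \<Rightarrow> circle) \<Rightarrow>
   ('a \<Rightarrow> real) \<Rightarrow> bool" where
  "local_lift A U \<theta> f \<longleftrightarrow> open U \<and> smooth_fun A U f \<and> (\<forall>q\<in>U. \<theta> q = to_circle (f q))"

definition smooth_circle_fun ::
  "('a::topological_space, 'e::euclidean_space) chart set \<Rightarrow> 'a set \<Rightarrow> ('a \<Rightarrow> circle) \<Rightarrow> bool" where
  "smooth_circle_fun A W \<theta> \<longleftrightarrow> (\<forall>p\<in>W. \<exists>U f. p \<in> U \<and> U \<subseteq> W \<and> local_lift A U \<theta> f)"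

definition circle_differential ::
  "('a::topological_space, 'e::euclidean_space) chart set \<Rightarrow> ('a \<Rightarrow> circle) \<Rightarrow> 'a \<Rightarrow> 'e covector" where
  "circle_differential A \<theta> p =
     (THE \<xi>. \<exists>U f. p \<in> U \<and> local_lift A U \<theta> f \<and> \<xi> = differential A f p)"


section \<open>Foliations and distributions\<close>

text \<open>A \<open>k\<close>-dimensional foliation of an open set \<open>W\<close> is given by its set \<open>F\<close> of leaves. Leaves
  carry the topology induced from the manifold, in which a set of leaves of an irrational flow on
  a torus can have a connected union; this is why leaves and plaques are described here by paths.
  The leaf directions of a foliated chart are those of a subset \<open>K\<close> of the standard basis.\<close>

definition plaque :: "('a, 'e::euclidean_space) chart \<Rightarrow> 'e set \<Rightarrow> 'a \<Rightarrow> 'a set" where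
  "plaque c K q = {p \<in> fst c. \<forall>i\<in>Basis - K. snd c p \<bullet> i = snd c q \<bullet> i}"

definition foliated_chart ::
  "('a::topological_space, 'e::euclidean_space) chart set \<Rightarrow> nat \<Rightarrow> 'a set set \<Rightarrow>
   ('a, 'e) chart \<Rightarrow> 'e set \<Rightarrow> bool" where
  "foliated_chart A k F c K \<longleftrightarrow> smooth_chart A c \<and> (\<exists>a b. snd c ` fst c = box a b) \<and>
     fst c \<subseteq> \<Union>F \<and> K \<subseteq> Basis \<and> card K = k \<and>
     (\<forall>L\<in>F. \<forall>q\<in>L \<inter> fst c. path_component_set (L \<inter> fst c) q = plaque c K q)"

definition foliation ::
  "('a::topological_space, 'e::euclidean_space) chart set \<Rightarrow> 'a set \<Rightarrow> nat \<Rightarrow> 'a set set \<Rightarrow> bool" where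
  "foliation A W k F \<longleftrightarrow> partition_on W F \<and> (\<forall>L\<in>F. path_connected L) \<and>
     (\<forall>p\<in>W. \<exists>c K. p \<in> fst c \<and> foliated_chart A k F c K)"

definition foliation_tangent ::
  "('a::topological_space, 'e::euclidean_space) chart set \<Rightarrow> nat \<Rightarrow> 'a set set \<Rightarrow> 'a \<Rightarrow> 'e set" where
  "foliation_tangent A k F p =
     {v. \<exists>c K. p \<in> fst c \<and> foliated_chart A k F c K \<and> tangent_map A (snd c) p v \<in> span K}"

text \<open>A function on \<open>U\<close> is a first integral if it is constant on the leaves of the foliation
  induced on \<open>U\<close>.\<close>

definition local_first_integral ::
  "('a::topological_space, 'e::euclidean_space) chart set \<Rightarrow> 'a set set \<Rightarrow> 'a set \<Rightarrow>
   ('a \<Rightarrow> real) \<Rightarrow> bool" where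
  "local_first_integral A F U f \<longleftrightarrow> smooth_fun A U f \<and>
     (\<forall>L\<in>F. \<forall>p q. path_component (L \<inter> U) p q \<longrightarrow> f p = f q)"

definition integrable_distribution ::
  "('a::topological_space, 'e::euclidean_space) chart set \<Rightarrow> 'a set \<Rightarrow> nat \<Rightarrow> ('a \<Rightarrow> 'e set) \<Rightarrow> bool" where
  "integrable_distribution A V k D \<longleftrightarrow> (\<forall>p\<in>V. subspace (D p) \<and> dim (D p) = k) \<and>
     (\<forall>p\<in>V. \<exists>c K. smooth_chart A c \<and> p \<in> fst c \<and> fst c \<subseteq> V \<and> K \<subseteq> Basis \<and> card K = k \<and>
        (\<forall>q\<in>fst c. D q = {v. tangent_map A (snd c) q v \<in> span K}))"

definition int_span :: "nat \<Rightarrow> (nat \<Rightarrow> 'v::real_vector) \<Rightarrow> 'v set" where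
  "int_span r y = {\<Sum>i<r. of_int (n i) *\<^sub>R y i | n. True}"

text \<open>A bundle over \<open>V\<close> of lattices of rank \<open>r\<close> in the fibers of the distribution \<open>D\<close>.\<close>

definition lattice_bundle ::
  "('a::topological_space, 'e::euclidean_space) chart set \<Rightarrow> 'a set \<Rightarrow> nat \<Rightarrow>
   ('a \<Rightarrow> 'e set) \<Rightarrow> ('a \<Rightarrow> 'e set) \<Rightarrow> bool" where
  "lattice_bundle A V r D L \<longleftrightarrow> (\<forall>p\<in>V. \<exists>U y. open U \<and> p \<in> U \<and> U \<subseteq> V \<and>
     (\<forall>i<r. smooth_vector_field A U (y i)) \<and>
     (\<forall>q\<in>U. inj_on (\<lambda>i. y i q) {..<r} \<and> independent ((\<lambda>i. y i q) ` {..<r}) \<and>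
        span ((\<lambda>i. y i q) ` {..<r}) = D q \<and> L q = int_span r (\<lambda>i. y i q)))"


section \<open>Poisson manifolds\<close>

record (overloaded) ('a, 'e) poisson_manifold =
  atlas :: "('a, 'e) chart set"
  bivector :: "'a \<Rightarrow> ('e::euclidean_space) covector \<Rightarrow> 'e covector \<Rightarrow> real"

definition bracket ::
  "('a, 'e::euclidean_space) poisson_manifold \<Rightarrow> ('a \<Rightarrow> real) \<Rightarrow> ('a \<Rightarrow> real) \<Rightarrow> 'a \<Rightarrow> real" where
  "bracket M f g p = bivector M p (differential (atlas M) f p) (differential (atlas M) g p)"

definition poisson ::
  "('a::{t2_space,second_countable_topology}, 'e::euclidean_space) poisson_manifold \<Rightarrow> bool" where
  "poisson M \<longleftrightarrow> smooth_atlas (atlas M) \<and>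
     (\<forall>p. bilinear (bivector M p) \<and> (\<forall>\<xi> \<eta>. bivector M p \<xi> \<eta> = - bivector M p \<eta> \<xi>)) \<and>
     (\<forall>W f g. open W \<and> smooth_fun (atlas M) W f \<and> smooth_fun (atlas M) W g \<longrightarrow>
        smooth_fun (atlas M) W (bracket M f g)) \<and>
     (\<forall>W f g h. open W \<and> smooth_fun (atlas M) W f \<and> smooth_fun (atlas M) W g \<and>
        smooth_fun (atlas M) W h \<longrightarrow>
        (\<forall>p\<in>W. bracket M f (bracket M g h) p + bracket M g (bracket M h f) p +
                 bracket M h (bracket M f g) p = 0))"

definition sharp ::
  "('a, 'e::euclidean_space) poisson_manifold \<Rightarrow> 'a \<Rightarrow> 'e covector \<Rightarrow> 'e" where
  "sharp M p \<xi> = (THE v. \<forall>\<eta>. blinfun_apply \<eta> v = bivector M p \<xi> \<eta>)"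

definition hamiltonian ::
  "('a, 'e::euclidean_space) poisson_manifold \<Rightarrow> ('a \<Rightarrow> real) \<Rightarrow> 'a \<Rightarrow> 'e" where
  "hamiltonian M h p = - sharp M p (differential (atlas M) h p)"

definition circle_hamiltonian ::
  "('a::topological_space, 'e::euclidean_space) poisson_manifold \<Rightarrow> ('a \<Rightarrow> circle) \<Rightarrow> 'a \<Rightarrow> 'e" where
  "circle_hamiltonian M \<theta> p = - sharp M p (circle_differential (atlas M) \<theta> p)"

definition poisson_map ::
  "('a::topological_space, 'e::euclidean_space) poisson_manifold \<Rightarrow>
   ('b::topological_space, 'f::euclidean_space) poisson_manifold \<Rightarrow> ('a \<Rightarrow> 'b) \<Rightarrow> bool" where
  "poisson_map M B \<phi> \<longleftrightarrow> smooth_map (atlas M) (atlas B) \<phi> \<and>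
     (\<forall>W f g. open W \<and> smooth_fun (atlas B) W f \<and> smooth_fun (atlas B) W g \<longrightarrow>
        (\<forall>p\<in>\<phi> -` W. bracket M (f \<circ> \<phi>) (g \<circ> \<phi>) p = bracket B f g (\<phi> p)))"


section \<open>NCI systems\<close>

definition abstract_nci ::
  "('a::{t2_space,second_countable_topology}, 'e::euclidean_space) poisson_manifold \<Rightarrow>
   nat \<Rightarrow> 'a set set \<Rightarrow> bool" where
  "abstract_nci M r F \<longleftrightarrow> poisson M \<and> foliation (atlas M) UNIV r F \<and>
     (\<forall>m. \<exists>U f. open U \<and> m \<in> U \<and> (\<forall>i<r. local_first_integral (atlas M) F U (f i)) \<and>
        (\<forall>p\<in>U. span ((\<lambda>i. hamiltonian M (f i) p) ` {..<r}) = foliation_tangent (atlas M) r F p))"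

definition nci_system ::
  "('a::{t2_space,second_countable_topology}, 'e::euclidean_space) poisson_manifold \<Rightarrow>
   ('b::{t2_space,second_countable_topology}, 'f::euclidean_space) poisson_manifold \<Rightarrow>
   ('a \<Rightarrow> 'b) \<Rightarrow> nat \<Rightarrow> bool" where
  "nci_system M B \<phi> r \<longleftrightarrow> surj \<phi> \<and> abstract_nci M r {\<phi> -` {b} | b. True} \<and>
     poisson B \<and> submersion (atlas M) (atlas B) \<phi> \<and> poisson_map M B \<phi>"

definition compact_fibers :: "('a::topological_space \<Rightarrow> 'b) \<Rightarrow> bool" where
  "compact_fibers \<phi> \<longleftrightarrow> (\<forall>b. compact (\<phi> -` {b}))"


section \<open>The action bundle and the action lattice\<close>

text \<open>The fiber of the action bundle at \<open>b\<close> is the quotient of \<open>Ker \<pi>\<^sup>\<sharp>\<close> by \<open>pull_kernel\<close>; its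
  elements are cosets, that is, sets of covectors. Whether \<open>\<Pi>\<^sup>\<sharp>(\<phi>\<^sup>*\<xi>)\<close> vanishes at \<open>m\<close> does not depend
  on the point \<open>m\<close> of the fiber over \<open>b\<close> in an NCI system.\<close>

definition sharp_kernel ::
  "('b, 'f::euclidean_space) poisson_manifold \<Rightarrow> 'b \<Rightarrow> 'f covector set" where
  "sharp_kernel B b = {\<xi>. sharp B b \<xi> = 0}"

definition pull_kernel ::
  "('a, 'e::euclidean_space) poisson_manifold \<Rightarrow> ('b, 'f::euclidean_space) poisson_manifold \<Rightarrow>
   ('a \<Rightarrow> 'b) \<Rightarrow> 'b \<Rightarrow> 'f covector set" where
  "pull_kernel M B \<phi> b =
     {\<xi>. \<forall>m\<in>\<phi> -` {b}. sharp M m (pullback (atlas M) (atlas B) \<phi> m \<xi>) = 0}"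

definition action_class ::
  "('a, 'e::euclidean_space) poisson_manifold \<Rightarrow> ('b, 'f::euclidean_space) poisson_manifold \<Rightarrow>
   ('a \<Rightarrow> 'b) \<Rightarrow> 'b \<Rightarrow> 'f covector \<Rightarrow> 'f covector set" where
  "action_class M B \<phi> b \<xi> = {\<eta> \<in> sharp_kernel B b. \<eta> - \<xi> \<in> pull_kernel M B \<phi> b}"

definition action_fiber ::
  "('a, 'e::euclidean_space) poisson_manifold \<Rightarrow> ('b, 'f::euclidean_space) poisson_manifold \<Rightarrow>
   ('a \<Rightarrow> 'b) \<Rightarrow> 'b \<Rightarrow> 'f covector set set" where
  "action_fiber M B \<phi> b = action_class M B \<phi> b ` sharp_kernel B b"

definition action_vector ::
  "('a, 'e::euclidean_space) poisson_manifold \<Rightarrow> ('b, 'f::euclidean_space) poisson_manifold \<Rightarrow>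
   ('a \<Rightarrow> 'b) \<Rightarrow> 'f covector set \<Rightarrow> 'a \<Rightarrow> 'e" where
  "action_vector M B \<phi> \<alpha> m =
     the_elem ((\<lambda>\<xi>. sharp M m (pullback (atlas M) (atlas B) \<phi> m \<xi>)) ` \<alpha>)"

definition action_lattice ::
  "('a::topological_space, 'e::euclidean_space) poisson_manifold \<Rightarrow>
   ('b, 'f::euclidean_space) poisson_manifold \<Rightarrow> ('a \<Rightarrow> 'b) \<Rightarrow> 'b \<Rightarrow> 'f covector set set" where
  "action_lattice M B \<phi> b = {\<alpha> \<in> action_fiber M B \<phi> b.
     \<exists>\<Phi>. complete_flow (atlas M) (\<phi> -` {b}) (action_vector M B \<phi> \<alpha>) \<Phi> \<and>
         (\<forall>m\<in>\<phi> -` {b}. \<Phi> 1 m = m)}"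

definition lattice_section ::
  "('a::topological_space, 'e::euclidean_space) poisson_manifold \<Rightarrow>
   ('b::topological_space, 'f::euclidean_space) poisson_manifold \<Rightarrow> ('a \<Rightarrow> 'b) \<Rightarrow> 'b set \<Rightarrow>
   ('b \<Rightarrow> 'f covector set) \<Rightarrow> bool" where
  "lattice_section M B \<phi> V e \<longleftrightarrow> (\<forall>b\<in>V. e b \<in> action_lattice M B \<phi> b) \<and>
     (\<forall>b\<in>V. \<exists>U \<alpha>. open U \<and> b \<in> U \<and> U \<subseteq> V \<and> smooth_one_form (atlas B) U \<alpha> \<and>
        (\<forall>q\<in>U. \<alpha> q \<in> sharp_kernel B q \<and> e q = action_class M B \<phi> q (\<alpha> q)))"

definition section_field ::
  "('a, 'e::euclidean_space) poisson_manifold \<Rightarrow> ('b, 'f::euclidean_space) poisson_manifold \<Rightarrow>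
   ('a \<Rightarrow> 'b) \<Rightarrow> ('b \<Rightarrow> 'f covector set) \<Rightarrow> 'a \<Rightarrow> 'e" where
  "section_field M B \<phi> e m = action_vector M B \<phi> (e (\<phi> m)) m"

text \<open>The integral linear combination of cosets; all choices of representatives \<open>\<eta>\<close> give the
  same coset.\<close>

definition class_comb ::
  "('a, 'e::euclidean_space) poisson_manifold \<Rightarrow> ('b, 'f::euclidean_space) poisson_manifold \<Rightarrow>
   ('a \<Rightarrow> 'b) \<Rightarrow> 'b \<Rightarrow> nat \<Rightarrow> (nat \<Rightarrow> int) \<Rightarrow> (nat \<Rightarrow> 'f covector set) \<Rightarrow> 'f covector set" where
  "class_comb M B \<phi> b r n \<alpha> =
     (\<Union>\<eta>\<in>{\<eta>. \<forall>i<r. \<eta> i \<in> \<alpha> i}. action_class M B \<phi> b (\<Sum>i<r. of_int (n i) *\<^sub>R \<eta> i))"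

definition lattice_trivialization ::
  "('a::topological_space, 'e::euclidean_space) poisson_manifold \<Rightarrow>
   ('b::topological_space, 'f::euclidean_space) poisson_manifold \<Rightarrow> ('a \<Rightarrow> 'b) \<Rightarrow> nat \<Rightarrow> 'b set \<Rightarrow>
   (nat \<Rightarrow> 'b \<Rightarrow> 'f covector set) \<Rightarrow> bool" where
  "lattice_trivialization M B \<phi> r V e \<longleftrightarrow> (\<forall>i<r. lattice_section M B \<phi> V (e i)) \<and>
     (\<forall>b\<in>V. (\<forall>l\<in>action_lattice M B \<phi> b. \<exists>n. l = class_comb M B \<phi> b r n (\<lambda>i. e i b)) \<and>
        (\<forall>n. class_comb M B \<phi> b r n (\<lambda>i. e i b) = action_class M B \<phi> b 0 \<longrightarrow> (\<forall>i<r. n i = 0)))"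


section \<open>Angle variables and angle foliations\<close>

definition adapted_angle_variables ::
  "('a::topological_space, 'e::euclidean_space) poisson_manifold \<Rightarrow>
   ('b, 'f::euclidean_space) poisson_manifold \<Rightarrow> ('a \<Rightarrow> 'b) \<Rightarrow> nat \<Rightarrow> 'b set \<Rightarrow>
   (nat \<Rightarrow> 'b \<Rightarrow> 'f covector set) \<Rightarrow> (nat \<Rightarrow> 'a \<Rightarrow> circle) \<Rightarrow> bool" where
  "adapted_angle_variables M B \<phi> r V e \<theta> \<longleftrightarrow>
     (\<forall>i<r. smooth_circle_fun (atlas M) (\<phi> -` V) (\<theta> i)) \<and>
     (\<forall>i<r. \<forall>j<r. \<forall>m\<in>\<phi> -` V.
        bivector M m (circle_differential (atlas M) (\<theta> i) m)
                     (circle_differential (atlas M) (\<theta> j) m) = 0 \<and>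
        blinfun_apply (circle_differential (atlas M) (\<theta> j) m) (section_field M B \<phi> (e i) m) =
          (if i = j then 1 else 0))"

definition local_angle_variables ::
  "('a::topological_space, 'e::euclidean_space) poisson_manifold \<Rightarrow>
   ('b::topological_space, 'f::euclidean_space) poisson_manifold \<Rightarrow> ('a \<Rightarrow> 'b) \<Rightarrow> nat \<Rightarrow> 'b set \<Rightarrow>
   (nat \<Rightarrow> 'a \<Rightarrow> circle) \<Rightarrow> bool" where
  "local_angle_variables M B \<phi> r V \<theta> \<longleftrightarrow>
     (\<exists>e. lattice_trivialization M B \<phi> r V e \<and> adapted_angle_variables M B \<phi> r V e \<theta>)"

text \<open>The leaves of the foliation of \<open>W\<close> defined by \<open>\<theta>\<close>: the connected components of the
  level sets.\<close>

definition level_foliation ::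
  "nat \<Rightarrow> 'a::topological_space set \<Rightarrow> (nat \<Rightarrow> 'a \<Rightarrow> circle) \<Rightarrow> 'a set set" where
  "level_foliation r W \<theta> = (\<Union>c. components {m \<in> W. \<forall>i<r. \<theta> i m = c i})"

definition angle_foliation ::
  "('a::topological_space, 'e::euclidean_space) poisson_manifold \<Rightarrow>
   ('b::topological_space, 'f::euclidean_space) poisson_manifold \<Rightarrow> ('a \<Rightarrow> 'b) \<Rightarrow> 'b set \<Rightarrow>
   'a set set \<Rightarrow> bool" where
  "angle_foliation M B \<phi> V G \<longleftrightarrow> (\<exists>k. foliation (atlas M) (\<phi> -` V) k G \<and>
     (\<forall>m\<in>\<phi> -` V.
        {v + w | v w. v \<in> foliation_tangent (atlas M) k G m \<and>
                      map_differential (atlas M) (atlas B) \<phi> m w = 0} = UNIV \<and>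
        (\<forall>v\<in>foliation_tangent (atlas M) k G m.
           map_differential (atlas M) (atlas B) \<phi> m v = 0 \<longrightarrow> v = 0)) \<and>
     (\<forall>e. lattice_section M B \<phi> V e \<longrightarrow>
        (\<exists>\<Phi>. complete_flow (atlas M) (\<phi> -` V) (section_field M B \<phi> e) \<Phi> \<and>
             (\<forall>t. \<forall>L\<in>G. \<Phi> t ` L \<in> G))) \<and>
     (\<forall>m\<in>\<phi> -` V. \<forall>\<xi>. (\<forall>v\<in>foliation_tangent (atlas M) k G m. blinfun_apply \<xi> v = 0) \<longrightarrow>
        sharp M m \<xi> \<in> foliation_tangent (atlas M) k G m))"

text \<open>The value at \<open>b\<close> of the vector field to which \<open>X\<close> is \<open>\<phi>\<close>-related.\<close>

definition pushforward ::
  "('a, 'e::euclidean_space) chart set \<Rightarrow> ('b, 'f::euclidean_space) chart set \<Rightarrow>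
   ('a \<Rightarrow> 'b) \<Rightarrow> ('a \<Rightarrow> 'e) \<Rightarrow> 'b \<Rightarrow> 'f" where
  "pushforward A A' \<phi> X b = (THE y. \<forall>m\<in>\<phi> -` {b}. map_differential A A' \<phi> m (X m) = y)"

definition angle_field ::
  "('a::topological_space, 'e::euclidean_space) poisson_manifold \<Rightarrow>
   ('b, 'f::euclidean_space) poisson_manifold \<Rightarrow> ('a \<Rightarrow> 'b) \<Rightarrow> ('a \<Rightarrow> circle) \<Rightarrow> 'b \<Rightarrow> 'f" where
  "angle_field M B \<phi> \<theta> = pushforward (atlas M) (atlas B) \<phi> (circle_hamiltonian M \<theta>)"

definition angle_distribution ::
  "('a::topological_space, 'e::euclidean_space) poisson_manifold \<Rightarrow>
   ('b, 'f::euclidean_space) poisson_manifold \<Rightarrow> ('a \<Rightarrow> 'b) \<Rightarrow> nat \<Rightarrow> (nat \<Rightarrow> 'a \<Rightarrow> circle) \<Rightarrow>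
   'b \<Rightarrow> 'f set" where
  "angle_distribution M B \<phi> r \<theta> b = span ((\<lambda>i. angle_field M B \<phi> (\<theta> i) b) ` {..<r})"

definition angle_lattice ::
  "('a::topological_space, 'e::euclidean_space) poisson_manifold \<Rightarrow>
   ('b, 'f::euclidean_space) poisson_manifold \<Rightarrow> ('a \<Rightarrow> 'b) \<Rightarrow> nat \<Rightarrow> (nat \<Rightarrow> 'a \<Rightarrow> circle) \<Rightarrow>
   'b \<Rightarrow> 'f set" where
  "angle_lattice M B \<phi> r \<theta> b = int_span r (\<lambda>i. angle_field M B \<phi> (\<theta> i) b)"

end

theory Submission
  imports Defs
begin

text \<open>
  The pairing \<open>w = {\<theta>\<^sub>i, g \<circ> \<phi>}\<close> of an angle variable with a function on the base is constant on the fibers: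
  its derivatives along the action fields are constant on each fiber, and they vanish where \<open>w\<close> attains its
  maximum on the compact fiber. Hence the fields \<open>Y\<^sub>i = \<phi>\<^sub>* X\<^bsub>\<theta>\<^sub>i\<^esub>\<close> are well defined; they commute by the Jacobi
  identity and \<open>{\<theta>\<^sub>i, \<theta>\<^sub>j} = 0\<close>, and they are independent because the one-forms that represent the action
  fields form a dual family. Commuting independent fields are straightened by their flows, which gives
  the foliated charts; the leaves are the classes of points joined by paths inside plaques.

  Two systems of angle variables with the same foliation have differentials that vanish on its tangent
  spaces, so their matrix of change is determined by the values on the action fields. It is integral, because
  the action fields of both frames generate the same lattice.
\<close>

section \<open>Calculus of \<open>C\<^sup>k\<close> maps\<close>

text \<open>Tangent vectors are read in the preferred chart of their base point, so a smooth vector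
  field need not be a continuous function. Smoothness and commutation of the fields on the base are
  therefore tested on real functions: these are pulled back by \<phi>, handled with Poisson
  brackets, and the results descend through local sections of the submersion. The straightening map
  must be smooth in all its variables, which needs smooth dependence of solutions on parameters.
  Time is fixed to [0,1] and the parameter is kept small instead, until the right-hand side has
  Lipschitz constant 1/2. A function bounded by a plus half its supremum is bounded by 2a, and this
  replaces Gronwall's inequality. The linearized equation has the same constant, so differentiation
  can be repeated. Hence the form of \<open>Ck_fam\<close>: derivatives are taken in the space
  variable only, with joint continuity in the time s. A leaf may be dense. What keeps a path in it
  from crossing between plaques is countability: the transversal coordinates along the path form a
  countable connected set, hence a point.\<close>

primrec Ck_fam :: "nat \<Rightarrow> real set \<Rightarrow> 'e::euclidean_space set \<Rightarrow>
    (real \<Rightarrow> 'e \<Rightarrow> 'g::real_normed_vector) \<Rightarrow> bool" where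
  "Ck_fam 0 S Z u \<longleftrightarrow> continuous_on (S \<times> Z) (\<lambda>(s, z). u s z)"
| "Ck_fam (Suc k) S Z u \<longleftrightarrow> continuous_on (S \<times> Z) (\<lambda>(s, z). u s z) \<and>
     (\<forall>s\<in>S. \<forall>z\<in>Z. u s differentiable (at z)) \<and>
     (\<forall>v. Ck_fam k S Z (\<lambda>s z. frechet_derivative (u s) (at z) v))"

lemma Ck_fam_continuous: "Ck_fam k S Z u \<Longrightarrow> continuous_on (S \<times> Z) (\<lambda>(s, z). u s z)"
  by (cases k) auto

lemma Ck_fam_differentiable:
  "Ck_fam (Suc k) S Z u \<Longrightarrow> s \<in> S \<Longrightarrow> z \<in> Z \<Longrightarrow>
    (u s has_derivative frechet_derivative (u s) (at z)) (at z)"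
  by (simp add: frechet_derivative_works)

lemma Ck_fam_deriv: "Ck_fam (Suc k) S Z u \<Longrightarrow> Ck_fam k S Z (\<lambda>s z. frechet_derivative (u s) (at z) v)"
  by simp

lemma Ck_fam_SucD: "Ck_fam (Suc k) S Z u \<Longrightarrow> Ck_fam k S Z u"
  by (induction k arbitrary: u) auto

lemma Ck_fam_subset: "Ck_fam k S Z u \<Longrightarrow> T \<subseteq> S \<Longrightarrow> Y \<subseteq> Z \<Longrightarrow> Ck_fam k T Y u"
proof (induction k arbitrary: u)
  case 0
  then show ?case by (auto intro: continuous_on_subset)
next
  case (Suc k)
  then have "continuous_on (T \<times> Y) (\<lambda>(s, z). u s z)"
    by (auto intro: continuous_on_subset)
  with Suc show ?case by (auto simp: subset_iff)
qed

lemma frechet_derivative_cong_open: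
  assumes "open Z" "z \<in> Z" "\<And>x. x \<in> Z \<Longrightarrow> f x = g x"
  shows "frechet_derivative f (at z) = frechet_derivative g (at z)"
proof -
  have "(f has_derivative D) (at z) \<longleftrightarrow> (g has_derivative D) (at z)" for D
    using has_derivative_transform_within_open[OF _ assms(1,2), of f D UNIV g]
      has_derivative_transform_within_open[OF _ assms(1,2), of g D UNIV f] assms(3) by auto
  then show ?thesis by (simp add: frechet_derivative_def)
qed

lemma Ck_fam_cong:
  assumes "Ck_fam k S Z u" "open Z" "\<And>s z. s \<in> S \<Longrightarrow> z \<in> Z \<Longrightarrow> u s z = u' s z"
  shows "Ck_fam k S Z u'"
  using assms
proof (induction k arbitrary: u u')
  case 0
  then have "continuous_on (S \<times> Z) (\<lambda>(s, z). u s z) \<longleftrightarrow> continuous_on (S \<times> Z) (\<lambda>(s, z). u' s z)"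
    by (intro continuous_on_cong) auto
  with 0 show ?case by simp
next
  case (Suc k)
  have "continuous_on (S \<times> Z) (\<lambda>(s, z). u s z) \<longleftrightarrow> continuous_on (S \<times> Z) (\<lambda>(s, z). u' s z)"
    using Suc.prems by (intro continuous_on_cong) auto
  moreover have "u' s differentiable (at z)" if "s \<in> S" "z \<in> Z" for s z
    using Suc.prems that has_derivative_transform_within_open[of "u s" _ z UNIV Z "u' s"]
    unfolding differentiable_def by (metis Ck_fam_differentiable)
  moreover have "Ck_fam k S Z (\<lambda>s z. frechet_derivative (u' s) (at z) v)" for v
    by (rule Suc.IH[OF Ck_fam_deriv[OF Suc.prems(1), of v] Suc.prems(2)])
      (use Suc.prems in \<open>auto intro!: fun_cong[OF frechet_derivative_cong_open, of Z]\<close>)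
  ultimately show ?case using Suc.prems by simp
qed

text \<open>The parameter set \<open>S\<close> is usually [0,1], which is not open, so continuity is
  taken within \<open>S \<times> Z\<close> and localized in the second factor only.\<close>

lemma continuous_on_Times_local:
  fixes f :: "'a::metric_space \<times> 'b::metric_space \<Rightarrow> 'c::metric_space"
  assumes "\<And>z. z \<in> Z \<Longrightarrow> \<exists>U. open U \<and> z \<in> U \<and> continuous_on (S \<times> (Z \<inter> U)) f"
  shows "continuous_on (S \<times> Z) f"
  unfolding continuous_on_eq_continuous_within
proof (rule ballI)
  fix x assume x: "x \<in> S \<times> Z"
  then obtain U where U: "open U" "snd x \<in> U" "continuous_on (S \<times> (Z \<inter> U)) f"
    using assms[of "snd x"] by auto
  have "continuous (at x within S \<times> (Z \<inter> U)) f"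
    using U x by (auto simp: continuous_on_eq_continuous_within)
  moreover have "at x within S \<times> (Z \<inter> U) = at x within S \<times> Z"
    by (rule at_within_nhd[of x "UNIV \<times> U"])
      (use U x in \<open>auto intro: open_Times simp: mem_Times_iff\<close>)
  ultimately show "continuous (at x within S \<times> Z) f" by simp
qed

lemma Ck_fam_local:
  assumes "\<And>z. z \<in> Z \<Longrightarrow> \<exists>U. open U \<and> z \<in> U \<and> Ck_fam k S (Z \<inter> U) u"
  shows "Ck_fam k S Z u"
  using assms
proof (induction k arbitrary: u)
  case 0
  then show ?case by (simp add: continuous_on_Times_local)
next
  case (Suc k)
  have loc: "\<exists>U. open U \<and> z \<in> U \<and> continuous_on (S \<times> (Z \<inter> U)) (\<lambda>(s, z). u s z)" if "z \<in> Z" for z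
    using Suc.prems[OF that] by auto
  have "continuous_on (S \<times> Z) (\<lambda>(s, z). u s z)"
    by (rule continuous_on_Times_local[OF loc])
  moreover have "u s differentiable (at z)" if "s \<in> S" "z \<in> Z" for s z
    using Suc.prems[OF \<open>z \<in> Z\<close>] that by auto
  moreover have "Ck_fam k S Z (\<lambda>s z. frechet_derivative (u s) (at z) v)" for v
  proof (rule Suc.IH)
    show "\<exists>U. open U \<and> z \<in> U \<and> Ck_fam k S (Z \<inter> U) (\<lambda>s z. frechet_derivative (u s) (at z) v)"
      if "z \<in> Z" for z
      using Suc.prems[OF that] by auto
  qed
  ultimately show ?case by simp
qed

text \<open>Derivatives are taken in \<open>z\<close> alone, so continuity in the parameter gives
  every order.\<close>

lemma Ck_fam_param:
  assumes "continuous_on S c"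
  shows "Ck_fam k S Z (\<lambda>s z. c s)"
proof (cases k)
  have "continuous_on (S \<times> Z) (\<lambda>x. c (fst x))"
    by (rule continuous_on_compose2[OF assms continuous_on_fst[OF continuous_on_id]]) auto
  then have 1: "continuous_on (S \<times> Z) (\<lambda>(s, z). c s)"
    by (simp add: case_prod_beta)
  have 0: "Ck_fam m S Z (\<lambda>s z. 0)" for m
    by (induction m) (simp_all add: case_prod_beta)
  show "Ck_fam k S Z (\<lambda>s z. c s)" if "k = 0"
    using 1 that by simp
  show "Ck_fam k S Z (\<lambda>s z. c s)" if "k = Suc m" for m
    using 1 0 that by simp
qed

lemma Ck_fam_const: "Ck_fam k S Z (\<lambda>s z. c)"
  by (rule Ck_fam_param) simp

lemma Ck_fam_linear:
  assumes "bounded_linear L"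
  shows "Ck_fam k S Z (\<lambda>s. L)"
proof (cases k)
  have 1: "continuous_on (S \<times> Z) (\<lambda>(s, z). L z)"
    by (simp add: case_prod_beta bounded_linear.continuous_on[OF assms] continuous_on_snd)
  show ?thesis if "k = 0" using 1 that by simp
  have "(L has_derivative L) (at z)" for z
    by (rule bounded_linear_imp_has_derivative[OF assms])
  then have "L differentiable (at z)" "frechet_derivative L (at z) = L" for z
    by (auto simp: differentiable_def simp flip: frechet_derivative_at)
  then show ?thesis if "k = Suc m" for m
    using 1 that by (simp add: Ck_fam_const)
qed

lemma Ck_fam_add:
  assumes "Ck_fam k S Z u" "Ck_fam k S Z w" "open Z"
  shows "Ck_fam k S Z (\<lambda>s z. u s z + w s z)"
  using assms
proof (induction k arbitrary: u w)
  case 0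
  then show ?case by (auto simp: case_prod_beta intro!: continuous_intros)
next
  case (Suc k)
  have c: "continuous_on (S \<times> Z) (\<lambda>(s, z). u s z + w s z)"
    using Suc.prems by (auto simp: case_prod_beta intro!: continuous_intros)
  have d: "((\<lambda>z. u s z + w s z) has_derivative
      (\<lambda>v. frechet_derivative (u s) (at z) v + frechet_derivative (w s) (at z) v)) (at z)"
    if "s \<in> S" "z \<in> Z" for s z
    using Suc.prems that by (intro has_derivative_add Ck_fam_differentiable)
  have "Ck_fam k S Z (\<lambda>s z. frechet_derivative (\<lambda>z. u s z + w s z) (at z) v)" for v
    by (rule Ck_fam_cong[OF Suc.IH[OF Ck_fam_deriv[OF Suc.prems(1), of v] Ck_fam_deriv[OF Suc.prems(2), of v]]])
      (use Suc.prems(3) in \<open>auto simp flip: frechet_derivative_at[OF d]\<close>)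
  with c d show ?case by (auto simp: differentiable_def)
qed

lemma Ck_fam_bilinear:
  assumes "bounded_bilinear h" "Ck_fam k S Z u" "Ck_fam k S Z w" "open Z"
  shows "Ck_fam k S Z (\<lambda>s z. h (u s z) (w s z))"
  using assms(2-)
proof (induction k arbitrary: u w)
  case 0
  then show ?case
    by (auto simp: case_prod_beta intro: bounded_bilinear.continuous_on[OF assms(1)])
next
  case (Suc k)
  have c: "continuous_on (S \<times> Z) (\<lambda>(s, z). h (u s z) (w s z))"
    using Suc.prems by (auto simp: case_prod_beta intro: bounded_bilinear.continuous_on[OF assms(1)])
  have d: "((\<lambda>z. h (u s z) (w s z)) has_derivative
      (\<lambda>v. h (u s z) (frechet_derivative (w s) (at z) v) + h (frechet_derivative (u s) (at z) v) (w s z))) (at z)"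
    if "s \<in> S" "z \<in> Z" for s z
    using Suc.prems that by (intro bounded_bilinear.FDERIV[OF assms(1)] Ck_fam_differentiable)
  have "Ck_fam k S Z (\<lambda>s z. h (u s z) (frechet_derivative (w s) (at z) v) + h (frechet_derivative (u s) (at z) v) (w s z))" for v
    by (intro Ck_fam_add Suc.IH Ck_fam_deriv Ck_fam_SucD[OF Suc.prems(1)] Ck_fam_SucD[OF Suc.prems(2)] Suc.prems)
  then have "Ck_fam k S Z (\<lambda>s z. frechet_derivative (\<lambda>z. h (u s z) (w s z)) (at z) v)" for v
    by (rule Ck_fam_cong)
      (use Suc.prems(3) in \<open>auto simp flip: frechet_derivative_at[OF d]\<close>)
  with c d show ?case by (auto simp: differentiable_def)
qed

lemma Ck_fam_scaleR:
  "Ck_fam k S Z u \<Longrightarrow> Ck_fam k S Z w \<Longrightarrow> open Z \<Longrightarrow> Ck_fam k S Z (\<lambda>s z. u s z *\<^sub>R w s z)"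
  by (rule Ck_fam_bilinear[OF bounded_bilinear_scaleR])

lemma Ck_fam_inner:
  "Ck_fam k S Z u \<Longrightarrow> Ck_fam k S Z w \<Longrightarrow> open Z \<Longrightarrow> Ck_fam k S Z (\<lambda>s z. u s z \<bullet> w s z)"
  by (rule Ck_fam_bilinear[OF bounded_bilinear_inner])

lemma Ck_fam_sum:
  assumes "\<And>i. i \<in> I \<Longrightarrow> Ck_fam k S Z (u i)" "open Z"
  shows "Ck_fam k S Z (\<lambda>s z. \<Sum>i\<in>I. u i s z)"
  using assms
  by (induction I rule: infinite_finite_induct) (auto intro: Ck_fam_const Ck_fam_add)

lemma Ck_fam_bounded_linear:
  assumes L: "bounded_linear L" and "Ck_fam k S Z u" "open Z"
  shows "Ck_fam k S Z (\<lambda>s z. L (u s z))"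
  using assms(2-)
proof (induction k arbitrary: u)
  case 0
  then show ?case
    by (auto simp: case_prod_beta intro: bounded_linear.continuous_on[OF L])
next
  case (Suc k)
  have c: "continuous_on (S \<times> Z) (\<lambda>(s, z). L (u s z))"
    using Suc.prems by (auto simp: case_prod_beta intro: bounded_linear.continuous_on[OF L])
  have d: "((\<lambda>z. L (u s z)) has_derivative (\<lambda>v. L (frechet_derivative (u s) (at z) v))) (at z)"
    if "s \<in> S" "z \<in> Z" for s z
    using Suc.prems that by (intro bounded_linear.has_derivative[OF L] Ck_fam_differentiable)
  have "Ck_fam k S Z (\<lambda>s z. frechet_derivative (\<lambda>z. L (u s z)) (at z) v)" for v
    by (rule Ck_fam_cong[OF Suc.IH[OF Ck_fam_deriv[OF Suc.prems(1), of v]]])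
      (use Suc.prems(2) in \<open>auto simp flip: frechet_derivative_at[OF d]\<close>)
  with c d show ?case by (auto simp: differentiable_def)
qed

lemma Ck_fam_Pair:
  assumes "Ck_fam k S Z u" "Ck_fam k S Z w" "open Z"
  shows "Ck_fam k S Z (\<lambda>s z. (u s z, w s z))"
proof -
  have "bounded_linear (\<lambda>x. (x, 0))" "bounded_linear (\<lambda>x. (0, x))"
    by (auto intro: bounded_linear_Pair bounded_linear_ident bounded_linear_zero)
  then have "Ck_fam k S Z (\<lambda>s z. (u s z, 0) + (0, w s z))"
    using assms by (intro Ck_fam_add Ck_fam_bounded_linear[where L = "\<lambda>x. (x, 0)"]
      Ck_fam_bounded_linear[where L = "\<lambda>x. (0, x)"])
  then show ?thesis by simp
qed

text \<open>With this expansion, continuity and smoothness of a family of linear maps reduce to its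
  values on finitely many basis vectors, and directions that vary with the point can be
  treated.\<close>

lemma linear_eq_sum_Basis:
  assumes "linear f"
  shows "f x = (\<Sum>b\<in>Basis. (x \<bullet> b) *\<^sub>R f b)"
proof -
  have "f x = f (\<Sum>b\<in>Basis. (x \<bullet> b) *\<^sub>R b)"
    by (simp only: euclidean_representation)
  also have "\<dots> = (\<Sum>b\<in>Basis. (x \<bullet> b) *\<^sub>R f b)"
    by (simp add: linear_sum[OF assms] linear_scale[OF assms])
  finally show ?thesis .
qed

section \<open>Composition of families and the chain rule\<close>

lemma continuous_on_compose_fam:
  assumes "continuous_on (S \<times> Z) (\<lambda>(s, z). u s z)" "continuous_on (S \<times> T) (\<lambda>(s, y). h s y)"
    and "\<And>s z. s \<in> S \<Longrightarrow> z \<in> Z \<Longrightarrow> u s z \<in> T"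
  shows "continuous_on (S \<times> Z) (\<lambda>(s, z). h s (u s z))"
proof -
  have "continuous_on (S \<times> Z) (\<lambda>x. (fst x, (\<lambda>(s, z). u s z) x))"
    using assms(1) by (intro continuous_on_Pair continuous_on_fst continuous_on_id)
  then have "continuous_on (S \<times> Z) (\<lambda>x. (\<lambda>(s, y). h s y) (fst x, (\<lambda>(s, z). u s z) x))"
    by (rule continuous_on_compose2[OF assms(2)]) (use assms(3) in auto)
  then show ?thesis by (simp add: case_prod_beta)
qed

lemma Ck_fam_compose:
  fixes h :: "real \<Rightarrow> 'f::euclidean_space \<Rightarrow> 'g::real_normed_vector"
  assumes "Ck_fam k S Z u" "Ck_fam k S T h" "\<And>s z. s \<in> S \<Longrightarrow> z \<in> Z \<Longrightarrow> u s z \<in> T" "open Z"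
  shows "Ck_fam k S Z (\<lambda>s z. h s (u s z))"
  using assms
proof (induction k arbitrary: u h)
  case 0
  then show ?case by (auto intro: continuous_on_compose_fam)
next
  case (Suc k)
  have c: "continuous_on (S \<times> Z) (\<lambda>(s, z). h s (u s z))"
    using Suc.prems by (auto intro: continuous_on_compose_fam)
  have d: "((\<lambda>z. h s (u s z)) has_derivative
      (\<lambda>v. frechet_derivative (h s) (at (u s z)) (frechet_derivative (u s) (at z) v))) (at z)"
    if "s \<in> S" "z \<in> Z" for s z
    using diff_chain_at[OF Ck_fam_differentiable[OF Suc.prems(1) that]
        Ck_fam_differentiable[OF Suc.prems(2) that(1) Suc.prems(3)[OF that]]]
    by (simp add: o_def)
  have l: "linear (frechet_derivative (h s) (at (u s z)))" if "s \<in> S" "z \<in> Z" for s z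
    using Ck_fam_differentiable[OF Suc.prems(2) that(1) Suc.prems(3)[OF that]]
    by (rule has_derivative_linear)
  \<comment> \<open>The inner derivative is a direction that depends on \<open>z\<close>, while
    \<open>Ck_fam\<close> controls derivatives in fixed directions; expanding over
    \<open>Basis\<close> separates the two.\<close>
  have "Ck_fam k S Z (\<lambda>s z. \<Sum>b\<in>Basis. (frechet_derivative (u s) (at z) v \<bullet> b) *\<^sub>R
      frechet_derivative (h s) (at (u s z)) b)" for v
    by (intro Ck_fam_sum Ck_fam_scaleR Ck_fam_inner Ck_fam_const
        Ck_fam_deriv[OF Suc.prems(1)] Suc.IH[OF Ck_fam_SucD[OF Suc.prems(1)]] Ck_fam_deriv[OF Suc.prems(2)] Suc.prems)
  then have "Ck_fam k S Z (\<lambda>s z. frechet_derivative (\<lambda>z. h s (u s z)) (at z) v)" for v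
  proof (rule Ck_fam_cong)
    show "(\<Sum>b\<in>Basis. (frechet_derivative (u s) (at z) v \<bullet> b) *\<^sub>R frechet_derivative (h s) (at (u s z)) b)
      = frechet_derivative (\<lambda>z. h s (u s z)) (at z) v" if "s \<in> S" "z \<in> Z" for s z
      using linear_eq_sum_Basis[OF l[OF that]] frechet_derivative_at[OF d[OF that]] by metis
  qed (use Suc.prems in auto)
  with c d show ?case by (auto simp: differentiable_def)
qed

text \<open>One order of \<open>h\<close> is spent on the derivative, while base point and direction
  may both move with \<open>z\<close>. This is the shape of the right-hand side of a linearized
  equation.\<close>

lemma Ck_fam_deriv_compose:
  assumes h: "Ck_fam (Suc k) S T h" and "Ck_fam k S Z u" "Ck_fam k S Z v"
    and "\<And>s z. s \<in> S \<Longrightarrow> z \<in> Z \<Longrightarrow> u s z \<in> T" "open Z"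
  shows "Ck_fam k S Z (\<lambda>s z. frechet_derivative (h s) (at (u s z)) (v s z))"
proof -
  have l: "linear (frechet_derivative (h s) (at (u s z)))" if "s \<in> S" "z \<in> Z" for s z
    using Ck_fam_differentiable[OF h that(1) assms(4)[OF that]] by (rule has_derivative_linear)
  have "Ck_fam k S Z (\<lambda>s z. \<Sum>b\<in>Basis. (v s z \<bullet> b) *\<^sub>R frechet_derivative (h s) (at (u s z)) b)"
    by (intro Ck_fam_sum Ck_fam_scaleR Ck_fam_inner Ck_fam_const assms
        Ck_fam_compose[OF assms(2) Ck_fam_deriv[OF h]])
  then show ?thesis
    by (rule Ck_fam_cong) (use assms linear_eq_sum_Basis[OF l] in auto)
qed

section \<open>From families to plain smooth maps\<close>

lemma continuous_on_snd_fam: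
  assumes "continuous_on Z f" shows "continuous_on (S \<times> Z) (\<lambda>(s, z). f z)"
proof -
  have "continuous_on (S \<times> Z) (\<lambda>x. f (snd x))"
    by (rule continuous_on_compose2[OF assms continuous_on_snd[OF continuous_on_id]]) auto
  then show ?thesis by (simp add: case_prod_beta)
qed

lemma continuous_on_snd_fam_iff:
  "continuous_on ({0::real} \<times> Z) (\<lambda>(s, z). f z) \<longleftrightarrow> continuous_on Z f"
proof
  assume "continuous_on ({0::real} \<times> Z) (\<lambda>(s, z). f z)"
  moreover have "continuous_on Z (Pair (0::real))"
    by (intro continuous_on_Pair continuous_on_const continuous_on_id)
  ultimately have "continuous_on Z (\<lambda>z. (\<lambda>(s, z). f z) (0::real, z))"
    by (rule continuous_on_compose2) auto
  then show "continuous_on Z f" by simp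
qed (rule continuous_on_snd_fam)

lemma differentiable_imp_continuous_on_all:
  "\<forall>z\<in>Z. f differentiable (at z) \<Longrightarrow> continuous_on Z f"
  by (intro continuous_at_imp_continuous_on ballI differentiable_imp_continuous_within) auto

text \<open>A one-point parameter set turns the calculus of families into that of plain maps.
  \<open>Ck_fam\<close> asks for continuity at every order, \<open>Ck_on\<close> only at the lowest;
  differentiability supplies the rest.\<close>

lemma Ck_on_iff_fam: "Ck_on k Z f \<longleftrightarrow> Ck_fam k {0} Z (\<lambda>_. f)"
proof (induction k arbitrary: f)
  case 0
  show ?case by (simp add: continuous_on_snd_fam_iff)
next
  case (Suc k)
  show ?case using Suc.IH differentiable_imp_continuous_on_all[of Z f]
    by (auto simp: continuous_on_snd_fam_iff)
qed

lemma smooth_on_iff_fam: "smooth_on Z f \<longleftrightarrow> (\<forall>k. Ck_fam k {0} Z (\<lambda>_. f))"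
  by (simp add: smooth_on_def Ck_on_iff_fam)

lemma Ck_fam_of_Ck_on:
  "Ck_on k Z f \<Longrightarrow> Ck_fam k S Z (\<lambda>_. f)"
proof (induction k arbitrary: f)
  case 0
  then show ?case by (simp add: continuous_on_snd_fam)
next
  case (Suc k)
  then show ?case using differentiable_imp_continuous_on_all[of Z f]
    by (simp add: continuous_on_snd_fam)
qed

lemma smooth_on_fam: "smooth_on Z f \<Longrightarrow> Ck_fam k S Z (\<lambda>_. f)"
  by (simp add: smooth_on_def Ck_fam_of_Ck_on)

lemma smooth_on_has_derivative:
  "smooth_on Z f \<Longrightarrow> z \<in> Z \<Longrightarrow> (f has_derivative frechet_derivative f (at z)) (at z)"
  using Ck_fam_differentiable[of 0 "{0}" Z "\<lambda>_. f" 0 z] by (simp add: smooth_on_iff_fam del: Ck_fam.simps)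

lemma smooth_on_imp_continuous_on: "smooth_on Z f \<Longrightarrow> continuous_on Z f"
  unfolding smooth_on_def by (metis Ck_on.simps(1))

lemma smooth_on_deriv: "smooth_on Z f \<Longrightarrow> smooth_on Z (\<lambda>z. frechet_derivative f (at z) v)"
  unfolding smooth_on_def by (metis Ck_on.simps(2))

lemma smooth_on_subset: "smooth_on Z f \<Longrightarrow> Y \<subseteq> Z \<Longrightarrow> smooth_on Y f"
  unfolding smooth_on_iff_fam by (blast intro: Ck_fam_subset)

lemma smooth_on_cong: "smooth_on Z f \<Longrightarrow> open Z \<Longrightarrow> (\<And>z. z \<in> Z \<Longrightarrow> f z = g z) \<Longrightarrow> smooth_on Z g"
  unfolding smooth_on_iff_fam by (blast intro: Ck_fam_cong)

lemma smooth_on_local: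
  "(\<And>z. z \<in> Z \<Longrightarrow> \<exists>U. open U \<and> z \<in> U \<and> smooth_on (Z \<inter> U) f) \<Longrightarrow> smooth_on Z f"
  unfolding smooth_on_iff_fam by (meson Ck_fam_local)

lemma smooth_on_const: "smooth_on Z (\<lambda>z. c)"
  by (simp add: smooth_on_iff_fam Ck_fam_const)

lemma smooth_on_linear: "bounded_linear L \<Longrightarrow> smooth_on Z L"
  by (simp add: smooth_on_iff_fam Ck_fam_linear)

lemma smooth_on_add: "smooth_on Z f \<Longrightarrow> smooth_on Z g \<Longrightarrow> open Z \<Longrightarrow> smooth_on Z (\<lambda>z. f z + g z)"
  by (simp add: smooth_on_iff_fam Ck_fam_add)

lemma smooth_on_scaleR:
  "smooth_on Z f \<Longrightarrow> smooth_on Z g \<Longrightarrow> open Z \<Longrightarrow> smooth_on Z (\<lambda>z. f z *\<^sub>R g z)"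
  by (simp add: smooth_on_iff_fam Ck_fam_scaleR)

lemma smooth_on_mult:
  fixes f g :: "'e::euclidean_space \<Rightarrow> real"
  shows "smooth_on Z f \<Longrightarrow> smooth_on Z g \<Longrightarrow> open Z \<Longrightarrow> smooth_on Z (\<lambda>z. f z * g z)"
  using smooth_on_scaleR[of Z f g] by simp

lemma smooth_on_sum:
  "(\<And>i. i \<in> I \<Longrightarrow> smooth_on Z (f i)) \<Longrightarrow> open Z \<Longrightarrow> smooth_on Z (\<lambda>z. \<Sum>i\<in>I. f i z)"
  by (simp add: smooth_on_iff_fam Ck_fam_sum)

lemma smooth_on_bounded_linear:
  "bounded_linear L \<Longrightarrow> smooth_on Z f \<Longrightarrow> open Z \<Longrightarrow> smooth_on Z (\<lambda>z. L (f z))"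
  using Ck_fam_bounded_linear[of L _ "{0}" Z "\<lambda>_. f"] by (simp add: smooth_on_iff_fam)

lemma smooth_on_componentwise:
  fixes f :: "'e::euclidean_space \<Rightarrow> 'g::euclidean_space"
  assumes "\<And>b. b \<in> Basis \<Longrightarrow> smooth_on Z (\<lambda>z. f z \<bullet> b)" "open Z"
  shows "smooth_on Z f"
proof -
  have "smooth_on Z (\<lambda>z. \<Sum>b\<in>Basis. (f z \<bullet> b) *\<^sub>R b)"
    by (intro smooth_on_sum smooth_on_scaleR assms smooth_on_const)
  then show ?thesis by (simp add: euclidean_representation)
qed

lemma smooth_on_compose:
  fixes g :: "'f::euclidean_space \<Rightarrow> 'g::real_normed_vector"
  shows "smooth_on Z f \<Longrightarrow> smooth_on T g \<Longrightarrow> f ` Z \<subseteq> T \<Longrightarrow> open Z \<Longrightarrow> smooth_on Z (g \<circ> f)"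
  using Ck_fam_compose[of _ "{0}" Z "\<lambda>_. f" T "\<lambda>_. g"]
  by (simp add: smooth_on_iff_fam o_def image_subset_iff)

section \<open>The inverse function theorem for smooth maps\<close>

text \<open>With K bounding the inverse at \<open>y0\<close>, an operator within 1/(2K) of
  \<open>H y0\<close> has its inverse bounded by 2K. Then \<open>G y v - G y0 v\<close> is
  \<open>G y\<close> applied to a vector that tends to 0.\<close>

lemma continuous_inverse_operator:
  fixes H G :: "'e::euclidean_space \<Rightarrow> 'f::euclidean_space \<Rightarrow> 'f"
  assumes V: "open V" "y0 \<in> V"
    and lin: "\<And>y. y \<in> V \<Longrightarrow> linear (H y)" "\<And>y. y \<in> V \<Longrightarrow> linear (G y)"
    and inv: "\<And>y w. y \<in> V \<Longrightarrow> G y (H y w) = w" "\<And>y w. y \<in> V \<Longrightarrow> H y (G y w) = w"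
    and cont: "\<And>w. continuous (at y0) (\<lambda>y. H y w)"
  shows "continuous (at y0) (\<lambda>y. G y v)"
proof -
  obtain K where K: "K > 0" "\<And>w. norm (G y0 w) \<le> K * norm w"
    using linear_bounded_pos[OF lin(2)[OF V(2)]] by blast
  \<comment> \<open>The sum over basis vectors dominates the operator norm of
    \<open>H y - H y0\<close>, and it is continuous at \<open>y0\<close> as a finite sum of
    continuous terms.\<close>
  define \<epsilon> where "\<epsilon> = (\<lambda>y. \<Sum>b\<in>Basis. norm (H y b - H y0 b))"
  have "continuous (at y0) \<epsilon>"
    unfolding \<epsilon>_def by (intro continuous_sum continuous_norm continuous_diff cont continuous_const)
  then have "(\<epsilon> \<longlongrightarrow> \<epsilon> y0) (at y0)"
    by (simp add: continuous_at)
  then have "(\<epsilon> \<longlongrightarrow> 0) (at y0)" by (simp add: \<epsilon>_def)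
  then have small: "\<forall>\<^sub>F y in at y0. \<epsilon> y < 1 / (2 * K)"
    using K(1) by (intro order_tendstoD(2)) auto
  have diff: "norm (H y w - H y0 w) \<le> norm w * \<epsilon> y" if "y \<in> V" for y w
  proof -
    have "H y w - H y0 w = (\<Sum>b\<in>Basis. (w \<bullet> b) *\<^sub>R (H y b - H y0 b))"
      unfolding linear_eq_sum_Basis[OF lin(1)[OF that], of w] linear_eq_sum_Basis[OF lin(1)[OF V(2)], of w]
      by (simp add: sum_subtractf scaleR_right_diff_distrib)
    also have "norm \<dots> \<le> (\<Sum>b\<in>Basis. norm w * norm (H y b - H y0 b))"
      by (rule sum_norm_le) (auto intro: mult_right_mono simp: Basis_le_norm)
    finally show ?thesis by (simp add: \<epsilon>_def sum_distrib_left)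
  qed
  have bound: "norm (G y u) \<le> 2 * K * norm u" if "y \<in> V" "\<epsilon> y < 1 / (2 * K)" for y u
  proof -
    let ?w = "G y u"
    have "norm ?w = norm (G y0 (H y0 ?w))" using inv V by simp
    also have "\<dots> \<le> K * norm (H y0 ?w)" by (rule K)
    also have "norm (H y0 ?w) \<le> norm (H y ?w) + norm (H y ?w - H y0 ?w)"
      by norm
    also have "\<dots> \<le> norm u + norm ?w * (1 / (2 * K))"
      using diff[OF that(1), of ?w] inv(2)[OF that(1), of u] mult_left_mono[OF less_imp_le[OF that(2)], of "norm ?w"]
      by simp
    finally have "norm ?w \<le> K * (norm u + norm ?w * (1 / (2 * K)))"
      using K(1) by simp
    also have "\<dots> = K * norm u + norm ?w / 2" using K(1) by (simp add: field_simps)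
    finally show ?thesis by simp
  qed
  let ?z = "G y0 v"
  have "((\<lambda>y. H y ?z) \<longlongrightarrow> v) (at y0)"
    using cont[of ?z] inv(2)[OF V(2), of v] by (simp add: continuous_at)
  then have "((\<lambda>y. 2 * K * norm (v - H y ?z)) \<longlongrightarrow> 2 * K * norm (v - v)) (at y0)"
    by (intro tendsto_intros)
  then have lim: "((\<lambda>y. 2 * K * norm (v - H y ?z)) \<longlongrightarrow> 0) (at y0)" by simp
  have "\<forall>\<^sub>F y in at y0. y \<in> V"
    using V by (simp add: eventually_at_in_open')
  then have "\<forall>\<^sub>F y in at y0. norm (G y v - G y0 v) \<le> 2 * K * norm (v - H y ?z)"
    using small
  proof eventually_elim
    case (elim y)
    have "G y v - G y0 v = G y (v - H y ?z)"
      using inv elim by (simp add: linear_diff[OF lin(2)])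
    then show ?case using bound elim by metis
  qed
  then have "((\<lambda>y. G y v - G y0 v) \<longlongrightarrow> 0) (at y0)"
    by (rule Lim_null_comparison[OF _ lim])
  then show ?thesis
    by (simp add: continuous_at LIM_zero_iff)
qed

lemma Ck_fam_singleton_continuous_at:
  "Ck_fam k {0} V (\<lambda>_. f) \<Longrightarrow> open V \<Longrightarrow> y \<in> V \<Longrightarrow> continuous (at y) f"
  using Ck_fam_continuous[of k "{0}" V "\<lambda>_. f"]
  by (simp add: continuous_on_snd_fam_iff continuous_on_eq_continuous_at)

text \<open>The inverse of \<open>(y, w) \<mapsto> (y, H y w)\<close> is differentiable, since it is continuous.\<close>

lemma has_derivative_inverse_operator:
  fixes H G :: "'e::euclidean_space \<Rightarrow> 'f::euclidean_space \<Rightarrow> 'f"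
  assumes V: "open V" "y0 \<in> V"
    and lin: "\<And>y. y \<in> V \<Longrightarrow> linear (H y)" "\<And>y. y \<in> V \<Longrightarrow> linear (G y)"
    and inv: "\<And>y w. y \<in> V \<Longrightarrow> G y (H y w) = w" "\<And>y w. y \<in> V \<Longrightarrow> H y (G y w) = w"
    and der: "\<And>w. ((\<lambda>y. H y w) has_derivative (\<lambda>h. D h w)) (at y0)"
  shows "((\<lambda>y. G y v) has_derivative (\<lambda>h. - G y0 (\<Sum>b\<in>Basis. (G y0 v \<bullet> b) *\<^sub>R D h b))) (at y0)"
proof -
  have contG: "continuous (at y0) (\<lambda>y. G y v)" for v
    by (rule continuous_inverse_operator[OF V lin inv]) (assumption | rule has_derivative_continuous[OF der])+
  \<comment> \<open>Both maps are written over \<open>Basis\<close>, so that they are defined on all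
    pairs and only the finitely many maps \<open>H y b\<close> and \<open>G y b\<close> enter; over
    \<open>V\<close> they are \<open>(y, H y w)\<close> and \<open>(y, G y w)\<close>.\<close>
  define F where "F = (\<lambda>p::'e \<times> 'f. (fst p, \<Sum>b\<in>Basis. (snd p \<bullet> b) *\<^sub>R H (fst p) b))"
  define F' where "F' = (\<lambda>p::'e \<times> 'f. (fst p, \<Sum>b\<in>Basis. (snd p \<bullet> b) *\<^sub>R G (fst p) b))"
  define z where "z = G y0 v"
  have F: "F (y, w) = (y, H y w)" if "y \<in> V" for y w
    using linear_eq_sum_Basis[OF lin(1)[OF that], of w] by (simp add: F_def)
  have F': "F' (y, w) = (y, G y w)" if "y \<in> V" for y w
    using linear_eq_sum_Basis[OF lin(2)[OF that], of w] by (simp add: F'_def)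
  have derH: "((\<lambda>p::'e \<times> 'f. H (fst p) b) has_derivative (\<lambda>p. D (fst p) b)) (at (y0, w))" for b w
    using diff_chain_at[of fst fst "(y0, w)" "\<lambda>y. H y b" "\<lambda>h. D h b"] der[of b]
      has_derivative_fst[OF has_derivative_ident]
    by (auto simp: o_def)
  let ?F = "\<lambda>p::'e \<times> 'f. (fst p, H y0 (snd p) + (\<Sum>b\<in>Basis. (z \<bullet> b) *\<^sub>R D (fst p) b))"
  have "((\<lambda>p. \<Sum>b\<in>Basis. (snd p \<bullet> b) *\<^sub>R H (fst p) b) has_derivative
      (\<lambda>p. \<Sum>b\<in>Basis. (snd (y0, z) \<bullet> b) *\<^sub>R D (fst p) b + (snd p \<bullet> b) *\<^sub>R H (fst (y0, z)) b)) (at (y0, z))"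
    by (intro has_derivative_sum has_derivative_scaleR derH has_derivative_inner_left
        has_derivative_snd has_derivative_ident)
  then have "(F has_derivative (\<lambda>p. (fst p, \<Sum>b\<in>Basis. (z \<bullet> b) *\<^sub>R D (fst p) b + (snd p \<bullet> b) *\<^sub>R H y0 b))) (at (y0, z))"
    unfolding F_def by (intro has_derivative_Pair has_derivative_fst has_derivative_ident) simp
  also have "(\<lambda>p::'e \<times> 'f. (fst p, \<Sum>b\<in>Basis. (z \<bullet> b) *\<^sub>R D (fst p) b + (snd p \<bullet> b) *\<^sub>R H y0 b)) = ?F"
    by (simp add: sum.distrib add.commute flip: linear_eq_sum_Basis[OF lin(1)[OF V(2)]])
  finally have derF: "(F has_derivative ?F) (at (F' (y0, v)))"
    using V by (simp add: F' z_def)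
  let ?G = "\<lambda>p::'e \<times> 'f. (fst p, G y0 (snd p - (\<Sum>b\<in>Basis. (z \<bullet> b) *\<^sub>R D (fst p) b)))"
  have linD: "bounded_linear (\<lambda>h. D h b)" for b
    using der by (rule has_derivative_bounded_linear)
  have "(F' has_derivative ?G) (at (y0, v))"
  proof (rule has_derivative_inverse_basic[where g = F' and y = "(y0, v)", OF derF])
    have "bounded_linear (\<lambda>p::'e \<times> 'f. \<Sum>b\<in>Basis. (z \<bullet> b) *\<^sub>R D (fst p) b)"
      by (intro bounded_linear_sum bounded_linear_const_scaleR bounded_linear_compose[OF linD bounded_linear_fst])
    then show "bounded_linear ?G"
      by (intro bounded_linear_Pair bounded_linear_fst
          bounded_linear_compose[OF linear_conv_bounded_linear[THEN iffD1, OF lin(2)[OF V(2)]]]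
          bounded_linear_sub bounded_linear_snd)
    show "?G \<circ> ?F = id"
      using inv(1)[OF V(2)] by (simp add: fun_eq_iff)
    have "continuous (at (y0, v)) (\<lambda>p. G (fst p) b)" for b
      by (rule continuous_at_compose[of _ fst "\<lambda>y. G y b", unfolded o_def])
        (use contG in \<open>simp_all add: continuous_fst\<close>)
    then show "continuous (at (y0, v)) F'"
      unfolding F'_def by (intro continuous_intros)
    show "open (V \<times> (UNIV::'f set))" using V by (simp add: open_Times)
    show "(y0, v) \<in> V \<times> UNIV" using V by simp
    show "F (F' p) = p" if "p \<in> V \<times> UNIV" for p
      using that inv(2) by (auto simp: F F')
  qed
  then have "((\<lambda>y. snd (F' (y, v))) has_derivative (\<lambda>h. snd (?G (h, 0)))) (at y0)"
    using diff_chain_at[of "\<lambda>y. (y, v)" "\<lambda>h. (h, 0)" y0 "\<lambda>p. snd (F' p)" "\<lambda>p. snd (?G p)"]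
      has_derivative_snd[of F' ?G] has_derivative_Pair[OF has_derivative_ident has_derivative_const]
    by (auto simp: o_def)
  then have "((\<lambda>y. G y v) has_derivative (\<lambda>h. snd (?G (h, 0)))) (at y0)"
    by (rule has_derivative_transform_within_open[OF _ V]) (simp add: F')
  then show ?thesis
    using lin(2)[OF V(2)] by (simp add: z_def linear_neg)
qed

text \<open>The derivative of \<open>G y v\<close> is minus \<open>G y\<close> applied to the
  derivative of \<open>H\<close> at \<open>G y v\<close>. In this formula \<open>G\<close> appears
  undifferentiated, so order k of \<open>G\<close> gives order k + 1.\<close>

lemma Ck_inverse_operator:
  fixes H G :: "'e::euclidean_space \<Rightarrow> 'f::euclidean_space \<Rightarrow> 'f"
  assumes V: "open V"
    and lin: "\<And>y. y \<in> V \<Longrightarrow> linear (H y)" "\<And>y. y \<in> V \<Longrightarrow> linear (G y)"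
    and inv: "\<And>y w. y \<in> V \<Longrightarrow> G y (H y w) = w" "\<And>y w. y \<in> V \<Longrightarrow> H y (G y w) = w"
    and ck: "\<And>w. Ck_fam k {0} V (\<lambda>_ y. H y w)"
  shows "Ck_fam k {0} V (\<lambda>_ y. G y v)"
  using ck
proof (induction k arbitrary: v)
  case 0
  have "continuous_on V (\<lambda>y. G y v)"
    unfolding continuous_on_eq_continuous_at[OF V]
    by (intro ballI continuous_inverse_operator[OF V _ lin inv] Ck_fam_singleton_continuous_at[OF 0 V])
  then show ?case by (simp add: continuous_on_snd_fam)
next
  case (Suc k)
  have IH: "Ck_fam k {0} V (\<lambda>_ y. G y v)" for v
    by (rule Suc.IH[OF Ck_fam_SucD[OF Suc.prems]])
  have IH': "Ck_fam k {0} V (\<lambda>_ y. G y (u y))" if "Ck_fam k {0} V (\<lambda>_ y. u y)" for u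
  proof -
    have "Ck_fam k {0} V (\<lambda>_ y. \<Sum>b\<in>Basis. (u y \<bullet> b) *\<^sub>R G y b)"
      by (intro Ck_fam_sum Ck_fam_scaleR Ck_fam_inner Ck_fam_const IH that V)
    then show ?thesis
      by (rule Ck_fam_cong) (simp_all add: V flip: linear_eq_sum_Basis[OF lin(2)])
  qed
  let ?D = "\<lambda>y h w. frechet_derivative (\<lambda>y. H y w) (at y) h"
  have d: "((\<lambda>y. G y v) has_derivative (\<lambda>h. - G y (\<Sum>b\<in>Basis. (G y v \<bullet> b) *\<^sub>R ?D y h b))) (at y)"
    if "y \<in> V" for y v
    by (rule has_derivative_inverse_operator[OF V that lin inv])
      (use Ck_fam_differentiable[OF Suc.prems _ that] in auto)
  have "Ck_fam k {0} V (\<lambda>_ y. - G y (\<Sum>b\<in>Basis. (G y v \<bullet> b) *\<^sub>R ?D y h b))" for h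
    by (intro Ck_fam_bounded_linear[where L = uminus] bounded_linear_minus bounded_linear_ident IH'
        Ck_fam_sum Ck_fam_scaleR Ck_fam_inner Ck_fam_const IH V Ck_fam_deriv[OF Suc.prems])
  then have "Ck_fam k {0} V (\<lambda>_ y. frechet_derivative (\<lambda>y. G y v) (at y) h)" for h
    by (rule Ck_fam_cong) (use V in \<open>auto simp flip: frechet_derivative_at[OF d]\<close>)
  moreover have "continuous_on ({0::real} \<times> V) (\<lambda>(s, z). G z v)"
    using Ck_fam_continuous[OF IH] by auto
  ultimately show ?case using d by (auto simp: differentiable_def)
qed

text \<open>The derivative of the inverse is the inverse of the derivative of \<open>f\<close> along
  \<open>g\<close>. If \<open>g\<close> is C^k then so is this family of operators, hence
  \<open>g\<close> is C^(k+1); the induction starts from continuity of \<open>g\<close>.\<close>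

theorem smooth_inverse_function:
  fixes f :: "'f::euclidean_space \<Rightarrow> 'f"
  assumes U: "open U" "x0 \<in> U" and f: "smooth_on U f" and inj: "inj (frechet_derivative f (at x0))"
  obtains U' V g where "open U'" "U' \<subseteq> U" "x0 \<in> U'" "open V" "f x0 \<in> V" "homeomorphism U' V f g"
    "smooth_on V g" "\<And>x. x \<in> U' \<Longrightarrow> bij (frechet_derivative f (at x))"
proof -
  define f' where "f' = (\<lambda>x. Blinfun (frechet_derivative f (at x)))"
  have der: "(f has_derivative frechet_derivative f (at x)) (at x)" if "x \<in> U" for x
    by (rule smooth_on_has_derivative[OF f that])
  have f': "blinfun_apply (f' x) = frechet_derivative f (at x)" if "x \<in> U" for x
    unfolding f'_def by (rule bounded_linear_Blinfun_apply[OF has_derivative_bounded_linear[OF der[OF that]]])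
  have cont: "continuous_on U f'"
  proof (rule continuous_on_blinfun_componentwise)
    fix i :: 'f
    show "continuous_on U (\<lambda>x. blinfun_apply (f' x) i)"
      using smooth_on_imp_continuous_on[OF smooth_on_deriv[OF f, of i]]
      by (rule continuous_on_eq) (simp add: f')
  qed
  have lin: "linear (frechet_derivative f (at x))" if "x \<in> U" for x
    using der[OF that] by (rule has_derivative_linear)
  obtain j where j: "linear j" "j \<circ> frechet_derivative f (at x0) = id"
    using linear_injective_left_inverse[OF lin[OF U(2)] inj] by blast
  then have "blinfun_apply (Blinfun j) = j"
    by (simp add: bounded_linear_Blinfun_apply linear_conv_bounded_linear)
  then have invf: "Blinfun j o\<^sub>L f' x0 = id_blinfun"
    using j(2) f'[OF U(2)] by (intro blinfun_eqI) (simp add: fun_eq_iff)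
  have derf: "(f has_derivative blinfun_apply (f' x)) (at x)" if "x \<in> U" for x
    using der[OF that] f'[OF that] by simp
  show thesis
  proof (rule inverse_function_theorem[OF U(1) derf cont U(2) invf], assumption, goal_cases)
    case (1 U' V g g')
    note * = this
  have gU: "g y \<in> U'" if "y \<in> V" for y
    using *(6) that by (auto simp: homeomorphism_def)
  define H where "H = (\<lambda>y. frechet_derivative f (at (g y)))"
  have bij: "bij (H y)" if "y \<in> V" for y
    using *(9)[OF that] f'[of "g y"] gU[OF that] *(2) by (auto simp: H_def)
  have g': "g' y = inv (H y)" if "y \<in> V" for y
    using *(8)[OF that] f'[of "g y"] gU[OF that] *(2) by (auto simp: H_def)
  have derg: "(g has_derivative inv (H y)) (at y)" if "y \<in> V" for y
    using *(7)[OF that] g'[OF that] by simp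
  have Ck: "Ck_fam k {0} V (\<lambda>_. g)" for k
  proof (induction k)
    case 0
    show ?case using *(6) by (simp add: continuous_on_snd_fam homeomorphism_def)
  next
    case (Suc k)
    have "Ck_fam k {0} V (\<lambda>_ y. H y w)" for w
      unfolding H_def
      by (rule Ck_fam_compose[OF Suc, where h = "\<lambda>_ x. frechet_derivative f (at x) w" and T = U])
        (use *(2,4) gU smooth_on_fam[OF smooth_on_deriv[OF f]] in auto)
    then have "Ck_fam k {0} V (\<lambda>_ y. inv (H y) v)" for v
    proof (rule Ck_inverse_operator[OF *(4), rotated -1])
      fix y assume y: "y \<in> V"
      then have "g y \<in> U" using gU *(2) by auto
      from lin[OF this] show "linear (H y)" by (simp add: H_def)
      show "linear (inv (H y))" using derg[OF y] by (rule has_derivative_linear)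
      show "inv (H y) (H y w) = w" "H y (inv (H y) w) = w" for w
        using bij[OF y] by (auto simp: bij_def inv_f_f surj_f_inv_f)
    qed
    then have "Ck_fam k {0} V (\<lambda>_ y. frechet_derivative g (at y) v)" for v
      by (rule Ck_fam_cong) (use *(4) in \<open>auto simp flip: frechet_derivative_at[OF derg]\<close>)
    with Ck_fam_continuous[OF Suc] derg show ?case
      by (auto simp: differentiable_def)
  qed
  then have "smooth_on V g" by (simp add: smooth_on_iff_fam)
  moreover have "bij (frechet_derivative f (at x))" if "x \<in> U'" for x
  proof -
    have "f x \<in> V" "g (f x) = x" using *(6) that by (auto simp: homeomorphism_def)
    then show ?thesis using bij[of "f x"] by (simp add: H_def)
  qed
  ultimately show ?case by (rule that[OF *(1-6)])
qed
qed

section \<open>Smooth dependence for ordinary differential equations\<close>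

text \<open>The integral from 0 to s of the right-hand side along \<open>y\<close>, moved to the
  fixed interval [0,1] by substitution, so that its dependence on s is that of an integrand on a
  parameter. The value at s = 0 is 0.\<close>

definition picard :: "(real \<Rightarrow> 'e \<times> 'f \<Rightarrow> 'f::euclidean_space) \<Rightarrow> (real \<Rightarrow> 'e \<Rightarrow> 'f) \<Rightarrow> real \<Rightarrow> 'e \<Rightarrow> 'f" where
  "picard R y s z = s *\<^sub>R integral {0..1} (\<lambda>\<sigma>. R (s * \<sigma>) (z, y (s * \<sigma>) z))"

text \<open>Integral form of the initial value problem y' = R(s, (z, y)), y(0) = 0; other initial
  values have to be put into \<open>R\<close>.\<close>

definition ode_solution ::
  "(real \<Rightarrow> 'e::euclidean_space \<times> 'f \<Rightarrow> 'f::euclidean_space) \<Rightarrow> 'e set \<Rightarrow> (real \<Rightarrow> 'e \<Rightarrow> 'f) \<Rightarrow> bool" where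
  "ode_solution R Z y \<longleftrightarrow> continuous_on ({0..1} \<times> Z) (\<lambda>(s, z). y s z) \<and>
     (\<forall>s\<in>{0..1}. \<forall>z\<in>Z. y s z = picard R y s z)"

lemma mult_unit_interval: "s \<in> {0..1} \<Longrightarrow> t \<in> {0..1} \<Longrightarrow> s * t \<in> {0..1::real}"
  by (simp add: mult_le_one)

lemma continuous_on_slice:
  assumes "continuous_on (S \<times> Z) (\<lambda>(s, z). f s z)" "z \<in> Z"
  shows "continuous_on S (\<lambda>s. f s z)"
proof -
  have "continuous_on S (\<lambda>s. (s, z))"
    by (intro continuous_on_Pair continuous_on_id continuous_on_const)
  from continuous_on_compose2[OF assms(1) this] assms(2) show ?thesis by auto
qed

lemma continuous_on_scaled:
  fixes g :: "real \<Rightarrow> 'f::topological_space"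
  assumes "continuous_on {0..1} g" "s \<in> {0..1}"
  shows "continuous_on {0..1} (\<lambda>\<sigma>. g (s * \<sigma>))"
proof (rule continuous_on_compose2[OF assms(1)])
  show "continuous_on {0..1} (\<lambda>\<sigma>. s * \<sigma>)"
    by (intro continuous_on_mult continuous_on_const continuous_on_id)
  show "(\<lambda>\<sigma>. s * \<sigma>) ` {0..1} \<subseteq> {0..1}"
    using mult_unit_interval[OF assms(2)] by blast
qed

lemma integrable_scaled:
  fixes g :: "real \<Rightarrow> 'f::banach"
  shows "continuous_on {0..1} g \<Longrightarrow> s \<in> {0..1} \<Longrightarrow> (\<lambda>\<sigma>. g (s * \<sigma>)) integrable_on {0..1}"
  by (rule integrable_continuous_real[OF continuous_on_scaled])

lemma continuous_on_scaled_integral: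
  fixes f :: "real \<Rightarrow> 'e::metric_space \<Rightarrow> 'f::banach"
  assumes "continuous_on ({0..1} \<times> Z) (\<lambda>(s, z). f s z)"
  shows "continuous_on ({0..1} \<times> Z) (\<lambda>(s, z). s *\<^sub>R integral {0..1} (\<lambda>\<sigma>. f (s * \<sigma>) z))"
proof -
  have "continuous_on (({0..1} \<times> Z) \<times> cbox 0 1) (\<lambda>x. (fst (fst x) * snd x, snd (fst x)) :: real \<times> 'e)"
    by (intro continuous_on_Pair continuous_on_mult continuous_on_fst continuous_on_snd continuous_on_id)
  then have "continuous_on (({0..1} \<times> Z) \<times> cbox 0 1)
      (\<lambda>x. (\<lambda>(s, z). f s z) (fst (fst x) * snd x, snd (fst x)))"
    by (rule continuous_on_compose2[OF assms]) (use mult_unit_interval in auto)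
  then have "continuous_on (({0..1} \<times> Z) \<times> cbox 0 1) (\<lambda>(x, \<sigma>). f (fst x * \<sigma>) (snd x))"
    by (simp add: case_prod_beta)
  from integral_continuous_on_param[OF this]
  have "continuous_on ({0..1} \<times> Z) (\<lambda>x. fst x *\<^sub>R integral {0..1} (\<lambda>\<sigma>. f (fst x * \<sigma>) (snd x)))"
    by (intro continuous_on_scaleR continuous_on_fst continuous_on_id) simp
  then show ?thesis by (simp add: case_prod_beta)
qed

lemma norm_scaled_integral_le:
  fixes g :: "real \<Rightarrow> 'f::banach"
  assumes "continuous_on {0..1} g" "s \<in> {0..1}" "\<And>t. t \<in> {0..1} \<Longrightarrow> norm (g t) \<le> B"
  shows "norm (s *\<^sub>R integral {0..1} (\<lambda>\<sigma>. g (s * \<sigma>))) \<le> B"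
proof -
  have "norm (integral {0..1} (\<lambda>\<sigma>. g (s * \<sigma>))) \<le> B * (1 - 0)"
    by (rule integral_bound[OF _ continuous_on_scaled[OF assms(1,2)]])
      (use assms mult_unit_interval in auto)
  then have "\<bar>s\<bar> * norm (integral {0..1} (\<lambda>\<sigma>. g (s * \<sigma>))) \<le> 1 * B"
    using assms(2) by (intro mult_mono) auto
  then show ?thesis by simp
qed

lemma scaled_integral_diff:
  fixes f g :: "real \<Rightarrow> 'f::banach"
  assumes "continuous_on {0..1} f" "continuous_on {0..1} g" "s \<in> {0..1}"
  shows "s *\<^sub>R integral {0..1} (\<lambda>\<sigma>. f (s * \<sigma>)) - s *\<^sub>R integral {0..1} (\<lambda>\<sigma>. g (s * \<sigma>))
    = s *\<^sub>R integral {0..1} (\<lambda>\<sigma>. f (s * \<sigma>) - g (s * \<sigma>))"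
  using integrable_scaled[OF assms(1,3)] integrable_scaled[OF assms(2,3)]
  by (simp add: integral_diff scaleR_right_diff_distrib)

text \<open>At a point where the norm is maximal, with B this maximum, the hypothesis reads B \<le>
  a + B/2. It serves for Lipschitz estimates, for the remainder in a derivative, and with a = 0 for
  uniqueness.\<close>

lemma contraction_bound:
  fixes \<delta> :: "real \<Rightarrow> 'f::real_normed_vector"
  assumes "continuous_on {0..1} \<delta>"
    and contr: "\<And>B s. (\<And>s. s \<in> {0..1} \<Longrightarrow> norm (\<delta> s) \<le> B) \<Longrightarrow> s \<in> {0..1} \<Longrightarrow> norm (\<delta> s) \<le> a + B / 2"
    and s: "s \<in> {0..1}"
  shows "norm (\<delta> s) \<le> 2 * a"
proof -
  obtain t where t: "t \<in> {0..1}" "\<And>s. s \<in> {0..1} \<Longrightarrow> norm (\<delta> s) \<le> norm (\<delta> t)"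
    using continuous_attains_sup[of "{0..1::real}" "\<lambda>s. norm (\<delta> s)"] continuous_on_norm[OF assms(1)]
    by auto
  from contr[OF t(2) t(1)] have "norm (\<delta> t) \<le> 2 * a" by simp
  with t(2)[OF s] show ?thesis by simp
qed

lemma continuous_on_graph:
  assumes "continuous_on (S \<times> (Z \<times> X)) (\<lambda>(s, p). R s p)" "continuous_on (S \<times> Z) (\<lambda>(s, z). y s z)"
    and "\<And>s z. s \<in> S \<Longrightarrow> z \<in> Z \<Longrightarrow> y s z \<in> X"
  shows "continuous_on (S \<times> Z) (\<lambda>(s, z). R s (z, y s z))"
proof (rule continuous_on_compose_fam[where u = "\<lambda>s z. (z, y s z)", OF _ assms(1)])
  have "continuous_on (S \<times> Z) (\<lambda>x. (snd x, (\<lambda>(s, z). y s z) x))"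
    by (intro continuous_on_Pair continuous_on_snd continuous_on_id assms)
  then show "continuous_on (S \<times> Z) (\<lambda>(s, z). (z, y s z))"
    by (simp add: case_prod_beta)
qed (use assms in auto)

text \<open>Banach's fixed point theorem on the bounded continuous functions of the whole space: the
  closest-point retraction onto [0,1] \<times> Z extends functions from the compact convex domain.
  The Lipschitz constant 1/2 on an interval of length 1 gives a contraction.\<close>

lemma picard_exists:
  fixes R :: "real \<Rightarrow> 'e::euclidean_space \<times> 'f::euclidean_space \<Rightarrow> 'f"
  assumes Z: "compact Z" "convex Z"
    and R: "continuous_on ({0..1} \<times> (Z \<times> UNIV)) (\<lambda>(s, p). R s p)"
    and lip: "\<And>s z x x'. s \<in> {0..1} \<Longrightarrow> z \<in> Z \<Longrightarrow> norm (R s (z, x) - R s (z, x')) \<le> norm (x - x') / 2"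
  shows "\<exists>y. ode_solution R Z y"
proof (cases "Z = {}")
  case False
  define D where "D = {0..1::real} \<times> Z"
  define c where "c = closest_point D"
  have D: "compact D" "convex D" "D \<noteq> {}"
    using Z False by (auto simp: D_def compact_Times convex_Times)
  then have "closed D" by (simp add: compact_imp_closed)
  with D have c: "continuous_on UNIV c" "c p \<in> D" "p \<in> D \<Longrightarrow> c p = p" for p
    unfolding c_def by (auto intro: continuous_on_closest_point closest_point_in_set closest_point_self)
  define F where "F = (\<lambda>(w :: real \<times> 'e \<Rightarrow> 'f) (s, z). picard R (\<lambda>s z. w (s, z)) s z)"
  have contR: "continuous_on ({0..1} \<times> Z) (\<lambda>(s, z). R s (z, w (s, z)))" if "continuous_on UNIV w" for w
    by (rule continuous_on_graph[OF R]) (use that in \<open>auto simp: case_prod_beta intro: continuous_on_subset\<close>)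
  have contF: "continuous_on D (F w)" if "continuous_on UNIV w" for w
    using continuous_on_scaled_integral[OF contR[OF that]] by (simp add: F_def D_def picard_def)
  have bF: "(\<lambda>p. F w (c p)) \<in> bcontfun" if "continuous_on UNIV w" for w
  proof -
    have "continuous_on UNIV (\<lambda>p. F w (c p))"
      by (rule continuous_on_compose2[OF contF[OF that] c(1)]) (use c in auto)
    moreover have "bounded (F w ` D)"
      by (rule compact_imp_bounded[OF compact_continuous_image[OF contF[OF that] D(1)]])
    then have "bounded (range (\<lambda>p. F w (c p)))"
      by (rule bounded_subset) (use c in auto)
    ultimately show ?thesis by (simp add: bcontfun_def)
  qed
  define T where "T = (\<lambda>w. Bcontfun (\<lambda>p. F (apply_bcontfun w) (c p)))"
  have T: "apply_bcontfun (T w) p = F (apply_bcontfun w) (c p)" for w p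
    unfolding T_def using Bcontfun_inverse[OF bF[of "apply_bcontfun w"]] by simp
  have "dist (T w) (T w') \<le> 1 / 2 * dist w w'" for w w'
  proof (rule dist_bound)
    fix p
    obtain s z where sz: "c p = (s, z)" "s \<in> {0..1}" "z \<in> Z"
      using c(2)[of p] by (auto simp: D_def)
    let ?g = "\<lambda>w t. R t (z, apply_bcontfun w (t, z))"
    have cont: "continuous_on {0..1} (?g w)" for w
      by (rule continuous_on_slice[OF contR sz(3)]) simp
    have "dist (apply_bcontfun (T w) p) (apply_bcontfun (T w') p)
      = norm (s *\<^sub>R integral {0..1} (\<lambda>\<sigma>. ?g w (s * \<sigma>) - ?g w' (s * \<sigma>)))"
      using scaled_integral_diff[OF cont cont sz(2), of w w'] by (simp add: T sz F_def picard_def dist_norm)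
    also have "\<dots> \<le> 1 / 2 * dist w w'"
    proof (rule norm_scaled_integral_le[OF continuous_on_diff[OF cont cont] sz(2)])
      fix t :: real assume "t \<in> {0..1}"
      from lip[OF this sz(3), of "apply_bcontfun w (t, z)" "apply_bcontfun w' (t, z)"]
      show "norm (?g w t - ?g w' t) \<le> 1 / 2 * dist w w'"
        using dist_bounded[of w "(t, z)" w'] by (simp add: dist_norm)
    qed
    finally show "dist (apply_bcontfun (T w) p) (apply_bcontfun (T w') p) \<le> 1 / 2 * dist w w'" .
  qed
  then obtain w where w: "T w = w"
    using banach_fix_type[of "1/2" T] by auto
  have "ode_solution R Z (\<lambda>s z. apply_bcontfun w (s, z))"
    unfolding ode_solution_def
  proof (intro conjI ballI)
    show "continuous_on ({0..1} \<times> Z) (\<lambda>(s, z). apply_bcontfun w (s, z))"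
      by (simp add: case_prod_beta)
    show "apply_bcontfun w (s, z) = picard R (\<lambda>s z. apply_bcontfun w (s, z)) s z"
      if "s \<in> {0..1}" "z \<in> Z" for s z
      using T[of w "(s, z)"] c(3)[of "(s, z)"] that by (simp add: w F_def D_def)
  qed
  then show ?thesis by blast
qed (auto simp: ode_solution_def)

section \<open>Differentiation of solutions in the parameter\<close>

lemma Ck_fam_mono: "Ck_fam n S Z u \<Longrightarrow> m \<le> n \<Longrightarrow> Ck_fam m S Z u"
proof (induction n)
  case (Suc n)
  show ?case
  proof (cases "m = Suc n")
    case False
    with Suc Ck_fam_SucD[OF Suc.prems(1)] show ?thesis by simp
  qed (use Suc.prems in simp)
qed simp

text \<open>The linearized equation along the solution is solved for each basis direction; Taylor's
  formula with uniform remainder and the contraction estimate identify the result with the derivative.\<close>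

lemma ode_solution_derivative_local:
  fixes R :: "real \<Rightarrow> 'e::euclidean_space \<times> 'f::euclidean_space \<Rightarrow> 'f"
  assumes Z: "open Z" and \<Omega>: "open \<Omega>" "convex \<Omega>" and R: "Ck_fam (Suc 0) {0..1} (Z \<times> \<Omega>) R"
    and y: "ode_solution R Z y" "\<And>s z. s \<in> {0..1} \<Longrightarrow> z \<in> Z \<Longrightarrow> y s z \<in> \<Omega>"
    and bnd: "\<And>s z x h. s \<in> {0..1} \<Longrightarrow> z \<in> Z \<Longrightarrow> x \<in> \<Omega> \<Longrightarrow>
        norm (frechet_derivative (R s) (at (z, x)) (0, h)) \<le> norm h / 2"
    and z0: "z0 \<in> Z"
  shows "\<exists>\<delta>>0. \<exists>L. ball z0 \<delta> \<subseteq> Z \<and>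
    (\<forall>s\<in>{0..1}. \<forall>z\<in>ball z0 \<delta>. (y s has_derivative L s z) (at z)) \<and>
    (\<forall>v. ode_solution (\<lambda>s p. frechet_derivative (R s) (at (fst p, y s (fst p))) (v, snd p))
        (ball z0 \<delta>) (\<lambda>s z. L s z v))"
proof -
  let ?I = "{0..1::real}"
  have ycont: "continuous_on (?I \<times> Z) (\<lambda>(s, z). y s z)"
    and yeq: "\<And>s z. s \<in> ?I \<Longrightarrow> z \<in> Z \<Longrightarrow> y s z = picard R y s z"
    using y(1) by (auto simp: ode_solution_def)
  define J where "J = (\<lambda>s q. Blinfun (frechet_derivative (R s) (at q)))"
  have derR: "(R s has_derivative frechet_derivative (R s) (at q)) (at q)" if "s \<in> ?I" "q \<in> Z \<times> \<Omega>" for s q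
    by (rule Ck_fam_differentiable[OF R that])
  have J: "blinfun_apply (J s q) = frechet_derivative (R s) (at q)" if "s \<in> ?I" "q \<in> Z \<times> \<Omega>" for s q
    unfolding J_def
    by (rule bounded_linear_Blinfun_apply[OF has_derivative_bounded_linear[OF derR[OF that]]])
  have derJ: "(R s has_derivative blinfun_apply (J s q)) (at q)" if "s \<in> ?I" "q \<in> Z \<times> \<Omega>" for s q
    using derR[OF that] J[OF that] by simp
  have Jcont: "continuous_on (?I \<times> (Z \<times> \<Omega>)) (\<lambda>(s, q). J s q)"
  proof (rule continuous_on_blinfun_componentwise)
    fix i :: "'e \<times> 'f"
    have "continuous_on (?I \<times> (Z \<times> \<Omega>)) (\<lambda>(s, q). frechet_derivative (R s) (at q) i)"
      using Ck_fam_deriv[OF R, of i] by simp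
    then show "continuous_on (?I \<times> (Z \<times> \<Omega>)) (\<lambda>x. blinfun_apply ((\<lambda>(s, q). J s q) x) i)"
      by (rule continuous_on_eq) (auto simp: J)
  qed
  have Rcont: "continuous_on (?I \<times> (Z \<times> \<Omega>)) (\<lambda>(s, q). R s q)"
    by (rule Ck_fam_continuous[OF R])
  have Jbnd: "norm (blinfun_apply (J s (z, x)) (0, h)) \<le> norm h / 2"
    if "s \<in> ?I" "z \<in> Z" "x \<in> \<Omega>" for s z x h
    using bnd[OF that] J[of s "(z, x)"] that by simp
  obtain \<delta> where \<delta>: "\<delta> > 0" "cball z0 \<delta> \<subseteq> Z"
    using Z z0 open_contains_cball by blast
  define C where "C = cball z0 \<delta>"
  have C: "compact C" "convex C" "C \<subseteq> Z" using \<delta> by (auto simp: C_def)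
  \<comment> \<open>The hull of all values makes the product \<open>Q\<close> compact and convex. It
    stays in \<Omega>, and the mean value estimates below run along segments inside it.\<close>
  define X where "X = convex hull ((\<lambda>(s, z). y s z) ` (?I \<times> C))"
  have "continuous_on (?I \<times> C) (\<lambda>(s, z). y s z)"
    by (rule continuous_on_subset[OF ycont]) (use C in auto)
  then have X: "compact X" "convex X"
    unfolding X_def using C(1)
    by (auto intro!: compact_convex_hull compact_continuous_image compact_Times)
  have X\<Omega>: "X \<subseteq> \<Omega>"
    unfolding X_def by (rule hull_minimal) (use y(2) C \<Omega> in auto)
  have yX: "y s z \<in> X" if "s \<in> ?I" "z \<in> C" for s z
    unfolding X_def by (rule hull_inc) (use that in force)
  define Q where "Q = C \<times> X"
  have Q: "compact Q" "convex Q" "Q \<subseteq> Z \<times> \<Omega>"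
    using C X X\<Omega> by (auto simp: Q_def compact_Times convex_Times)
  have JQ: "continuous_on (?I \<times> Q) (\<lambda>(s, q). J s q)"
    by (rule continuous_on_subset[OF Jcont]) (use Q in auto)
  have cIQ: "compact (?I \<times> Q)" using Q by (auto intro: compact_Times)
  have "bounded ((\<lambda>(s, q). J s q) ` (?I \<times> Q))"
    by (rule compact_imp_bounded[OF compact_continuous_image[OF JQ cIQ]])
  then obtain N where N: "N > 0" "\<And>s q. s \<in> ?I \<Longrightarrow> q \<in> Q \<Longrightarrow> norm (J s q) \<le> N"
    unfolding bounded_pos by fastforce
  have unif: "\<exists>\<eta>>0. \<forall>s\<in>?I. \<forall>q\<in>Q. \<forall>q'\<in>Q. dist q' q < \<eta> \<longrightarrow> norm (J s q' - J s q) < \<epsilon>" if "\<epsilon> > 0" for \<epsilon>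
  proof -
    have "uniformly_continuous_on (?I \<times> Q) (\<lambda>(s, q). J s q)"
      by (rule compact_uniformly_continuous[OF JQ cIQ])
    then obtain \<eta> where "\<eta> > 0" and \<eta>: "\<And>x x'. x \<in> ?I \<times> Q \<Longrightarrow> x' \<in> ?I \<times> Q \<Longrightarrow> dist x' x < \<eta> \<Longrightarrow>
        dist ((\<lambda>(s, q). J s q) x') ((\<lambda>(s, q). J s q) x) < \<epsilon>"
      unfolding uniformly_continuous_on_def using \<open>\<epsilon> > 0\<close> by metis
    have "norm (J s q' - J s q) < \<epsilon>" if "s \<in> ?I" "q \<in> Q" "q' \<in> Q" "dist q' q < \<eta>" for s q q'
      using \<eta>[of "(s, q)" "(s, q')"] that by (simp add: dist_norm norm_Pair)
    with \<open>\<eta> > 0\<close> show ?thesis by blast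
  qed
  have JG: "continuous_on (?I \<times> Z) (\<lambda>(s, z). J s (z, y s z))"
    by (rule continuous_on_graph[OF Jcont ycont]) (use y(2) in auto)
  define R' where "R' = (\<lambda>v s p. blinfun_apply (J s (fst p, y s (fst p))) (v, snd p))"
  have R'cont: "continuous_on (?I \<times> (C \<times> UNIV)) (\<lambda>(s, p). R' v s p)" for v
  proof -
    have "continuous_on (?I \<times> (C \<times> (UNIV :: 'f set))) (\<lambda>x. (fst x, fst (snd x)) :: real \<times> 'e)"
      by (intro continuous_on_Pair continuous_on_fst continuous_on_snd continuous_on_id)
    then have "continuous_on (?I \<times> (C \<times> (UNIV :: 'f set))) (\<lambda>x. (\<lambda>(s, z). J s (z, y s z)) (fst x, fst (snd x)))"
      by (rule continuous_on_compose2[OF JG]) (use C in auto)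
    then have "continuous_on (?I \<times> (C \<times> (UNIV :: 'f set))) (\<lambda>x. blinfun_apply
        ((\<lambda>(s, z). J s (z, y s z)) (fst x, fst (snd x))) (v, snd (snd x)))"
      by (intro bounded_bilinear.continuous_on[OF bounded_bilinear_blinfun_apply] continuous_on_Pair
          continuous_on_const continuous_on_snd continuous_on_id)
    then show ?thesis by (simp add: R'_def case_prod_beta)
  qed
  have "\<exists>W. ode_solution (R' v) C W" for v
  proof (rule picard_exists[OF C(1,2) R'cont])
    fix s z and x x' :: 'f assume sz: "s \<in> ?I" "z \<in> C"
    have "R' v s (z, x) - R' v s (z, x') = blinfun_apply (J s (z, y s z)) (0, x - x')"
      by (simp add: R'_def flip: blinfun.diff_right)
    then show "norm (R' v s (z, x) - R' v s (z, x')) \<le> norm (x - x') / 2"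
      using Jbnd[of s z "y s z"] sz C y(2)[of s z] by auto
  qed
  then obtain W where W: "\<And>v. ode_solution (R' v) C (W v)" by metis
  \<comment> \<open>Linear in \<open>h\<close> by construction; that it solves the linearized
    equation in every direction is superposition, shown in \<open>Leq\<close>.\<close>
  define L where "L = (\<lambda>s z h. \<Sum>i\<in>Basis. (h \<bullet> i) *\<^sub>R W i s z)"
  have Wcont: "continuous_on (?I \<times> C) (\<lambda>(s, z). W i s z)" for i
    using W by (auto simp: ode_solution_def)
  have Lcont: "continuous_on (?I \<times> C) (\<lambda>(s, z). L s z v)" for v
  proof -
    have "continuous_on (?I \<times> C) (\<lambda>x. \<Sum>i\<in>Basis. (v \<bullet> i) *\<^sub>R (\<lambda>(s, z). W i s z) x)"
      by (intro continuous_on_sum continuous_on_scaleR continuous_on_const Wcont)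
    then show ?thesis by (simp add: L_def case_prod_beta)
  qed
  have R'slice: "continuous_on ?I (\<lambda>s. R' v s (z, x s))" if "z \<in> C" "continuous_on ?I x" for v z x
  proof -
    have "continuous_on ?I (\<lambda>s. (s, (z, x s)))"
      by (intro continuous_on_Pair continuous_on_id continuous_on_const that)
    from continuous_on_compose2[OF R'cont this] that show ?thesis by auto
  qed
  have Leq: "L s z v = picard (R' v) (\<lambda>s z. L s z v) s z" if s: "s \<in> ?I" and z: "z \<in> C" for s z v
  proof -
    have int: "(\<lambda>\<sigma>. R' i (s * \<sigma>) (z, W i (s * \<sigma>) z)) integrable_on ?I" for i
      by (rule integrable_scaled[OF R'slice[OF z continuous_on_slice[OF Wcont z]] s])
    have "W i s z = picard (R' i) (W i) s z" for i
      using W[of i] s z by (simp add: ode_solution_def)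
    then have "L s z v = (\<Sum>i\<in>Basis. (v \<bullet> i) *\<^sub>R (s *\<^sub>R integral ?I (\<lambda>\<sigma>. R' i (s * \<sigma>) (z, W i (s * \<sigma>) z))))"
      unfolding L_def picard_def by simp
    also have "\<dots> = s *\<^sub>R (\<Sum>i\<in>Basis. integral ?I (\<lambda>\<sigma>. (v \<bullet> i) *\<^sub>R R' i (s * \<sigma>) (z, W i (s * \<sigma>) z)))"
      by (simp add: scaleR_right.sum scaleR_left_commute mult.commute)
    also have "\<dots> = s *\<^sub>R integral ?I (\<lambda>\<sigma>. \<Sum>i\<in>Basis. (v \<bullet> i) *\<^sub>R R' i (s * \<sigma>) (z, W i (s * \<sigma>) z))"
      by (subst integral_sum) (auto intro: integrable_cmul int)
    also have "(\<lambda>\<sigma>. \<Sum>i\<in>Basis. (v \<bullet> i) *\<^sub>R R' i (s * \<sigma>) (z, W i (s * \<sigma>) z)) =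
        (\<lambda>\<sigma>. R' v (s * \<sigma>) (z, L (s * \<sigma>) z v))"
    proof
      fix \<sigma>
      have "(v, L (s * \<sigma>) z v) = (\<Sum>i\<in>Basis. (v \<bullet> i) *\<^sub>R (i, W i (s * \<sigma>) z))"
        by (simp add: L_def sum_prod euclidean_representation)
      then have "blinfun_apply (J (s * \<sigma>) (z, y (s * \<sigma>) z)) (v, L (s * \<sigma>) z v) =
          (\<Sum>i\<in>Basis. (v \<bullet> i) *\<^sub>R blinfun_apply (J (s * \<sigma>) (z, y (s * \<sigma>) z)) (i, W i (s * \<sigma>) z))"
        by (simp only: blinfun.sum_right blinfun.scaleR_right)
      then show "(\<Sum>i\<in>Basis. (v \<bullet> i) *\<^sub>R R' i (s * \<sigma>) (z, W i (s * \<sigma>) z)) = R' v (s * \<sigma>) (z, L (s * \<sigma>) z v)"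
        by (simp add: R'_def)
    qed
    finally show ?thesis by (simp add: picard_def)
  qed
  have lip1: "norm (R t (z', c) - R t (z, c)) \<le> N * norm (z' - z)"
    if "t \<in> ?I" "z \<in> C" "z' \<in> C" "c \<in> X" for t z z' c
  proof -
    have "norm (R t (z', c) - R t (z, c)) \<le> N * norm ((z', c) - (z, c))"
    proof (rule differentiable_bound[OF Q(2), where f' = "\<lambda>q. blinfun_apply (J t q)"])
      fix q assume q: "q \<in> Q"
      with Q have "q \<in> Z \<times> \<Omega>" by blast
      from derJ[OF that(1) this] show "(R t has_derivative blinfun_apply (J t q)) (at q within Q)"
        by (rule has_derivative_at_withinI)
      show "onorm (blinfun_apply (J t q)) \<le> N"
        using N(2)[OF that(1) q] by (simp add: norm_blinfun.rep_eq)
    qed (use that in \<open>auto simp: Q_def\<close>)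
    then show ?thesis by (simp add: norm_Pair)
  qed
  have lip2: "norm (R t (z, a) - R t (z, c)) \<le> 1 / 2 * norm (a - c)"
    if "t \<in> ?I" "z \<in> C" "a \<in> X" "c \<in> X" for t z a c
  proof (rule differentiable_bound[OF X(2), where f = "\<lambda>x. R t (z, x)" and f' = "\<lambda>x h. blinfun_apply (J t (z, x)) (0, h)"])
    fix x assume x: "x \<in> X"
    then have zx: "(z, x) \<in> Z \<times> \<Omega>" using that C X\<Omega> by auto
    have "(Pair z has_derivative (\<lambda>h. (0, h))) (at x)"
      by (intro has_derivative_Pair has_derivative_const has_derivative_ident)
    from diff_chain_at[OF this derJ[OF that(1) zx]]
    have "((\<lambda>x. R t (z, x)) has_derivative (\<lambda>h. blinfun_apply (J t (z, x)) (0, h))) (at x)"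
      by (simp add: o_def)
    then show "((\<lambda>x. R t (z, x)) has_derivative (\<lambda>h. blinfun_apply (J t (z, x)) (0, h))) (at x within X)"
      by (rule has_derivative_at_withinI)
    show "onorm (\<lambda>h. blinfun_apply (J t (z, x)) (0, h)) \<le> 1 / 2"
      by (rule onorm_le) (use Jbnd[OF that(1), of z x] zx in auto)
  qed (use that in auto)
  have der: "(y s has_derivative L s z) (at z)" if s: "s \<in> ?I" and z: "z \<in> ball z0 \<delta>" for s z
    unfolding has_derivative_at_alt
  proof (intro conjI allI impI)
    show "bounded_linear (L s z)"
      unfolding L_def by (intro bounded_linear_sum bounded_linear_scaleR_const bounded_linear_inner_left)
    fix e :: real assume "e > 0"
    have zC: "z \<in> C" using z by (simp add: C_def)
    \<comment> \<open>The points of the graph move by at most (1 + 2N) |h| because of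
      \<open>ylip\<close>, and \<open>contraction_bound\<close> doubles the remainder; with this
      choice the final error is e |h|.\<close>
    define \<epsilon> where "\<epsilon> = e / (2 * (1 + 2 * N))"
    have "\<epsilon> > 0" using \<open>e > 0\<close> N by (simp add: \<epsilon>_def)
    from unif[OF this] obtain \<eta> where \<eta>: "\<eta> > 0"
      "\<And>s q q'. s \<in> ?I \<Longrightarrow> q \<in> Q \<Longrightarrow> q' \<in> Q \<Longrightarrow> dist q' q < \<eta> \<Longrightarrow> norm (J s q' - J s q) < \<epsilon>"
      by blast
    obtain \<rho> where \<rho>: "\<rho> > 0" "ball z \<rho> \<subseteq> ball z0 \<delta>"
      using z open_contains_ball[of "ball z0 \<delta>"] by (meson open_ball)
    show "\<exists>d>0. \<forall>z'. norm (z' - z) < d \<longrightarrow> norm (y s z' - y s z - L s z (z' - z)) \<le> e * norm (z' - z)"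
    proof (intro exI conjI allI impI)
      show "min \<rho> (\<eta> / (1 + 2 * N)) > 0" using \<rho> \<eta> N by simp
      fix z' assume z': "norm (z' - z) < min \<rho> (\<eta> / (1 + 2 * N))"
      define h where "h = z' - z"
      have z'C: "z' \<in> C"
        using z' \<rho> ball_subset_cball[of z0 \<delta>] by (auto simp: C_def dist_norm norm_minus_commute subset_iff)
      have zZ: "z \<in> Z" "z' \<in> Z" using zC z'C C by auto
      have yc: "continuous_on ?I (\<lambda>t. y t w)" if "w \<in> Z" for w
        by (rule continuous_on_slice[OF ycont that])
      have Rc: "continuous_on ?I (\<lambda>t. R t (w, y t w))" if "w \<in> Z" for w
        by (rule continuous_on_slice[OF continuous_on_graph[OF Rcont ycont y(2)] that])
      \<comment> \<open>Lipschitz dependence of the solution on the parameter: moving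
        \<open>z\<close> to \<open>z'\<close> costs N |h| in the right-hand side, and the
        contraction estimate doubles it.\<close>
      have ylip: "norm (y t z' - y t z) \<le> 2 * (N * norm h)" if t: "t \<in> ?I" for t
      proof (rule contraction_bound[OF continuous_on_diff[OF yc[OF zZ(2)] yc[OF zZ(1)]] _ t])
        fix B t assume B: "\<And>s. s \<in> ?I \<Longrightarrow> norm (y s z' - y s z) \<le> B" and t: "t \<in> ?I"
        have "y t z' - y t z = t *\<^sub>R integral ?I (\<lambda>\<sigma>. R (t * \<sigma>) (z', y (t * \<sigma>) z') - R (t * \<sigma>) (z, y (t * \<sigma>) z))"
          using scaled_integral_diff[OF Rc[OF zZ(2)] Rc[OF zZ(1)] t] yeq[OF t] zZ by (simp add: picard_def)
        also have "norm \<dots> \<le> N * norm h + B / 2"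
        proof (rule norm_scaled_integral_le[OF continuous_on_diff[OF Rc[OF zZ(2)] Rc[OF zZ(1)]] t])
          fix t :: real assume t: "t \<in> ?I"
          have "norm (R t (z', y t z') - R t (z, y t z)) \<le>
            norm (R t (z', y t z') - R t (z', y t z)) + norm (R t (z', y t z) - R t (z, y t z))"
            by norm
          also have "\<dots> \<le> 1 / 2 * norm (y t z' - y t z) + N * norm (z' - z)"
            by (intro add_mono lip1 lip2 t zC z'C yX)
          finally show "norm (R t (z', y t z') - R t (z, y t z)) \<le> N * norm h + B / 2"
            using B[OF t] by (simp add: h_def)
        qed
        finally show "norm (y t z' - y t z) \<le> N * norm h + B / 2" .
      qed
      define \<Delta> where "\<Delta> = (\<lambda>t. y t z' - y t z - L t z h)"
      define g where "g = (\<lambda>t. R t (z', y t z') - R t (z, y t z) - R' h t (z, L t z h))"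
      have Lc: "continuous_on ?I (\<lambda>t. L t z h)" by (rule continuous_on_slice[OF Lcont zC])
      have R'c: "continuous_on ?I (\<lambda>t. R' h t (z, L t z h))" by (rule R'slice[OF zC Lc])
      have gc: "continuous_on ?I g"
        unfolding g_def by (intro continuous_on_diff Rc zZ R'c)
      have "norm (\<Delta> s) \<le> 2 * (\<epsilon> * ((1 + 2 * N) * norm h))"
      proof (rule contraction_bound[OF _ _ s])
        show "continuous_on ?I \<Delta>"
          unfolding \<Delta>_def by (intro continuous_on_diff yc zZ Lc)
        fix B t assume B: "\<And>s. s \<in> ?I \<Longrightarrow> norm (\<Delta> s) \<le> B" and t: "t \<in> ?I"
        have "\<Delta> t = t *\<^sub>R integral ?I (\<lambda>\<sigma>. g (t * \<sigma>))"
          using scaled_integral_diff[OF continuous_on_diff[OF Rc[OF zZ(2)] Rc[OF zZ(1)]] R'c t]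
            scaled_integral_diff[OF Rc[OF zZ(2)] Rc[OF zZ(1)] t] yeq[OF t] zZ Leq[OF t zC, of h]
          by (simp add: \<Delta>_def g_def picard_def)
        also have "norm \<dots> \<le> \<epsilon> * ((1 + 2 * N) * norm h) + B / 2"
        proof (rule norm_scaled_integral_le[OF gc t])
          fix t :: real assume t: "t \<in> ?I"
          define q q' where "q = (z, y t z)" and "q' = (z', y t z')"
          have qQ: "q \<in> Q" "q' \<in> Q" using yX t zC z'C by (auto simp: q_def q'_def Q_def)
          have "norm (q' - q) \<le> norm h + norm (y t z' - y t z)"
            by (simp add: q_def q'_def h_def norm_Pair sqrt_sum_squares_le_sum)
          also have "\<dots> \<le> (1 + 2 * N) * norm h" using ylip[OF t] by (simp add: algebra_simps)
          finally have nq: "norm (q' - q) \<le> (1 + 2 * N) * norm h" .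
          also have "\<dots> < \<eta>"
            using z' N by (simp add: h_def field_simps)
          finally have nq': "norm (q' - q) < \<eta>" .
          have seg: "closed_segment q q' \<subseteq> Q" using Q(2) qQ by (simp add: closed_segment_subset)
          have "norm (R t q' - R t q - blinfun_apply (J t q) (q' - q)) \<le> norm (q' - q) * \<epsilon>"
          proof (rule differentiable_bound_linearization[where S = "closed_segment q q'" and f' = "\<lambda>q. blinfun_apply (J t q)"])
            show "q + u *\<^sub>R (q' - q) \<in> closed_segment q q'" if "u \<in> {0..1}" for u
              using that by (auto simp: in_segment algebra_simps intro!: exI[of _ u])
            fix x assume x: "x \<in> closed_segment q q'"
            then have xQ: "x \<in> Q" using seg by blast
            with Q have "x \<in> Z \<times> \<Omega>" by blast
            from derJ[OF t this] show "(R t has_derivative blinfun_apply (J t x)) (at x within closed_segment q q')"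
              by (rule has_derivative_at_withinI)
            have "dist x q < \<eta>"
              using segment_bound(1)[OF x] nq' by (simp add: dist_norm norm_minus_commute)
            from \<eta>(2)[OF t qQ(1) xQ this] have "norm (J t x - J t q) \<le> \<epsilon>" by simp
            moreover have "blinfun_apply (J t x) - blinfun_apply (J t q) = blinfun_apply (J t x - J t q)"
              by (simp add: fun_eq_iff blinfun.diff_left)
            ultimately show "onorm (blinfun_apply (J t x) - blinfun_apply (J t q)) \<le> \<epsilon>"
              by (simp add: norm_blinfun.rep_eq)
          qed simp
          also have "\<dots> \<le> \<epsilon> * ((1 + 2 * N) * norm h)"
            using nq \<open>\<epsilon> > 0\<close> by (simp add: mult.commute mult_left_mono)
          finally have 1: "norm (R t q' - R t q - blinfun_apply (J t q) (q' - q)) \<le> \<epsilon> * ((1 + 2 * N) * norm h)" .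
          have 2: "norm (blinfun_apply (J t q) (0, \<Delta> t)) \<le> B / 2"
            using Jbnd[OF t zZ(1), of "y t z" "\<Delta> t"] y(2)[OF t zZ(1)] B[OF t] by (simp add: q_def)
          \<comment> \<open>The integrand splits into Taylor's error at \<open>q\<close> and the
            derivative applied to \<open>(0, \<Delta> t)\<close>. The latter is at most half of the
            norm of \<open>\<Delta> t\<close> and is absorbed by the contraction.\<close>
          have "(q' - q) - (0, \<Delta> t) = (h, L t z h)"
            by (simp add: q_def q'_def h_def \<Delta>_def)
          then have 3: "blinfun_apply (J t q) (q' - q) - blinfun_apply (J t q) (0, \<Delta> t) = R' h t (z, L t z h)"
            by (simp only: R'_def q_def fst_conv snd_conv flip: blinfun.diff_right)
          have "g t = (R t q' - R t q - blinfun_apply (J t q) (q' - q)) + blinfun_apply (J t q) (0, \<Delta> t)"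
            using 3 by (simp add: g_def q_def q'_def algebra_simps)
          with 1 2 show "norm (g t) \<le> \<epsilon> * ((1 + 2 * N) * norm h) + B / 2"
            using norm_triangle_mono by metis
        qed
        finally show "norm (\<Delta> t) \<le> \<epsilon> * ((1 + 2 * N) * norm h) + B / 2" .
      qed
      also have "2 * (\<epsilon> * ((1 + 2 * N) * norm h)) = e * norm h"
        using N by (simp add: \<epsilon>_def field_simps)
      finally show "norm (y s z' - y s z - L s z (z' - z)) \<le> e * norm (z' - z)"
        by (simp add: \<Delta>_def h_def)
    qed
  qed
  have "ode_solution (\<lambda>s p. frechet_derivative (R s) (at (fst p, y s (fst p))) (v, snd p))
        (ball z0 \<delta>) (\<lambda>s z. L s z v)" for v
    unfolding ode_solution_def
  proof (intro conjI ballI)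
    show "continuous_on (?I \<times> ball z0 \<delta>) (\<lambda>(s, z). L s z v)"
      by (rule continuous_on_subset[OF Lcont]) (auto simp: C_def)
    fix s z assume s: "s \<in> ?I" and z: "z \<in> ball z0 \<delta>"
    then have zC: "z \<in> C" "z \<in> Z" using C by (auto simp: C_def)
    have eq: "R' v (s * \<sigma>) (z, x) = frechet_derivative (R (s * \<sigma>)) (at (fst (z, x), y (s * \<sigma>) (fst (z, x)))) (v, snd (z, x))"
      if "\<sigma> \<in> ?I" for \<sigma> x
      using J[OF mult_unit_interval[OF s that], of "(z, y (s * \<sigma>) z)"] zC y(2)[OF mult_unit_interval[OF s that] zC(2)]
      by (simp add: R'_def)
    have "picard (R' v) (\<lambda>s z. L s z v) s z =
      picard (\<lambda>s p. frechet_derivative (R s) (at (fst p, y s (fst p))) (v, snd p)) (\<lambda>s z. L s z v) s z"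
      unfolding picard_def
      by (rule arg_cong[where f = "\<lambda>x. s *\<^sub>R x"], rule integral_cong) (simp add: eq)
    then show "L s z v = picard (\<lambda>s p. frechet_derivative (R s) (at (fst p, y s (fst p))) (v, snd p)) (\<lambda>s z. L s z v) s z"
      using Leq[OF s zC(1)] by simp
  qed
  with der \<delta> show ?thesis
    by (intro exI[of _ \<delta>] exI[of _ L] conjI) (auto simp: subset_iff)
qed

text \<open>A derivative is unique, so the local candidates agree with
  \<open>frechet_derivative\<close>, and the statements on small balls patch to all of
  \<open>Z\<close>.\<close>

lemma ode_solution_derivative:
  fixes R :: "real \<Rightarrow> 'e::euclidean_space \<times> 'f::euclidean_space \<Rightarrow> 'f"
  assumes Z: "open Z" and \<Omega>: "open \<Omega>" "convex \<Omega>" and R: "Ck_fam (Suc 0) {0..1} (Z \<times> \<Omega>) R"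
    and y: "ode_solution R Z y" "\<And>s z. s \<in> {0..1} \<Longrightarrow> z \<in> Z \<Longrightarrow> y s z \<in> \<Omega>"
    and bnd: "\<And>s z x h. s \<in> {0..1} \<Longrightarrow> z \<in> Z \<Longrightarrow> x \<in> \<Omega> \<Longrightarrow>
        norm (frechet_derivative (R s) (at (z, x)) (0, h)) \<le> norm h / 2"
  shows "\<And>s z. s \<in> {0..1} \<Longrightarrow> z \<in> Z \<Longrightarrow> y s differentiable (at z)"
    and "ode_solution (\<lambda>s p. frechet_derivative (R s) (at (fst p, y s (fst p))) (v, snd p)) Z
      (\<lambda>s z. frechet_derivative (y s) (at z) v)"
proof -
  let ?R = "\<lambda>s p. frechet_derivative (R s) (at (fst p, y s (fst p))) (v, snd p)"
  have loc: "\<exists>\<delta>>0. \<exists>L. ball z0 \<delta> \<subseteq> Z \<and>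
    (\<forall>s\<in>{0..1}. \<forall>z\<in>ball z0 \<delta>. (y s has_derivative L s z) (at z)) \<and>
    ode_solution ?R (ball z0 \<delta>) (\<lambda>s z. L s z v)" if "z0 \<in> Z" for z0
    using ode_solution_derivative_local[OF Z \<Omega> R y bnd that] by blast
  show "y s differentiable (at z)" if "s \<in> {0..1}" "z \<in> Z" for s z
    using loc[OF that(2)] that(1) unfolding differentiable_def by (metis centre_in_ball)
  have *: "\<exists>\<delta>>0. ball z0 \<delta> \<subseteq> Z \<and> ode_solution ?R (ball z0 \<delta>) (\<lambda>s z. frechet_derivative (y s) (at z) v)"
    if z0: "z0 \<in> Z" for z0
  proof -
    obtain \<delta> L where \<delta>: "\<delta> > 0" "ball z0 \<delta> \<subseteq> Z"
      and L: "\<And>s z. s \<in> {0..1} \<Longrightarrow> z \<in> ball z0 \<delta> \<Longrightarrow> (y s has_derivative L s z) (at z)"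
      and sol: "ode_solution ?R (ball z0 \<delta>) (\<lambda>s z. L s z v)"
      using loc[OF z0] by blast
    have eq: "L s z v = frechet_derivative (y s) (at z) v" if "s \<in> {0..1}" "z \<in> ball z0 \<delta>" for s z
      using frechet_derivative_at[OF L[OF that]] by simp
    have cont: "continuous_on ({0..1} \<times> ball z0 \<delta>) (\<lambda>(s, z). L s z v)"
      and sol': "\<And>s z. s \<in> {0..1} \<Longrightarrow> z \<in> ball z0 \<delta> \<Longrightarrow> L s z v = picard ?R (\<lambda>s z. L s z v) s z"
      using sol by (auto simp: ode_solution_def)
    have cont': "continuous_on ({0..1} \<times> ball z0 \<delta>) (\<lambda>(s, z). frechet_derivative (y s) (at z) v)"
      by (rule continuous_on_eq[OF cont]) (auto simp: eq)
    have pic: "picard ?R (\<lambda>s z. L s z v) s z = picard ?R (\<lambda>s z. frechet_derivative (y s) (at z) v) s z"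
      if "s \<in> {0..1}" "z \<in> ball z0 \<delta>" for s z
      unfolding picard_def
      by (rule arg_cong[where f = "\<lambda>x. s *\<^sub>R x"], rule integral_cong)
        (simp add: eq[OF mult_unit_interval[OF that(1)] that(2)])
    have "frechet_derivative (y s) (at z) v = picard ?R (\<lambda>s z. frechet_derivative (y s) (at z) v) s z"
      if "s \<in> {0..1}" "z \<in> ball z0 \<delta>" for s z
      by (rule trans[OF trans[OF eq[OF that, symmetric] sol'[OF that]] pic[OF that]])
    with cont' have "ode_solution ?R (ball z0 \<delta>) (\<lambda>s z. frechet_derivative (y s) (at z) v)"
      unfolding ode_solution_def by blast
    with \<delta> show ?thesis by blast
  qed
  show "ode_solution ?R Z (\<lambda>s z. frechet_derivative (y s) (at z) v)"
    unfolding ode_solution_def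
  proof (intro conjI ballI)
    show "continuous_on ({0..1} \<times> Z) (\<lambda>(s, z). frechet_derivative (y s) (at z) v)"
    proof (rule continuous_on_Times_local)
      fix z0 assume "z0 \<in> Z"
      from *[OF this] obtain \<delta> where "\<delta> > 0" "ball z0 \<delta> \<subseteq> Z"
        "continuous_on ({0..1} \<times> ball z0 \<delta>) (\<lambda>(s, z). frechet_derivative (y s) (at z) v)"
        unfolding ode_solution_def by blast
      then show "\<exists>U. open U \<and> z0 \<in> U \<and> continuous_on ({0..1} \<times> (Z \<inter> U)) (\<lambda>(s, z). frechet_derivative (y s) (at z) v)"
        by (intro exI[of _ "ball z0 \<delta>"]) (simp add: Int_absorb1)
    qed
    show "frechet_derivative (y s) (at z) v = picard ?R (\<lambda>s z. frechet_derivative (y s) (at z) v) s z"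
      if "s \<in> {0..1}" "z \<in> Z" for s z
    proof -
      obtain \<delta> where "\<delta> > 0"
        "ode_solution ?R (ball z \<delta>) (\<lambda>s z. frechet_derivative (y s) (at z) v)"
        using *[OF \<open>z \<in> Z\<close>] by blast
      then have "\<forall>s\<in>{0..1}. \<forall>w\<in>ball z \<delta>. frechet_derivative (y s) (at w) v =
          picard ?R (\<lambda>s z. frechet_derivative (y s) (at z) v) s w"
        unfolding ode_solution_def by blast
      from bspec[OF this \<open>s \<in> {0..1}\<close>] show ?thesis
        by (rule bspec) (use \<open>\<delta> > 0\<close> in simp)
    qed
  qed
qed

text \<open>The derivative in direction \<open>v\<close> solves the linearized equation, whose
  right-hand side is affine in the unknown with the same constant 1/2. It contains \<open>y\<close>
  itself; the order of \<open>y\<close> already obtained from the induction hypothesis makes it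
  regular enough for the next order.\<close>

theorem Ck_ode_solution:
  fixes R :: "real \<Rightarrow> 'e::euclidean_space \<times> 'f::euclidean_space \<Rightarrow> 'f"
  assumes Z: "open Z" and \<Omega>: "open \<Omega>" "convex \<Omega>" and R: "Ck_fam (Suc k) {0..1} (Z \<times> \<Omega>) R"
    and y: "ode_solution R Z y" "\<And>s z. s \<in> {0..1} \<Longrightarrow> z \<in> Z \<Longrightarrow> y s z \<in> \<Omega>"
    and bnd: "\<And>s z x h. s \<in> {0..1} \<Longrightarrow> z \<in> Z \<Longrightarrow> x \<in> \<Omega> \<Longrightarrow>
        norm (frechet_derivative (R s) (at (z, x)) (0, h)) \<le> norm h / 2"
  shows "Ck_fam (Suc k) {0..1} Z y"
  using \<Omega> R y bnd
proof (induction k arbitrary: \<Omega> R y)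
  case 0
  note D = ode_solution_derivative[OF Z 0]
  show ?case using D(1) D(2) 0(4) by (auto simp: ode_solution_def)
next
  case (Suc k)
  note R1 = Ck_fam_SucD[OF Suc.prems(3)]
  have R0: "Ck_fam (Suc 0) {0..1} (Z \<times> \<Omega>) R"
    by (rule Ck_fam_mono[OF R1]) simp
  have yk: "Ck_fam (Suc k) {0..1} Z y"
    by (rule Suc.IH[OF Suc.prems(1,2) R1 Suc.prems(4,5,6)])
  note D = ode_solution_derivative[OF Z Suc.prems(1,2) R0 Suc.prems(4,5,6)]
  have "Ck_fam (Suc k) {0..1} Z (\<lambda>s z. frechet_derivative (y s) (at z) v)" for v
  \<comment> \<open>The linearized equation makes sense for all values of the unknown, so the
    induction hypothesis is used with the whole space in place of \<Omega>.\<close>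
  proof (rule Suc.IH[OF open_UNIV convex_UNIV _ D(2)])
    let ?R = "\<lambda>s p. frechet_derivative (R s) (at (fst p, y s (fst p))) (v, snd p)"
    have opn: "open (Z \<times> (UNIV :: 'f set))" using Z by (simp add: open_Times)
    show R': "Ck_fam (Suc k) {0..1} (Z \<times> UNIV) ?R"
    proof (rule Ck_fam_deriv_compose[OF Suc.prems(3) _ _ _ opn])
      have 1: "Ck_fam (Suc k) {0..1} (Z \<times> (UNIV :: 'f set)) (\<lambda>s p. y s (fst p))"
        by (rule Ck_fam_compose[OF Ck_fam_linear[OF bounded_linear_fst] yk _ opn]) auto
      then show "Ck_fam (Suc k) {0..1} (Z \<times> (UNIV :: 'f set)) (\<lambda>s p. (fst p, y s (fst p)))"
        by (intro Ck_fam_Pair Ck_fam_linear[OF bounded_linear_fst] opn)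
      show "Ck_fam (Suc k) {0..1} (Z \<times> (UNIV :: 'f set)) (\<lambda>s p. (v, snd p))"
        by (intro Ck_fam_Pair Ck_fam_const Ck_fam_linear[OF bounded_linear_snd] opn)
      show "(fst p, y s (fst p)) \<in> Z \<times> \<Omega>" if "s \<in> {0..1}" "p \<in> Z \<times> (UNIV :: 'f set)" for s p
        using that Suc.prems(5) by auto
    qed
    fix s z and x h :: 'f assume s: "s \<in> {0..1::real}" and z: "z \<in> Z"
    let ?A = "frechet_derivative (R s) (at (z, y s z))"
    have "bounded_linear ?A"
      using Ck_fam_differentiable[OF R0 s, of "(z, y s z)"] z Suc.prems(5)[OF s z]
      by (auto intro: has_derivative_bounded_linear)
    then have A: "(?A has_derivative ?A) (at (v, x))"
      by (rule bounded_linear_imp_has_derivative)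
    have P: "(Pair w has_derivative (\<lambda>h. (0, h))) (at x)" for w :: 'e
      by (intro has_derivative_Pair has_derivative_const has_derivative_ident)
    have "(?R s has_derivative frechet_derivative (?R s) (at (z, x))) (at (z, x))"
      by (rule Ck_fam_differentiable[OF R' s]) (use z in auto)
    note 1 = diff_chain_at[OF P this] and 2 = diff_chain_at[OF P A]
    have "?R s \<circ> Pair z = ?A \<circ> Pair v" by (simp add: o_def)
    with 1 have "frechet_derivative (?R s) (at (z, x)) \<circ> (\<lambda>h. (0, h)) = ?A \<circ> (\<lambda>h. (0, h))"
      by (intro has_derivative_unique[OF _ 2]) simp
    from fun_cong[OF this, of h]
    have "frechet_derivative (?R s) (at (z, x)) (0, h) = ?A (0, h)" by simp
    then show "norm (frechet_derivative (?R s) (at (z, x)) (0, h)) \<le> norm h / 2"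
      using Suc.prems(6)[OF s z Suc.prems(5)[OF s z], of h] by simp
  qed auto
  with D(1) Ck_fam_continuous[OF yk] show ?case
    unfolding Ck_fam.simps(2)[of "Suc k"] by blast
qed

section \<open>Commuting vector fields\<close>

lemma Ck_on_slice:
  "Ck_fam k S Z u \<Longrightarrow> s \<in> S \<Longrightarrow> Ck_on k Z (u s)"
proof (induction k arbitrary: u)
  case 0
  have "continuous_on Z (Pair s)"
    by (intro continuous_on_Pair continuous_on_const continuous_on_id)
  moreover have "continuous_on (S \<times> Z) (\<lambda>(s, z). u s z)" using 0 by simp
  ultimately have "continuous_on Z (\<lambda>z. (\<lambda>(s, z). u s z) (s, z))"
    by (elim continuous_on_compose2) (use 0 in auto)
  then show ?case by simp
next
  case (Suc k)
  then show ?case by auto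
qed

text \<open>Returns to the integral from 0 to s, to which the fundamental theorem of calculus
  applies.\<close>

lemma scaled_integral_eq:
  fixes g :: "real \<Rightarrow> 'f::banach"
  assumes "s \<in> {0..1}"
  shows "s *\<^sub>R integral {0..1} (\<lambda>\<sigma>. g (s * \<sigma>)) = integral {0..s} g"
proof (cases "s = 0")
  case False
  with assms have "s > 0" by simp
  then have "(\<lambda>x. x / s) ` {0..s} = {0..1}"
    by (auto simp: image_iff field_simps intro!: bexI[of _ "s * _"])
  with integral_stretch_real[OF False, of 0 s g] \<open>s > 0\<close>
  have "integral {0..1} (\<lambda>\<sigma>. g (s * \<sigma>)) = (1 / s) *\<^sub>R integral {0..s} g" by simp
  with \<open>s > 0\<close> show ?thesis by simp
qed simp

text \<open>Foliated charts have their leaf directions in \<open>Basis\<close>. So the given vectors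
  are matched with r standard basis vectors, and the matching is completed to an
  isomorphism.\<close>

lemma linear_iso_extend:
  fixes v :: "nat \<Rightarrow> 'f::euclidean_space"
  assumes "inj_on v {..<r}" "independent (v ` {..<r})"
  obtains K \<kappa> T where "K \<subseteq> (Basis :: 'f set)" "card K = r" "bij_betw \<kappa> {..<r} K"
    "linear T" "inj T" "\<And>i. i < r \<Longrightarrow> T (\<kappa> i) = v i"
proof -
  have "r = card (v ` {..<r})" using assms(1) by (simp add: card_image)
  also have "\<dots> \<le> DIM('f)" using independent_bound[OF assms(2)] by simp
  finally obtain K :: "'f set" where K: "K \<subseteq> Basis" "card K = r" and finK: "finite K"
    by (rule obtain_subset_with_card_n)
  with K obtain \<kappa> where \<kappa>: "bij_betw \<kappa> {..<r} K"
    using finite_same_card_bij[of "{..<r}" K] by auto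
  define f where "f = (\<lambda>k. v (inv_into {..<r} \<kappa> k))"
  have f: "f (\<kappa> i) = v i" if "i < r" for i
    using that \<kappa> by (simp add: f_def bij_betw_def inv_into_f_f)
  have \<kappa>K: "\<kappa> ` {..<r} = K" using \<kappa> by (simp add: bij_betw_def)
  have "f ` K = v ` {..<r}"
    unfolding \<kappa>K[symmetric] image_image using f by simp
  moreover have "inj_on f K"
  proof -
    have 1: "inj_on (inv_into {..<r} \<kappa>) K" by (rule inj_on_inv_into) (simp add: \<kappa>K)
    have 2: "inv_into {..<r} \<kappa> ` K = {..<r}"
      using bij_betw_inv_into[OF \<kappa>] by (simp add: bij_betw_def)
    show ?thesis
      using comp_inj_on[OF 1, of v] assms(1) 2 by (simp add: f_def o_def)
  qed
  moreover have "independent K" by (rule independent_mono[OF independent_Basis K(1)])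
  ultimately obtain T where T: "linear T" "inj T" "\<forall>k\<in>K. T k = f k"
    using eucl.linear_independent_extend_inj[of K f] assms(2) by auto
  have "T (\<kappa> i) = v i" if "i < r" for i
    using T(3) f[OF that] bij_betwE[OF \<kappa>] that by auto
  with that K \<kappa> T show thesis by blast
qed

lemma norm_sum_scaleR_le:
  assumes "\<And>i. i < r \<Longrightarrow> \<bar>c i\<bar> \<le> \<epsilon>" "\<And>i. i < (r::nat) \<Longrightarrow> norm (v i) \<le> m"
  shows "norm (\<Sum>i<r. c i *\<^sub>R (v i :: 'f::real_normed_vector)) \<le> real r * \<epsilon> * m"
proof -
  have "norm (\<Sum>i<r. c i *\<^sub>R v i) \<le> (\<Sum>i<r. \<epsilon> * m)"
  proof (rule sum_norm_le)
    fix i assume "i \<in> {..<r}"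
    then have "i < r" by simp
    from mult_mono[OF assms(1)[OF this] assms(2)[OF this]] assms(1)[OF this]
    show "norm (c i *\<^sub>R v i) \<le> \<epsilon> * m" by simp
  qed
  then show ?thesis by simp
qed

text \<open>Solving the radial equation \<open>x' = \<Sum> z\<^sub>i Y\<^sub>i(x)\<close> up to time 1, from an initial value that depends on the
  transversal components of \<open>z\<close>, straightens all the vector fields \<open>Y\<^sub>i\<close> at once:
  both \<open>s Y\<^sub>i(x(s))\<close> and the derivative of \<open>x(s)\<close> along \<open>z\<^sub>i\<close> solve the same linear equation.\<close>

locale commuting_fields =
  fixes Y :: "nat \<Rightarrow> 'f::euclidean_space \<Rightarrow> 'f" and U :: "'f set" and b :: 'f and r :: nat
    and K :: "'f set" and \<kappa> :: "nat \<Rightarrow> 'f" and T :: "'f \<Rightarrow> 'f"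
  assumes U: "open U" "b \<in> U"
    and Y: "\<And>i. i < r \<Longrightarrow> smooth_on U (Y i)"
    and comm: "\<And>i j x. i < r \<Longrightarrow> j < r \<Longrightarrow> x \<in> U \<Longrightarrow>
      frechet_derivative (Y i) (at x) (Y j x) = frechet_derivative (Y j) (at x) (Y i x)"
    and K: "K \<subseteq> Basis" and \<kappa>: "bij_betw \<kappa> {..<r} K"
    and T: "linear T" "inj T" "\<And>i. i < r \<Longrightarrow> T (\<kappa> i) = Y i b"
begin

text \<open>Initial displacement from \<open>b\<close>: the coordinates outside \<open>K\<close> run
  through a linear complement of the span of the fields at \<open>b\<close>, and those in
  \<open>K\<close> are discarded.\<close>

definition P :: "'f \<Rightarrow> 'f" where "P z = T (\<Sum>k\<in>Basis - K. (z \<bullet> k) *\<^sub>R k)"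

text \<open>The unknown is the displacement from the initial point \<open>b + P z\<close>, so that
  solutions start at 0. The parameter supplies both this initial point and the constant coefficients
  of the fields.\<close>

definition R :: "real \<Rightarrow> 'f \<times> 'f \<Rightarrow> 'f" where
  "R s p = (\<Sum>i<r. (fst p \<bullet> \<kappa> i) *\<^sub>R Y i (b + P (fst p) + snd p))"

lemma \<kappa>_K: "i < r \<Longrightarrow> \<kappa> i \<in> K" using \<kappa> by (auto simp: bij_betw_def)

lemma inner_\<kappa>: "i < r \<Longrightarrow> j < r \<Longrightarrow> \<kappa> i \<bullet> \<kappa> j = (if i = j then 1 else 0)"
  using \<kappa>_K[of i] \<kappa>_K[of j] K inj_on_eq_iff[OF bij_betw_imp_inj_on[OF \<kappa>], of i j]
  by (simp add: inner_Basis subset_iff)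

lemma inner_\<kappa>_le: "i < r \<Longrightarrow> \<bar>z \<bullet> \<kappa> i\<bar> \<le> norm z"
  using \<kappa>_K[of i] K by (auto intro: Basis_le_norm)

lemma P_linear: "bounded_linear P"
  unfolding P_def
  by (intro bounded_linear_compose[OF linear_conv_bounded_linear[THEN iffD1, OF T(1)]]
      bounded_linear_sum bounded_linear_scaleR_const bounded_linear_inner_left)

lemma P_\<kappa>: assumes "i < r" shows "P (\<kappa> i) = 0"
proof -
  have "\<kappa> i \<bullet> k = 0" if "k \<in> Basis - K" for k
    using that \<kappa>_K[OF assms] K by (auto simp: inner_Basis)
  then show ?thesis by (simp add: P_def linear_0[OF T(1)])
qed

lemma P_Basis: assumes "k \<in> Basis - K" shows "P k = T k"
proof -
  have "(\<Sum>l\<in>Basis - K. (k \<bullet> l) *\<^sub>R l) = (\<Sum>l\<in>Basis - K. if l = k then k else 0)"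
    using assms by (intro sum.cong) (auto simp: inner_Basis)
  also have "\<dots> = k" using assms by simp
  finally show ?thesis by (simp add: P_def)
qed

abbreviation DY :: "nat \<Rightarrow> 'f \<Rightarrow> 'f \<Rightarrow> 'f" where
  "DY i x \<equiv> frechet_derivative (Y i) (at x)"

lemma derY: "i < r \<Longrightarrow> x \<in> U \<Longrightarrow> (Y i has_derivative DY i x) (at x)"
  by (rule smooth_on_has_derivative[OF Y])

lemma R_has_derivative:
  assumes "b + P z + y \<in> U"
  shows "(R s has_derivative (\<lambda>q. \<Sum>i<r. (z \<bullet> \<kappa> i) *\<^sub>R DY i (b + P z + y) (P (fst q) + snd q) +
      (fst q \<bullet> \<kappa> i) *\<^sub>R Y i (b + P z + y))) (at (z, y))"
proof -
  have "((\<lambda>p. b + P (fst p) + snd p) has_derivative (\<lambda>q. 0 + P (fst q) + snd q)) (at (z, y))"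
    by (intro has_derivative_add has_derivative_const has_derivative_snd has_derivative_ident
        bounded_linear.has_derivative[OF P_linear] has_derivative_fst)
  then have "((\<lambda>p. Y i (b + P (fst p) + snd p)) has_derivative
      (\<lambda>q. DY i (b + P z + y) (P (fst q) + snd q))) (at (z, y))" if "i < r" for i
    using has_derivative_compose[of "\<lambda>p. b + P (fst p) + snd p" _ "(z, y)" UNIV "Y i"] derY[OF that assms]
    by (auto simp del: add_0_left simp: add_0_left[of "P _"])
  then have "(R s has_derivative (\<lambda>q. \<Sum>i<r. (fst (z, y) \<bullet> \<kappa> i) *\<^sub>R DY i (b + P z + y) (P (fst q) + snd q) +
      (fst q \<bullet> \<kappa> i) *\<^sub>R Y i (b + P (fst (z, y)) + snd (z, y)))) (at (z, y))"
    unfolding R_def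
    by (intro has_derivative_sum has_derivative_scaleR has_derivative_inner_left has_derivative_fst
        has_derivative_ident) auto
  then show ?thesis by simp
qed

lemma R_derivative:
  assumes "b + P z + y \<in> U"
  shows "frechet_derivative (R s) (at (z, y)) (v, w) = (\<Sum>i<r. (z \<bullet> \<kappa> i) *\<^sub>R DY i (b + P z + y) (P v + w) +
      (v \<bullet> \<kappa> i) *\<^sub>R Y i (b + P z + y))"
  using frechet_derivative_at[OF R_has_derivative[OF assms], symmetric, of s] by simp

text \<open>Initial displacement and right-hand side are linear in the components of z. So on a
  compact ball around \<open>b\<close> all required bounds, in particular the Lipschitz constant
  1/2, hold as soon as z is small.\<close>

lemma bounds:
  obtains \<rho> \<epsilon> where "\<rho> > 0" "\<epsilon> > 0" "cball b \<rho> \<subseteq> U"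
    "\<And>z. norm z \<le> \<epsilon> \<Longrightarrow> norm (P z) \<le> \<rho> / 4"
    "\<And>z x. norm z \<le> \<epsilon> \<Longrightarrow> x \<in> cball b \<rho> \<Longrightarrow> norm (\<Sum>i<r. (z \<bullet> \<kappa> i) *\<^sub>R Y i x) \<le> \<rho> / 4"
    "\<And>z x h. norm z \<le> \<epsilon> \<Longrightarrow> x \<in> cball b \<rho> \<Longrightarrow> norm (\<Sum>i<r. (z \<bullet> \<kappa> i) *\<^sub>R DY i x h) \<le> norm h / 2"
    "\<And>z x x'. norm z \<le> \<epsilon> \<Longrightarrow> x \<in> cball b \<rho> \<Longrightarrow> x' \<in> cball b \<rho> \<Longrightarrow>
      norm ((\<Sum>i<r. (z \<bullet> \<kappa> i) *\<^sub>R Y i x) - (\<Sum>i<r. (z \<bullet> \<kappa> i) *\<^sub>R Y i x')) \<le> norm (x - x') / 2"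
proof -
  obtain \<rho> where \<rho>: "\<rho> > 0" "cball b \<rho> \<subseteq> U"
    using U open_contains_cball by blast
  let ?C = "cball b \<rho>"
  have "\<exists>m. \<forall>i<r. \<forall>x\<in>?C. norm (Y i x) \<le> m \<and> (\<forall>h. norm (DY i x h) \<le> m * norm h)"
  proof -
    have "\<exists>m. \<forall>x\<in>?C. norm (Y i x) \<le> m \<and> (\<forall>h. norm (DY i x h) \<le> m * norm h)" if i: "i < r" for i
    proof -
      have bd: "\<exists>m. \<forall>x\<in>?C. norm (g x) \<le> m" if "smooth_on U g" for g :: "'f \<Rightarrow> 'f"
        using compact_imp_bounded[OF compact_continuous_image[OF
          continuous_on_subset[OF smooth_on_imp_continuous_on[OF that] \<rho>(2)] compact_cball]]
        unfolding bounded_iff by auto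
      obtain m0 where m0: "\<And>x. x \<in> ?C \<Longrightarrow> norm (Y i x) \<le> m0"
        using bd[OF Y[OF i]] by blast
      have "\<forall>k. \<exists>m. \<forall>x\<in>?C. norm (DY i x k) \<le> m"
        using bd[OF smooth_on_deriv[OF Y[OF i]]] by blast
      then obtain m1 where m1: "\<And>k x. x \<in> ?C \<Longrightarrow> norm (DY i x k) \<le> m1 k" by metis
      have "norm (DY i x h) \<le> (\<Sum>k\<in>Basis. m1 k) * norm h" if x: "x \<in> ?C" for x h
      proof -
        have lin: "linear (DY i x)"
          by (rule has_derivative_linear[OF derY[OF i subsetD[OF \<rho>(2) x]]])
        have "DY i x h = (\<Sum>k\<in>Basis. (h \<bullet> k) *\<^sub>R DY i x k)"
          by (rule linear_eq_sum_Basis[OF lin])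
        also have "norm \<dots> \<le> (\<Sum>k\<in>Basis. norm h * m1 k)"
          using m1[OF x] by (intro sum_norm_le) (auto intro!: mult_mono Basis_le_norm)
        finally show ?thesis by (simp add: sum_distrib_left mult.commute)
      qed
      moreover have "m0 \<le> max m0 (\<Sum>k\<in>Basis. m1 k)" "(\<Sum>k\<in>Basis. m1 k) \<le> max m0 (\<Sum>k\<in>Basis. m1 k)" by auto
      ultimately show ?thesis
        by (intro exI[of _ "max m0 (\<Sum>k\<in>Basis. m1 k)"])
          (meson m0 order_trans mult_right_mono norm_ge_zero)
    qed
    then obtain m where m: "\<And>i. i < r \<Longrightarrow> \<forall>x\<in>?C. norm (Y i x) \<le> m i \<and> (\<forall>h. norm (DY i x h) \<le> m i * norm h)"
      by metis
    have le: "m i \<le> (\<Sum>i<r. \<bar>m i\<bar>)" if "i < r" for i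
      using member_le_sum[of i "{..<r}" "\<lambda>i. \<bar>m i\<bar>"] that by auto
    show ?thesis
    proof (intro exI[of _ "\<Sum>i<r. \<bar>m i\<bar>"] allI impI ballI conjI)
      fix i x h assume i: "i < r" and x: "x \<in> ?C"
      show "norm (Y i x) \<le> (\<Sum>i<r. \<bar>m i\<bar>)" using m[OF i] x le[OF i] by force
      have "norm (DY i x h) \<le> m i * norm h" using m[OF i] x by blast
      also have "\<dots> \<le> (\<Sum>i<r. \<bar>m i\<bar>) * norm h" by (rule mult_right_mono[OF le[OF i]]) simp
      finally show "norm (DY i x h) \<le> (\<Sum>i<r. \<bar>m i\<bar>) * norm h" .
    qed
  qed
  then obtain m0 where m0: "\<And>i x. i < r \<Longrightarrow> x \<in> ?C \<Longrightarrow> norm (Y i x) \<le> m0"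
    "\<And>i x h. i < r \<Longrightarrow> x \<in> ?C \<Longrightarrow> norm (DY i x h) \<le> m0 * norm h" by blast
  define m where "m = max m0 1"
  have m: "norm (Y i x) \<le> m" "norm (DY i x h) \<le> m * norm h" "m > 0" if "i < r" "x \<in> ?C" for i x h
  proof -
    show "norm (Y i x) \<le> m" using m0(1)[OF that] by (simp add: m_def)
    have "m0 * norm h \<le> m * norm h" by (rule mult_right_mono) (simp_all add: m_def)
    with m0(2)[OF that, of h] show "norm (DY i x h) \<le> m * norm h" by linarith
  qed (simp add: m_def)
  have mpos: "m > 0" by (simp add: m_def)
  obtain N where N: "N > 0" "\<And>z. norm (P z) \<le> norm z * N"
    using bounded_linear.pos_bounded[OF P_linear] by blast
  \<comment> \<open>The first entry bounds \<open>P\<close>. The second makes r \<epsilon> m at most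
    \<rho>/4, for the speed, and at most 1/2, for the Lipschitz constant. The factor r + 1 keeps the
    denominator positive when r = 0.\<close>
  define \<epsilon> where "\<epsilon> = min (\<rho> / 4 / N) (min (\<rho> / 4) (1/2) / ((real r + 1) * m))"
  have \<epsilon>: "\<epsilon> > 0" using \<rho> N mpos by (simp add: \<epsilon>_def)
  have "\<epsilon> \<le> min (\<rho> / 4) (1/2) / ((real r + 1) * m)" by (simp add: \<epsilon>_def)
  then have "\<epsilon> * ((real r + 1) * m) \<le> min (\<rho> / 4) (1/2)"
    using mpos by (subst (asm) pos_le_divide_eq) auto
  moreover have "real r * \<epsilon> * m \<le> \<epsilon> * ((real r + 1) * m)" using \<epsilon> mpos by (simp add: algebra_simps)
  ultimately have r\<epsilon>: "real r * \<epsilon> * m \<le> \<rho> / 4" "real r * \<epsilon> * m \<le> 1/2" by auto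
  have ze: "\<bar>z \<bullet> \<kappa> i\<bar> \<le> \<epsilon>" if "norm z \<le> \<epsilon>" "i < r" for z i
    using inner_\<kappa>_le[OF that(2), of z] that(1) by simp
  have comp: "real r * \<epsilon> * (m * c) \<le> c / 2" if "c \<ge> 0" for c
    using mult_right_mono[OF r\<epsilon>(2) that] by (simp add: mult_ac)
  show thesis
  proof (rule that[OF \<rho>(1) \<epsilon> \<rho>(2)])
    show "norm (P z) \<le> \<rho> / 4" if "norm z \<le> \<epsilon>" for z
    proof -
      have "norm z \<le> \<rho> / 4 / N" using that by (simp add: \<epsilon>_def)
      then have "norm z * N \<le> \<rho> / 4" using N by (simp add: field_simps)
      with N(2)[of z] show ?thesis by linarith
    qed
    fix z x :: 'f assume z: "norm z \<le> \<epsilon>" and x: "x \<in> ?C"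
    show "norm (\<Sum>i<r. (z \<bullet> \<kappa> i) *\<^sub>R Y i x) \<le> \<rho> / 4"
      using norm_sum_scaleR_le[of r "\<lambda>i. z \<bullet> \<kappa> i" \<epsilon> "\<lambda>i. Y i x" m] ze[OF z] m(1)[OF _ x] r\<epsilon>(1) by fastforce
    show "norm (\<Sum>i<r. (z \<bullet> \<kappa> i) *\<^sub>R DY i x h) \<le> norm h / 2" for h
      using norm_sum_scaleR_le[of r "\<lambda>i. z \<bullet> \<kappa> i" \<epsilon> "\<lambda>i. DY i x h" "m * norm h"] ze[OF z] m(2)[OF _ x] comp[of "norm h"]
      by fastforce
    show "norm ((\<Sum>i<r. (z \<bullet> \<kappa> i) *\<^sub>R Y i x) - (\<Sum>i<r. (z \<bullet> \<kappa> i) *\<^sub>R Y i x')) \<le> norm (x - x') / 2"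
      if x': "x' \<in> ?C" for x'
    proof -
      have lip: "norm (Y i x - Y i x') \<le> m * norm (x - x')" if i: "i < r" for i
      proof (rule differentiable_bound[OF convex_cball[of b \<rho>], where f' = "DY i"])
        fix w assume w: "w \<in> ?C"
        then have "w \<in> U" using \<rho> by blast
        from derY[OF i this] show "(Y i has_derivative DY i w) (at w within ?C)"
          by (rule has_derivative_at_withinI)
        show "onorm (DY i w) \<le> m"
          by (rule onorm_le) (use m(2)[OF i w] in auto)
      qed (use x x' in auto)
      have "(\<Sum>i<r. (z \<bullet> \<kappa> i) *\<^sub>R Y i x) - (\<Sum>i<r. (z \<bullet> \<kappa> i) *\<^sub>R Y i x') = (\<Sum>i<r. (z \<bullet> \<kappa> i) *\<^sub>R (Y i x - Y i x'))"
        by (simp add: sum_subtractf scaleR_right_diff_distrib)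
      then show ?thesis
        using norm_sum_scaleR_le[of r "\<lambda>i. z \<bullet> \<kappa> i" \<epsilon> "\<lambda>i. Y i x - Y i x'" "m * norm (x - x')"] ze[OF z] lip
          comp[of "norm (x - x')"] by fastforce
    qed
  qed
qed

lemma straightening:
  obtains Z \<Psi> where "open Z" "0 \<in> Z" "smooth_on Z \<Psi>" "\<Psi> 0 = b" "\<Psi> ` Z \<subseteq> U"
    "inj (frechet_derivative \<Psi> (at 0))"
    "\<And>z i. z \<in> Z \<Longrightarrow> i < r \<Longrightarrow> frechet_derivative \<Psi> (at z) (\<kappa> i) = Y i (\<Psi> z)"
proof -
  let ?I = "{0..1::real}"
  show thesis
  proof (rule bounds, goal_cases)
  case (1 \<rho> \<epsilon>)
  note \<rho> = 1(1,3) and \<epsilon> = 1(2) and bP = 1(4) and bY = 1(5) and bDY = 1(6) and lY = 1(7)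
  define Z where "Z = ball (0::'f) \<epsilon>"
  define \<Omega> where "\<Omega> = ball (0::'f) (\<rho> / 2)"
  have Z: "open Z" "0 \<in> Z" and \<Omega>: "open \<Omega>" "convex \<Omega>" using \<epsilon> by (auto simp: Z_def \<Omega>_def)
  have ball: "b + P z + y \<in> cball b \<rho>" if "norm z \<le> \<epsilon>" "norm y \<le> \<rho> / 2" for z y
  proof -
    have "norm (P z + y) \<le> \<rho>" using bP[OF that(1)] that(2) norm_triangle_ineq[of "P z" y] \<rho>(1) by linarith
    moreover have "dist b (b + P z + y) = norm (P z + y)"
      by (metis add.assoc add_diff_cancel_left' dist_commute dist_norm)
    ultimately show ?thesis by simp
  qed
  have inU: "b + P z + y \<in> cball b \<rho>" "b + P z + y \<in> U" if "z \<in> Z" "y \<in> \<Omega>" for z y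
    using ball[of z y] that \<rho>(2) by (auto simp: Z_def \<Omega>_def)
  have smR: "smooth_on (Z \<times> \<Omega>) (R s)" for s
  proof -
    have opn: "open (Z \<times> \<Omega>)" using Z \<Omega> by (simp add: open_Times)
    have "smooth_on (Z \<times> \<Omega>) (\<lambda>p. b + P (fst p) + snd p)"
      by (intro smooth_on_add smooth_on_const opn smooth_on_linear bounded_linear_snd
          bounded_linear_compose[OF P_linear bounded_linear_fst])
    then have "smooth_on (Z \<times> \<Omega>) (\<lambda>p. Y i (b + P (fst p) + snd p))" if "i < r" for i
      using smooth_on_compose[OF _ Y[OF that] _ opn] inU by (fastforce simp: o_def)
    moreover have "bounded_linear (\<lambda>p::'f \<times> 'f. fst p \<bullet> \<kappa> i)" for i
      by (rule bounded_linear_compose[OF bounded_linear_inner_left bounded_linear_fst])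
    ultimately show ?thesis
      unfolding R_def by (intro smooth_on_sum smooth_on_scaleR opn) (auto intro: smooth_on_linear)
  qed
  have CkR: "Ck_fam k ?I (Z \<times> \<Omega>) R" for k
  proof -
    have "(\<lambda>_. R 0) = R" by (simp add: R_def fun_eq_iff)
    with smooth_on_fam[OF smR[of 0], of k ?I] show ?thesis by simp
  qed
  \<comment> \<open>Truncating the displacement by the 1-Lipschitz retraction to the ball of radius
    \<rho>/4 gives an equation on the whole space. Its solutions have speed at most \<rho>/4 on
    [0,1], so they stay in that ball, where the truncation is the identity.\<close>
  define cl where "cl = closest_point (cball (0::'f) (\<rho> / 4))"
  have ne: "cball (0::'f) (\<rho> / 4) \<noteq> {}" using \<rho>(1) by simp
  have cl: "continuous_on UNIV cl" "cl y \<in> cball 0 (\<rho> / 4)" "y \<in> cball 0 (\<rho> / 4) \<Longrightarrow> cl y = y"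
    "dist (cl y) (cl y') \<le> dist y y'" for y y'
    unfolding cl_def
    by (rule continuous_on_closest_point[OF convex_cball closed_cball ne]
        closest_point_in_set[OF closed_cball ne] closest_point_self
        closest_point_lipschitz[OF convex_cball closed_cball ne] | assumption)+
  have ncl: "norm (cl y) \<le> \<rho> / 4" "norm (cl y) \<le> \<rho> / 2" for y using cl(2)[of y] \<rho>(1) by auto
  define Rc where "Rc = (\<lambda>s::real. \<lambda>p::'f \<times> 'f. \<Sum>i<r. (fst p \<bullet> \<kappa> i) *\<^sub>R Y i (b + P (fst p) + cl (snd p)))"
  let ?Z = "cball (0::'f) \<epsilon>"
  have contRc: "continuous_on (?I \<times> (?Z \<times> UNIV)) (\<lambda>(s, p). Rc s p)"
  proof -
    have "continuous_on (?I \<times> (?Z \<times> UNIV)) (\<lambda>x. (\<Sum>i<r. (fst (snd x) \<bullet> \<kappa> i) *\<^sub>R Y i (b + P (fst (snd x)) + cl (snd (snd x)))))"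
    proof (intro continuous_on_sum continuous_on_scaleR)
      fix i assume i: "i \<in> {..<r}"
      show "continuous_on (?I \<times> (?Z \<times> (UNIV::'f set))) (\<lambda>x. fst (snd x) \<bullet> \<kappa> i)"
        by (intro continuous_on_inner continuous_on_fst continuous_on_snd continuous_on_id continuous_on_const)
      have "continuous_on (?I \<times> (?Z \<times> (UNIV::'f set))) (\<lambda>x. b + P (fst (snd x)) + cl (snd (snd x)))"
        by (intro continuous_on_add continuous_on_const bounded_linear.continuous_on[OF P_linear]
            continuous_on_compose2[OF cl(1)] continuous_on_fst continuous_on_snd continuous_on_id) auto
      then show "continuous_on (?I \<times> (?Z \<times> (UNIV::'f set))) (\<lambda>x. Y i (b + P (fst (snd x)) + cl (snd (snd x))))"
        by (rule continuous_on_compose2[OF smooth_on_imp_continuous_on[OF Y[of i]], rotated 1])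
          (use i \<rho>(2) ball ncl in auto)
    qed
    then show ?thesis by (simp add: Rc_def case_prod_beta)
  qed
  obtain y where sol: "ode_solution Rc ?Z y"
  proof (rule exE[OF picard_exists[OF compact_cball convex_cball contRc]])
    fix s z x x' assume "z \<in> ?Z"
    then have z: "norm z \<le> \<epsilon>" by simp
    have "norm (Rc s (z, x) - Rc s (z, x')) \<le> norm ((b + P z + cl x) - (b + P z + cl x')) / 2"
      unfolding Rc_def fst_conv snd_conv by (rule lY[OF z ball[OF z ncl(2)] ball[OF z ncl(2)]])
    also have "\<dots> \<le> norm (x - x') / 2" using cl(4)[of x x'] by (simp add: dist_norm)
    finally show "norm (Rc s (z, x) - Rc s (z, x')) \<le> norm (x - x') / 2" .
  qed blast
  have ycont: "continuous_on (?I \<times> ?Z) (\<lambda>(s, z). y s z)"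
    and yeq: "\<And>s z. s \<in> ?I \<Longrightarrow> z \<in> ?Z \<Longrightarrow> y s z = picard Rc y s z"
    using sol by (auto simp: ode_solution_def)
  have ysmall: "norm (y s z) \<le> \<rho> / 4" if s: "s \<in> ?I" and z: "z \<in> ?Z" for s z
    unfolding yeq[OF that] picard_def
  proof (rule norm_scaled_integral_le[OF _ s])
    show "continuous_on ?I (\<lambda>t. Rc t (z, y t z))"
      by (rule continuous_on_slice[OF continuous_on_graph[OF contRc ycont] z]) auto
    show "norm (Rc t (z, y t z)) \<le> \<rho> / 4" for t
      unfolding Rc_def fst_conv snd_conv by (rule bY) (use z ball[of z] ncl in auto)
  qed
  have y\<Omega>: "y s z \<in> \<Omega>" if "s \<in> ?I" "z \<in> Z" for s z
    using ysmall[of s z] that \<rho>(1) by (auto simp: Z_def \<Omega>_def)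
  have solR: "ode_solution R Z y"
    unfolding ode_solution_def
  proof (intro conjI ballI)
    show "continuous_on (?I \<times> Z) (\<lambda>(s, z). y s z)"
      by (rule continuous_on_subset[OF ycont]) (auto simp: Z_def)
    fix s z assume s: "s \<in> ?I" and "z \<in> Z"
    then have z: "z \<in> ?Z" by (auto simp: Z_def)
    have "picard Rc y s z = picard R y s z"
      unfolding picard_def
      by (rule arg_cong[where f = "\<lambda>x. s *\<^sub>R x"], rule integral_cong)
        (use ysmall[OF mult_unit_interval[OF s] z] in \<open>simp add: Rc_def R_def cl(3)\<close>)
    with yeq[OF s z] show "y s z = picard R y s z" by simp
  qed
  have bnd: "norm (frechet_derivative (R s) (at (z, x)) (0, h)) \<le> norm h / 2"
    if "z \<in> Z" "x \<in> \<Omega>" for s z x h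
    using bDY[OF _ inU(1)[OF that], of z h] that
    by (simp add: R_derivative[OF inU(2)[OF that]] linear_0[OF bounded_linear.linear[OF P_linear]] Z_def)
  have D1: "y s differentiable (at z)" if "s \<in> ?I" "z \<in> Z" for s z
    by (rule ode_solution_derivative(1)[OF Z(1) \<Omega> CkR solR y\<Omega> bnd]) (use that in auto)
  have D2: "ode_solution (\<lambda>s p. frechet_derivative (R s) (at (fst p, y s (fst p))) (v, snd p)) Z
      (\<lambda>s z. frechet_derivative (y s) (at z) v)" for v
    by (rule ode_solution_derivative(2)[OF Z(1) \<Omega> CkR solR y\<Omega> bnd]) auto
  have Cky: "Ck_fam k ?I Z y" for k
    by (rule Ck_fam_SucD, rule Ck_ode_solution[OF Z(1) \<Omega> CkR solR y\<Omega> bnd]) auto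
  define x where "x = (\<lambda>s z. b + P z + y s z)"
  have xU: "x s z \<in> U" "x s z \<in> cball b \<rho>" if "s \<in> ?I" "z \<in> Z" for s z
    using inU[OF that(2) y\<Omega>[OF that]] by (auto simp: x_def)
  let ?W = "\<lambda>v s z. frechet_derivative (y s) (at z) v"
  have dery: "(y s has_derivative frechet_derivative (y s) (at z)) (at z)" if "s \<in> ?I" "z \<in> Z" for s z
    using D1[OF that] by (simp add: frechet_derivative_works)
  have derx: "(x s has_derivative (\<lambda>v. P v + ?W v s z)) (at z)" if "s \<in> ?I" "z \<in> Z" for s z
    using has_derivative_add[OF has_derivative_add[OF has_derivative_const
          bounded_linear_imp_has_derivative[OF P_linear]] dery[OF that], of b]
    by (simp add: x_def)
  have Weq: "?W v s z = s *\<^sub>R integral ?I (\<lambda>\<sigma>. \<Sum>i<r. (z \<bullet> \<kappa> i) *\<^sub>R DY i (x (s * \<sigma>) z) (P v + ?W v (s * \<sigma>) z) +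
      (v \<bullet> \<kappa> i) *\<^sub>R Y i (x (s * \<sigma>) z))" if s: "s \<in> ?I" and z: "z \<in> Z" for v s z
  proof -
    have "?W v s z = picard (\<lambda>s p. frechet_derivative (R s) (at (fst p, y s (fst p))) (v, snd p)) (?W v) s z"
      using D2[of v] s z by (simp add: ode_solution_def)
    also have "\<dots> = s *\<^sub>R integral ?I (\<lambda>\<sigma>. \<Sum>i<r. (z \<bullet> \<kappa> i) *\<^sub>R DY i (x (s * \<sigma>) z) (P v + ?W v (s * \<sigma>) z) +
      (v \<bullet> \<kappa> i) *\<^sub>R Y i (x (s * \<sigma>) z))"
      unfolding picard_def
      by (rule arg_cong[where f = "\<lambda>x. s *\<^sub>R x"], rule integral_cong)
        (use inU(2)[OF z y\<Omega>[OF mult_unit_interval[OF s] z]] in \<open>simp add: R_derivative x_def\<close>)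
    finally show ?thesis .
  qed
  have ycont': "continuous_on ?I (\<lambda>s. y s z)" and Wcont: "continuous_on ?I (\<lambda>s. ?W v s z)" if "z \<in> Z" for z v
    using continuous_on_slice[of ?I Z y, OF _ that] continuous_on_slice[of ?I Z "?W v", OF _ that] solR D2[of v]
    by (auto simp: ode_solution_def)
  have xcont: "continuous_on ?I (\<lambda>s. x s z)" if "z \<in> Z" for z
    unfolding x_def by (intro continuous_on_add continuous_on_const ycont' that)
  have Yxcont: "continuous_on ?I (\<lambda>s. Y i (x s z))" if "i < r" "z \<in> Z" for i z
    by (rule continuous_on_compose2[OF smooth_on_imp_continuous_on[OF Y[OF that(1)]] xcont[OF that(2)]])
      (use xU that in auto)
  have DYcont: "continuous_on ?I (\<lambda>s. DY i (x s z) (w s))" if "i < r" "z \<in> Z" "continuous_on ?I w" for i z w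
  proof -
    have lin: "linear (DY i (x s z))" if "s \<in> ?I" for s
      using derY[OF \<open>i < r\<close> xU(1)[OF that \<open>z \<in> Z\<close>]] by (rule has_derivative_linear)
    have "continuous_on ?I (\<lambda>s. \<Sum>k\<in>Basis. (w s \<bullet> k) *\<^sub>R DY i (x s z) k)"
    proof (intro continuous_on_sum continuous_on_scaleR continuous_on_inner continuous_on_const that)
      show "continuous_on ?I (\<lambda>s. DY i (x s z) k)" for k
        by (rule continuous_on_compose2[OF smooth_on_imp_continuous_on[OF smooth_on_deriv[OF Y[OF that(1)]]] xcont[OF that(2)]])
          (use xU that in auto)
    qed
    then show ?thesis
      by (rule continuous_on_eq) (simp flip: linear_eq_sum_Basis[OF lin])
  qed
  have key: "?W (\<kappa> i) s z = s *\<^sub>R Y i (x s z)" if i: "i < r" and s: "s \<in> ?I" and z: "z \<in> Z" for i s z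
  proof -
    define V where "V = (\<lambda>s. s *\<^sub>R Y i (x s z))"
    define A where "A = (\<lambda>w s. \<Sum>j<r. (z \<bullet> \<kappa> j) *\<^sub>R DY j (x s z) (w s))"
    have Acont: "continuous_on ?I (A w)" if "continuous_on ?I w" for w
      unfolding A_def by (intro continuous_on_sum continuous_on_scaleR continuous_on_const DYcont z that) auto
    have Vcont: "continuous_on ?I V"
      unfolding V_def by (intro continuous_on_scaleR continuous_on_id Yxcont i z)
    have xdot: "((\<lambda>s. x s z) has_vector_derivative (\<Sum>j<r. (z \<bullet> \<kappa> j) *\<^sub>R Y j (x s z))) (at s within ?I)"
      if "s \<in> ?I" for s
    proof -
      let ?g = "\<lambda>s. \<Sum>j<r. (z \<bullet> \<kappa> j) *\<^sub>R Y j (x s z)"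
      have gc: "continuous_on ?I ?g"
        by (intro continuous_on_sum continuous_on_scaleR continuous_on_const Yxcont z) auto
      have "x t z = b + P z + integral {0..t} ?g" if t: "t \<in> ?I" for t
      proof -
        have "y t z = picard R y t z" using solR t z by (simp add: ode_solution_def)
        then have "y t z = t *\<^sub>R integral ?I (\<lambda>\<sigma>. ?g (t * \<sigma>))"
          by (simp add: picard_def R_def x_def)
        then show ?thesis using scaled_integral_eq[OF t, of ?g] by (simp add: x_def)
      qed
      moreover have "((\<lambda>t. b + P z + integral {0..t} ?g) has_vector_derivative 0 + ?g s) (at s within ?I)"
        by (intro has_vector_derivative_add has_vector_derivative_const integral_has_vector_derivative gc that)
      ultimately show ?thesis
        using that by (auto intro: has_vector_derivative_transform[of s ?I])
    qed
    have Vdot: "(V has_vector_derivative A V s + Y i (x s z)) (at s within ?I)" if t: "s \<in> ?I" for s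
    proof -
      have U: "x s z \<in> U" by (rule xU(1)[OF t z])
      have lin: "linear (DY j (x s z))" if "j < r" for j
        using derY[OF that U] by (rule has_derivative_linear)
      have "((\<lambda>s. Y i (x s z)) has_vector_derivative DY i (x s z) (\<Sum>j<r. (z \<bullet> \<kappa> j) *\<^sub>R Y j (x s z))) (at s within ?I)"
        using vector_derivative_diff_chain_within[OF xdot[OF t] has_derivative_at_withinI[OF derY[OF i U]]]
        by (simp add: o_def)
      then have "(V has_vector_derivative s *\<^sub>R DY i (x s z) (\<Sum>j<r. (z \<bullet> \<kappa> j) *\<^sub>R Y j (x s z)) + 1 *\<^sub>R Y i (x s z)) (at s within ?I)"
        unfolding V_def by (intro has_vector_derivative_scaleR DERIV_ident)
      \<comment> \<open>Commutation exchanges the two fields here. It turns the derivative of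
        \<open>V\<close> into the linear equation that the derivative of the solution along
        \<open>\<kappa> i\<close> satisfies.\<close>
      moreover have "DY i (x s z) (\<Sum>j<r. (z \<bullet> \<kappa> j) *\<^sub>R Y j (x s z)) = (\<Sum>j<r. (z \<bullet> \<kappa> j) *\<^sub>R DY j (x s z) (Y i (x s z)))"
        using comm[OF i _ U] by (simp add: linear_sum[OF lin[OF i]] linear_scale[OF lin[OF i]])
      then have "s *\<^sub>R DY i (x s z) (\<Sum>j<r. (z \<bullet> \<kappa> j) *\<^sub>R Y j (x s z)) = A V s"
        using lin by (simp add: A_def V_def scaleR_right.sum linear_scale mult.commute)
      ultimately show ?thesis by simp
    qed
    let ?f = "\<lambda>s. A V s + Y i (x s z)" and ?w = "\<lambda>s. A (\<lambda>s. ?W (\<kappa> i) s z) s + Y i (x s z)"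
    have fc: "continuous_on ?I ?f" "continuous_on ?I ?w"
      by (intro continuous_on_add Acont Vcont Yxcont i z Wcont)+
    have Veq: "V t = t *\<^sub>R integral ?I (\<lambda>\<sigma>. ?f (t * \<sigma>))" if t: "t \<in> ?I" for t
    proof -
      have "(?f has_integral V t - V 0) {0..t}"
      proof (rule fundamental_theorem_of_calculus)
        fix u assume "u \<in> {0..t}"
        then show "(V has_vector_derivative ?f u) (at u within {0..t})"
          using t by (intro has_vector_derivative_within_subset[OF Vdot]) auto
      qed (use t in simp)
      then have "integral {0..t} ?f = V t" by (simp add: integral_unique V_def)
      then show ?thesis using scaled_integral_eq[OF t, of ?f] by simp
    qed
    have Weq': "?W (\<kappa> i) t z = t *\<^sub>R integral ?I (\<lambda>\<sigma>. ?w (t * \<sigma>))" if t: "t \<in> ?I" for t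
    proof -
      have "(\<Sum>j<r. (\<kappa> i \<bullet> \<kappa> j) *\<^sub>R Y j w) = Y i w" for w
      proof -
        have "(\<Sum>j<r. (\<kappa> i \<bullet> \<kappa> j) *\<^sub>R Y j w) = (\<Sum>j<r. if j = i then Y j w else 0)"
          using inner_\<kappa>[OF i] by (intro sum.cong) auto
        then show ?thesis using i by simp
      qed
      then show ?thesis using Weq[OF t z, of "\<kappa> i"] by (simp add: P_\<kappa>[OF i] A_def sum.distrib)
    qed
    have "norm (?W (\<kappa> i) s z - V s) \<le> 2 * 0"
    \<comment> \<open>The difference satisfies the homogeneous linear equation with value 0 at time
      0, so the estimate applies with a = 0.\<close>
    proof (rule contraction_bound[OF continuous_on_diff[OF Wcont[OF z] Vcont] _ s])
      fix B t assume B: "\<And>s. s \<in> ?I \<Longrightarrow> norm (?W (\<kappa> i) s z - V s) \<le> B" and t: "t \<in> ?I"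
      have "?W (\<kappa> i) t z - V t = t *\<^sub>R integral ?I (\<lambda>\<sigma>. ?w (t * \<sigma>) - ?f (t * \<sigma>))"
        using scaled_integral_diff[OF fc(2,1) t] Veq[OF t] Weq'[OF t] by metis
      also have "norm \<dots> \<le> B / 2"
      proof (rule norm_scaled_integral_le[OF continuous_on_diff[OF fc(2,1)] t])
        fix u :: real assume u: "u \<in> ?I"
        have lin: "linear (DY j (x u z))" if "j < r" for j
          using derY[OF that xU(1)[OF u z]] by (rule has_derivative_linear)
        have "?w u - ?f u = (\<Sum>j<r. (z \<bullet> \<kappa> j) *\<^sub>R DY j (x u z) (?W (\<kappa> i) u z - V u))"
          using lin by (simp add: A_def linear_diff scaleR_right_diff_distrib sum_subtractf)
        also have "norm \<dots> \<le> norm (?W (\<kappa> i) u z - V u) / 2"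
          by (rule bDY) (use z xU(2)[OF u z] in \<open>auto simp: Z_def\<close>)
        finally show "norm (?w u - ?f u) \<le> B / 2" using B[OF u] by simp
      qed
      finally show "norm (?W (\<kappa> i) t z - V t) \<le> 0 + B / 2" by simp
    qed
    then show ?thesis by (simp add: V_def)
  qed
  have y0: "y s 0 = 0" if "s \<in> ?I" for s
    using solR that Z(2) by (auto simp: ode_solution_def picard_def R_def)
  have "linear P" using P_linear by (rule bounded_linear.linear)
  then have x0: "x s 0 = b" if "s \<in> ?I" for s
    using y0[OF that] by (simp add: x_def linear_0)
  \<comment> \<open>At z = 0 all coefficients of the fields vanish, so transversal directions move
    only the initial point. Together with \<open>key\<close> this makes \<open>T\<close> the
    derivative of \<Psi> at 0.\<close>
  have W0: "?W k 1 0 = 0" if k: "k \<in> Basis - K" for k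
  proof -
    have "k \<bullet> \<kappa> i = 0" if "i < r" for i
      using k \<kappa>_K[OF that] K by (auto simp: inner_Basis)
    then show ?thesis using Weq[of 1 0 k] Z(2) by simp
  qed
  define \<Psi> where "\<Psi> = x 1"
  have der\<Psi>: "(\<Psi> has_derivative (\<lambda>v. P v + ?W v 1 z)) (at z)" if "z \<in> Z" for z
    using derx[of 1 z] that by (simp add: \<Psi>_def)
  have fr: "frechet_derivative \<Psi> (at z) = (\<lambda>v. P v + ?W v 1 z)" if "z \<in> Z" for z
    using frechet_derivative_at[OF der\<Psi>[OF that]] by simp
  have "frechet_derivative \<Psi> (at 0) k = T k" if k: "k \<in> Basis" for k
  proof (cases "k \<in> K")
    case True
    then obtain i where i: "i < r" "k = \<kappa> i" using \<kappa> by (auto simp: bij_betw_def)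
    then show ?thesis using key[OF i(1), of 1 0] Z(2) x0[of 1] by (simp add: fr P_\<kappa> T(3))
  next
    case False
    then show ?thesis using k W0[of k] Z(2) P_Basis[of k] by (simp add: fr)
  qed
  then have T0: "frechet_derivative \<Psi> (at 0) = T"
    using linear_eq_stdbasis[OF has_derivative_linear[OF der\<Psi>[OF Z(2)]] T(1)] Z(2) by (auto simp: fr)
  have sm: "smooth_on Z \<Psi>"
  proof -
    have "smooth_on Z (y 1)"
      unfolding smooth_on_def using Ck_on_slice[OF Cky, of 1] by auto
    then show ?thesis
      unfolding \<Psi>_def x_def
      by (intro smooth_on_add[OF smooth_on_add[OF smooth_on_const smooth_on_linear[OF P_linear]]] Z)
  qed
  show ?case
  proof (rule that[OF Z sm])
    show "\<Psi> 0 = b" using x0[of 1] by (simp add: \<Psi>_def)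
    show "\<Psi> ` Z \<subseteq> U" using xU(1)[of 1] by (auto simp: \<Psi>_def)
    show "inj (frechet_derivative \<Psi> (at 0))" using T0 T(2) by simp
    show "frechet_derivative \<Psi> (at z) (\<kappa> i) = Y i (\<Psi> z)" if "z \<in> Z" "i < r" for z i
    proof -
      have "frechet_derivative \<Psi> (at z) (\<kappa> i) = P (\<kappa> i) + ?W (\<kappa> i) 1 z"
        by (simp only: fr[OF that(1)])
      with key[OF that(2) _ that(1), of 1] P_\<kappa>[OF that(2)] show ?thesis by (simp add: \<Psi>_def)
    qed
  qed
qed
qed

end

text \<open>The inverse of the straightening map is a coordinate map whose derivative sends each
  \<open>Y i\<close> to the basis vector \<open>\<kappa> i\<close>, because the derivatives of
  \<Psi> and \<open>g\<close> are mutually inverse.\<close>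

theorem frobenius_commuting:
  fixes Y :: "nat \<Rightarrow> 'f::euclidean_space \<Rightarrow> 'f"
  assumes U: "open U" "b \<in> U" and Y: "\<And>i. i < r \<Longrightarrow> smooth_on U (Y i)"
    and comm: "\<And>i j x. i < r \<Longrightarrow> j < r \<Longrightarrow> x \<in> U \<Longrightarrow>
      frechet_derivative (Y i) (at x) (Y j x) = frechet_derivative (Y j) (at x) (Y i x)"
    and ind: "inj_on (\<lambda>i. Y i b) {..<r}" "independent ((\<lambda>i. Y i b) ` {..<r})"
  obtains W Z g \<Psi> K where "open W" "b \<in> W" "W \<subseteq> U" "open Z" "homeomorphism W Z g \<Psi>"
    "smooth_on W g" "smooth_on Z \<Psi>" "K \<subseteq> (Basis :: 'f set)" "card K = r"
    "\<And>x v. x \<in> W \<Longrightarrow> frechet_derivative g (at x) v \<in> span K \<longleftrightarrow> v \<in> span ((\<lambda>i. Y i x) ` {..<r})"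
proof -
  obtain K \<kappa> T where K0: "K \<subseteq> (Basis :: 'f set)" "card K = r" and \<kappa>: "bij_betw \<kappa> {..<r} K"
    and T: "linear T" "inj T" "\<And>i. i < r \<Longrightarrow> T (\<kappa> i) = Y i b"
    by (rule linear_iso_extend[OF ind], blast)
  interpret commuting_fields Y U b r K \<kappa> T
    by (rule commuting_fields.intro) (fact U Y comm K0 \<kappa> T)+
  show thesis
  proof (rule straightening, goal_cases)
  case (1 Z \<Psi>)
  note Z = 1(1,2) and \<Psi> = 1(3,4,5) and inj = 1(6) and D\<Psi> = 1(7)
  obtain Z' W g where Z': "open Z'" "Z' \<subseteq> Z" "0 \<in> Z'" and W: "open W" "\<Psi> 0 \<in> W"
    and hom: "homeomorphism Z' W \<Psi> g" and g: "smooth_on W g"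
    by (rule smooth_inverse_function[OF Z \<Psi>(1) inj], blast)
  have span: "frechet_derivative g (at x) v \<in> span K \<longleftrightarrow> v \<in> span ((\<lambda>i. Y i x) ` {..<r})"
    if x: "x \<in> W" for x v
  proof -
    define z where "z = g x"
    have z: "z \<in> Z'" "z \<in> Z" "\<Psi> z = x" using hom x Z' by (auto simp: z_def homeomorphism_def)
    note dg = smooth_on_has_derivative[OF g x]
    note d\<Psi> = smooth_on_has_derivative[OF \<Psi>(1) z(2)]
    let ?G = "frechet_derivative g (at x)" and ?F = "frechet_derivative \<Psi> (at z)"
    have "((\<lambda>w. w) has_derivative ?G \<circ> ?F) (at z)"
      by (rule has_derivative_transform_within_open[OF diff_chain_at[OF d\<Psi>] Z'(1) z(1)])
        (use dg z hom in \<open>auto simp: homeomorphism_def\<close>)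
    from has_derivative_unique[OF this has_derivative_ident] have GF: "?G (?F u) = u" for u
      by (metis comp_apply)
    have "((\<lambda>w. w) has_derivative ?F \<circ> ?G) (at x)"
      by (rule has_derivative_transform_within_open[OF diff_chain_at[OF dg] W(1) x])
        (use d\<Psi> hom in \<open>auto simp: homeomorphism_def z_def\<close>)
    from has_derivative_unique[OF this has_derivative_ident] have FG: "?F (?G u) = u" for u
      by (metis comp_apply)
    have "(\<lambda>i. Y i x) ` {..<r} = ?F ` K"
      using D\<Psi>[OF z(2)] z(3) \<kappa> by (auto simp: bij_betw_def image_iff)
    then have "span ((\<lambda>i. Y i x) ` {..<r}) = ?F ` span K"
      by (simp add: span_linear_image[OF has_derivative_linear[OF d\<Psi>]])
    then show ?thesis using GF FG by (auto simp: image_iff) (metis FG)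
  qed
  have "W \<subseteq> U" using hom \<Psi>(3) Z' by (auto simp: homeomorphism_def)
  show ?case
    by (rule that[OF W(1) _ \<open>W \<subseteq> U\<close> Z'(1) _ g smooth_on_subset[OF \<Psi>(1) Z'(2)] K0 span])
      (use W(2) \<Psi>(2) hom in \<open>auto simp: homeomorphism_symD\<close>)
qed
qed

section \<open>Manifolds\<close>

lemma is_chart_homeomorphism:
  "is_chart c \<Longrightarrow> homeomorphism (fst c) (snd c ` fst c) (snd c) (chart_inv c)"
  by (simp add: is_chart_def)

lemma is_chart_open: "is_chart c \<Longrightarrow> open (fst c)" "is_chart c \<Longrightarrow> open (snd c ` fst c)"
  by (simp_all add: is_chart_def)

lemma chart_inv_chart: "is_chart c \<Longrightarrow> p \<in> fst c \<Longrightarrow> chart_inv c (snd c p) = p"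
  using is_chart_homeomorphism[of c] by (simp add: homeomorphism_def)

lemma chart_chart_inv: "is_chart c \<Longrightarrow> x \<in> snd c ` fst c \<Longrightarrow> snd c (chart_inv c x) = x"
  using is_chart_homeomorphism[of c] by (auto simp: homeomorphism_def)

lemma chart_inv_in: "is_chart c \<Longrightarrow> x \<in> snd c ` fst c \<Longrightarrow> chart_inv c x \<in> fst c"
  using is_chart_homeomorphism[of c] by (auto simp: homeomorphism_def)

lemma chart_inj: "is_chart c \<Longrightarrow> p \<in> fst c \<Longrightarrow> q \<in> fst c \<Longrightarrow> snd c p = snd c q \<Longrightarrow> p = q"
  by (metis chart_inv_chart)

lemma chart_image_Int:
  assumes "is_chart c"
  shows "snd c ` (fst c \<inter> W) = (snd c ` fst c) \<inter> chart_inv c -` W"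
  using chart_inv_chart[OF assms] by force

lemma open_chart_image:
  assumes "is_chart c" "open W"
  shows "open (snd c ` (fst c \<inter> W))"
  unfolding chart_image_Int[OF assms(1)]
  using assms is_chart_homeomorphism[OF assms(1)] is_chart_open[OF assms(1)]
  by (intro continuous_open_preimage) (auto simp: homeomorphism_def)

lemma smooth_chart_is_chart: "smooth_chart A c \<Longrightarrow> is_chart c"
  by (simp add: smooth_chart_def)

locale manifold =
  fixes A :: "('a::{t2_space,second_countable_topology}, 'e::euclidean_space) chart set"
  assumes atlas: "smooth_atlas A"
begin

lemma smooth_chart_atlas: "c \<in> A \<Longrightarrow> smooth_chart A c"
  using atlas by (auto simp: smooth_atlas_def smooth_chart_def)

lemma chart_at: "chart_at A p \<in> A" "p \<in> fst (chart_at A p)" "smooth_chart A (chart_at A p)"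
proof -
  have "p \<in> (\<Union>c\<in>A. fst c)" using atlas by (auto simp: smooth_atlas_def)
  then have "\<exists>c. c \<in> A \<and> p \<in> fst c" by blast
  from someI_ex[OF this] show "chart_at A p \<in> A" "p \<in> fst (chart_at A p)"
    by (auto simp: chart_at_def)
  then show "smooth_chart A (chart_at A p)" by (simp add: smooth_chart_atlas)
qed

lemma is_chart_at: "is_chart (chart_at A p)"
  by (rule smooth_chart_is_chart[OF chart_at(3)])

lemma transition_smooth_atlas:
  assumes "smooth_chart A c" "c' \<in> A"
  shows "smooth_on (snd c ` (fst c \<inter> fst c')) (snd c' \<circ> chart_inv c)"
    "smooth_on (snd c' ` (fst c \<inter> fst c')) (snd c \<circ> chart_inv c')"
  using assms by (auto simp: smooth_chart_def compatible_charts_def)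

text \<open>By definition a chart of the maximal atlas is compatible with the charts of
  \<open>A\<close>; for two such charts a direct comparison is at hand when one of them lies in
  \<open>A\<close>.\<close>

lemma smooth_on_change_chart:
  assumes c: "smooth_chart A c" and c': "smooth_chart A c'" and atl: "c \<in> A \<or> c' \<in> A"
    and U: "open U" "U \<subseteq> fst c" "U \<subseteq> fst c'"
    and f: "smooth_on (snd c ` U) (f \<circ> chart_inv c)"
  shows "smooth_on (snd c' ` U) (f \<circ> chart_inv c')"
proof -
  note ch = smooth_chart_is_chart[OF c] smooth_chart_is_chart[OF c']
  have U': "fst c' \<inter> U = U" "U \<subseteq> fst c' \<inter> fst c" using U by auto
  have opn: "open (snd c' ` U)" using open_chart_image[OF ch(2) U(1)] U' by simp
  have tr: "smooth_on (snd c' ` (fst c' \<inter> fst c)) (snd c \<circ> chart_inv c')"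
    using atl transition_smooth_atlas(2)[OF c, of c'] transition_smooth_atlas(1)[OF c', of c]
    by (metis Int_commute)
  have "smooth_on (snd c' ` U) ((f \<circ> chart_inv c) \<circ> (snd c \<circ> chart_inv c'))"
    by (rule smooth_on_compose[OF smooth_on_subset[OF tr image_mono[OF U'(2)]] f _ opn])
      (use U chart_inv_chart[OF ch(2)] in auto)
  then show ?thesis
    by (rule smooth_on_cong[OF _ opn]) (auto simp: chart_inv_chart[OF ch(1)] chart_inv_chart[OF ch(2)] subsetD[OF U(2)] subsetD[OF U(3)])
qed

text \<open>The test may use a different chart of the maximal atlas at each point, since the
  comparison is always with a chart of \<open>A\<close>.\<close>

lemma smooth_funI:
  assumes W: "\<And>p. p \<in> W \<Longrightarrow> \<exists>c U. smooth_chart A c \<and> open U \<and> p \<in> U \<and> U \<subseteq> fst c \<and>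
      smooth_on (snd c ` U) (f \<circ> chart_inv c)" and opn: "open W"
  shows "smooth_fun A W f"
  unfolding smooth_fun_def
proof
  fix c' assume c': "c' \<in> A"
  note sc' = smooth_chart_atlas[OF c'] and ic' = smooth_chart_is_chart[OF smooth_chart_atlas[OF c']]
  show "smooth_on (snd c' ` (fst c' \<inter> W)) (f \<circ> chart_inv c')"
  proof (rule smooth_on_local)
    fix x assume "x \<in> snd c' ` (fst c' \<inter> W)"
    then obtain p where p: "p \<in> fst c'" "p \<in> W" "x = snd c' p" by auto
    obtain c U where c: "smooth_chart A c" "open U" "p \<in> U" "U \<subseteq> fst c"
      and sm: "smooth_on (snd c ` U) (f \<circ> chart_inv c)" using W[OF p(2)] by blast
    define U' where "U' = U \<inter> fst c' \<inter> W"
    have U': "open U'" using c(2) opn is_chart_open[OF ic'] by (simp add: U'_def open_Int)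
    have sm': "smooth_on (snd c' ` U') (f \<circ> chart_inv c')"
      by (rule smooth_on_change_chart[OF c(1) sc' _ U' _ _ smooth_on_subset[OF sm]])
        (use c' c(4) in \<open>auto simp: U'_def\<close>)
    show "\<exists>N. open N \<and> x \<in> N \<and> smooth_on (snd c' ` (fst c' \<inter> W) \<inter> N) (f \<circ> chart_inv c')"
    proof (intro exI conjI)
      have "fst c' \<inter> U' = U'" by (auto simp: U'_def)
      then show "open (snd c' ` U')" using open_chart_image[OF ic' U'] by simp
      show "x \<in> snd c' ` U'" using p c by (auto simp: U'_def)
      have "snd c' ` (fst c' \<inter> W) \<inter> snd c' ` U' = snd c' ` U'" by (auto simp: U'_def)
      with sm' show "smooth_on (snd c' ` (fst c' \<inter> W) \<inter> snd c' ` U') (f \<circ> chart_inv c')" by simp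
    qed
  qed
qed

text \<open>Near each point the preferred chart, a member of \<open>A\<close>, mediates between the
  definition and the chart \<open>c\<close>.\<close>

lemma smooth_fun_chart:
  assumes f: "smooth_fun A W f" and W: "open W" and c: "smooth_chart A c"
  shows "smooth_on (snd c ` (fst c \<inter> W)) (f \<circ> chart_inv c)"
proof (rule smooth_on_local)
  note ic = smooth_chart_is_chart[OF c]
  fix x assume "x \<in> snd c ` (fst c \<inter> W)"
  then obtain p where p: "p \<in> fst c" "p \<in> W" "x = snd c p" by auto
  define U where "U = fst c \<inter> W \<inter> fst (chart_at A p)"
  have U: "open U" using W is_chart_open[OF ic] is_chart_open[OF is_chart_at] by (auto simp: U_def)
  have "smooth_on (snd (chart_at A p) ` U) (f \<circ> chart_inv (chart_at A p))"
    using f chart_at(1)[of p] unfolding smooth_fun_def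
    by (auto intro: smooth_on_subset simp: U_def)
  then have "smooth_on (snd c ` U) (f \<circ> chart_inv c)"
    by (intro smooth_on_change_chart[OF chart_at(3)[of p] c _ U]) (auto simp: U_def chart_at)
  moreover have "fst c \<inter> U = U" "snd c ` (fst c \<inter> W) \<inter> snd c ` U = snd c ` U" by (auto simp: U_def)
  ultimately show "\<exists>N. open N \<and> x \<in> N \<and> smooth_on (snd c ` (fst c \<inter> W) \<inter> N) (f \<circ> chart_inv c)"
    using open_chart_image[OF ic U] p chart_at(2)[of p]
    by (intro exI[of _ "snd c ` U"]) (auto simp: U_def)
qed

lemma smooth_fun_chart_map: "smooth_chart A c \<Longrightarrow> smooth_fun A (fst c) (snd c)"
  unfolding smooth_fun_def
  by (rule ballI, subst Int_commute, rule transition_smooth_atlas(2))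

lemma smooth_fun_subset: "smooth_fun A W f \<Longrightarrow> U \<subseteq> W \<Longrightarrow> smooth_fun A U f"
  unfolding smooth_fun_def by (meson Int_mono image_mono order_refl smooth_on_subset)

lemma open_atlas_image: "c \<in> A \<Longrightarrow> open W \<Longrightarrow> open (snd c ` (fst c \<inter> W))"
  by (rule open_chart_image[OF smooth_chart_is_chart[OF smooth_chart_atlas]])

lemma smooth_fun_cong:
  assumes "smooth_fun A W f" "open W" "\<And>p. p \<in> W \<Longrightarrow> f p = g p"
  shows "smooth_fun A W g"
  unfolding smooth_fun_def
proof
  fix c assume c: "c \<in> A"
  then have "smooth_on (snd c ` (fst c \<inter> W)) (f \<circ> chart_inv c)"
    using assms(1) by (simp add: smooth_fun_def)
  then show "smooth_on (snd c ` (fst c \<inter> W)) (g \<circ> chart_inv c)"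
    by (rule smooth_on_cong[OF _ open_atlas_image[OF c assms(2)]])
      (use assms(3) chart_inv_chart[OF smooth_chart_is_chart[OF smooth_chart_atlas[OF c]]] in auto)
qed

lemma smooth_fun_local:
  assumes "\<And>p. p \<in> W \<Longrightarrow> \<exists>U. open U \<and> p \<in> U \<and> smooth_fun A U f" "open W"
  shows "smooth_fun A W f"
proof (rule smooth_funI[OF _ assms(2)])
  fix p assume "p \<in> W"
  then obtain U where U: "open U" "p \<in> U" "smooth_fun A U f" using assms(1) by blast
  show "\<exists>c U. smooth_chart A c \<and> open U \<and> p \<in> U \<and> U \<subseteq> fst c \<and> smooth_on (snd c ` U) (f \<circ> chart_inv c)"
    using smooth_fun_chart[OF U(3,1) chart_at(3)] U chart_at is_chart_open(1)[OF is_chart_at]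
    by (intro exI[of _ "chart_at A p"] exI[of _ "fst (chart_at A p) \<inter> U"]) auto
qed

lemma smooth_fun_const: "smooth_fun A W (\<lambda>p. k)"
  by (simp add: smooth_fun_def o_def smooth_on_const)

lemma smooth_fun_add:
  "smooth_fun A W f \<Longrightarrow> smooth_fun A W g \<Longrightarrow> open W \<Longrightarrow> smooth_fun A W (\<lambda>p. f p + g p)"
  using open_atlas_image by (auto simp: smooth_fun_def o_def intro: smooth_on_add)

lemma smooth_fun_mult:
  fixes f g :: "'a \<Rightarrow> real"
  shows "smooth_fun A W f \<Longrightarrow> smooth_fun A W g \<Longrightarrow> open W \<Longrightarrow> smooth_fun A W (\<lambda>p. f p * g p)"
  using open_atlas_image by (auto simp: smooth_fun_def o_def intro: smooth_on_mult)

lemma smooth_fun_sum: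
  "(\<And>i. i \<in> I \<Longrightarrow> smooth_fun A W (f i)) \<Longrightarrow> open W \<Longrightarrow> smooth_fun A W (\<lambda>p. \<Sum>i\<in>I. f i p)"
  using open_atlas_image by (auto simp: smooth_fun_def o_def intro!: smooth_on_sum)

lemma smooth_fun_bounded_linear:
  assumes "bounded_linear L" "smooth_fun A W f" "open W"
  shows "smooth_fun A W (\<lambda>p. L (f p))"
  using assms(2) smooth_on_bounded_linear[OF assms(1) _ open_atlas_image[OF _ assms(3)]]
  by (auto simp: smooth_fun_def o_def)

lemma smooth_fun_continuous:
  assumes f: "smooth_fun A W f" and W: "open W"
  shows "continuous_on W f"
proof (rule continuous_at_imp_continuous_on, rule ballI)
  fix p assume p: "p \<in> W"
  let ?c = "chart_at A p"
  let ?U = "fst ?c \<inter> W"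
  have opn: "open ?U" using W is_chart_open[OF is_chart_at] by auto
  have "continuous_on ?U (snd ?c)"
    using is_chart_homeomorphism[OF is_chart_at[of p]]
    by (auto simp: homeomorphism_def intro: continuous_on_subset)
  then have "continuous_on ?U (\<lambda>q. (f \<circ> chart_inv ?c) (snd ?c q))"
    by (rule continuous_on_compose2[OF smooth_on_imp_continuous_on[OF smooth_fun_chart[OF f W chart_at(3)]]]) auto
  then have "continuous_on ?U f"
    by (rule continuous_on_eq) (simp add: chart_inv_chart[OF is_chart_at])
  then show "continuous (at p) f"
    using opn p chart_at(2) by (simp add: continuous_on_eq_continuous_at)
qed

section \<open>Tangent maps and differentials in preferred charts\<close>

lemma chart_rep_has_derivative:
  assumes "smooth_fun A W f" "open W" "p \<in> W" "smooth_chart A c" "p \<in> fst c"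
  shows "(f \<circ> chart_inv c has_derivative frechet_derivative (f \<circ> chart_inv c) (at (snd c p))) (at (snd c p))"
  by (rule smooth_on_has_derivative[OF smooth_fun_chart[OF assms(1,2,4)]]) (use assms in auto)

lemma tangent_map_has_derivative:
  assumes "smooth_fun A W f" "open W" "p \<in> W"
  shows "(f \<circ> chart_inv (chart_at A p) has_derivative tangent_map A f p) (at (snd (chart_at A p) p))"
  unfolding tangent_map_def by (rule chart_rep_has_derivative[OF assms chart_at(3,2)])

lemma tangent_map_eqI:
  "(f \<circ> chart_inv (chart_at A p) has_derivative D) (at (snd (chart_at A p) p)) \<Longrightarrow> tangent_map A f p = D"
  unfolding tangent_map_def by (simp flip: frechet_derivative_at)

lemma tangent_map_bounded_linear:
  assumes "smooth_fun A W f" "open W" "p \<in> W"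
  shows "bounded_linear (tangent_map A f p)"
  using tangent_map_has_derivative[OF assms] by (rule has_derivative_bounded_linear)

lemma tangent_map_linear:
  assumes "smooth_fun A W f" "open W" "p \<in> W"
  shows "linear (tangent_map A f p)"
  by (rule bounded_linear.linear[OF tangent_map_bounded_linear[OF assms]])

lemma tangent_map_cong:
  assumes "open W" "p \<in> W" "\<And>q. q \<in> W \<Longrightarrow> f q = g q"
  shows "tangent_map A f p = tangent_map A g p"
  unfolding tangent_map_def
proof (rule frechet_derivative_cong_open[OF open_chart_image[OF is_chart_at assms(1)]])
  show "snd (chart_at A p) p \<in> snd (chart_at A p) ` (fst (chart_at A p) \<inter> W)"
    using assms chart_at by auto
qed (use assms chart_inv_chart[OF is_chart_at] in auto)

text \<open>Chain rule for a change of coordinates: \<open>tangent_map A (snd c) p\<close> is the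
  Jacobian from the preferred chart of \<open>p\<close> to \<open>c\<close>. Computations in other
  charts go through this formula.\<close>

lemma tangent_map_chart:
  assumes f: "smooth_fun A W f" "open W" "p \<in> W" and c: "smooth_chart A c" "p \<in> fst c"
  shows "tangent_map A f p v = frechet_derivative (f \<circ> chart_inv c) (at (snd c p)) (tangent_map A (snd c) p v)"
proof -
  let ?a = "chart_at A p"
  note ic = smooth_chart_is_chart[OF c(1)]
  let ?x = "snd ?a p"
  have inv: "chart_inv ?a ?x = p" by (rule chart_inv_chart[OF is_chart_at chart_at(2)])
  have d1: "(snd c \<circ> chart_inv ?a has_derivative tangent_map A (snd c) p) (at ?x)"
    by (rule tangent_map_has_derivative[OF smooth_fun_chart_map[OF c(1)] is_chart_open(1)[OF ic] c(2)])
  have "(f \<circ> chart_inv c has_derivative frechet_derivative (f \<circ> chart_inv c) (at (snd c p)))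
      (at ((snd c \<circ> chart_inv ?a) ?x))"
    using chart_rep_has_derivative[OF f c] inv by simp
  from diff_chain_at[OF d1 this]
  have "(f \<circ> chart_inv ?a has_derivative
      frechet_derivative (f \<circ> chart_inv c) (at (snd c p)) \<circ> tangent_map A (snd c) p) (at ?x)"
    by (rule has_derivative_transform_within_open[OF _ open_chart_image[OF is_chart_at[of p] is_chart_open(1)[OF ic]]])
      (use c chart_at chart_inv_chart[OF is_chart_at] chart_inv_chart[OF ic] in auto)
  from tangent_map_eqI[OF this] show ?thesis by simp
qed

lemma tangent_map_chart_at: "tangent_map A (snd (chart_at A p)) p = (\<lambda>v. v)"
proof (rule tangent_map_eqI)
  show "(snd (chart_at A p) \<circ> chart_inv (chart_at A p) has_derivative (\<lambda>v. v)) (at (snd (chart_at A p) p))"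
    by (rule has_derivative_transform_within_open[OF has_derivative_ident is_chart_open(2)[OF is_chart_at]])
      (use chart_at chart_chart_inv[OF is_chart_at] in auto)
qed

lemma tangent_chart_linear:
  assumes "smooth_chart A c" "p \<in> fst c"
  shows "linear (tangent_map A (snd c) p)"
  by (rule tangent_map_linear[OF smooth_fun_chart_map[OF assms(1)]
        is_chart_open(1)[OF smooth_chart_is_chart[OF assms(1)]] assms(2)])

text \<open>The Jacobian back to the preferred chart is a left inverse, and both spaces have the
  same dimension.\<close>

lemma tangent_chart_bij:
  assumes c: "smooth_chart A c" "p \<in> fst c"
  shows "bij (tangent_map A (snd c) p)"
proof -
  let ?a = "chart_at A p"
  have "frechet_derivative (snd ?a \<circ> chart_inv c) (at (snd c p)) (tangent_map A (snd c) p v) = v" for v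
    using tangent_map_chart[OF smooth_fun_chart_map[OF chart_at(3)[of p]] is_chart_open(1)[OF is_chart_at] chart_at(2) c, of v]
    by (simp add: tangent_map_chart_at)
  then have "inj (tangent_map A (snd c) p)" by (metis injI)
  then show ?thesis
    using linear_inj_imp_surj[OF tangent_chart_linear[OF c]] by (simp add: bij_def)
qed

lemma tangent_map_const: "tangent_map A (\<lambda>q. k) p v = 0"
proof -
  have "tangent_map A (\<lambda>q. k) p = (\<lambda>v. 0)"
    by (rule tangent_map_eqI) (simp add: o_def)
  then show ?thesis by simp
qed

lemma tangent_map_add:
  assumes "smooth_fun A W f" "smooth_fun A W g" "open W" "p \<in> W"
  shows "tangent_map A (\<lambda>q. f q + g q) p v = tangent_map A f p v + tangent_map A g p v"
proof -
  have "tangent_map A (\<lambda>q. f q + g q) p = (\<lambda>v. tangent_map A f p v + tangent_map A g p v)"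
    using has_derivative_add[OF tangent_map_has_derivative[OF assms(1,3,4)] tangent_map_has_derivative[OF assms(2,3,4)]]
    by (intro tangent_map_eqI) (simp add: o_def)
  then show ?thesis by simp
qed

lemma tangent_map_mult:
  fixes f g :: "'a \<Rightarrow> real"
  assumes "smooth_fun A W f" "smooth_fun A W g" "open W" "p \<in> W"
  shows "tangent_map A (\<lambda>q. f q * g q) p v = f p * tangent_map A g p v + g p * tangent_map A f p v"
proof -
  have "tangent_map A (\<lambda>q. f q * g q) p = (\<lambda>v. f p * tangent_map A g p v + tangent_map A f p v * g p)"
    using has_derivative_mult[OF tangent_map_has_derivative[OF assms(1,3,4)] tangent_map_has_derivative[OF assms(2,3,4)]]
    by (intro tangent_map_eqI) (simp add: o_def chart_inv_chart[OF is_chart_at chart_at(2)])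
  then show ?thesis by (simp add: mult.commute)
qed

lemma tangent_map_bounded_linear_comp:
  assumes "bounded_linear L" "smooth_fun A W f" "open W" "p \<in> W"
  shows "tangent_map A (\<lambda>q. L (f q)) p v = L (tangent_map A f p v)"
proof -
  have "tangent_map A (\<lambda>q. L (f q)) p = (\<lambda>v. L (tangent_map A f p v))"
    using bounded_linear.has_derivative[OF assms(1) tangent_map_has_derivative[OF assms(2-4)]]
    by (intro tangent_map_eqI) (simp add: o_def)
  then show ?thesis by simp
qed

lemma tangent_map_sum:
  assumes "\<And>i. i \<in> I \<Longrightarrow> smooth_fun A W (f i)" "open W" "p \<in> W"
  shows "tangent_map A (\<lambda>q. \<Sum>i\<in>I. f i q) p v = (\<Sum>i\<in>I. tangent_map A (f i) p v)"
proof -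
  have "tangent_map A (\<lambda>q. \<Sum>i\<in>I. f i q) p = (\<lambda>v. \<Sum>i\<in>I. tangent_map A (f i) p v)"
    using has_derivative_sum[of I "\<lambda>i. f i \<circ> chart_inv (chart_at A p)", OF tangent_map_has_derivative[OF assms]]
    by (intro tangent_map_eqI) (simp add: o_def)
  then show ?thesis by simp
qed

lemma differential_apply:
  assumes "smooth_fun A W f" "open W" "p \<in> W"
  shows "blinfun_apply (differential A f p) v = tangent_map A f p v"
  unfolding differential_def
  by (simp add: bounded_linear_Blinfun_apply[OF tangent_map_bounded_linear[OF assms]])

lemma differential_cong:
  assumes "open W" "p \<in> W" "\<And>q. q \<in> W \<Longrightarrow> f q = g q"
  shows "differential A f p = differential A g p"
  unfolding differential_def using tangent_map_cong[OF assms] by simp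

lemma differential_const: "differential A (\<lambda>q. k) p = 0"
  by (intro blinfun_eqI) (simp add: differential_apply[OF smooth_fun_const[of UNIV]] tangent_map_const)

lemma differential_add:
  assumes "smooth_fun A W f" "smooth_fun A W g" "open W" "p \<in> W"
  shows "differential A (\<lambda>q. f q + g q) p = differential A f p + differential A g p"
  using assms
  by (intro blinfun_eqI) (simp add: differential_apply[of W] smooth_fun_add tangent_map_add[of W] blinfun.add_left)

lemma differential_mult:
  assumes "smooth_fun A W f" "smooth_fun A W g" "open W" "p \<in> W"
  shows "differential A (\<lambda>q. f q * g q) p = f p *\<^sub>R differential A g p + g p *\<^sub>R differential A f p"
  using assms
  by (intro blinfun_eqI)
    (simp add: differential_apply[of W] smooth_fun_mult tangent_map_mult[of W] blinfun.add_left blinfun.scaleR_left)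

lemma differential_sum:
  assumes "\<And>i. i \<in> I \<Longrightarrow> smooth_fun A W (f i)" "open W" "p \<in> W"
  shows "differential A (\<lambda>q. \<Sum>i\<in>I. f i q) p = (\<Sum>i\<in>I. differential A (f i) p)"
  using assms
  by (intro blinfun_eqI)
    (simp add: differential_apply[of W] smooth_fun_sum tangent_map_sum[of I W] blinfun.sum_left)

lemma smooth_fun_coordinate:
  "smooth_fun A (fst (chart_at A p)) (\<lambda>q. blinfun_apply \<xi> (snd (chart_at A p) q))"
  by (rule smooth_fun_bounded_linear[OF blinfun.bounded_linear_right smooth_fun_chart_map[OF chart_at(3)]
        is_chart_open(1)[OF is_chart_at]])

text \<open>Every covector at \<open>p\<close> is thus the differential of a smooth function, so
  identities known for brackets of functions pass to the bivector.\<close>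

lemma differential_coordinate:
  "differential A (\<lambda>q. blinfun_apply \<xi> (snd (chart_at A p) q)) p = \<xi>"
  by (intro blinfun_eqI)
    (simp add: differential_apply[OF smooth_fun_coordinate is_chart_open(1)[OF is_chart_at] chart_at(2)]
      tangent_map_bounded_linear_comp[OF blinfun.bounded_linear_right smooth_fun_chart_map[OF chart_at(3)]
        is_chart_open(1)[OF is_chart_at] chart_at(2)] tangent_map_chart_at)

text \<open>The coordinate vector field of \<open>c\<close> in direction \<open>l\<close>, written
  at each point in the preferred chart of that point.\<close>

definition coord_field :: "('a, 'e) chart \<Rightarrow> 'e \<Rightarrow> 'a \<Rightarrow> 'e" where
  "coord_field c l p = inv (tangent_map A (snd c) p) l"

lemma tangent_coord_field:
  assumes "smooth_chart A c" "p \<in> fst c"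
  shows "tangent_map A (snd c) p (coord_field c l p) = l"
  unfolding coord_field_def
  using tangent_chart_bij[OF assms] by (simp add: bij_is_surj surj_f_inv_f)

text \<open>Along this field a function is differentiated like its representation in
  \<open>c\<close> in the constant direction \<open>l\<close>.\<close>

lemma smooth_vector_field_coord:
  assumes c: "smooth_chart A c"
  shows "smooth_vector_field A (fst c) (coord_field c l)"
  unfolding smooth_vector_field_def
proof (intro allI impI, elim conjE)
  fix W and f :: "'a \<Rightarrow> real" assume W: "open W" "W \<subseteq> fst c" and f: "smooth_fun A W f"
  note ic = smooth_chart_is_chart[OF c]
  have Wc: "fst c \<inter> W = W" using W by auto
  have "smooth_on (snd c ` W) (f \<circ> chart_inv c)"
    using smooth_fun_chart[OF f W(1) c] Wc by simp
  from smooth_on_deriv[OF this, of l]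
  have sm: "smooth_on (snd c ` W) (\<lambda>x. frechet_derivative (f \<circ> chart_inv c) (at x) l)" .
  have opn: "open (snd c ` W)" using open_chart_image[OF ic W(1)] Wc by simp
  show "smooth_fun A W (\<lambda>p. blinfun_apply (differential A f p) (coord_field c l p))"
  proof (rule smooth_funI[OF _ W(1)])
    fix p assume "p \<in> W"
    have "smooth_on (snd c ` W) ((\<lambda>p. blinfun_apply (differential A f p) (coord_field c l p)) \<circ> chart_inv c)"
    proof (rule smooth_on_cong[OF sm opn])
      fix x assume "x \<in> snd c ` W"
      then obtain q where q: "q \<in> W" "x = snd c q" by auto
      then have qc: "q \<in> fst c" using W by auto
      show "frechet_derivative (f \<circ> chart_inv c) (at x) l =
          ((\<lambda>p. blinfun_apply (differential A f p) (coord_field c l p)) \<circ> chart_inv c) x"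
        using q qc chart_inv_chart[OF ic qc] tangent_map_chart[OF f W(1) q(1) c qc, of "coord_field c l q"]
        by (simp add: differential_apply[OF f W(1)] tangent_coord_field[OF c qc])
    qed
    with c W \<open>p \<in> W\<close> show "\<exists>c' U. smooth_chart A c' \<and> open U \<and> p \<in> U \<and> U \<subseteq> fst c' \<and>
        smooth_on (snd c' ` U) ((\<lambda>p. blinfun_apply (differential A f p) (coord_field c l p)) \<circ> chart_inv c')"
      by blast
  qed
qed

lemma smooth_vector_field_subset: "smooth_vector_field A V X \<Longrightarrow> U \<subseteq> V \<Longrightarrow> smooth_vector_field A U X"
  unfolding smooth_vector_field_def by blast

lemma smooth_fun_chart_component:
  assumes "smooth_chart A c" shows "smooth_fun A (fst c) (\<lambda>q. snd c q \<bullet> l)"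
  by (rule smooth_fun_bounded_linear[OF bounded_linear_inner_left smooth_fun_chart_map[OF assms]
        is_chart_open(1)[OF smooth_chart_is_chart[OF assms]]])

lemma differential_chart_component:
  assumes c: "smooth_chart A c" "p \<in> fst c"
  shows "blinfun_apply (differential A (\<lambda>q. snd c q \<bullet> l) p) v = tangent_map A (snd c) p v \<bullet> l"
  using differential_apply[OF smooth_fun_chart_component[OF c(1)] is_chart_open(1)[OF smooth_chart_is_chart[OF c(1)]] c(2)]
    tangent_map_bounded_linear_comp[OF bounded_linear_inner_left smooth_fun_chart_map[OF c(1)]
      is_chart_open(1)[OF smooth_chart_is_chart[OF c(1)]] c(2)]
  by simp

text \<open>Expansion in the coordinate differentials. For a smooth one-form the coefficients are
  smooth functions, because the coordinate fields are smooth.\<close>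

lemma covector_eq_sum:
  assumes c: "smooth_chart A c" "p \<in> fst c"
  shows "\<xi> = (\<Sum>l\<in>Basis. blinfun_apply \<xi> (coord_field c l p) *\<^sub>R differential A (\<lambda>q. snd c q \<bullet> l) p)"
proof (rule blinfun_eqI)
  fix v
  let ?t = "tangent_map A (snd c) p"
  have "?t v = ?t (\<Sum>l\<in>Basis. (?t v \<bullet> l) *\<^sub>R coord_field c l p)"
    using tangent_chart_linear[OF c]
    by (simp add: linear_sum linear_scale tangent_coord_field[OF c] euclidean_representation)
  then have "v = (\<Sum>l\<in>Basis. (?t v \<bullet> l) *\<^sub>R coord_field c l p)"
    using tangent_chart_bij[OF c] by (metis bij_is_inj injD)
  then have "blinfun_apply \<xi> v = (\<Sum>l\<in>Basis. (?t v \<bullet> l) *\<^sub>R blinfun_apply \<xi> (coord_field c l p))"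
    by (metis (no_types, lifting) blinfun.scaleR_right blinfun.sum_right sum.cong)
  then show "blinfun_apply \<xi> v =
      blinfun_apply (\<Sum>l\<in>Basis. blinfun_apply \<xi> (coord_field c l p) *\<^sub>R differential A (\<lambda>q. snd c q \<bullet> l) p) v"
    by (simp add: blinfun.sum_left blinfun.scaleR_left differential_chart_component[OF c] mult.commute)
qed

end

section \<open>Smooth maps and their differentials\<close>

locale manifold_map = M: manifold A + N: manifold A'
  for A :: "('a::{t2_space,second_countable_topology}, 'e::euclidean_space) chart set"
    and A' :: "('b::{t2_space,second_countable_topology}, 'f::euclidean_space) chart set" +
  fixes \<phi> :: "'a \<Rightarrow> 'b"
  assumes smooth: "smooth_map A A' \<phi>"
begin

lemma continuous: "continuous_on UNIV \<phi>"
  using smooth by (simp add: smooth_map_def)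

lemma open_vimage: "open W \<Longrightarrow> open (\<phi> -` W)"
  using continuous by (simp add: open_vimage)

lemma smooth_fun_compose:
  assumes f: "smooth_fun A' W f" and W: "open W"
  shows "smooth_fun A (\<phi> -` W) (f \<circ> \<phi>)"
proof (rule M.smooth_funI[OF _ open_vimage[OF W]])
  fix p assume p: "p \<in> \<phi> -` W"
  let ?c = "chart_at A p" and ?d = "chart_at A' (\<phi> p)"
  define U where "U = fst ?c \<inter> \<phi> -` (fst ?d \<inter> W)"
  have oU: "open (\<phi> -` (fst ?d \<inter> W))"
    using W is_chart_open[OF N.is_chart_at] by (intro open_vimage open_Int) auto
  then have U: "open U" unfolding U_def using is_chart_open(1)[OF M.is_chart_at] by blast
  have s1: "smooth_fun A (\<phi> -` fst ?d) (snd ?d \<circ> \<phi>)"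
    using smooth N.chart_at(1)[of "\<phi> p"] by (auto simp: smooth_map_def)
  have opn: "open (snd ?c ` U)"
    using open_chart_image[OF M.is_chart_at[of p] oU] by (simp add: U_def)
  have "smooth_on (snd ?c ` U) ((snd ?d \<circ> \<phi>) \<circ> chart_inv ?c)"
    using s1 M.chart_at(1)[of p] unfolding smooth_fun_def by (auto simp: U_def intro: smooth_on_subset)
  moreover have "smooth_on (snd ?d ` (fst ?d \<inter> W)) (f \<circ> chart_inv ?d)"
    using f N.chart_at(1) by (auto simp: smooth_fun_def)
  ultimately have "smooth_on (snd ?c ` U) ((f \<circ> chart_inv ?d) \<circ> ((snd ?d \<circ> \<phi>) \<circ> chart_inv ?c))"
    by (rule smooth_on_compose[OF _ _ _ opn])
      (use chart_inv_chart[OF M.is_chart_at] in \<open>auto simp: U_def\<close>)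
  then have "smooth_on (snd ?c ` U) ((f \<circ> \<phi>) \<circ> chart_inv ?c)"
    by (rule smooth_on_cong[OF _ opn])
      (use chart_inv_chart[OF M.is_chart_at] chart_inv_chart[OF N.is_chart_at] in \<open>auto simp: U_def\<close>)
  then show "\<exists>c U. smooth_chart A c \<and> open U \<and> p \<in> U \<and> U \<subseteq> fst c \<and> smooth_on (snd c ` U) ((f \<circ> \<phi>) \<circ> chart_inv c)"
    using U p M.chart_at N.chart_at by (intro exI[of _ ?c] exI[of _ U]) (auto simp: U_def)
qed

lemma tangent_map_compose:
  assumes f: "smooth_fun A' W f" and W: "open W" "\<phi> p \<in> W"
  shows "tangent_map A (f \<circ> \<phi>) p v = tangent_map A' f (\<phi> p) (map_differential A A' \<phi> p v)"
proof -
  let ?c = "chart_at A p" and ?d = "chart_at A' (\<phi> p)"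
  let ?x = "snd ?c p"
  have inv: "chart_inv ?c ?x = p" by (rule chart_inv_chart[OF M.is_chart_at M.chart_at(2)])
  have s1: "smooth_fun A (\<phi> -` fst ?d) (snd ?d \<circ> \<phi>)"
    using smooth N.chart_at(1)[of "\<phi> p"] by (auto simp: smooth_map_def)
  have od: "open (\<phi> -` fst ?d)" by (rule open_vimage[OF is_chart_open(1)[OF N.is_chart_at]])
  have d1: "((snd ?d \<circ> \<phi>) \<circ> chart_inv ?c has_derivative map_differential A A' \<phi> p) (at ?x)"
    unfolding map_differential_def
    by (rule M.tangent_map_has_derivative[OF s1 od]) (simp add: N.chart_at)
  have "(f \<circ> chart_inv ?d has_derivative tangent_map A' f (\<phi> p)) (at (((snd ?d \<circ> \<phi>) \<circ> chart_inv ?c) ?x))"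
    using N.tangent_map_has_derivative[OF f W] inv by simp
  from diff_chain_at[OF d1 this]
  have "((f \<circ> \<phi>) \<circ> chart_inv ?c has_derivative tangent_map A' f (\<phi> p) \<circ> map_differential A A' \<phi> p) (at ?x)"
    by (rule has_derivative_transform_within_open[OF _ open_chart_image[OF M.is_chart_at[of p] od]])
      (use M.chart_at N.chart_at chart_inv_chart[OF M.is_chart_at] chart_inv_chart[OF N.is_chart_at] in auto)
  from M.tangent_map_eqI[OF this] show ?thesis by simp
qed

lemma map_differential_bounded_linear: "bounded_linear (map_differential A A' \<phi> p)"
  unfolding map_differential_def
proof (rule M.tangent_map_bounded_linear)
  show "smooth_fun A (\<phi> -` fst (chart_at A' (\<phi> p))) (snd (chart_at A' (\<phi> p)) \<circ> \<phi>)"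
    using smooth N.chart_at(1)[of "\<phi> p"] by (auto simp: smooth_map_def)
qed (simp_all add: open_vimage is_chart_open N.is_chart_at N.chart_at)

lemma pullback_apply: "blinfun_apply (pullback A A' \<phi> p \<xi>) v = blinfun_apply \<xi> (map_differential A A' \<phi> p v)"
  unfolding pullback_def
  by (subst bounded_linear_Blinfun_apply)
    (auto intro: bounded_linear_compose[OF blinfun.bounded_linear_right map_differential_bounded_linear])

lemma pullback_differential:
  assumes "smooth_fun A' W f" "open W" "\<phi> p \<in> W"
  shows "pullback A A' \<phi> p (differential A' f (\<phi> p)) = differential A (f \<circ> \<phi>) p"
  by (rule blinfun_eqI)
    (use assms open_vimage[OF assms(2)] in \<open>simp add: pullback_apply N.differential_apply[OF assms]
      M.differential_apply[OF smooth_fun_compose[OF assms(1,2)]] tangent_map_compose[OF assms]\<close>)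

end

section \<open>Foliations\<close>

lemma span_Basis_subset: "K \<subseteq> Basis \<Longrightarrow> w \<in> span K \<longleftrightarrow> (\<forall>i\<in>Basis - K. w \<bullet> i = 0)"
  by (auto simp: span_substd_basis)

lemma mem_plaque_iff:
  assumes "K \<subseteq> Basis"
  shows "q \<in> plaque c K p \<longleftrightarrow> q \<in> fst c \<and> snd c q - snd c p \<in> span K"
  by (auto simp: plaque_def span_Basis_subset[OF assms] inner_diff_left)

lemma plaque_self: "p \<in> fst c \<Longrightarrow> p \<in> plaque c K p"
  by (simp add: plaque_def)

lemma plaque_eq: "q \<in> plaque c K p \<Longrightarrow> plaque c K q = plaque c K p"
  by (auto simp: plaque_def)

lemma plaque_sym: "q \<in> plaque c K p \<Longrightarrow> p \<in> fst c \<Longrightarrow> p \<in> plaque c K q"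
  by (auto simp: plaque_def)

text \<open>The classes of the relation are relatively open along the path, and [0,1] is connected.
  It is applied to lying in a common leaf, to being joined by chains of plaques, and to equality of
  the values of a function.\<close>

lemma local_relation_path:
  assumes g: "path g"
    and sym: "\<And>x y. R x y \<Longrightarrow> R y x" and trans: "\<And>x y z. R x y \<Longrightarrow> R y z \<Longrightarrow> R x z"
    and loc: "\<And>t. t \<in> {0..1} \<Longrightarrow> \<exists>T. openin (top_of_set {0..1}) T \<and> t \<in> T \<and> (\<forall>s\<in>T. R (g t) (g s))"
    and t: "t \<in> {0..1}"
  shows "R (pathstart g) (g t)"
proof -
  have "(\<lambda>s t. R (g s) (g t)) 0 t"
    by (rule connected_equivalence_relation[of "{0..1::real}"]) (use loc t in \<open>auto intro: sym trans\<close>)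
  then show ?thesis by (simp add: pathstart_def)
qed

lemma openin_path_vimage:
  assumes "path g" "open N"
  shows "openin (top_of_set {0..1}) ({0..1} \<inter> g -` N)"
  using assms unfolding path_def by (rule continuous_openin_preimage_gen)

context manifold
begin

text \<open>\<open>chart_inv\<close> inverts the coordinate map on the domain of the chart, so
  restricting the domain may change it as a function; on the smaller image the two agree.\<close>

lemma smooth_chart_restrict:
  assumes c: "smooth_chart A c" and U: "open U"
  shows "smooth_chart A (fst c \<inter> U, snd c)"
    "x \<in> snd c ` (fst c \<inter> U) \<Longrightarrow> chart_inv (fst c \<inter> U, snd c) x = chart_inv c x"
proof -
  note ic = smooth_chart_is_chart[OF c]
  let ?c = "(fst c \<inter> U, snd c)"
  have inj: "inj_on (snd c) (fst c)" using chart_inj[OF ic] by (meson inj_onI)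
  have inv: "chart_inv ?c x = chart_inv c x" if "x \<in> snd c ` (fst c \<inter> U)" for x
  proof -
    from that obtain p where p: "p \<in> fst c" "p \<in> U" "x = snd c p" by auto
    have "chart_inv ?c x = p" unfolding chart_inv_def
      using inv_into_f_f[of "snd c" "fst c \<inter> U" p] inj_on_subset[OF inj, of "fst c \<inter> U"] p by simp
    moreover have "chart_inv c x = p" using chart_inv_chart[OF ic p(1)] p(3) by simp
    ultimately show ?thesis by simp
  qed
  then show "x \<in> snd c ` (fst c \<inter> U) \<Longrightarrow> chart_inv ?c x = chart_inv c x" .
  have opn: "open (fst c \<inter> U)" "open (snd c ` (fst c \<inter> U))"
    using is_chart_open[OF ic] U open_chart_image[OF ic U] by auto
  have "homeomorphism (fst c \<inter> U) (snd c ` (fst c \<inter> U)) (snd c) (chart_inv c)"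
    by (rule homeomorphism_of_subsets[OF is_chart_homeomorphism[OF ic]]) auto
  then have "homeomorphism (fst c \<inter> U) (snd c ` (fst c \<inter> U)) (snd c) (chart_inv ?c)"
    by (rule homeomorphism_cong) (use inv in auto)
  then have "is_chart ?c" using opn by (simp add: is_chart_def)
  moreover have "compatible_charts ?c c'" if c': "c' \<in> A" for c'
    unfolding compatible_charts_def
  proof
    have ic': "is_chart c'" by (rule smooth_chart_is_chart[OF smooth_chart_atlas[OF c']])
    have "open (snd c ` (fst c \<inter> (U \<inter> fst c')))"
      using open_chart_image[OF ic, of "U \<inter> fst c'"] U is_chart_open[OF ic'] by auto
    then have o: "open (snd c ` (fst c \<inter> U \<inter> fst c'))" by (simp add: Int_assoc)
    have "smooth_on (snd c ` (fst c \<inter> U \<inter> fst c')) (snd c' \<circ> chart_inv c)"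
      by (rule smooth_on_subset[OF transition_smooth_atlas(1)[OF c c']]) auto
    then have "smooth_on (snd c ` (fst c \<inter> U \<inter> fst c')) (snd c' \<circ> chart_inv ?c)"
      by (rule smooth_on_cong[OF _ o]) (use inv in auto)
    then show "smooth_on (snd ?c ` (fst ?c \<inter> fst c')) (snd c' \<circ> chart_inv ?c)" by simp
    show "smooth_on (snd c' ` (fst ?c \<inter> fst c')) (snd ?c \<circ> chart_inv c')"
      unfolding fst_conv snd_conv by (rule smooth_on_subset[OF transition_smooth_atlas(2)[OF c c']]) auto
  qed
  ultimately show "smooth_chart A ?c" by (simp add: smooth_chart_def)
qed

text \<open>A straight line of the coordinate space, brought back to the manifold. It moves inside a
  plaque as long as \<open>w\<close> lies in the leaf directions and the line stays in the
  chart.\<close>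

definition chart_line :: "('a, 'e) chart \<Rightarrow> 'a \<Rightarrow> 'e \<Rightarrow> real \<Rightarrow> 'a" where
  "chart_line c p w t = chart_inv c (snd c p + t *\<^sub>R w)"

text \<open>The coordinate velocity \<open>w\<close> is constant, but the tangent vector
  \<open>v\<close> that represents it changes with \<open>t\<close>, since each point has its own
  preferred chart.\<close>

lemma chart_line_derivative:
  assumes c: "smooth_chart A c" and f: "smooth_fun A W f" "open W"
    and q: "snd c p + t *\<^sub>R w \<in> snd c ` (fst c \<inter> W)"
    and v: "tangent_map A (snd c) (chart_line c p w t) v = w"
  shows "((\<lambda>t. f (chart_line c p w t)) has_derivative (\<lambda>h. h *\<^sub>R tangent_map A f (chart_line c p w t) v)) (at t within S)"
proof -
  note ic = smooth_chart_is_chart[OF c]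
  let ?x = "snd c p + t *\<^sub>R w" and ?q = "chart_line c p w t"
  obtain q where q': "q \<in> fst c" "q \<in> W" "snd c q = ?x" using q by force
  then have qq: "?q = q" "?q \<in> fst c" "?q \<in> W" "snd c ?q = ?x"
    using chart_inv_chart[OF ic q'(1)] by (auto simp: chart_line_def)
  have "((\<lambda>t. snd c p + t *\<^sub>R w) has_derivative (\<lambda>h. 0 + h *\<^sub>R w)) (at t within S)"
    by (intro has_derivative_add has_derivative_const has_derivative_scaleR_left has_derivative_ident)
  moreover have "(f \<circ> chart_inv c has_derivative frechet_derivative (f \<circ> chart_inv c) (at ?x)) (at ?x)"
    using chart_rep_has_derivative[OF f qq(3) c qq(2)] qq(4) by simp
  ultimately have "((\<lambda>t. (f \<circ> chart_inv c) (snd c p + t *\<^sub>R w)) has_derivative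
      (\<lambda>h. frechet_derivative (f \<circ> chart_inv c) (at ?x) (0 + h *\<^sub>R w))) (at t within S)"
    by (rule has_derivative_compose)
  moreover have "frechet_derivative (f \<circ> chart_inv c) (at ?x) (0 + h *\<^sub>R w) = h *\<^sub>R tangent_map A f ?q v" for h
    using tangent_map_chart[OF f qq(3) c qq(2), of v] v qq(4)
      linear_scale[OF has_derivative_linear[OF chart_rep_has_derivative[OF f qq(3) c qq(2)]], of h w] by simp
  ultimately show ?thesis by (simp add: chart_line_def o_def)
qed

lemma chart_line_constant:
  assumes c: "smooth_chart A c" and f: "smooth_fun A W f" "open W"
    and seg: "\<And>t. t \<in> {0..1} \<Longrightarrow> snd c p + t *\<^sub>R w \<in> snd c ` (fst c \<inter> W)"
    and zero: "\<And>t v. t \<in> {0..1} \<Longrightarrow> tangent_map A (snd c) (chart_line c p w t) v = w \<Longrightarrow>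
        tangent_map A f (chart_line c p w t) v = 0"
  shows "f (chart_line c p w 1) = f (chart_line c p w 0)"
proof (rule has_derivative_zero_unique[of "{0..1::real}"])
  fix t :: real assume t: "t \<in> {0..1}"
  have "chart_line c p w t \<in> fst c"
    using seg[OF t] chart_inv_in[OF smooth_chart_is_chart[OF c]] by (auto simp: chart_line_def)
  then obtain v where v: "tangent_map A (snd c) (chart_line c p w t) v = w"
    using tangent_chart_bij[OF c] by (metis bij_is_surj surjD)
  show "((\<lambda>t. f (chart_line c p w t)) has_derivative (\<lambda>h. 0)) (at t within {0..1})"
    using chart_line_derivative[OF c f seg[OF t] v, of "{0..1}"] zero[OF t v] by simp
qed auto

lemma chart_line_end:
  assumes "is_chart c" "p \<in> fst c" "q \<in> fst c"
  shows "chart_line c p (snd c q - snd c p) 0 = p" "chart_line c p (snd c q - snd c p) 1 = q"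
  using assms by (simp_all add: chart_line_def chart_inv_chart)

text \<open>The chart straightens a distribution instead of a set of leaves, so it can be used
  before leaves exist.\<close>

definition adapted_chart :: "'a set \<Rightarrow> ('a \<Rightarrow> 'e set) \<Rightarrow> ('a, 'e) chart \<Rightarrow> 'e set \<Rightarrow> bool" where
  "adapted_chart V D c K \<longleftrightarrow> smooth_chart A c \<and> fst c \<subseteq> V \<and> K \<subseteq> Basis \<and>
     (\<forall>q\<in>fst c. D q = {v. tangent_map A (snd c) q v \<in> span K})"

text \<open>On the preimage of a coordinate ball the segment between two points of a plaque stays in
  both charts. Its velocity lies in \<open>D\<close>, so the transversal coordinates of
  \<open>c'\<close> are constant along it.\<close>

lemma local_plaque_inclusion:
  assumes c: "adapted_chart V D c K" and c': "adapted_chart V D c' K'" and p: "p \<in> fst c" "p \<in> fst c'"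
  obtains N where "open N" "p \<in> N" "N \<subseteq> fst c \<inter> fst c'"
    "\<And>x y. x \<in> N \<Longrightarrow> y \<in> N \<Longrightarrow> y \<in> plaque c K x \<Longrightarrow> y \<in> plaque c' K' x"
proof -
  have sc: "smooth_chart A c" "smooth_chart A c'" and K: "K \<subseteq> Basis" "K' \<subseteq> Basis"
    and D: "\<And>q. q \<in> fst c \<Longrightarrow> D q = {v. tangent_map A (snd c) q v \<in> span K}"
      "\<And>q. q \<in> fst c' \<Longrightarrow> D q = {v. tangent_map A (snd c') q v \<in> span K'}"
    using c c' by (auto simp: adapted_chart_def)
  note ic = smooth_chart_is_chart[OF sc(1)] and ic' = smooth_chart_is_chart[OF sc(2)]
  have "open (snd c ` (fst c \<inter> fst c'))" by (rule open_chart_image[OF ic is_chart_open(1)[OF ic']])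
  moreover have "snd c p \<in> snd c ` (fst c \<inter> fst c')" using p by auto
  ultimately obtain \<epsilon> where \<epsilon>: "\<epsilon> > 0" "ball (snd c p) \<epsilon> \<subseteq> snd c ` (fst c \<inter> fst c')"
    using open_contains_ball by meson
  define N where "N = fst c \<inter> snd c -` ball (snd c p) \<epsilon>"
  have "open N" unfolding N_def
    using is_chart_homeomorphism[OF ic] is_chart_open[OF ic]
    by (intro continuous_open_preimage) (auto simp: homeomorphism_def)
  moreover have "p \<in> N" using p \<epsilon> by (simp add: N_def)
  moreover have "N \<subseteq> fst c \<inter> fst c'"
  proof
    fix q assume q: "q \<in> N"
    then obtain q' where "q' \<in> fst c \<inter> fst c'" "snd c q = snd c q'" using \<epsilon>(2) by (auto simp: N_def)
    then show "q \<in> fst c \<inter> fst c'" using q chart_inj[OF ic, of q q'] by (auto simp: N_def)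
  qed
  moreover have "y \<in> plaque c' K' x" if x: "x \<in> N" and y: "y \<in> N" and pl: "y \<in> plaque c K x" for x y
  proof -
    define w where "w = snd c y - snd c x"
    have w: "w \<in> span K" using pl by (simp add: mem_plaque_iff[OF K(1)] w_def)
    have seg: "snd c x + t *\<^sub>R w \<in> snd c ` (fst c \<inter> fst c')" if t: "t \<in> {0..1}" for t
    proof -
      have "snd c x \<in> ball (snd c p) \<epsilon>" "snd c y \<in> ball (snd c p) \<epsilon>" using x y by (auto simp: N_def)
      then have "closed_segment (snd c x) (snd c y) \<subseteq> ball (snd c p) \<epsilon>"
        by (simp add: closed_segment_subset)
      moreover have "snd c x + t *\<^sub>R w \<in> closed_segment (snd c x) (snd c y)"
        using t by (auto simp: in_segment w_def algebra_simps intro!: exI[of _ t])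
      ultimately show ?thesis using \<epsilon> by blast
    qed
    have xy: "x \<in> fst c" "y \<in> fst c" using x y by (auto simp: N_def)
    have "snd c' y \<bullet> i = snd c' x \<bullet> i" if i: "i \<in> Basis - K'" for i
    proof -
      have "snd c' (chart_line c x w 1) \<bullet> i = snd c' (chart_line c x w 0) \<bullet> i"
      proof (rule chart_line_constant[OF sc(1) smooth_fun_chart_component[OF sc(2), of i] is_chart_open(1)[OF ic'] seg])
        fix t :: real and v assume t: "t \<in> {0..1}"
        let ?q = "chart_line c x w t"
        assume v: "tangent_map A (snd c) ?q v = w"
        have q: "?q \<in> fst c" "?q \<in> fst c'"
          using seg[OF t] chart_inv_chart[OF ic] by (auto simp: chart_line_def)
        then have "v \<in> D ?q" using D(1) w v by auto
        then have "tangent_map A (snd c') ?q v \<in> span K'" using D(2) q by auto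
        then show "tangent_map A (\<lambda>q. snd c' q \<bullet> i) ?q v = 0"
          using i differential_chart_component[OF sc(2) q(2), of i v]
            differential_apply[OF smooth_fun_chart_component[OF sc(2)] is_chart_open(1)[OF ic'] q(2), of i v]
          by (simp add: span_Basis_subset[OF K(2)])
      qed
      then show ?thesis using chart_line_end[OF ic xy] by (simp add: w_def)
    qed
    moreover have "y \<in> fst c'" using \<open>N \<subseteq> fst c \<inter> fst c'\<close> y by auto
    ultimately show ?thesis by (simp add: plaque_def)
  qed
  ultimately show thesis by (rule that)
qed

lemma adapted_chart_restrict_box:
  assumes c: "adapted_chart V D c K" and p: "p \<in> fst c"
  obtains c' a b where "adapted_chart V D c' K" "p \<in> fst c'" "snd c' ` fst c' = box a b"
proof -
  have sc: "smooth_chart A c" using c by (simp add: adapted_chart_def)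
  note ic = smooth_chart_is_chart[OF sc]
  obtain a b where ab: "snd c p \<in> box a b" "box a b \<subseteq> snd c ` fst c"
    by (rule open_contains_box[OF is_chart_open(2)[OF ic] imageI[OF p]]) (rule that)
  define U where "U = fst c \<inter> snd c -` box a b"
  have U: "open U" unfolding U_def
    using is_chart_homeomorphism[OF ic] is_chart_open[OF ic]
    by (intro continuous_open_preimage) (auto simp: homeomorphism_def)
  have "adapted_chart V D (fst c \<inter> U, snd c) K"
    using c smooth_chart_restrict(1)[OF sc U] by (auto simp: adapted_chart_def)
  moreover have "p \<in> fst (fst c \<inter> U, snd c)" using p ab by (simp add: U_def)
  moreover have "snd (fst c \<inter> U, snd c) ` fst (fst c \<inter> U, snd c) = box a b"
    using ab by (auto simp: U_def)
  ultimately show thesis by (rule that)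
qed

text \<open>The definition of \<open>foliation_tangent\<close> collects vectors from all foliated
  charts. A coordinate line in a plaque of another chart stays in the leaf and, being connected, in
  one plaque of \<open>c\<close>; so the transversal coordinates of \<open>c\<close> have derivative
  zero along it.\<close>

lemma foliation_tangent_foliated_chart:
  assumes c: "foliated_chart A k F c K" and p: "p \<in> fst c"
  shows "foliation_tangent A k F p = {v. tangent_map A (snd c) p v \<in> span K}"
proof
  show "{v. tangent_map A (snd c) p v \<in> span K} \<subseteq> foliation_tangent A k F p"
    using c p unfolding foliation_tangent_def by blast
  show "foliation_tangent A k F p \<subseteq> {v. tangent_map A (snd c) p v \<in> span K}"
  proof
    fix v assume "v \<in> foliation_tangent A k F p"
    then obtain c' K' where p': "p \<in> fst c'" and c': "foliated_chart A k F c' K'"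
      and v: "tangent_map A (snd c') p v \<in> span K'" unfolding foliation_tangent_def by blast
    have sc: "smooth_chart A c" "smooth_chart A c'" and K: "K \<subseteq> Basis" "K' \<subseteq> Basis"
      using c c' by (auto simp: foliated_chart_def)
    note ic = smooth_chart_is_chart[OF sc(1)] and ic' = smooth_chart_is_chart[OF sc(2)]
    obtain L where L: "L \<in> F" "p \<in> L" using c p by (auto simp: foliated_chart_def)
    have plc: "path_component_set (L \<inter> fst c) p = plaque c K p"
      and plc': "path_component_set (L \<inter> fst c') p = plaque c' K' p"
      using c c' L p p' by (auto simp: foliated_chart_def)
    define w where "w = tangent_map A (snd c') p v"
    have "open (snd c' ` (fst c' \<inter> fst c))" by (rule open_chart_image[OF ic' is_chart_open(1)[OF ic]])
    moreover have "snd c' p \<in> snd c' ` (fst c' \<inter> fst c)" using p p' by auto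
    ultimately obtain \<epsilon> where \<epsilon>: "\<epsilon> > 0" "cball (snd c' p) \<epsilon> \<subseteq> snd c' ` (fst c' \<inter> fst c)"
      using open_contains_cball by meson
    \<comment> \<open>The line stays in the overlap for |t| \<le> \<eta>; the added 1 covers w =
      0.\<close>
    define \<eta> where "\<eta> = \<epsilon> / (norm w + 1)"
    have \<eta>: "\<eta> > 0" using \<epsilon> by (simp add: \<eta>_def add_nonneg_pos)
    have in_ball: "snd c' p + t *\<^sub>R w \<in> snd c' ` (fst c' \<inter> fst c)" if "\<bar>t\<bar> \<le> \<eta>" for t
    proof -
      have "\<bar>t\<bar> * norm w \<le> \<eta> * norm w" using that by (rule mult_right_mono) simp
      also have "\<dots> \<le> \<eta> * (norm w + 1)" using \<eta> by simp
      also have "\<dots> = \<epsilon>" using add_nonneg_pos[of "norm w" 1] by (simp add: \<eta>_def)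
      finally show ?thesis using \<epsilon>(2) by (auto simp: dist_norm)
    qed
    let ?\<gamma> = "chart_line c' p w"
    have line: "?\<gamma> t \<in> fst c' \<inter> fst c" "snd c' (?\<gamma> t) = snd c' p + t *\<^sub>R w" if "\<bar>t\<bar> \<le> \<eta>" for t
      using in_ball[OF that] chart_inv_chart[OF ic'] by (auto simp: chart_line_def)
    have \<gamma>0: "?\<gamma> 0 = p" using chart_inv_chart[OF ic' p'] by (simp add: chart_line_def)
    have L\<gamma>: "?\<gamma> t \<in> L" if t: "\<bar>t\<bar> \<le> \<eta>" for t
    proof -
      have "?\<gamma> t \<in> plaque c' K' p"
        using line[OF t] v by (auto simp: mem_plaque_iff[OF K(2)] w_def intro: span_scale)
      then show ?thesis using path_component_subset[of "L \<inter> fst c'" p] plc' by auto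
    qed
    have cont: "continuous_on {-\<eta>..\<eta>} ?\<gamma>"
      unfolding chart_line_def
    proof (rule continuous_on_compose2[of "snd c' ` fst c'" "chart_inv c'"])
      show "continuous_on (snd c' ` fst c') (chart_inv c')"
        using is_chart_homeomorphism[OF ic'] by (simp add: homeomorphism_def)
      show "continuous_on {-\<eta>..\<eta>} (\<lambda>t. snd c' p + t *\<^sub>R w)" by (intro continuous_intros)
      show "(\<lambda>t. snd c' p + t *\<^sub>R w) ` {-\<eta>..\<eta>} \<subseteq> snd c' ` fst c'"
      proof (rule image_subsetI)
        fix t assume "t \<in> {-\<eta>..\<eta>}"
        then have "\<bar>t\<bar> \<le> \<eta>" by auto
        from in_ball[OF this] show "snd c' p + t *\<^sub>R w \<in> snd c' ` fst c'" by blast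
      qed
    qed
    have pl: "?\<gamma> t \<in> plaque c K p" if t: "\<bar>t\<bar> \<le> \<eta>" for t
    proof -
      have "path_connected (?\<gamma> ` {-\<eta>..\<eta>})"
        by (rule path_connected_continuous_image[OF cont]) (simp add: convex_imp_path_connected)
      moreover have "?\<gamma> ` {-\<eta>..\<eta>} \<subseteq> L \<inter> fst c" using line L\<gamma> by force
      moreover have "p \<in> ?\<gamma> ` {-\<eta>..\<eta>}" using \<gamma>0 \<eta> by (auto intro!: image_eqI[of _ _ 0])
      ultimately have "?\<gamma> ` {-\<eta>..\<eta>} \<subseteq> path_component_set (L \<inter> fst c) p"
        by (intro path_component_maximal) auto
      moreover have "?\<gamma> t \<in> ?\<gamma> ` {-\<eta>..\<eta>}" using t by (intro imageI) auto
      ultimately show ?thesis using plc by blast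
    qed
    have "tangent_map A (snd c) p v \<bullet> i = 0" if i: "i \<in> Basis - K" for i
    proof -
      let ?f = "\<lambda>q. snd c q \<bullet> i"
      have "((\<lambda>t. ?f (?\<gamma> t)) has_derivative (\<lambda>h. h *\<^sub>R tangent_map A ?f (?\<gamma> 0) v)) (at 0)"
      proof (rule chart_line_derivative[OF sc(2) smooth_fun_chart_component[OF sc(1)] is_chart_open(1)[OF ic]])
        show "snd c' p + 0 *\<^sub>R w \<in> snd c' ` (fst c' \<inter> fst c)" using p p' by auto
        show "tangent_map A (snd c') (?\<gamma> 0) v = w" unfolding \<gamma>0 by (simp add: w_def)
      qed
      moreover have "((\<lambda>t. ?f (?\<gamma> t)) has_derivative (\<lambda>h. 0)) (at 0)"
        by (rule has_derivative_transform_within_open[of "\<lambda>t. ?f p" _ 0 UNIV "{-\<eta><..<\<eta>}"])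
          (use \<eta> pl i in \<open>auto simp: plaque_def\<close>)
      ultimately have "(\<lambda>h::real. h *\<^sub>R tangent_map A ?f p v) = (\<lambda>h. 0)"
        using has_derivative_unique \<gamma>0 by metis
      from fun_cong[OF this, of 1] have "tangent_map A ?f p v = 0" by simp
      then show ?thesis
        using differential_chart_component[OF sc(1) p, of i v]
          differential_apply[OF smooth_fun_chart_component[OF sc(1)] is_chart_open(1)[OF ic] p, of i v] by simp
    qed
    then show "v \<in> {v. tangent_map A (snd c) p v \<in> span K}" by (simp add: span_Basis_subset[OF K(1)])
  qed
qed

section \<open>Tangent spaces determine the leaves\<close>

lemma foliated_chart_adapted:
  assumes F: "foliation A V k F" and c: "foliated_chart A k F c K"
  shows "adapted_chart V (foliation_tangent A k F) c K"
  using foliation_tangent_foliated_chart[OF c] c F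
  by (auto simp: adapted_chart_def foliated_chart_def foliation_def partition_on_def)

text \<open>An interval around \<open>t\<close> is mapped into \<open>N\<close>. Its image is a path
  connected part of the leaf, hence lies in a path component of its trace on the chart, which is a
  plaque.\<close>

lemma path_plaque_local:
  assumes c: "foliated_chart A k F c K" and L: "L \<in> F" and g: "path g" "path_image g \<subseteq> L"
    and t: "t \<in> {0..1}" and N: "open N" "N \<subseteq> fst c" "g t \<in> N"
  obtains T where "openin (top_of_set {0..1}) T" "t \<in> T" "g ` T \<subseteq> N \<inter> plaque c K (g t)"
proof -
  have op: "openin (top_of_set {0..1}) ({0..1} \<inter> g -` N)"
    by (rule openin_path_vimage[OF g(1) N(1)])
  have mem: "t \<in> {0..1} \<inter> g -` N" using t N by simp
  from conjunct2[OF op[unfolded openin_contains_ball], THEN bspec, OF mem]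
  obtain e where e: "e > 0" "ball t e \<inter> {0..1} \<subseteq> {0..1} \<inter> g -` N" by (elim exE conjE)
  let ?T = "{0..1} \<inter> ball t e"
  have gL: "g s \<in> L" if "s \<in> {0..1}" for s using g(2) that by (auto simp: path_image_def)
  have "continuous_on ?T g"
    by (rule continuous_on_subset[OF g(1)[unfolded path_def]]) auto
  moreover have "path_connected ?T"
    by (rule convex_imp_path_connected) (auto intro!: convex_Int)
  ultimately have pc: "path_connected (g ` ?T)" by (rule path_connected_continuous_image)
  have gN: "g ` ?T \<subseteq> N" using e(2) by blast
  have tT: "t \<in> ?T" using t e by simp
  have "g ` ?T \<subseteq> L \<inter> fst c" using gN N(2) gL by auto
  then have "g ` ?T \<subseteq> path_component_set (L \<inter> fst c) (g t)"
    using pc tT by (intro path_component_maximal) auto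
  also have "\<dots> = plaque c K (g t)"
    using c L gL[OF t] N unfolding foliated_chart_def by blast
  finally show thesis
    using gN tT by (intro that[of ?T]) (auto simp: openin_open_Int)
qed

text \<open>A path in a leaf of \<open>F\<close> moves locally inside plaques of \<open>F\<close>.
  These are locally contained in plaques of \<open>F'\<close> because the tangent spaces agree, so
  the path cannot change the leaf of \<open>F'\<close>.\<close>

lemma foliation_leaf_subset:
  assumes F: "foliation A V k F" and F': "foliation A V k' F'"
    and D: "\<And>p. p \<in> V \<Longrightarrow> foliation_tangent A k F p = foliation_tangent A k' F' p"
    and L: "L \<in> F" "L' \<in> F'" "x \<in> L" "x \<in> L'"
  shows "L \<subseteq> L'"
proof
  fix y assume y: "y \<in> L"
  have FV: "\<Union>F = V" "\<Union>F' = V" "disjoint F'" using F F' by (auto simp: foliation_def partition_on_def)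
  have "path_connected L" using F L by (simp add: foliation_def)
  then obtain g where g: "path g" "path_image g \<subseteq> L" "pathstart g = x" "pathfinish g = y"
    using L y unfolding path_connected_def by blast
  let ?R = "\<lambda>x y. \<exists>L\<in>F'. x \<in> L \<and> y \<in> L"
  have "?R (pathstart g) (g 1)"
  proof (rule local_relation_path[OF g(1)])
    fix t :: real assume t: "t \<in> {0..1}"
    have gL: "g s \<in> L" if "s \<in> {0..1}" for s using g(2) that by (auto simp: path_image_def)
    have gV: "g t \<in> V" using gL[OF t] FV L by blast
    then obtain L'' where L'': "L'' \<in> F'" "g t \<in> L''" using FV by blast
    obtain c K where c: "g t \<in> fst c" "foliated_chart A k F c K" using F gV unfolding foliation_def by blast
    obtain c' K' where c': "g t \<in> fst c'" "foliated_chart A k' F' c' K'" using F' gV unfolding foliation_def by blast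
    have a: "adapted_chart V (foliation_tangent A k F) c K" by (rule foliated_chart_adapted[OF F c(2)])
    have a': "adapted_chart V (foliation_tangent A k F) c' K'"
      using foliated_chart_adapted[OF F' c'(2)] D by (auto simp: adapted_chart_def)
    obtain N where N: "open N" "g t \<in> N" "N \<subseteq> fst c \<inter> fst c'"
      and pl: "\<And>x y. x \<in> N \<Longrightarrow> y \<in> N \<Longrightarrow> y \<in> plaque c K x \<Longrightarrow> y \<in> plaque c' K' x"
      using local_plaque_inclusion[OF a a' c(1) c'(1)] by metis
    obtain T where T: "openin (top_of_set {0..1}) T" "t \<in> T" "g ` T \<subseteq> N \<inter> plaque c K (g t)"
      by (rule path_plaque_local[OF c(2) L(1) g(1,2) t N(1) _ N(2)]) (use N(3) in blast)
    show "\<exists>T. openin (top_of_set {0..1}) T \<and> t \<in> T \<and> (\<forall>s\<in>T. ?R (g t) (g s))"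
    proof (intro exI conjI ballI)
      show "openin (top_of_set {0..1}) T" "t \<in> T" by (fact T)+
      fix s assume "s \<in> T"
      then have gs: "g s \<in> N" "g s \<in> plaque c K (g t)" using T(3) by blast+
      then have "g s \<in> plaque c' K' (g t)" using pl[OF N(2)] by blast
      also have "plaque c' K' (g t) = path_component_set (L'' \<inter> fst c') (g t)"
        using c' L'' by (auto simp: foliated_chart_def)
      also have "\<dots> \<subseteq> L''" using path_component_subset by blast
      finally show "?R (g t) (g s)" using L'' by blast
    qed
  next
    show "?R a b \<Longrightarrow> ?R b c \<Longrightarrow> ?R a c" for a b c
      using FV(3) by (metis disjointD disjoint_iff)
  qed auto
  then obtain L'' where "L'' \<in> F'" "x \<in> L''" "y \<in> L''" using g by (auto simp: pathfinish_def)
  then show "y \<in> L'" using FV(3) L by (metis disjointD disjoint_iff)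
qed

lemma foliation_unique:
  assumes F: "foliation A V k F" and F': "foliation A V k' F'"
    and D: "\<And>p. p \<in> V \<Longrightarrow> foliation_tangent A k F p = foliation_tangent A k' F' p"
  shows "F = F'"
proof -
  have *: "F1 \<subseteq> F2" if F1: "foliation A V k1 F1" and F2: "foliation A V k2 F2"
    and D: "\<And>p. p \<in> V \<Longrightarrow> foliation_tangent A k1 F1 p = foliation_tangent A k2 F2 p" for k1 k2 F1 F2
  proof
    fix L assume L: "L \<in> F1"
    have P: "\<Union>F1 = V" "{} \<notin> F1" "\<Union>F2 = V" using F1 F2 by (auto simp: foliation_def partition_on_def)
    then obtain x where x: "x \<in> L" using L by (metis ex_in_conv)
    then obtain L' where L': "L' \<in> F2" "x \<in> L'" using L P by blast
    have "L \<subseteq> L'" by (rule foliation_leaf_subset[OF F1 F2 D L L'(1) x L'(2)])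
    moreover have "L' \<subseteq> L" by (rule foliation_leaf_subset[OF F2 F1 D[symmetric] L'(1) L L'(2) x])
    ultimately show "L \<in> F2" using L' by simp
  qed
  show ?thesis using *[OF F F' D] *[OF F' F D[symmetric]] by blast
qed

end

section \<open>Leaves of an integrable distribution\<close>

context manifold
begin

text \<open>Leaves are countable unions of plaques, hence thin, hence their paths inside a chart stay in a plaque.\<close>

definition thin :: "'a set \<Rightarrow> ('a \<Rightarrow> 'e set) \<Rightarrow> 'a set \<Rightarrow> bool" where
  "thin V D X \<longleftrightarrow> (\<forall>c K. adapted_chart V D c K \<longrightarrow> countable ((\<lambda>y. plaque c K y) ` (X \<inter> fst c)))"

lemma thin_singleton: "thin V D {x}"
  unfolding thin_def by (auto intro: countable_subset[of _ "{plaque _ _ x}"])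

lemma thin_Union:
  assumes "countable I" "\<And>i. i \<in> I \<Longrightarrow> thin V D (X i)"
  shows "thin V D (\<Union>i\<in>I. X i)"
  unfolding thin_def
proof (intro allI impI)
  fix c K assume c: "adapted_chart V D c K"
  have "(\<lambda>y. plaque c K y) ` ((\<Union>i\<in>I. X i) \<inter> fst c) = (\<Union>i\<in>I. (\<lambda>y. plaque c K y) ` (X i \<inter> fst c))"
    by blast
  moreover have "countable (\<Union>i\<in>I. (\<lambda>y. plaque c K y) ` (X i \<inter> fst c))"
    using assms c unfolding thin_def by (intro countable_UN) blast+
  ultimately show "countable ((\<lambda>y. plaque c K y) ` ((\<Union>i\<in>I. X i) \<inter> fst c))"
    by simp
qed

text \<open>Near each of its points in another chart the plaque is contained in one plaque of that
  chart. A small basic open set around the point therefore determines that plaque, and second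
  countability gives the count.\<close>

lemma thin_plaque:
  assumes c: "adapted_chart V D c K" and x: "x \<in> fst c"
  shows "thin V D (plaque c K x)"
  unfolding thin_def
proof (intro allI impI)
  fix c' K' assume c': "adapted_chart V D c' K'"
  obtain \<B> :: "'a set set" where \<B>: "countable \<B>" "topological_basis \<B>"
    using ex_countable_basis by blast
  \<comment> \<open>The witness is chosen from the basic open set and the given plaque alone, so
    \<open>g\<close> takes countably many values on the basis.\<close>
  define g where "g = (\<lambda>O'. plaque c' K' (SOME z. z \<in> O' \<inter> plaque c K x \<inter> fst c'))"
  have "(\<lambda>y. plaque c' K' y) ` (plaque c K x \<inter> fst c') \<subseteq> g ` \<B>"
  proof
    fix P assume "P \<in> (\<lambda>y. plaque c' K' y) ` (plaque c K x \<inter> fst c')"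
    then obtain y where y: "y \<in> plaque c K x" "y \<in> fst c'" "P = plaque c' K' y" by blast
    then have yc: "y \<in> fst c" by (simp add: plaque_def)
    obtain N where N: "open N" "y \<in> N" and pl: "\<And>x z. x \<in> N \<Longrightarrow> z \<in> N \<Longrightarrow> z \<in> plaque c K x \<Longrightarrow> z \<in> plaque c' K' x"
      using local_plaque_inclusion[OF c c' yc y(2)] by metis
    obtain O' where O': "O' \<in> \<B>" "y \<in> O'" "O' \<subseteq> N"
      using topological_basisE[OF \<B>(2) N] by blast
    define z where "z = (SOME z. z \<in> O' \<inter> plaque c K x \<inter> fst c')"
    have "z \<in> O' \<inter> plaque c K x \<inter> fst c'"
      unfolding z_def by (rule someI[of _ y]) (use y O' in blast)
    then have z: "z \<in> N" "z \<in> plaque c K y"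
      using O' plaque_eq[OF y(1)] by auto
    have "z \<in> plaque c' K' y" by (rule pl[OF N(2) z])
    moreover have "g O' = plaque c' K' z" by (simp only: g_def z_def)
    ultimately have "g O' = P" using plaque_eq[of z c' K' y] y(3) by simp
    then show "P \<in> g ` \<B>" using O' by blast
  qed
  then show "countable ((\<lambda>y. plaque c' K' y) ` (plaque c K x \<inter> fst c'))"
    by (rule countable_subset) (use \<B> in simp)
qed

text \<open>The image of the chart is a box, hence convex, so the coordinate segment between two
  points of a plaque is available.\<close>

lemma plaque_segment:
  assumes c: "adapted_chart V D c K" and box: "snd c ` fst c = box a b" and x: "x \<in> fst c" and y: "y \<in> plaque c K x"
  obtains g where "path g" "pathstart g = x" "pathfinish g = y" "path_image g \<subseteq> plaque c K x"
proof -
  have sc: "smooth_chart A c" and K: "K \<subseteq> Basis" using c by (auto simp: adapted_chart_def)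
  note ic = smooth_chart_is_chart[OF sc]
  define w where "w = snd c y - snd c x"
  have yc: "y \<in> fst c" and w: "w \<in> span K" using y by (auto simp: mem_plaque_iff[OF K] w_def)
  have seg: "snd c x + t *\<^sub>R w \<in> snd c ` fst c" if "t \<in> {0..1}" for t
  proof -
    have "closed_segment (snd c x) (snd c y) \<subseteq> box a b"
      using x yc box by (intro closed_segment_subset convex_box) auto
    moreover have "snd c x + t *\<^sub>R w \<in> closed_segment (snd c x) (snd c y)"
      using that by (auto simp: in_segment w_def algebra_simps intro!: exI[of _ t])
    ultimately show ?thesis using box by blast
  qed
  let ?g = "chart_line c x w"
  have "continuous_on {0..1} ?g"
    unfolding chart_line_def
    by (rule continuous_on_compose2[of "snd c ` fst c" "chart_inv c"])
      (use is_chart_homeomorphism[OF ic] seg in \<open>auto simp: homeomorphism_def intro!: continuous_intros\<close>)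
  then have "path ?g" by (simp add: path_def)
  moreover have "pathstart ?g = x" "pathfinish ?g = y"
    using chart_line_end[OF ic x yc] by (simp_all add: pathstart_def pathfinish_def w_def)
  moreover have "?g t \<in> plaque c K x" if "t \<in> {0..1}" for t
    using seg[OF that] chart_chart_inv[OF ic] chart_inv_in[OF ic] w
    by (auto simp: mem_plaque_iff[OF K] chart_line_def intro: span_scale)
  then have "path_image ?g \<subseteq> plaque c K x" by (auto simp: path_image_def)
  ultimately show thesis by (rule that)
qed

text \<open>Leaves are the classes of the relation generated by the plaques of countably many box
  charts that cover \<open>V\<close>. Countability of the family makes a leaf a countable union of
  plaques together with its base point, while \<open>plR\<close> puts the plaques of every other
  adapted box chart into single classes as well.\<close>

theorem foliation_exists:
  assumes V: "open V" and D: "integrable_distribution A V r D"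
  obtains T where "foliation A V r T" "\<And>p. p \<in> V \<Longrightarrow> foliation_tangent A r T p = D p"
proof -
  define good where "good = (\<lambda>(c, K). adapted_chart V D c K \<and> card K = r \<and> (\<exists>a b. snd c ` fst c = box a b))"
  have ex: "\<exists>Q. good Q \<and> p \<in> fst (fst Q)" if p: "p \<in> V" for p
  proof -
    obtain c K where c: "smooth_chart A c" "p \<in> fst c" "fst c \<subseteq> V" "K \<subseteq> Basis" "card K = r"
        "\<forall>q\<in>fst c. D q = {v. tangent_map A (snd c) q v \<in> span K}"
      using D p unfolding integrable_distribution_def by blast
    then have "adapted_chart V D c K" by (simp add: adapted_chart_def)
    from adapted_chart_restrict_box[OF this c(2)]
    obtain c' a b where "adapted_chart V D c' K" "p \<in> fst c'" "snd c' ` fst c' = box a b" by blast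
    with c(5) show ?thesis by (intro exI[of _ "(c', K)"]) (auto simp: good_def)
  qed
  have opn: "open (fst (fst Q))" if "good Q" for Q
    using that is_chart_open(1)[OF smooth_chart_is_chart] by (auto simp: good_def adapted_chart_def)
  obtain \<C> where \<C>: "countable \<C>" "\<And>Q. Q \<in> \<C> \<Longrightarrow> good Q" "\<And>p. p \<in> V \<Longrightarrow> \<exists>Q\<in>\<C>. p \<in> fst (fst Q)"
  proof -
    have "open S" if "S \<in> (\<lambda>Q. fst (fst Q)) ` Collect good" for S
      using that opn by blast
    then obtain \<F>' where F: "\<F>' \<subseteq> (\<lambda>Q. fst (fst Q)) ` Collect good" "countable \<F>'"
        "\<Union>\<F>' = \<Union>((\<lambda>Q. fst (fst Q)) ` Collect good)"
      by (rule Lindelof)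
    then have "\<forall>S\<in>\<F>'. \<exists>Q. good Q \<and> S = fst (fst Q)" by blast
    then obtain q where q: "\<And>S. S \<in> \<F>' \<Longrightarrow> good (q S) \<and> S = fst (fst (q S))" by metis
    show thesis
    proof (rule that[of "q ` \<F>'"])
      show "countable (q ` \<F>')" using F by simp
      show "good Q" if "Q \<in> q ` \<F>'" for Q using that q by blast
      fix p assume "p \<in> V"
      from ex[OF this] have "p \<in> \<Union>\<F>'" unfolding F(3) by blast
      then obtain S where "S \<in> \<F>'" "p \<in> S" by blast
      then show "\<exists>Q\<in>q ` \<F>'. p \<in> fst (fst Q)" using q by blast
    qed
  qed
  define E where "E = (\<lambda>p q. \<exists>c K. (c, K) \<in> \<C> \<and> p \<in> fst c \<and> q \<in> plaque c K p)"
  have EI: "E p q" if "(c, K) \<in> \<C>" "p \<in> fst c" "q \<in> plaque c K p" for c K p q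
    using that unfolding E_def by blast
  have Esym: "E q p" if pq: "E p q" for p q
  proof -
    obtain c K where cK: "(c, K) \<in> \<C>" "p \<in> fst c" "q \<in> plaque c K p"
      using pq unfolding E_def by blast
    have "q \<in> fst c" using cK(3) by (simp add: plaque_def)
    then show ?thesis by (rule EI[OF cK(1) _ plaque_sym[OF cK(3,2)]])
  qed
  define R where "R = E\<^sup>*\<^sup>*"
  have Rrefl: "R p p" and Rtrans: "R p q \<Longrightarrow> R q s \<Longrightarrow> R p s" for p q s
    by (auto simp: R_def)
  have Rsym: "R q p" if "R p q" for p q
    using that unfolding R_def
    by (induction rule: rtranclp_induct) (auto intro: Esym converse_rtranclp_into_rtranclp)
  have ER: "E p q \<Longrightarrow> R p q" for p q by (simp add: R_def)
  have good\<C>: "adapted_chart V D c K" "\<exists>a b. snd c ` fst c = box a b" "fst c \<subseteq> V" if "(c, K) \<in> \<C>" for c K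
    using \<C>(2)[OF that] by (auto simp: good_def adapted_chart_def)
  have EV: "q \<in> V" if "E p q" for p q
  proof -
    obtain c K where cK: "(c, K) \<in> \<C>" "q \<in> plaque c K p"
      using \<open>E p q\<close> unfolding E_def by blast
    then show ?thesis using good\<C>(3)[OF cK(1)] by (auto simp: plaque_def)
  qed
  have RV: "q \<in> V" if "R p q" "p \<in> V" for p q
    using that unfolding R_def by (induction rule: rtranclp_induct) (auto dest: EV)
  have locE: "\<exists>N. open N \<and> x \<in> N \<and> (\<forall>y\<in>N. y \<in> plaque c K x \<longrightarrow> E x y)"
    if c: "adapted_chart V D c K" and x: "x \<in> fst c" for c K x
  proof -
    have "x \<in> V" using c x unfolding adapted_chart_def by blast
    then obtain Q where Q: "Q \<in> \<C>" "x \<in> fst (fst Q)" using \<C>(3) by blast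
    obtain c' K' where Q': "Q = (c', K')" by (cases Q)
    have c': "(c', K') \<in> \<C>" "x \<in> fst c'" using Q Q' by simp_all
    obtain N where N: "open N" "x \<in> N" and pl: "\<And>x y. x \<in> N \<Longrightarrow> y \<in> N \<Longrightarrow> y \<in> plaque c K x \<Longrightarrow> y \<in> plaque c' K' x"
      using local_plaque_inclusion[OF c good\<C>(1)[OF c'(1)] x c'(2)] by metis
    have "\<forall>y\<in>N. y \<in> plaque c K x \<longrightarrow> E x y"
      using EI[OF c'] pl[OF N(2)] by blast
    then show ?thesis using N by blast
  qed
  \<comment> \<open>A segment in the plaque is covered by small pieces, each of them inside one
    plaque of a chart of the countable family.\<close>
  have plR: "R x y" if c: "adapted_chart V D c K" and box: "snd c ` fst c = box a b" and x: "x \<in> fst c"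
      and y: "y \<in> plaque c K x" for c K a b x y
  proof -
    obtain g where g: "path g" "pathstart g = x" "pathfinish g = y" "path_image g \<subseteq> plaque c K x"
      by (rule plaque_segment[OF c box x y])
    have "R (pathstart g) (g 1)"
    proof (rule local_relation_path[where R = R, OF g(1) Rsym Rtrans])
      fix t :: real assume t: "t \<in> {0..1}"
      have gp: "g s \<in> plaque c K x" if "s \<in> {0..1}" for s using g(4) that by (auto simp: path_image_def)
      then have gt: "g t \<in> fst c" using t by (auto simp: plaque_def)
      obtain N where N: "open N" "g t \<in> N" "\<And>y. y \<in> N \<Longrightarrow> y \<in> plaque c K (g t) \<Longrightarrow> E (g t) y"
        using locE[OF c gt] by blast
      have loc: "R (g t) (g s)" if s: "s \<in> {0..1} \<inter> g -` N" for s
      proof -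
        have "g s \<in> plaque c K (g t)" using gp[of s] s plaque_eq[OF gp[OF t]] by simp
        with s show ?thesis by (intro ER N(3)) auto
      qed
      show "\<exists>T. openin (top_of_set {0..1}) T \<and> t \<in> T \<and> (\<forall>s\<in>T. R (g t) (g s))"
      proof (intro exI conjI ballI)
        show "openin (top_of_set {0..1}) ({0..1} \<inter> g -` N)"
          by (rule openin_path_vimage[OF g(1) N(1)])
        show "t \<in> {0..1} \<inter> g -` N" using t N(2) by simp
      qed (rule loc)
    qed simp_all
    then show ?thesis using g by (simp add: pathfinish_def)
  qed
  define leaf where "leaf = (\<lambda>p. {q. R p q})"
  have leaf_eq: "leaf p = leaf q" if "R p q" for p q
    unfolding leaf_def using Rtrans[OF that] Rtrans[OF Rsym[OF that]] by blast
  define T where "T = leaf ` V"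
  have thin_leaf: "thin V D (leaf p)" for p
  proof -
    \<comment> \<open>The points reached from \<open>p\<close> in n plaque steps; their union over n
      is the leaf.\<close>
    define L where "L = (\<lambda>n. {q. (E ^^ n) p q})"
    have "thin V D (L n)" for n
    proof (induction n)
      case 0
      have "L 0 = {p}" by (auto simp: L_def)
      then show ?case by (simp add: thin_singleton)
    next
      case (Suc n)
      have "L (Suc n) = (\<Union>Q\<in>\<C>. \<Union>((\<lambda>y. plaque (fst Q) (snd Q) y) ` (L n \<inter> fst (fst Q))))"
      proof (rule set_eqI, rule iffI)
        fix q assume "q \<in> L (Suc n)"
        then obtain y where y: "y \<in> L n" "E y q" unfolding L_def by auto
        then obtain c K where "(c, K) \<in> \<C>" "y \<in> fst c" "q \<in> plaque c K y" unfolding E_def by blast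
        with y show "q \<in> (\<Union>Q\<in>\<C>. \<Union>((\<lambda>y. plaque (fst Q) (snd Q) y) ` (L n \<inter> fst (fst Q))))"
          by (intro UN_I[of "(c, K)"]) auto
      next
        fix q assume "q \<in> (\<Union>Q\<in>\<C>. \<Union>((\<lambda>y. plaque (fst Q) (snd Q) y) ` (L n \<inter> fst (fst Q))))"
        then obtain Q y where Q: "Q \<in> \<C>" "y \<in> L n" "y \<in> fst (fst Q)" "q \<in> plaque (fst Q) (snd Q) y" by blast
        then have "E y q" by (intro EI[of "fst Q" "snd Q"]) simp_all
        with Q(2) show "q \<in> L (Suc n)" unfolding L_def by auto
      qed
      moreover have "thin V D (\<Union>Q\<in>\<C>. \<Union>((\<lambda>y. plaque (fst Q) (snd Q) y) ` (L n \<inter> fst (fst Q))))"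
      proof (rule thin_Union[OF \<C>(1)])
        fix Q assume Q: "Q \<in> \<C>"
        then have a: "adapted_chart V D (fst Q) (snd Q)" using good\<C>(1)[of "fst Q" "snd Q"] by simp
        have "countable ((\<lambda>y. plaque (fst Q) (snd Q) y) ` (L n \<inter> fst (fst Q)))"
          using Suc a unfolding thin_def by blast
        then have "thin V D (\<Union>P\<in>(\<lambda>y. plaque (fst Q) (snd Q) y) ` (L n \<inter> fst (fst Q)). P)"
          by (rule thin_Union) (use thin_plaque[OF a] in auto)
        then show "thin V D (\<Union>((\<lambda>y. plaque (fst Q) (snd Q) y) ` (L n \<inter> fst (fst Q))))" by simp
      qed
      ultimately show ?case by simp
    qed
    then have "thin V D (\<Union>n\<in>UNIV. L n)" by (intro thin_Union) auto
    moreover have "leaf p = (\<Union>n\<in>UNIV. L n)"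
      by (auto simp: leaf_def R_def L_def rtranclp_power)
    ultimately show ?thesis by simp
  qed
  have fol: "foliated_chart A r T c K" if c: "adapted_chart V D c K" "card K = r" and box: "snd c ` fst c = box a b" for c K a b
  proof -
    have sc: "smooth_chart A c" "fst c \<subseteq> V" and K: "K \<subseteq> Basis" using c by (auto simp: adapted_chart_def)
    note ic = smooth_chart_is_chart[OF sc(1)]
    have "path_component_set (L \<inter> fst c) q = plaque c K q" if L: "L \<in> T" and q: "q \<in> L \<inter> fst c" for L q
    proof
      obtain p where p: "L = leaf p" using L by (auto simp: T_def)
      have Lq: "L = leaf q" using q leaf_eq[of p q] by (simp add: p leaf_def)
      show "plaque c K q \<subseteq> path_component_set (L \<inter> fst c) q"
      proof
        fix y assume y: "y \<in> plaque c K q"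
        obtain g where g: "path g" "pathstart g = q" "pathfinish g = y" "path_image g \<subseteq> plaque c K q"
          using plaque_segment[OF c(1) box _ y] q by blast
        have "plaque c K q \<subseteq> L \<inter> fst c"
          using plR[OF c(1) box, of q] q by (auto simp: Lq leaf_def plaque_def)
        then show "y \<in> path_component_set (L \<inter> fst c) q"
          using g unfolding path_component_def by auto
      qed
      show "path_component_set (L \<inter> fst c) q \<subseteq> plaque c K q"
      proof
        fix y assume "y \<in> path_component_set (L \<inter> fst c) q"
        then obtain g where g: "path g" "path_image g \<subseteq> L \<inter> fst c" "pathstart g = q" "pathfinish g = y"
          unfolding path_component_def by auto
        \<comment> \<open>The transversal coordinates, constant on each plaque. Along a path in the
          leaf their values form a countable connected set, hence a single point.\<close>
        define \<tau> where "\<tau> = (\<lambda>z. \<Sum>i\<in>Basis - K. (snd c z \<bullet> i) *\<^sub>R i)"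
        have \<tau>: "\<tau> z \<bullet> i = snd c z \<bullet> i" if "i \<in> Basis - K" for z i
        proof -
          have "\<tau> z \<bullet> i = (\<Sum>j\<in>Basis - K. if j = i then snd c z \<bullet> i else 0)"
            unfolding \<tau>_def inner_sum_left using that by (intro sum.cong) (auto simp: inner_Basis)
          then show ?thesis using that by simp
        qed
        have "continuous_on (fst c) \<tau>"
          unfolding \<tau>_def using is_chart_homeomorphism[OF ic]
          by (intro continuous_on_sum continuous_on_scaleR continuous_on_inner continuous_on_const)
            (auto simp: homeomorphism_def)
        then have "continuous_on (path_image g) \<tau>" using g by (auto intro: continuous_on_subset)
        then have conn: "connected (\<tau> ` path_image g)"
          using connected_continuous_image connected_path_image[OF g(1)] by blast
        have "countable ((\<lambda>z. plaque c K z) ` (L \<inter> fst c))"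
          using thin_leaf[of p] c(1) unfolding thin_def p by blast
        then have "countable ((\<lambda>P. \<tau> (SOME z. z \<in> P)) ` (\<lambda>z. plaque c K z) ` (L \<inter> fst c))" by simp
        moreover have "\<tau> ` path_image g \<subseteq> (\<lambda>P. \<tau> (SOME z. z \<in> P)) ` (\<lambda>z. plaque c K z) ` (L \<inter> fst c)"
        proof
          fix u assume "u \<in> \<tau> ` path_image g"
          then obtain z where z: "z \<in> L \<inter> fst c" "u = \<tau> z" using g by blast
          have "(SOME x. x \<in> plaque c K z) \<in> plaque c K z"
            by (rule someI[of _ z]) (use z in \<open>simp add: plaque_self\<close>)
          then have "\<tau> (SOME x. x \<in> plaque c K z) = \<tau> z"
            by (simp add: plaque_def \<tau>_def)
          then show "u \<in> (\<lambda>P. \<tau> (SOME z. z \<in> P)) ` (\<lambda>z. plaque c K z) ` (L \<inter> fst c)"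
            using z by force
        qed
        ultimately have "countable (\<tau> ` path_image g)" using countable_subset by blast
        moreover have qy: "q \<in> path_image g" "y \<in> path_image g"
          using g(3,4) pathstart_in_path_image[of g] pathfinish_in_path_image[of g] by auto
        ultimately have "\<tau> y = \<tau> q" using connected_uncountable[OF conn, of "\<tau> y" "\<tau> q"] by blast
        then have "snd c y \<bullet> i = snd c q \<bullet> i" if "i \<in> Basis - K" for i
          using \<tau>[OF that] by metis
        then show "y \<in> plaque c K q" using qy g(2) by (auto simp: plaque_def)
      qed
    qed
    moreover have "V \<subseteq> \<Union>T" using Rrefl by (auto simp: T_def leaf_def)
    ultimately show ?thesis using c(2) sc K box unfolding foliated_chart_def by blast
  qed
  have "foliation A V r T"
    unfolding foliation_def
  proof (intro conjI ballI)
    show "partition_on V T"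
    proof (rule partition_onI)
      show "\<Union>T = V" using Rrefl RV by (auto simp: T_def leaf_def)
      show "disjnt L L'" if LL: "L \<in> T" "L' \<in> T" "L \<noteq> L'" for L L'
      proof (rule ccontr)
        assume "\<not> disjnt L L'"
        then obtain x where x: "x \<in> L" "x \<in> L'" by (auto simp: disjnt_def)
        from LL(1,2) obtain p q where pq: "L = leaf p" "L' = leaf q" unfolding T_def by blast
        with x have "R p x" "R q x" by (simp_all add: leaf_def)
        with pq have "L = L'" using leaf_eq[of p x] leaf_eq[of q x] by simp
        with LL(3) show False by simp
      qed
      show "{} \<notin> T" using Rrefl by (auto simp: T_def leaf_def)
    qed
    fix L assume "L \<in> T"
    then obtain p where p: "L = leaf p" by (auto simp: T_def)
    have "path_component L p q" if "R p q" for q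
      using that unfolding R_def
    proof (induction rule: rtranclp_induct)
      case base
      show ?case by (rule path_component_refl) (simp add: p leaf_def Rrefl)
    next
      case (step y z)
      then obtain c K where cK: "(c, K) \<in> \<C>" "y \<in> fst c" "z \<in> plaque c K y" unfolding E_def by blast
      obtain a b where box: "snd c ` fst c = box a b" using good\<C>(2)[OF cK(1)] by blast
      obtain g where g: "path g" "pathstart g = y" "pathfinish g = z" "path_image g \<subseteq> plaque c K y"
        by (rule plaque_segment[OF good\<C>(1)[OF cK(1)] box cK(2,3)])
      have "plaque c K y \<subseteq> L"
        using plR[OF good\<C>(1)[OF cK(1)] box cK(2)] step(1) Rtrans unfolding p leaf_def R_def[symmetric] by blast
      with g have "path_component L y z" unfolding path_component_def by blast
      with step show ?case using path_component_trans by blast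
    qed
    then have *: "path_component L p q" if "q \<in> L" for q using that by (simp add: p leaf_def)
    show "path_connected L"
      unfolding path_connected_component using * path_component_sym path_component_trans by blast
  next
    fix p assume "p \<in> V"
    then obtain Q where Q: "Q \<in> \<C>" "p \<in> fst (fst Q)" using \<C>(3) by blast
    obtain c K where cK: "Q = (c, K)" by (cases Q)
    then obtain a b where "adapted_chart V D c K" "card K = r" "snd c ` fst c = box a b"
      using \<C>(2)[OF Q(1)] by (auto simp: good_def)
    from fol[OF this] Q(2) cK show "\<exists>c K. p \<in> fst c \<and> foliated_chart A r T c K"
      by (intro exI[of _ c] exI[of _ K]) simp
  qed
  moreover have "foliation_tangent A r T p = D p" if pV: "p \<in> V" for p
  proof -
    obtain Q where Q: "Q \<in> \<C>" "p \<in> fst (fst Q)" using \<C>(3)[OF pV] by blast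
    obtain c K where cK: "Q = (c, K)" by (cases Q)
    then obtain a b where box: "snd c ` fst c = box a b" and ad: "adapted_chart V D c K" "card K = r"
      using \<C>(2)[OF Q(1)] by (auto simp: good_def)
    show ?thesis
      using foliation_tangent_foliated_chart[OF fol[OF ad box], of p] Q cK ad by (simp add: adapted_chart_def)
  qed
  ultimately show thesis by (rule that)
qed

end

section \<open>Integrability of commuting frames and fibers of submersions\<close>

lemma dual_family_independent:
  fixes x :: "nat \<Rightarrow> 'v::euclidean_space"
  assumes lin: "\<And>j. j < r \<Longrightarrow> linear (\<xi> j)"
    and dual: "\<And>i j. i < r \<Longrightarrow> j < r \<Longrightarrow> \<xi> j (x i) = (if i = j then 1 else 0 :: real)"
  shows "inj_on x {..<r}" "independent (x ` {..<r})"
proof -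
  show inj: "inj_on x {..<r}"
  proof (rule inj_onI)
    fix i j assume ij: "i \<in> {..<r}" "j \<in> {..<r}" "x i = x j"
    show "i = j"
    proof (rule ccontr)
      assume "i \<noteq> j"
      with ij dual[of j i] have "\<xi> i (x j) = 0" by simp
      moreover have "\<xi> i (x i) = 1" using ij dual[of i i] by simp
      ultimately show False using ij(3) by simp
    qed
  qed
  show "independent (x ` {..<r})"
  proof (rule independent_if_scalars_zero)
    fix f v assume s: "(\<Sum>v\<in>x ` {..<r}. f v *\<^sub>R v) = 0" and "v \<in> x ` {..<r}"
    then obtain j where j: "j < r" "v = x j" by auto
    have "0 = \<xi> j (\<Sum>i<r. f (x i) *\<^sub>R x i)"
      using s by (simp add: sum.reindex[OF inj] linear_0[OF lin[OF j(1)]])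
    also have "\<dots> = (\<Sum>i<r. f (x i) * \<xi> j (x i))"
      by (simp add: linear_sum[OF lin[OF j(1)]] linear_scale[OF lin[OF j(1)]])
    also have "\<dots> = (\<Sum>i<r. if i = j then f (x j) else 0)"
      using dual j(1) by (intro sum.cong) auto
    finally show "f v = 0" using j by simp
  qed simp
qed

text \<open>The \<open>x i\<close> are r independent vectors in a space spanned by r vectors, so
  they span it too.\<close>

lemma dual_family_span:
  fixes x y :: "nat \<Rightarrow> 'v::euclidean_space"
  assumes lin: "\<And>j. j < r \<Longrightarrow> linear (\<xi> j)"
    and dual: "\<And>i j. i < r \<Longrightarrow> j < r \<Longrightarrow> \<xi> j (x i) = (if i = j then 1 else 0 :: real)"
    and sub: "\<And>i. i < r \<Longrightarrow> x i \<in> span (y ` {..<r})"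
  shows "span (x ` {..<r}) = span (y ` {..<r})"
proof -
  have ind: "inj_on x {..<r}" "independent (x ` {..<r})"
    by (rule dual_family_independent[of r \<xi> x, OF lin dual]; assumption)+
  have "dim (span (y ` {..<r})) \<le> card (y ` {..<r})" by (rule dim_le_card) auto
  also have "\<dots> \<le> r" using card_image_le[of "{..<r}" y] by simp
  also have "r = card (x ` {..<r})" using ind(1) by (simp add: card_image)
  finally have le: "dim (span (y ` {..<r})) \<le> card (x ` {..<r})" .
  have "span (y ` {..<r}) \<subseteq> span (x ` {..<r})"
    by (rule card_ge_dim_independent[OF _ ind(2) le]) (use sub in auto)
  moreover have "span (x ` {..<r}) \<subseteq> span (y ` {..<r})"
    by (rule span_minimal) (use sub in auto)
  ultimately show ?thesis by blast
qed

section \<open>Straightening commuting frames on a manifold\<close>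

context manifold
begin

text \<open>The chart \<open>d\<close> is followed by a diffeomorphism of open coordinate sets. Its
  inverse has to be identified with that of the composite, as \<open>chart_inv\<close> is defined by
  choice on the domain.\<close>

lemma smooth_chart_compose:
  assumes d: "smooth_chart A d" and W: "open W" "W \<subseteq> snd d ` fst d" and Z: "open Z"
    and hom: "homeomorphism W Z g \<Psi>" and g: "smooth_on W g" and \<Psi>: "smooth_on Z \<Psi>"
  shows "smooth_chart A (fst d \<inter> snd d -` W, g \<circ> snd d)"
proof -
  note id = smooth_chart_is_chart[OF d]
  let ?S = "fst d \<inter> snd d -` W"
  let ?c = "(?S, g \<circ> snd d)"
  have homd: "homeomorphism (fst d) (snd d ` fst d) (snd d) (chart_inv d)" by (rule is_chart_homeomorphism[OF id])
  have S: "open ?S"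
    using homd is_chart_open[OF id] W(1) by (intro continuous_open_preimage) (auto simp: homeomorphism_def)
  have dS: "snd d ` ?S = W" using W(2) by auto
  have homS: "homeomorphism ?S W (snd d) (chart_inv d)"
    by (rule homeomorphism_of_subsets[OF homd]) (use W dS in auto)
  have homc: "homeomorphism ?S Z (g \<circ> snd d) (chart_inv d \<circ> \<Psi>)"
    by (rule homeomorphism_compose[OF homS hom])
  have img: "(g \<circ> snd d) ` ?S = Z" using homc by (simp add: homeomorphism_def)
  have inj: "inj_on (g \<circ> snd d) ?S" using homc unfolding homeomorphism_def by (metis inj_on_inverseI)
  have inv: "chart_inv ?c z = chart_inv d (\<Psi> z)" if z: "z \<in> Z" for z
  proof -
    have 1: "(chart_inv d \<circ> \<Psi>) z \<in> ?S" "(g \<circ> snd d) ((chart_inv d \<circ> \<Psi>) z) = z"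
      using homc z by (auto simp: homeomorphism_def)
    show ?thesis
      unfolding chart_inv_def fst_conv snd_conv using inv_into_f_f[OF inj 1(1)] 1(2)
      by (simp add: chart_inv_def)
  qed
  have ic: "is_chart ?c"
    unfolding is_chart_def fst_conv snd_conv img
  proof (intro conjI S Z)
    show "homeomorphism ?S Z (g \<circ> snd d) (chart_inv ?c)"
      by (rule homeomorphism_cong[OF homc]) (use inv in auto)
  qed
  have "compatible_charts ?c c'" if c': "c' \<in> A" for c'
    unfolding compatible_charts_def fst_conv snd_conv
  proof
    have ic': "is_chart c'" by (rule smooth_chart_is_chart[OF smooth_chart_atlas[OF c']])
    let ?N = "(g \<circ> snd d) ` (?S \<inter> fst c')"
    have oN: "open ?N" using open_chart_image[OF ic is_chart_open(1)[OF ic']] by simp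
    have NZ: "?N \<subseteq> Z" using img by blast
    have \<Psi>N: "\<Psi> ` ?N \<subseteq> snd d ` (fst d \<inter> fst c')" using hom by (auto simp: homeomorphism_def)
    have "smooth_on ?N ((snd c' \<circ> chart_inv d) \<circ> \<Psi>)"
      by (rule smooth_on_compose[OF smooth_on_subset[OF \<Psi> NZ] transition_smooth_atlas(1)[OF d c'] \<Psi>N oN])
    then show "smooth_on ?N (snd c' \<circ> chart_inv ?c)"
    proof (rule smooth_on_cong[OF _ oN])
      fix z assume "z \<in> ?N"
      then have "z \<in> Z" using NZ by blast
      from inv[OF this] show "((snd c' \<circ> chart_inv d) \<circ> \<Psi>) z = (snd c' \<circ> chart_inv ?c) z" by simp
    qed
    have oN': "open (snd c' ` (?S \<inter> fst c'))"
      using open_chart_image[OF ic' S] by (simp add: Int_commute)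
    have s1: "smooth_on (snd c' ` (?S \<inter> fst c')) (snd d \<circ> chart_inv c')"
      by (rule smooth_on_subset[OF transition_smooth_atlas(2)[OF d c']]) auto
    have "smooth_on (snd c' ` (?S \<inter> fst c')) (g \<circ> (snd d \<circ> chart_inv c'))"
      by (rule smooth_on_compose[OF s1 g _ oN']) (use chart_inv_chart[OF ic'] in auto)
    then show "smooth_on (snd c' ` (?S \<inter> fst c')) (g \<circ> snd d \<circ> chart_inv c')"
      by (simp add: o_assoc)
  qed
  with ic show ?thesis by (simp add: smooth_chart_def)
qed

text \<open>Commutation is stated on functions, because a field read in varying preferred charts
  cannot be differentiated directly. Applied to the coordinate functions of one chart it becomes the
  symmetry of derivatives that \<open>frobenius_commuting\<close> requires.\<close>

theorem commuting_fields_integrable: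
  assumes V: "open V" and Y: "\<And>i. i < r \<Longrightarrow> smooth_vector_field A V (Y i)"
    and ind: "\<And>p. p \<in> V \<Longrightarrow> inj_on (\<lambda>i. Y i p) {..<r} \<and> independent ((\<lambda>i. Y i p) ` {..<r})"
    and comm: "\<And>W g i j p. open W \<Longrightarrow> W \<subseteq> V \<Longrightarrow> smooth_fun A W (g :: 'a \<Rightarrow> real) \<Longrightarrow> i < r \<Longrightarrow> j < r \<Longrightarrow> p \<in> W \<Longrightarrow>
      tangent_map A (\<lambda>q. tangent_map A g q (Y i q)) p (Y j p) =
      tangent_map A (\<lambda>q. tangent_map A g q (Y j q)) p (Y i p)"
  shows "integrable_distribution A V r (\<lambda>p. span ((\<lambda>i. Y i p) ` {..<r}))"
  unfolding integrable_distribution_def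
proof (intro conjI ballI)
  fix p assume p: "p \<in> V"
  show "subspace (span ((\<lambda>i. Y i p) ` {..<r}))" by (rule subspace_span)
  show "dim (span ((\<lambda>i. Y i p) ` {..<r})) = r"
    using ind[OF p] by (simp add: dim_span dim_eq_card_independent card_image)
next
  fix p assume p: "p \<in> V"
  define d where "d = chart_at A p"
  have d: "smooth_chart A d" and pd: "p \<in> fst d" using chart_at by (auto simp: d_def)
  note id = smooth_chart_is_chart[OF d]
  define Q where "Q = fst d \<inter> V"
  have Q: "open Q" "Q \<subseteq> fst d" "Q \<subseteq> V" "p \<in> Q" using is_chart_open[OF id] V p pd by (auto simp: Q_def)
  define U where "U = snd d ` Q"
  have U: "open U" using open_chart_image[OF id V] by (simp add: U_def Q_def)
  have inv: "chart_inv d x \<in> Q" "snd d (chart_inv d x) = x" if "x \<in> U" for x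
    using that chart_inv_chart[OF id] Q by (auto simp: U_def)
  have inv': "chart_inv d (snd d q) = q" if "q \<in> Q" for q using chart_inv_chart[OF id] that Q by auto
  define G where "G = (\<lambda>i l q. tangent_map A (\<lambda>q. snd d q \<bullet> l) q (Y i q))"
  \<comment> \<open>The fields in the coordinates of the single chart \<open>d\<close>, where they
    are smooth as ordinary maps.\<close>
  define Yh where "Yh = (\<lambda>i x. tangent_map A (snd d) (chart_inv d x) (Y i (chart_inv d x)))"
  have sml: "smooth_fun A Q (\<lambda>q. snd d q \<bullet> l)" for l
    by (rule smooth_fun_subset[OF smooth_fun_chart_component[OF d] Q(2)])
  have YhG: "Yh i x \<bullet> l = G i l (chart_inv d x)" if "x \<in> U" for i x l
  proof -
    have q: "chart_inv d x \<in> fst d" using inv[OF that] Q by auto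
    show ?thesis
      unfolding Yh_def G_def
      using differential_chart_component[OF d q, of l] differential_apply[OF sml[of l] Q(1) inv(1)[OF that]] by simp
  qed
  have smG: "smooth_fun A Q (G i l)" if i: "i < r" for i l
  proof -
    have "smooth_fun A Q (\<lambda>q. blinfun_apply (differential A (\<lambda>q. snd d q \<bullet> l) q) (Y i q))"
      using Y[OF i] sml[of l] Q unfolding smooth_vector_field_def by blast
    then show ?thesis
      by (rule smooth_fun_cong[OF _ Q(1)]) (simp add: G_def differential_apply[OF sml Q(1)])
  qed
  have dQ: "fst d \<inter> Q = Q" using Q by auto
  have smGh: "smooth_on U (G i l \<circ> chart_inv d)" if "i < r" for i l
    using smooth_fun_chart[OF smG[OF that] Q(1) d] by (simp add: dQ U_def)
  have smYl: "smooth_on U (\<lambda>x. Yh i x \<bullet> l)" if "i < r" for i l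
    by (rule smooth_on_cong[OF smGh[OF that] U]) (simp add: YhG)
  have smY: "smooth_on U (Yh i)" if "i < r" for i
    by (rule smooth_on_componentwise[OF smYl[OF that] U])
  have DY: "frechet_derivative (Yh i) (at x) (Yh j x) \<bullet> l = tangent_map A (G i l) (chart_inv d x) (Y j (chart_inv d x))"
    if "i < r" "j < r" "x \<in> U" for i j x l
  proof -
    let ?q = "chart_inv d x"
    note q = inv[OF that(3)]
    have qd: "?q \<in> fst d" using q Q by auto
    have "((\<lambda>x. Yh i x \<bullet> l) has_derivative (\<lambda>v. frechet_derivative (Yh i) (at x) v \<bullet> l)) (at x)"
      by (rule has_derivative_inner_left[OF smooth_on_has_derivative[OF smY[OF that(1)] that(3)]])
    then have "frechet_derivative (Yh i) (at x) (Yh j x) \<bullet> l = frechet_derivative (\<lambda>x. Yh i x \<bullet> l) (at x) (Yh j x)"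
      using frechet_derivative_at by metis
    also have "frechet_derivative (\<lambda>x. Yh i x \<bullet> l) (at x) = frechet_derivative (G i l \<circ> chart_inv d) (at x)"
      by (rule frechet_derivative_cong_open[OF U that(3)]) (simp add: YhG)
    also have "frechet_derivative (G i l \<circ> chart_inv d) (at x) (Yh j x) = tangent_map A (G i l) ?q (Y j ?q)"
      using tangent_map_chart[OF smG[OF that(1)] Q(1) q(1) d qd, of l "Y j ?q"] q(2) by (simp add: Yh_def)
    finally show ?thesis .
  qed
  have commY: "frechet_derivative (Yh i) (at x) (Yh j x) = frechet_derivative (Yh j) (at x) (Yh i x)"
    if "i < r" "j < r" "x \<in> U" for i j x
  proof (rule euclidean_eqI)
    fix l :: 'e
    show "frechet_derivative (Yh i) (at x) (Yh j x) \<bullet> l = frechet_derivative (Yh j) (at x) (Yh i x) \<bullet> l"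
      using comm[OF Q(1,3) sml[of l] that(1,2) inv(1)[OF that(3)]]
      unfolding DY[OF that] DY[OF that(2,1,3)] G_def .
  qed
  let ?T = "tangent_map A (snd d)"
  have linT: "linear (?T q)" and bijT: "bij (?T q)" if "q \<in> Q" for q
    using tangent_chart_linear[OF d] tangent_chart_bij[OF d] that Q by auto
  have YhT: "Yh i (snd d q) = ?T q (Y i q)" if "q \<in> Q" for i q
    by (simp add: Yh_def inv'[OF that])
  have xU: "snd d p \<in> U" using Q by (simp add: U_def)
  have injY: "inj_on (\<lambda>i. Yh i (snd d p)) {..<r}"
    using ind[OF p] bijT[OF Q(4)] unfolding YhT[OF Q(4)] inj_on_def bij_def by blast
  have indY: "independent ((\<lambda>i. Yh i (snd d p)) ` {..<r})"
  proof -
    have "independent (?T p ` (\<lambda>i. Y i p) ` {..<r})"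
      using ind[OF p] bijT[OF Q(4)]
      by (intro linear_independent_injective_image[OF linT[OF Q(4)]]) (auto simp: bij_def intro: inj_on_subset)
    then show ?thesis by (simp add: image_image YhT[OF Q(4)])
  qed
  show "\<exists>c K. smooth_chart A c \<and> p \<in> fst c \<and> fst c \<subseteq> V \<and> K \<subseteq> Basis \<and> card K = r \<and>
      (\<forall>q\<in>fst c. span ((\<lambda>i. Y i q) ` {..<r}) = {v. tangent_map A (snd c) q v \<in> span K})"
  proof (rule frobenius_commuting[OF U xU smY commY injY indY], assumption, assumption, assumption, assumption, goal_cases)
    case (1 W Z g \<Psi> K)
    note W = 1(1,2,3) and Z = 1(4) and hom = 1(5) and g = 1(6) and \<Psi> = 1(7) and K = 1(8,9) and sp = 1(10)
    have WQ: "W \<subseteq> snd d ` fst d" using W(3) Q by (auto simp: U_def)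
    let ?S = "fst d \<inter> snd d -` W"
    have c: "smooth_chart A (?S, g \<circ> snd d)"
      by (rule smooth_chart_compose[OF d W(1) WQ Z hom g \<Psi>])
    have S: "open ?S" using is_chart_open(1)[OF smooth_chart_is_chart[OF c]] by simp
    have SQ: "q \<in> Q" if "q \<in> ?S" for q
    proof -
      have "snd d q \<in> U" using that W(3) by auto
      then obtain q' where "q' \<in> Q" "snd d q = snd d q'" by (auto simp: U_def)
      then show ?thesis using chart_inj[OF id, of q q'] that Q by auto
    qed
    have "span ((\<lambda>i. Y i q) ` {..<r}) = {v. tangent_map A (g \<circ> snd d) q v \<in> span K}" if q: "q \<in> ?S" for q
    proof -
      have qW: "snd d q \<in> W" and qd: "q \<in> fst d" using q by auto
      have smc: "smooth_fun A ?S (g \<circ> snd d)" using smooth_fun_chart_map[OF c] by simp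
      have fd: "frechet_derivative ((g \<circ> snd d) \<circ> chart_inv d) (at (snd d q)) = frechet_derivative g (at (snd d q))"
        by (rule frechet_derivative_cong_open[OF W(1) qW]) (use WQ chart_chart_inv[OF id] in auto)
      have "tangent_map A (g \<circ> snd d) q v \<in> span K \<longleftrightarrow> v \<in> span ((\<lambda>i. Y i q) ` {..<r})" for v
      proof -
        have "tangent_map A (g \<circ> snd d) q v \<in> span K \<longleftrightarrow> ?T q v \<in> span ((\<lambda>i. Yh i (snd d q)) ` {..<r})"
          using tangent_map_chart[OF smc S q d qd, of v] sp[OF qW, of "?T q v"] by (simp add: fd)
        also have "(\<lambda>i. Yh i (snd d q)) ` {..<r} = ?T q ` (\<lambda>i. Y i q) ` {..<r}"
          by (simp add: image_image YhT[OF SQ[OF q]])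
        also have "span \<dots> = ?T q ` span ((\<lambda>i. Y i q) ` {..<r})"
          by (rule span_linear_image[OF linT[OF SQ[OF q]]])
        also have "?T q v \<in> \<dots> \<longleftrightarrow> v \<in> span ((\<lambda>i. Y i q) ` {..<r})"
          using bijT[OF SQ[OF q]] by (simp add: bij_def inj_image_mem_iff)
        finally show ?thesis .
      qed
      then show ?thesis by blast
    qed
    moreover have "?S \<subseteq> V" using SQ Q by blast
    moreover have "p \<in> ?S" using W pd by simp
    ultimately show ?case using c K
      by (intro exI[of _ "(?S, g \<circ> snd d)"] exI[of _ K]) simp
  qed
qed

end

section \<open>Submersions: local sections and curves in fibers\<close>

context manifold_map
begin

lemma local_representative:
  obtains O' where "open O'" "O' = snd (chart_at A m) ` (fst (chart_at A m) \<inter> \<phi> -` fst (chart_at A' (\<phi> m)))"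
    "snd (chart_at A m) m \<in> O'"
    "smooth_on O' ((snd (chart_at A' (\<phi> m)) \<circ> \<phi>) \<circ> chart_inv (chart_at A m))"
    "((snd (chart_at A' (\<phi> m)) \<circ> \<phi>) \<circ> chart_inv (chart_at A m) has_derivative map_differential A A' \<phi> m)
      (at (snd (chart_at A m) m))"
proof -
  let ?a = "chart_at A m" and ?d = "chart_at A' (\<phi> m)"
  have s: "smooth_fun A (\<phi> -` fst ?d) (snd ?d \<circ> \<phi>)"
    using smooth N.chart_at(1)[of "\<phi> m"] by (auto simp: smooth_map_def)
  have od: "open (\<phi> -` fst ?d)" by (rule open_vimage[OF is_chart_open(1)[OF N.is_chart_at]])
  show thesis
  proof (rule that[OF _ refl])
    show "open (snd ?a ` (fst ?a \<inter> \<phi> -` fst ?d))" by (rule open_chart_image[OF M.is_chart_at od])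
    show "snd ?a m \<in> snd ?a ` (fst ?a \<inter> \<phi> -` fst ?d)" using M.chart_at(2)[of m] N.chart_at(2)[of "\<phi> m"] by auto
    show "smooth_on (snd ?a ` (fst ?a \<inter> \<phi> -` fst ?d)) ((snd ?d \<circ> \<phi>) \<circ> chart_inv ?a)"
      by (rule M.smooth_fun_chart[OF s od M.chart_at(3)])
    show "((snd ?d \<circ> \<phi>) \<circ> chart_inv ?a has_derivative map_differential A A' \<phi> m) (at (snd ?a m))"
      unfolding map_differential_def
      by (rule M.tangent_map_has_derivative[OF s od]) (simp add: N.chart_at(2))
  qed
qed

text \<open>A right inverse \<open>T\<close> of the derivative gives an affine slice through
  \<open>m\<close> on which \<phi> is a local diffeomorphism. Its inverse is a local section of
  \<phi>, and \<open>q\<close> is the smooth function \<open>q \<circ> \<phi>\<close> along that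
  section.\<close>

lemma smooth_fun_descend:
  fixes q :: "'b \<Rightarrow> 'g::real_normed_vector"
  assumes surj: "surj \<phi>" and sub: "\<And>m. surj (map_differential A A' \<phi> m)"
    and W: "open W" and q: "smooth_fun A (\<phi> -` W) (q \<circ> \<phi>)"
  shows "smooth_fun A' W q"
proof (rule N.smooth_funI[OF _ W])
  fix b assume b: "b \<in> W"
  obtain m where m: "\<phi> m = b" using surj by (metis surjD)
  let ?a = "chart_at A m" and ?d = "chart_at A' (\<phi> m)"
  let ?L = "map_differential A A' \<phi> m" and ?x = "snd ?a m"
  define F where "F = (snd ?d \<circ> \<phi>) \<circ> chart_inv ?a"
  obtain O' where O': "open O'" "O' = snd ?a ` (fst ?a \<inter> \<phi> -` fst ?d)" "?x \<in> O'"
    and F: "smooth_on O' F" "(F has_derivative ?L) (at ?x)"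
    unfolding F_def by (rule local_representative)
  note bl = map_differential_bounded_linear[of m]
  obtain T where T: "linear T" "?L \<circ> T = id"
    using linear_surjective_right_inverse[OF bounded_linear.linear[OF bl] sub] by blast
  have blT: "bounded_linear T" using T(1) by (simp add: linear_conv_bounded_linear)
  let ?h = "\<lambda>y. ?x + T y"
  have smh: "smooth_on S ?h" if "open S" for S
    by (intro smooth_on_add smooth_on_const smooth_on_linear blT that)
  define U where "U = ?h -` (snd ?a ` (fst ?a \<inter> \<phi> -` (fst ?d \<inter> W)))"
  have oW: "open (\<phi> -` (fst ?d \<inter> W))"
    using W is_chart_open(1)[OF N.is_chart_at] by (intro open_vimage open_Int) auto
  have U: "open U"
    unfolding U_def
    by (intro Topological_Spaces.open_vimage open_chart_image[OF M.is_chart_at oW]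
        continuous_on_add continuous_on_const linear_continuous_on blT)
  have U0: "0 \<in> U"
    unfolding U_def using linear_0[OF T(1)] M.chart_at(2)[of m] N.chart_at(2)[of "\<phi> m"] b m by auto
  have hU: "?h y \<in> snd ?a ` (fst ?a \<inter> \<phi> -` (fst ?d \<inter> W))" "?h y \<in> O'" if "y \<in> U" for y
    using that by (auto simp: U_def O'(2))
  have smH: "smooth_on U (F \<circ> ?h)"
    by (rule smooth_on_compose[OF smh[OF U] F(1) _ U]) (use hU in auto)
  have dh: "(?h has_derivative T) (at 0)"
    using has_derivative_add[OF has_derivative_const bounded_linear_imp_has_derivative[OF blT], of ?x] by simp
  have "(F \<circ> ?h has_derivative ?L \<circ> T) (at 0)"
    by (rule diff_chain_at[OF dh]) (use F(2) linear_0[OF T(1)] in simp)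
  then have "frechet_derivative (F \<circ> ?h) (at 0) = id"
    using T(2) by (simp flip: frechet_derivative_at)
  then have inj: "inj (frechet_derivative (F \<circ> ?h) (at 0))" by simp
  show "\<exists>c U. smooth_chart A' c \<and> open U \<and> b \<in> U \<and> U \<subseteq> fst c \<and> smooth_on (snd c ` U) (q \<circ> chart_inv c)"
  proof (rule smooth_inverse_function[OF U U0 smH inj], goal_cases)
    case (1 U' V g)
    note U' = 1(1,2,3) and V = 1(4,5) and hom = 1(6) and g = 1(7)
    have Vd: "V \<subseteq> snd ?d ` (fst ?d \<inter> W)"
    proof
      fix y assume y: "y \<in> V"
      then have gy: "g y \<in> U" "F (?h (g y)) = y" using hom U' by (auto simp: homeomorphism_def)
      then obtain p where p: "p \<in> fst ?a" "\<phi> p \<in> fst ?d \<inter> W" "?h (g y) = snd ?a p" using hU by blast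
      have "y = snd ?d (\<phi> p)" using gy(2) p chart_inv_chart[OF M.is_chart_at p(1)] by (simp add: F_def)
      then show "y \<in> snd ?d ` (fst ?d \<inter> W)" using p(2) by blast
    qed
    define S where "S = fst ?d \<inter> snd ?d -` V"
    have S: "open S"
      unfolding S_def using is_chart_homeomorphism[OF N.is_chart_at[of "\<phi> m"]] is_chart_open[OF N.is_chart_at[of "\<phi> m"]] V(1)
      by (intro continuous_open_preimage) (auto simp: homeomorphism_def)
    have dS: "snd ?d ` S = V" using Vd by (auto simp: S_def)
    have "(F \<circ> ?h) 0 = snd ?d b"
      using linear_0[OF T(1)] chart_inv_chart[OF M.is_chart_at M.chart_at(2), of m] m by (simp add: F_def)
    then have bS: "b \<in> S" using V(2) N.chart_at(2)[of b] m by (simp add: S_def)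
    have sq: "smooth_on (snd ?a ` (fst ?a \<inter> \<phi> -` W)) ((q \<circ> \<phi>) \<circ> chart_inv ?a)"
      by (rule M.smooth_fun_chart[OF q open_vimage[OF W] M.chart_at(3)])
    have "smooth_on V (?h \<circ> g)" by (rule smooth_on_compose[OF g smh[OF open_UNIV] _ V(1)]) simp
    then have "smooth_on V (((q \<circ> \<phi>) \<circ> chart_inv ?a) \<circ> (?h \<circ> g))"
    proof (rule smooth_on_compose[OF _ sq _ V(1)])
      show "(?h \<circ> g) ` V \<subseteq> snd ?a ` (fst ?a \<inter> \<phi> -` W)"
      proof (rule image_subsetI)
        fix y assume "y \<in> V"
        then have "g y \<in> U" using hom U' by (auto simp: homeomorphism_def)
        from hU(1)[OF this] show "(?h \<circ> g) y \<in> snd ?a ` (fst ?a \<inter> \<phi> -` W)" by auto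
      qed
    qed
    then have "smooth_on V (q \<circ> chart_inv ?d)"
    proof (rule smooth_on_cong[OF _ V(1)])
      fix y assume y: "y \<in> V"
      then have gy: "g y \<in> U" "F (?h (g y)) = y" using hom U' by (auto simp: homeomorphism_def)
      then obtain p where p: "p \<in> fst ?a" "\<phi> p \<in> fst ?d \<inter> W" "?h (g y) = snd ?a p" using hU by blast
      have ip: "chart_inv ?a (?h (g y)) = p" using p chart_inv_chart[OF M.is_chart_at p(1)] by simp
      have "y = snd ?d (\<phi> p)" using gy(2) ip by (simp add: F_def)
      then have "chart_inv ?d y = \<phi> p" using chart_inv_chart[OF N.is_chart_at, of "\<phi> p"] p(2) by simp
      then show "(((q \<circ> \<phi>) \<circ> chart_inv ?a) \<circ> (?h \<circ> g)) y = (q \<circ> chart_inv ?d) y" using ip by simp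
    qed
    then show ?case
      using S bS dS N.chart_at(3)[of "\<phi> m"] by (intro exI[of _ ?d] exI[of _ S]) (auto simp: S_def)
  qed
qed

text \<open>Every kernel vector of a submersion is the velocity of a curve in the fiber, by the inverse
  function theorem for \<open>(t, y) \<mapsto> (t, \<phi>(x + t v + T y))\<close> with a right inverse \<open>T\<close> of the derivative.\<close>

lemma fiber_curve:
  assumes sub: "surj (map_differential A A' \<phi> m)" and v: "map_differential A A' \<phi> m v = 0"
  obtains \<epsilon> \<gamma> where "\<epsilon> > 0" "\<gamma> 0 = snd (chart_at A m) m" "continuous_on {-\<epsilon>..\<epsilon>} \<gamma>"
    "(\<gamma> has_derivative (\<lambda>h. h *\<^sub>R v)) (at 0)"
    "\<And>t. \<bar>t\<bar> \<le> \<epsilon> \<Longrightarrow> \<gamma> t \<in> snd (chart_at A m) ` (fst (chart_at A m) \<inter> \<phi> -` {\<phi> m})"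
proof -
  let ?a = "chart_at A m" and ?d = "chart_at A' (\<phi> m)"
  let ?L = "map_differential A A' \<phi> m" and ?x = "snd ?a m"
  define F where "F = (snd ?d \<circ> \<phi>) \<circ> chart_inv ?a"
  obtain O' where O': "open O'" "O' = snd ?a ` (fst ?a \<inter> \<phi> -` fst ?d)" "?x \<in> O'"
    and F: "smooth_on O' F" "(F has_derivative ?L) (at ?x)"
    unfolding F_def by (rule local_representative)
  note bl = map_differential_bounded_linear[of m]
  note linL = bounded_linear.linear[OF bl]
  obtain T where T: "linear T" "?L \<circ> T = id"
    using linear_surjective_right_inverse[OF linL sub] by blast
  have LT: "?L (T y) = y" for y using T(2) by (metis comp_apply id_apply)
  have blT: "bounded_linear T" using T(1) by (simp add: linear_conv_bounded_linear)
  have blv: "bounded_linear (\<lambda>p::real \<times> 'f. fst p *\<^sub>R v + T (snd p))"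
    by (intro bounded_linear_add bounded_linear_scaleR_const bounded_linear_fst
        bounded_linear_compose[OF blT bounded_linear_snd])
  let ?h = "\<lambda>p::real \<times> 'f. ?x + (fst p *\<^sub>R v + T (snd p))"
  have h0: "?h (0, 0) = ?x" using linear_0[OF T(1)] by simp
  define U where "U = ?h -` O'"
  have U: "open U"
    unfolding U_def by (intro Topological_Spaces.open_vimage O' continuous_on_add continuous_on_const linear_continuous_on blv)
  have U0: "(0, 0) \<in> U" using O'(3) h0 by (simp add: U_def)
  define H where "H = (\<lambda>p. (fst p, F (?h p)))"
  have smh: "smooth_on U ?h" by (intro smooth_on_add smooth_on_const smooth_on_linear blv U)
  have smFh: "smooth_on U (\<lambda>p. F (?h p))"
    using smooth_on_compose[OF smh F(1) _ U] by (auto simp: U_def o_def)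
  have "bounded_linear (\<lambda>s::real. (s, 0::'f))" "bounded_linear (\<lambda>y::'f. (0::real, y))"
    by (auto intro: bounded_linear_Pair bounded_linear_ident bounded_linear_zero)
  then have "smooth_on U (\<lambda>p. (fst p, 0) + (0, F (?h p)))"
    by (intro smooth_on_add smooth_on_bounded_linear[where L = "\<lambda>s. (s, 0)"]
        smooth_on_bounded_linear[where L = "\<lambda>y. (0, y)"] smooth_on_linear[OF bounded_linear_fst] smFh U)
  then have smH: "smooth_on U H" by (simp add: H_def)
  have dh: "(?h has_derivative (\<lambda>p. fst p *\<^sub>R v + T (snd p))) (at (0, 0))"
    using has_derivative_add[OF has_derivative_const bounded_linear_imp_has_derivative[OF blv], of ?x] by simp
  have "(F has_derivative ?L) (at (?h (0, 0)))" using F(2) h0 by simp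
  from has_derivative_compose[OF dh this]
  have "(H has_derivative (\<lambda>p. (fst p, ?L (fst p *\<^sub>R v + T (snd p))))) (at (0, 0))"
    unfolding H_def by (intro has_derivative_Pair has_derivative_fst has_derivative_ident)
  also have "(\<lambda>p. (fst p, ?L (fst p *\<^sub>R v + T (snd p)))) = (\<lambda>p. p)"
    using v LT by (simp add: fun_eq_iff linear_add[OF linL] linear_scale[OF linL])
  finally have dH: "(H has_derivative (\<lambda>p. p)) (at (0, 0))" .
  have frH: "frechet_derivative H (at (0, 0)) = (\<lambda>p. p)" using frechet_derivative_at[OF dH] by simp
  then have inj: "inj (frechet_derivative H (at (0, 0)))" by simp
  show thesis
  proof (rule smooth_inverse_function[OF U U0 smH inj], goal_cases)
    case (1 U' V g)
    note U' = 1(1,2,3) and V = 1(4,5) and hom = 1(6) and g = 1(7)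
    define y0 where "y0 = F ?x"
    have H0: "H (0, 0) = (0, y0)" using h0 by (simp add: H_def y0_def)
    have gH: "g (H p) = p" if "p \<in> U'" for p using hom that by (simp add: homeomorphism_def)
    have Hg: "H (g y) = y" "g y \<in> U'" if "y \<in> V" for y using hom that by (auto simp: homeomorphism_def)
    have yV: "(0, y0) \<in> V" using V(2) H0 by simp
    have g0: "g (0, y0) = (0, 0)" using gH[OF U'(3)] H0 by simp
    \<comment> \<open>The inverse has the identity as derivative at the base point, so the curve
      \<open>g (t, y0)\<close> leaves in direction \<open>(1, 0)\<close>, which the linear part of
      the affine map sends to \<open>v\<close>.\<close>
    have dg: "(g has_derivative (\<lambda>p. p)) (at (0, y0))"
      by (rule has_derivative_inverse_basic[where f = H and f' = "\<lambda>p. p" and T = V])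
        (use dH g0 Hg(1) V yV smooth_on_imp_continuous_on[OF g] in \<open>auto simp: continuous_on_eq_continuous_at o_def id_def\<close>)
    obtain \<epsilon> where \<epsilon>: "\<epsilon> > 0" "cball (0, y0) \<epsilon> \<subseteq> V" using V(1) yV open_contains_cball by blast
    have tV: "(t, y0) \<in> V" if "\<bar>t\<bar> \<le> \<epsilon>" for t using \<epsilon>(2) that by (auto simp: dist_Pair_Pair)
    define \<gamma> where "\<gamma> = (\<lambda>t. ?h (g (t, y0)))"
    show ?case
    proof (rule that[OF \<epsilon>(1), of \<gamma>])
      show "\<gamma> 0 = ?x" using g0 h0 by (simp add: \<gamma>_def)
      have "continuous_on {-\<epsilon>..\<epsilon>} (\<lambda>t. g (t, y0))"
        by (rule continuous_on_compose2[OF smooth_on_imp_continuous_on[OF g]])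
          (use tV in \<open>auto intro!: continuous_intros\<close>)
      then show "continuous_on {-\<epsilon>..\<epsilon>} \<gamma>"
        unfolding \<gamma>_def
        by (intro continuous_on_add continuous_on_const bounded_linear.continuous_on[OF blv])
      have "((\<lambda>t. (t, y0)) has_derivative (\<lambda>s. (s, 0))) (at 0)"
        by (intro has_derivative_Pair has_derivative_ident has_derivative_const)
      from has_derivative_compose[OF this dg] have dgt: "((\<lambda>t. g (t, y0)) has_derivative (\<lambda>s. (s, 0))) (at 0)" .
      have "(?h has_derivative (\<lambda>p. fst p *\<^sub>R v + T (snd p))) (at (g (0, y0)))" using dh g0 by simp
      from has_derivative_compose[OF dgt this] show "(\<gamma> has_derivative (\<lambda>h. h *\<^sub>R v)) (at 0)"
        using linear_0[OF T(1)] by (simp add: \<gamma>_def)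
      fix t assume t: "\<bar>t\<bar> \<le> \<epsilon>"
      have "\<gamma> t \<in> O'" using Hg(2)[OF tV[OF t]] U'(2) by (auto simp: U_def \<gamma>_def)
      then obtain p where p: "p \<in> fst ?a" "\<phi> p \<in> fst ?d" "\<gamma> t = snd ?a p" using O'(2) by auto
      have "F (\<gamma> t) = snd (H (g (t, y0)))" by (simp add: H_def \<gamma>_def)
      then have "F (\<gamma> t) = y0" by (simp only: Hg(1)[OF tV[OF t]] snd_conv)
      then have "snd ?d (\<phi> p) = snd ?d (\<phi> m)"
        using p chart_inv_chart[OF M.is_chart_at p(1)] chart_inv_chart[OF M.is_chart_at M.chart_at(2), of m]
        by (simp add: F_def y0_def)
      then have "\<phi> p = \<phi> m" using chart_inj[OF N.is_chart_at p(2) N.chart_at(2)] by simp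
      then show "\<gamma> t \<in> snd ?a ` (fst ?a \<inter> \<phi> -` {\<phi> m})" using p by auto
    qed
  qed
qed

end

section \<open>Poisson manifolds and NCI systems\<close>

lemma to_circle_eq_iff: "to_circle x = to_circle y \<longleftrightarrow> x - y \<in> \<int>"
  by transfer (rule refl)

section \<open>Circle-valued functions\<close>

context manifold
begin

text \<open>Two lifts differ by a continuous integer-valued function. It is locally constant, so the
  differentials agree and the description in \<open>circle_differential\<close> is well
  defined.\<close>

lemma circle_differential_lift:
  assumes f: "local_lift A U \<theta> f" and p: "p \<in> U"
  shows "circle_differential A \<theta> p = differential A f p"
  unfolding circle_differential_def
proof (rule the_equality)
  show "\<exists>U f'. p \<in> U \<and> local_lift A U \<theta> f' \<and> differential A f p = differential A f' p"
    using assms by blast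
  fix \<xi> assume "\<exists>U f. p \<in> U \<and> local_lift A U \<theta> f \<and> \<xi> = differential A f p"
  then obtain U' f' where f': "p \<in> U'" "local_lift A U' \<theta> f'" "\<xi> = differential A f' p" by blast
  define W where "W = U \<inter> U'"
  have W: "open W" "p \<in> W" using f f' p by (auto simp: W_def local_lift_def)
  have sm: "smooth_fun A W f" "smooth_fun A W f'"
    using f f'(2) smooth_fun_subset[of U f W] smooth_fun_subset[of U' f' W] by (auto simp: W_def local_lift_def)
  have int: "f' q - f q \<in> \<int>" if "q \<in> W" for q
    using f f' that by (auto simp: W_def local_lift_def simp flip: to_circle_eq_iff)
  have "continuous_on W (\<lambda>q. f' q - f q)"
    by (intro continuous_on_diff smooth_fun_continuous sm W)
  then have "open (W \<inter> (\<lambda>q. f' q - f q) -` ball (f' p - f p) 1)"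
    by (intro continuous_open_preimage W open_ball)
  then obtain S where S: "open S" "p \<in> S" "\<And>q. q \<in> S \<Longrightarrow> dist (f' q - f q) (f' p - f p) < 1"
    using W(2) that[of "W \<inter> (\<lambda>q. f' q - f q) -` ball (f' p - f p) 1"] by (auto simp: dist_commute)
  have eq: "f' q = f q + (f' p - f p)" if q: "q \<in> W \<inter> S" for q
  proof -
    have "(f' q - f q) - (f' p - f p) \<in> \<int>" by (rule Ints_diff[OF int int]) (use q W in auto)
    moreover have "\<bar>(f' q - f q) - (f' p - f p)\<bar> < 1" using S(3)[of q] q by (simp add: dist_real_def)
    ultimately have "(f' q - f q) - (f' p - f p) = 0" using Ints_nonzero_abs_less1 by blast
    then show ?thesis by simp
  qed
  have WS: "open (W \<inter> S)" "p \<in> W \<inter> S" using W S by auto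
  have "differential A f' p = differential A (\<lambda>q. f q + (f' p - f p)) p"
    by (rule differential_cong[OF WS eq])
  also have "\<dots> = differential A f p"
    using differential_add[OF smooth_fun_subset[OF sm(1)] smooth_fun_const WS, of "f' p - f p"]
    by (simp add: differential_const)
  finally show "\<xi> = differential A f p" using f' by simp
qed

lemma smooth_circle_fun_lift:
  assumes "smooth_circle_fun A W \<theta>" "p \<in> W"
  obtains U f where "open U" "p \<in> U" "U \<subseteq> W" "smooth_fun A U f" "\<forall>q\<in>U. \<theta> q = to_circle (f q)"
    "\<forall>q\<in>U. circle_differential A \<theta> q = differential A f q"
proof -
  obtain U f where U: "p \<in> U" "U \<subseteq> W" "local_lift A U \<theta> f"
    using assms by (auto simp: smooth_circle_fun_def)
  show thesis
    by (rule that[of U f]) (use U circle_differential_lift[OF U(3)] in \<open>auto simp: local_lift_def\<close>)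
qed

end

lemma covector_sum_Basis: "\<eta> = (\<Sum>l\<in>Basis. blinfun_apply \<eta> l *\<^sub>R blinfun_inner_right l)"
  for \<eta> :: "'e::euclidean_space covector"
proof (rule blinfun_eqI)
  fix v
  have "blinfun_apply \<eta> v = (\<Sum>l\<in>Basis. (v \<bullet> l) *\<^sub>R blinfun_apply \<eta> l)"
    by (rule linear_eq_sum_Basis) (simp add: bounded_linear.linear blinfun.bounded_linear_right)
  then show "blinfun_apply \<eta> v = blinfun_apply (\<Sum>l\<in>Basis. blinfun_apply \<eta> l *\<^sub>R blinfun_inner_right l) v"
    by (simp add: blinfun.sum_left blinfun.scaleR_left inner_commute mult.commute)
qed

section \<open>Calculus of the Poisson bracket\<close>

locale poisson_mfd =
  fixes M :: "('a::{t2_space,second_countable_topology}, 'e::euclidean_space) poisson_manifold"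
  assumes poisson: "poisson M"
begin

sublocale manifold "atlas M"
  by (rule manifold.intro) (rule conjunct1[OF poisson[unfolded poisson_def]])

lemma biv: "bilinear (bivector M p)" and biv_antisym: "bivector M p \<xi> \<eta> = - bivector M p \<eta> \<xi>"
proof -
  have *: "\<forall>p. bilinear (bivector M p) \<and> (\<forall>\<xi> \<eta>. bivector M p \<xi> \<eta> = - bivector M p \<eta> \<xi>)"
    using poisson unfolding poisson_def by (elim conjE)
  then show "bilinear (bivector M p)" by blast
  from * show "bivector M p \<xi> \<eta> = - bivector M p \<eta> \<xi>" by blast
qed

lemma biv_linear: "linear (bivector M p \<xi>)" "linear (\<lambda>\<xi>. bivector M p \<xi> \<eta>)"
  using biv by (auto simp: bilinear_def)

text \<open>Existence for the definite description in \<open>sharp\<close>: in finite dimension a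
  linear functional on covectors is evaluation at a vector, here built from its values on the
  coordinate covectors.\<close>

lemma sharp_apply: "blinfun_apply \<eta> (sharp M p \<xi>) = bivector M p \<xi> \<eta>"
proof -
  define v where "v = (\<Sum>l\<in>Basis. bivector M p \<xi> (blinfun_inner_right l) *\<^sub>R l)"
  have v: "blinfun_apply \<eta> v = bivector M p \<xi> \<eta>" for \<eta>
  proof -
    have "bivector M p \<xi> \<eta> = bivector M p \<xi> (\<Sum>l\<in>Basis. blinfun_apply \<eta> l *\<^sub>R blinfun_inner_right l)"
      using covector_sum_Basis[of \<eta>] by simp
    also have "\<dots> = (\<Sum>l\<in>Basis. blinfun_apply \<eta> l * bivector M p \<xi> (blinfun_inner_right l))"
      by (simp add: linear_sum[OF biv_linear(1)] linear_scale[OF biv_linear(1)])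
    also have "\<dots> = blinfun_apply \<eta> v"
      by (simp add: v_def blinfun.sum_right blinfun.scaleR_right mult.commute)
    finally show ?thesis by simp
  qed
  have "w = v" if w: "\<forall>\<eta>. blinfun_apply \<eta> w = bivector M p \<xi> \<eta>" for w
  proof (rule euclidean_eqI)
    fix l :: 'e
    have "blinfun_apply (blinfun_inner_right l) w = blinfun_apply (blinfun_inner_right l) v"
      by (simp only: w[rule_format] v)
    then show "w \<bullet> l = v \<bullet> l" by (simp add: inner_commute)
  qed
  then have "sharp M p \<xi> = v" unfolding sharp_def by (intro the_equality) (use v in auto)
  with v show ?thesis by simp
qed

lemma sharp_eqI:
  assumes "\<And>\<eta>. blinfun_apply \<eta> v = bivector M p \<xi> \<eta>"
  shows "sharp M p \<xi> = v"
proof (rule euclidean_eqI)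
  fix l :: 'e
  show "sharp M p \<xi> \<bullet> l = v \<bullet> l"
    using sharp_apply[of "blinfun_inner_right l" p \<xi>] assms[of "blinfun_inner_right l"] by (simp add: inner_commute)
qed

lemma sharp_add: "sharp M p (\<xi> + \<eta>) = sharp M p \<xi> + sharp M p \<eta>"
  by (rule sharp_eqI) (simp add: blinfun.add_right sharp_apply linear_add[OF biv_linear(2)])

lemma sharp_scaleR: "sharp M p (k *\<^sub>R \<xi>) = k *\<^sub>R sharp M p \<xi>"
  by (rule sharp_eqI) (simp add: blinfun.scaleR_right sharp_apply linear_scale[OF biv_linear(2)])

lemma sharp_linear: "linear (sharp M p)"
  by (intro linearI sharp_add sharp_scaleR)

lemma hamiltonian_apply: "blinfun_apply \<eta> (hamiltonian M h p) = - bivector M p (differential (atlas M) h p) \<eta>"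
  by (simp add: hamiltonian_def blinfun.minus_right sharp_apply)

lemma circle_hamiltonian_apply:
  "blinfun_apply \<eta> (circle_hamiltonian M \<theta> p) = - bivector M p (circle_differential (atlas M) \<theta> p) \<eta>"
  by (simp add: circle_hamiltonian_def blinfun.minus_right sharp_apply)

lemma bracket_smooth:
  "open W \<Longrightarrow> smooth_fun (atlas M) W f \<Longrightarrow> smooth_fun (atlas M) W g \<Longrightarrow> smooth_fun (atlas M) W (bracket M f g)"
  using poisson unfolding poisson_def by blast

lemma bracket_antisym: "bracket M f g p = - bracket M g f p"
  unfolding bracket_def by (rule biv_antisym)

lemma bracket_cong_right:
  assumes "open W" "p \<in> W" "\<And>q. q \<in> W \<Longrightarrow> g q = g' q"
  shows "bracket M f g p = bracket M f g' p"
  unfolding bracket_def using differential_cong[OF assms] by simp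

lemma bracket_cong_left:
  assumes "open W" "p \<in> W" "\<And>q. q \<in> W \<Longrightarrow> f q = f' q"
  shows "bracket M f g p = bracket M f' g p"
  unfolding bracket_def using differential_cong[OF assms] by simp

lemma bracket_const: "bracket M f (\<lambda>q. k) p = 0" "bracket M (\<lambda>q. k) f p = 0"
  unfolding bracket_def by (simp_all add: differential_const linear_0[OF biv_linear(1)] linear_0[OF biv_linear(2)])

lemma bracket_locally_const:
  assumes "open W" "p \<in> W" "\<And>q. q \<in> W \<Longrightarrow> g q = k"
  shows "bracket M f g p = 0" "bracket M g f p = 0"
  using bracket_cong_right[OF assms, where f = f] bracket_cong_left[OF assms, where g = f] by (simp_all add: bracket_const)

lemma bracket_mult_right:
  assumes "smooth_fun (atlas M) W g" "smooth_fun (atlas M) W h" "open W" "p \<in> W"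
  shows "bracket M f (\<lambda>q. g q * h q) p = g p * bracket M f h p + h p * bracket M f g p"
  unfolding bracket_def differential_mult[OF assms]
  by (simp add: linear_add[OF biv_linear(1)] linear_scale[OF biv_linear(1)])

lemma bracket_sum_right:
  assumes "\<And>i. i \<in> I \<Longrightarrow> smooth_fun (atlas M) W (g i)" "open W" "p \<in> W"
  shows "bracket M f (\<lambda>q. \<Sum>i\<in>I. g i q) p = (\<Sum>i\<in>I. bracket M f (g i) p)"
  using differential_sum[of I W g p] assms by (simp add: bracket_def linear_sum[OF biv_linear(1)])

lemma bracket_minus_right:
  assumes "smooth_fun (atlas M) W g" "open W" "p \<in> W"
  shows "bracket M f (\<lambda>q. - g q) p = - bracket M f g p"
  using bracket_mult_right[OF smooth_fun_const[where k = "-1"] assms, where f = f] bracket_const(1)[of f "-1" p] by simp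

text \<open>Bracketing with \<open>f\<close> is a derivation of the bracket. Double brackets are
  rearranged in this form below.\<close>

lemma bracket_jacobi:
  assumes "open W" "smooth_fun (atlas M) W f" "smooth_fun (atlas M) W g" "smooth_fun (atlas M) W h" "p \<in> W"
  shows "bracket M f (bracket M g h) p = bracket M (bracket M f g) h p + bracket M g (bracket M f h) p"
proof -
  have "bracket M f (bracket M g h) p + bracket M g (bracket M h f) p + bracket M h (bracket M f g) p = 0"
    using poisson assms unfolding poisson_def by blast
  moreover have "bracket M g (bracket M h f) p = - bracket M g (bracket M f h) p"
  proof -
    have "bracket M h f = (\<lambda>q. - bracket M f h q)" by (rule ext) (rule bracket_antisym)
    then show ?thesis
      using bracket_minus_right[OF bracket_smooth[OF assms(1,2,4)] assms(1,5), where f = g] by simp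
  qed
  moreover have "bracket M h (bracket M f g) p = - bracket M (bracket M f g) h p" by (rule bracket_antisym)
  ultimately show ?thesis by linarith
qed

end

section \<open>Fibers of an NCI system\<close>

locale nci =
  fixes M :: "('a::{t2_space,second_countable_topology}, 'e::euclidean_space) poisson_manifold"
    and B :: "('b::{t2_space,second_countable_topology}, 'f::euclidean_space) poisson_manifold"
    and \<phi> :: "'a \<Rightarrow> 'b" and r :: nat
  assumes nci: "nci_system M B \<phi> r"
begin

sublocale PM: poisson_mfd M
  by (rule poisson_mfd.intro) (use nci[unfolded nci_system_def abstract_nci_def] in blast)

sublocale PB: poisson_mfd B
  by (rule poisson_mfd.intro) (use nci[unfolded nci_system_def] in blast)

sublocale mm: manifold_map "atlas M" "atlas B" \<phi>
  by (intro manifold_map.intro manifold_map_axioms.intro PM.manifold_axioms PB.manifold_axioms)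
    (use nci[unfolded nci_system_def submersion_def] in blast)

abbreviation dphi :: "'a \<Rightarrow> 'e \<Rightarrow> 'f" where
  "dphi m \<equiv> map_differential (atlas M) (atlas B) \<phi> m"

abbreviation pb :: "'a \<Rightarrow> 'f covector \<Rightarrow> 'e covector" where
  "pb m \<equiv> pullback (atlas M) (atlas B) \<phi> m"

abbreviation fibers :: "'a set set" where
  "fibers \<equiv> {\<phi> -` {b} | b. True}"

lemma surj_phi: "surj \<phi>" using nci by (simp add: nci_system_def)

lemma surj_dphi: "surj (dphi m)" using nci by (simp add: nci_system_def submersion_def)

lemma dphi_linear: "linear (dphi m)"
  by (rule bounded_linear.linear[OF mm.map_differential_bounded_linear])

lemma pb_linear: "linear (pb m)"
  by (intro linearI blinfun_eqI) (simp_all add: mm.pullback_apply blinfun.add_left blinfun.scaleR_left)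

text \<open>The Poisson map condition concerns functions; linear functions of the preferred
  coordinates realize arbitrary covectors as differentials.\<close>

lemma bivector_pb: "bivector M p (pb p \<xi>) (pb p \<eta>) = bivector B (\<phi> p) \<xi> \<eta>"
proof -
  let ?d = "chart_at (atlas B) (\<phi> p)"
  let ?f = "\<lambda>\<xi> q. blinfun_apply \<xi> (snd ?d q)"
  have W: "open (fst ?d)" "\<phi> p \<in> fst ?d" using is_chart_open(1)[OF PB.is_chart_at] PB.chart_at(2) by auto
  have "poisson_map M B \<phi>" using nci by (simp add: nci_system_def)
  then have pm: "\<forall>W f g. open W \<and> smooth_fun (atlas B) W f \<and> smooth_fun (atlas B) W g \<longrightarrow>
      (\<forall>p\<in>\<phi> -` W. bracket M (f \<circ> \<phi>) (g \<circ> \<phi>) p = bracket B f g (\<phi> p))"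
    unfolding poisson_map_def by (elim conjE)
  have "bracket M (?f \<xi> \<circ> \<phi>) (?f \<eta> \<circ> \<phi>) p = bracket B (?f \<xi>) (?f \<eta>) (\<phi> p)"
    by (rule pm[rule_format, of "fst ?d"]) (use W PB.smooth_fun_coordinate in auto)
  then show ?thesis
    using mm.pullback_differential[OF PB.smooth_fun_coordinate W, of \<xi>]
      mm.pullback_differential[OF PB.smooth_fun_coordinate W, of \<eta>]
    by (simp add: bracket_def PB.differential_coordinate)
qed

text \<open>Covectors in the kernel of the sharp map of \<open>B\<close> therefore yield vectors
  tangent to the fibers.\<close>

lemma dphi_sharp_pb: "dphi p (sharp M p (pb p \<xi>)) = sharp B (\<phi> p) \<xi>"
  by (rule PB.sharp_eqI[symmetric])
    (simp add: PM.sharp_apply bivector_pb flip: mm.pullback_apply)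

lemma foliation_fibers: "foliation (atlas M) UNIV r fibers"
  using nci by (simp add: nci_system_def abstract_nci_def)

lemma foliated_chart_fibers:
  obtains c K where "m \<in> fst c" "foliated_chart (atlas M) r fibers c K"
  using foliation_fibers unfolding foliation_def by blast

lemma plaque_fiber:
  assumes c: "foliated_chart (atlas M) r fibers c K" and m: "m \<in> fst c"
  shows "path_component_set (\<phi> -` {\<phi> m} \<inter> fst c) m = plaque c K m" "plaque c K m \<subseteq> \<phi> -` {\<phi> m}"
proof -
  have "\<forall>L\<in>fibers. \<forall>q\<in>L \<inter> fst c. path_component_set (L \<inter> fst c) q = plaque c K q"
    using c by (simp add: foliated_chart_def)
  then show *: "path_component_set (\<phi> -` {\<phi> m} \<inter> fst c) m = plaque c K m" using m by blast
  show "plaque c K m \<subseteq> \<phi> -` {\<phi> m}" unfolding *[symmetric] using path_component_subset by blast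
qed

text \<open>The curve of \<open>fiber_curve\<close> lives in coordinates; here it is returned to the
  manifold and followed by a function.\<close>

lemma fiber_curve_composition:
  fixes h :: "'a \<Rightarrow> 'g::real_normed_vector"
  assumes h: "smooth_fun (atlas M) S h" "open S" "m \<in> S" and v: "dphi m v = 0"
  obtains \<epsilon> \<gamma> where "\<epsilon> > 0" "\<gamma> 0 = m" "continuous_on {-\<epsilon>..\<epsilon>} \<gamma>"
    "\<And>t. \<bar>t\<bar> \<le> \<epsilon> \<Longrightarrow> \<phi> (\<gamma> t) = \<phi> m"
    "((\<lambda>t. h (\<gamma> t)) has_derivative (\<lambda>s. s *\<^sub>R tangent_map (atlas M) h m v)) (at 0)"
proof -
  show thesis
  proof (rule mm.fiber_curve[OF surj_dphi v], goal_cases)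
  case (1 \<epsilon> \<gamma>)
  let ?a = "chart_at (atlas M) m"
  have in_a: "\<gamma> t \<in> snd ?a ` fst ?a" "\<phi> (chart_inv ?a (\<gamma> t)) = \<phi> m" if "\<bar>t\<bar> \<le> \<epsilon>" for t
    using 1(5)[OF that] chart_inv_chart[OF PM.is_chart_at[of m]] by auto
  show ?case
  proof (rule that[OF 1(1), of "\<lambda>t. chart_inv ?a (\<gamma> t)"])
    show m0: "chart_inv ?a (\<gamma> 0) = m" using 1(2) chart_inv_chart[OF PM.is_chart_at PM.chart_at(2)] by simp
    have "continuous_on (snd ?a ` fst ?a) (chart_inv ?a)"
      using is_chart_homeomorphism[OF PM.is_chart_at[of m]] by (simp add: homeomorphism_def)
    then show "continuous_on {-\<epsilon>..\<epsilon>} (\<lambda>t. chart_inv ?a (\<gamma> t))"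
    proof (rule continuous_on_compose2[OF _ 1(3)])
      show "\<gamma> ` {-\<epsilon>..\<epsilon>} \<subseteq> snd ?a ` fst ?a"
      proof (rule image_subsetI)
        fix t assume "t \<in> {-\<epsilon>..\<epsilon>}"
        then have "\<bar>t\<bar> \<le> \<epsilon>" by auto
        then show "\<gamma> t \<in> snd ?a ` fst ?a" by (rule in_a)
      qed
    qed
    show "\<phi> (chart_inv ?a (\<gamma> t)) = \<phi> m" if "\<bar>t\<bar> \<le> \<epsilon>" for t by (rule in_a(2)[OF that])
    have "(h \<circ> chart_inv ?a has_derivative tangent_map (atlas M) h m) (at (\<gamma> 0))"
      using PM.tangent_map_has_derivative[OF h] 1(2) by simp
    from has_derivative_compose[OF 1(4) this]
    show "((\<lambda>t. h (chart_inv ?a (\<gamma> t))) has_derivative (\<lambda>s. s *\<^sub>R tangent_map (atlas M) h m v)) (at 0)"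
      by (simp add: linear_scale[OF PM.tangent_map_linear[OF h]])
  qed
  qed
qed

text \<open>A coordinate line in a plaque stays in the fiber, which gives one inclusion. For the
  other, plaques are known only as path components of the fiber in a chart, so a kernel vector must
  be the velocity of a curve inside the fiber; the submersion provides it.\<close>

lemma foliation_tangent_fibers: "foliation_tangent (atlas M) r fibers m = {v. dphi m v = 0}"
proof -
  obtain c K where m: "m \<in> fst c" and c: "foliated_chart (atlas M) r fibers c K"
    by (rule foliated_chart_fibers)
  have sc: "smooth_chart (atlas M) c" and K: "K \<subseteq> Basis" using c by (auto simp: foliated_chart_def)
  note ic = smooth_chart_is_chart[OF sc]
  have "dphi m v = 0" if v: "tangent_map (atlas M) (snd c) m v \<in> span K" for v
  proof -
    define w where "w = tangent_map (atlas M) (snd c) m v"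
    let ?d = "chart_at (atlas B) (\<phi> m)" and ?\<gamma> = "PM.chart_line c m w"
    have sd: "smooth_fun (atlas M) (\<phi> -` fst ?d) (snd ?d \<circ> \<phi>)"
      using mm.smooth_fun_compose[OF PB.smooth_fun_chart_map[OF PB.chart_at(3)] is_chart_open(1)[OF PB.is_chart_at]] .
    have od: "open (\<phi> -` fst ?d)" by (rule mm.open_vimage[OF is_chart_open(1)[OF PB.is_chart_at]])
    have \<gamma>0: "?\<gamma> 0 = m" using chart_inv_chart[OF ic m] by (simp add: PM.chart_line_def)
    have d1: "((\<lambda>t. (snd ?d \<circ> \<phi>) (?\<gamma> t)) has_derivative
        (\<lambda>h. h *\<^sub>R tangent_map (atlas M) (snd ?d \<circ> \<phi>) (?\<gamma> 0) v)) (at 0)"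
    proof (rule PM.chart_line_derivative[OF sc sd od])
      show "snd c m + 0 *\<^sub>R w \<in> snd c ` (fst c \<inter> \<phi> -` fst ?d)" using m PB.chart_at(2)[of "\<phi> m"] by auto
      show "tangent_map (atlas M) (snd c) (?\<gamma> 0) v = w" unfolding \<gamma>0 by (simp add: w_def)
    qed
    obtain \<epsilon> where \<epsilon>: "\<epsilon> > 0" "ball (snd c m) \<epsilon> \<subseteq> snd c ` fst c"
      by (rule openE[OF is_chart_open(2)[OF ic] imageI[OF m]])
    define \<eta> where "\<eta> = \<epsilon> / (norm w + 1)"
    have \<eta>: "\<eta> > 0" using \<epsilon> by (simp add: \<eta>_def add_nonneg_pos)
    have fib: "\<phi> (?\<gamma> t) = \<phi> m" if t: "t \<in> {-\<eta><..<\<eta>}" for t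
    proof -
      have "norm (t *\<^sub>R w) \<le> \<bar>t\<bar> * (norm w + 1)" by (simp add: mult_left_mono)
      also have "\<dots> < \<eta> * (norm w + 1)" using t by (intro mult_strict_right_mono) (auto intro: add_nonneg_pos)
      also have "\<dots> = \<epsilon>" using add_nonneg_pos[of "norm w" 1] by (simp add: \<eta>_def)
      finally have "snd c m + t *\<^sub>R w \<in> snd c ` fst c" using \<epsilon>(2) by (auto simp: dist_norm)
      then have "?\<gamma> t \<in> plaque c K m"
        using v chart_chart_inv[OF ic] chart_inv_in[OF ic]
        by (auto simp: mem_plaque_iff[OF K] PM.chart_line_def w_def intro: span_scale)
      then show ?thesis using plaque_fiber(2)[OF c m] by auto
    qed
    have d2: "((\<lambda>t. (snd ?d \<circ> \<phi>) (?\<gamma> t)) has_derivative (\<lambda>h. 0)) (at 0)"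
      by (rule has_derivative_transform_within_open[of "\<lambda>t. snd ?d (\<phi> m)" _ 0 UNIV "{-\<eta><..<\<eta>}"])
        (use \<eta> fib in auto)
    from fun_cong[OF has_derivative_unique[OF d1 d2], of 1] show ?thesis
      by (simp add: \<gamma>0 map_differential_def)
  qed
  moreover have "tangent_map (atlas M) (snd c) m v \<in> span K" if v: "dphi m v = 0" for v
  proof -
    have "tangent_map (atlas M) (snd c) m v \<bullet> i = 0" if i: "i \<in> Basis - K" for i
    proof (rule fiber_curve_composition[OF PM.smooth_fun_chart_component[OF sc, of i] is_chart_open(1)[OF ic] m v], goal_cases)
      case (1 \<epsilon> \<gamma>)
      have "0 \<in> {-\<epsilon>..\<epsilon>}" using 1 by simp
      with 1(3) have "continuous (at 0 within {-\<epsilon>..\<epsilon>}) \<gamma>"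
        by (simp add: continuous_on_eq_continuous_within)
      have op: "openin (top_of_set {-\<epsilon>..\<epsilon>}) ({-\<epsilon>..\<epsilon>} \<inter> \<gamma> -` fst c)"
        by (rule continuous_openin_preimage_gen[OF 1(3) is_chart_open(1)[OF ic]])
      have mem: "0 \<in> {-\<epsilon>..\<epsilon>} \<inter> \<gamma> -` fst c" using 1 m by simp
      from conjunct2[OF op[unfolded openin_contains_ball], THEN bspec, OF mem]
      obtain e where e: "e > 0" "ball 0 e \<inter> {-\<epsilon>..\<epsilon>} \<subseteq> {-\<epsilon>..\<epsilon>} \<inter> \<gamma> -` fst c" by (elim exE conjE)
      \<comment> \<open>On this interval the curve stays both in the fiber and in the chart, so its
        image lies in one path component, the plaque of \<open>m\<close>.\<close>
      define \<eta> where "\<eta> = min e \<epsilon>"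
      have \<eta>: "\<eta> > 0" using e 1 by (simp add: \<eta>_def)
      let ?I = "{-\<eta><..<\<eta>}"
      have sub: "\<gamma> t \<in> \<phi> -` {\<phi> m} \<inter> fst c" if "t \<in> ?I" for t
      proof -
        have "\<bar>t\<bar> \<le> \<epsilon>" "t \<in> ball 0 e \<inter> {-\<epsilon>..\<epsilon>}" using that by (auto simp: \<eta>_def)
        then show ?thesis using 1(4)[of t] e(2) by auto
      qed
      have "continuous_on ?I \<gamma>" by (rule continuous_on_subset[OF 1(3)]) (auto simp: \<eta>_def)
      moreover have "path_connected ?I" by (simp add: convex_imp_path_connected)
      ultimately have pc: "path_connected (\<gamma> ` ?I)" by (rule path_connected_continuous_image)
      have "\<gamma> 0 \<in> \<gamma> ` ?I" using \<eta> by (intro imageI) simp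
      then have m\<gamma>: "m \<in> \<gamma> ` ?I" by (simp only: 1(2))
      have "\<gamma> ` ?I \<subseteq> path_component_set (\<phi> -` {\<phi> m} \<inter> fst c) m"
        by (rule path_component_maximal[OF m\<gamma> pc image_subsetI[OF sub]])
      then have pl: "\<gamma> t \<in> plaque c K m" if "t \<in> ?I" for t
        using plaque_fiber(1)[OF c m] that by blast
      have "((\<lambda>t. snd c (\<gamma> t) \<bullet> i) has_derivative (\<lambda>h. 0)) (at 0)"
        by (rule has_derivative_transform_within_open[of "\<lambda>t. snd c m \<bullet> i" _ 0 UNIV ?I])
          (use \<eta> pl i in \<open>auto simp: plaque_def\<close>)
      from fun_cong[OF has_derivative_unique[OF this 1(5)], of 1]
      show ?case
        using PM.differential_chart_component[OF sc m, of i v]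
          PM.differential_apply[OF PM.smooth_fun_chart_component[OF sc] is_chart_open(1)[OF ic] m, of i v] by simp
    qed
    then show ?thesis by (simp add: span_Basis_subset[OF K])
  qed
  ultimately show ?thesis unfolding PM.foliation_tangent_foliated_chart[OF c m] by blast
qed

lemma first_integrals:
  obtains N f where "open N" "m \<in> N" "\<And>i. i < r \<Longrightarrow> smooth_fun (atlas M) N (f i)"
    "\<And>p. p \<in> N \<Longrightarrow> span ((\<lambda>i. hamiltonian M (f i) p) ` {..<r}) = {v. dphi p v = 0}"
proof -
  obtain N f where "open N" "m \<in> N" "\<forall>i<r. local_first_integral (atlas M) fibers N (f i)"
    "\<forall>p\<in>N. span ((\<lambda>i. hamiltonian M (f i) p) ` {..<r}) = foliation_tangent (atlas M) r fibers p"
    using nci unfolding nci_system_def abstract_nci_def by blast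
  then show thesis
    unfolding local_first_integral_def foliation_tangent_fibers by (intro that[of N f]) blast+
qed

text \<open>A fiber is a leaf, hence path connected. Locally a path stays in a plaque, and nearby
  points of the plaque are joined to \<open>m\<close> by coordinate lines with vertical
  velocity.\<close>

lemma constant_on_fiber:
  fixes h :: "'a \<Rightarrow> real"
  assumes h: "smooth_fun (atlas M) S h" "open S" "\<phi> -` {b} \<subseteq> S"
    and zero: "\<And>m v. \<phi> m = b \<Longrightarrow> dphi m v = 0 \<Longrightarrow> tangent_map (atlas M) h m v = 0"
    and xy: "\<phi> x = b" "\<phi> y = b"
  shows "h x = h y"
proof -
  let ?L = "\<phi> -` {b}"
  have L: "?L \<in> fibers" by blast
  have "path_connected ?L" using foliation_fibers L unfolding foliation_def by blast
  then obtain g where g: "path g" "path_image g \<subseteq> ?L" "pathstart g = x" "pathfinish g = y"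
    using xy unfolding path_connected_def by (metis vimage_singleton_eq)
  have "h (pathstart g) = h (g 1)"
  proof (rule local_relation_path[where R = "\<lambda>x y. h x = h y", OF g(1)])
    fix t :: real assume t: "t \<in> {0..1}"
    define m where "m = g t"
    have "g t \<in> path_image g" using t unfolding path_image_def by (rule imageI)
    then have mb: "\<phi> m = b" using g(2) by (auto simp: m_def)
    obtain c K where m: "m \<in> fst c" and c: "foliated_chart (atlas M) r fibers c K"
      by (rule foliated_chart_fibers)
    have sc: "smooth_chart (atlas M) c" and K: "K \<subseteq> Basis" using c by (auto simp: foliated_chart_def)
    note ic = smooth_chart_is_chart[OF sc]
    have "snd c m \<in> snd c ` (fst c \<inter> S)" using m mb h(3) by auto
    from openE[OF open_chart_image[OF ic h(2)] this]
    obtain \<epsilon> where \<epsilon>: "\<epsilon> > 0" "ball (snd c m) \<epsilon> \<subseteq> snd c ` (fst c \<inter> S)" .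
    define N where "N = fst c \<inter> snd c -` ball (snd c m) \<epsilon>"
    have "open N" unfolding N_def
      using is_chart_homeomorphism[OF ic] is_chart_open[OF ic]
      by (intro continuous_open_preimage) (auto simp: homeomorphism_def)
    moreover have "N \<subseteq> fst c" "g t \<in> N" using m \<epsilon>(1) by (auto simp: N_def m_def)
    ultimately have N: "open N" "N \<subseteq> fst c" "g t \<in> N" by blast+
    obtain T where T: "openin (top_of_set {0..1}) T" "t \<in> T" "g ` T \<subseteq> N \<inter> plaque c K (g t)"
      by (rule PM.path_plaque_local[OF c L g(1,2) t N])
    have const: "h m = h q" if q: "q \<in> N" "q \<in> plaque c K m" for q
    proof -
      define w where "w = snd c q - snd c m"
      have w: "w \<in> span K" and qc: "q \<in> fst c" using q by (auto simp: mem_plaque_iff[OF K] w_def)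
      have seg: "snd c m + t *\<^sub>R w \<in> snd c ` (fst c \<inter> S)" if t: "t \<in> {0..1}" for t
      proof -
        have "snd c m \<in> ball (snd c m) \<epsilon>" "snd c q \<in> ball (snd c m) \<epsilon>" using q \<epsilon> by (auto simp: N_def)
        then have "closed_segment (snd c m) (snd c q) \<subseteq> ball (snd c m) \<epsilon>"
          by (simp add: closed_segment_subset)
        moreover have "snd c m + t *\<^sub>R w \<in> closed_segment (snd c m) (snd c q)"
          using t by (auto simp: in_segment w_def algebra_simps intro!: exI[of _ t])
        ultimately show ?thesis using \<epsilon> by blast
      qed
      have "h (PM.chart_line c m w 1) = h (PM.chart_line c m w 0)"
      proof (rule PM.chart_line_constant[OF sc h(1,2) seg])
        fix t :: real and v assume t: "t \<in> {0..1}"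
        let ?q = "PM.chart_line c m w t"
        assume v: "tangent_map (atlas M) (snd c) ?q v = w"
        have sc': "snd c m + t *\<^sub>R w \<in> snd c ` fst c" using seg[OF t] by blast
        have q': "?q \<in> fst c" unfolding PM.chart_line_def by (rule chart_inv_in[OF ic sc'])
        have "?q \<in> plaque c K m"
          unfolding mem_plaque_iff[OF K] using q' w chart_chart_inv[OF ic sc']
          by (simp add: PM.chart_line_def span_scale)
        then have "\<phi> ?q = b" using plaque_fiber(2)[OF c m] mb by auto
        moreover have "v \<in> foliation_tangent (atlas M) r fibers ?q"
          unfolding PM.foliation_tangent_foliated_chart[OF c q'] using v w by simp
        then have "dphi ?q v = 0" unfolding foliation_tangent_fibers by simp
        ultimately show "tangent_map (atlas M) h ?q v = 0" by (rule zero)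
      qed
      then show ?thesis using PM.chart_line_end[OF ic m qc] by (simp add: w_def)
    qed
    show "\<exists>T. openin (top_of_set {0..1}) T \<and> t \<in> T \<and> (\<forall>s\<in>T. h (g t) = h (g s))"
    proof (intro exI conjI ballI)
      show "openin (top_of_set {0..1}) T" "t \<in> T" by (fact T)+
      fix s assume "s \<in> T"
      then have "g s \<in> N" "g s \<in> plaque c K m" using T(3) by (auto simp: m_def)
      from const[OF this] show "h (g t) = h (g s)" by (simp add: m_def)
    qed
  qed auto
  then show ?thesis using g by (simp add: pathfinish_def)
qed

text \<open>Along a curve in the fiber with velocity \<open>v\<close>, the function has a local
  maximum at time 0.\<close>

lemma tangent_zero_at_fiber_max:
  fixes h :: "'a \<Rightarrow> real"
  assumes h: "smooth_fun (atlas M) S h" "open S" "m \<in> S" and max: "\<And>q. \<phi> q = \<phi> m \<Longrightarrow> h q \<le> h m"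
    and v: "dphi m v = 0"
  shows "tangent_map (atlas M) h m v = 0"
proof (rule fiber_curve_composition[OF h v], goal_cases)
  case (1 \<epsilon> \<gamma>)
  have "\<forall>\<^sub>F t in at 0. t \<in> {-\<epsilon><..<\<epsilon>}"
    by (rule eventually_at_in_open') (use 1 in auto)
  then have "\<forall>\<^sub>F t in at 0. h (\<gamma> t) \<le> h (\<gamma> 0)"
  proof eventually_elim
    case (elim t)
    then have "\<bar>t\<bar> \<le> \<epsilon>" by auto
    then show ?case using max[OF 1(4)] 1(2) by simp
  qed
  from fun_cong[OF has_derivative_local_max[OF 1(5) this], of 1] show ?case by simp
qed

end

section \<open>Angle fields\<close>

context nci
begin

text \<open>All members of the coset give the same vector, so \<open>the_elem\<close> is applied to
  a singleton.\<close>

lemma action_vector_class: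
  assumes \<xi>: "\<xi> \<in> \<alpha>" and \<alpha>: "\<And>\<eta>. \<eta> \<in> \<alpha> \<Longrightarrow> \<eta> - \<xi> \<in> pull_kernel M B \<phi> (\<phi> m)"
  shows "action_vector M B \<phi> \<alpha> m = sharp M m (pb m \<xi>)"
proof -
  have "sharp M m (pb m \<eta>) = sharp M m (pb m \<xi>)" if "\<eta> \<in> \<alpha>" for \<eta>
  proof -
    have "sharp M m (pb m (\<eta> - \<xi>)) = 0" using \<alpha>[OF that] by (simp add: pull_kernel_def)
    then show ?thesis by (simp add: linear_diff[OF pb_linear] linear_diff[OF PM.sharp_linear])
  qed
  then have "(\<lambda>\<xi>. sharp M m (pb m \<xi>)) ` \<alpha> = (\<lambda>_. sharp M m (pb m \<xi>)) ` \<alpha>" by (rule image_cong[OF refl])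
  also have "\<dots> = {sharp M m (pb m \<xi>)}" using \<xi> by (simp add: image_constant)
  finally have "(\<lambda>\<xi>. sharp M m (pb m \<xi>)) ` \<alpha> = {sharp M m (pb m \<xi>)}" .
  then show ?thesis by (simp add: action_vector_def)
qed

lemma zero_pull_kernel: "0 \<in> pull_kernel M B \<phi> b"
  by (simp add: pull_kernel_def linear_0[OF pb_linear] linear_0[OF PM.sharp_linear])

lemma action_vector_action_class:
  assumes "\<xi> \<in> sharp_kernel B (\<phi> m)"
  shows "action_vector M B \<phi> (action_class M B \<phi> (\<phi> m) \<xi>) m = sharp M m (pb m \<xi>)"
  by (rule action_vector_class) (use assms zero_pull_kernel in \<open>auto simp: action_class_def\<close>)

end

section \<open>Action fields and angle differentials\<close>

locale nci_angle = nci M B \<phi> r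
  for M :: "('a::{t2_space,second_countable_topology}, 'e::euclidean_space) poisson_manifold"
    and B :: "('b::{t2_space,second_countable_topology}, 'f::euclidean_space) poisson_manifold"
    and \<phi> :: "'a \<Rightarrow> 'b" and r :: nat +
  fixes V :: "'b set" and e :: "nat \<Rightarrow> 'b \<Rightarrow> 'f covector set" and \<theta> :: "nat \<Rightarrow> 'a \<Rightarrow> circle"
  assumes compact: "compact_fibers \<phi>" and V: "open V"
    and triv: "lattice_trivialization M B \<phi> r V e"
    and angle: "adapted_angle_variables M B \<phi> r V e \<theta>"
begin

abbreviation act :: "nat \<Rightarrow> 'a \<Rightarrow> 'e" where
  "act i m \<equiv> section_field M B \<phi> (e i) m"

abbreviation d\<theta> :: "nat \<Rightarrow> 'a \<Rightarrow> 'e covector" where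
  "d\<theta> i m \<equiv> circle_differential (atlas M) (\<theta> i) m"

text \<open>Finitely many neighbourhoods are intersected, so that one-forms representing all r
  lattice sections are available at once.\<close>

lemma action_forms:
  assumes b: "b \<in> V"
  obtains U \<alpha> where "open U" "b \<in> U" "U \<subseteq> V" "\<And>i. i < r \<Longrightarrow> smooth_one_form (atlas B) U (\<alpha> i)"
    "\<And>i q. i < r \<Longrightarrow> q \<in> U \<Longrightarrow> sharp B q (\<alpha> i q) = 0"
    "\<And>i m. i < r \<Longrightarrow> \<phi> m \<in> U \<Longrightarrow> act i m = sharp M m (pb m (\<alpha> i (\<phi> m)))"
proof -
  define P where "P = (\<lambda>i p. open (fst p) \<and> b \<in> fst p \<and> fst p \<subseteq> V \<and> smooth_one_form (atlas B) (fst p) (snd p) \<and>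
      (\<forall>q\<in>fst p. snd p q \<in> sharp_kernel B q \<and> e i q = action_class M B \<phi> q (snd p q)))"
  have "\<exists>p. P i p" if i: "i < r" for i
  proof -
    have "lattice_section M B \<phi> V (e i)" using triv i by (simp add: lattice_trivialization_def)
    then obtain U \<alpha> where "open U \<and> b \<in> U \<and> U \<subseteq> V \<and> smooth_one_form (atlas B) U \<alpha> \<and>
      (\<forall>q\<in>U. \<alpha> q \<in> sharp_kernel B q \<and> e i q = action_class M B \<phi> q (\<alpha> q))"
      unfolding lattice_section_def using b by blast
    then have "P i (U, \<alpha>)" unfolding P_def fst_conv snd_conv .
    then show ?thesis ..
  qed
  then have "\<forall>i\<in>{..<r}. \<exists>p. P i p" by simp
  then obtain p where p: "\<forall>i\<in>{..<r}. P i (p i)" by (rule bchoice[elim_format]) blast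
  define U where "U = (\<lambda>i. fst (p i))"
  define \<alpha> where "\<alpha> = (\<lambda>i. snd (p i))"
  have *: "open (U i) \<and> b \<in> U i \<and> U i \<subseteq> V \<and> smooth_one_form (atlas B) (U i) (\<alpha> i) \<and>
      (\<forall>q\<in>U i. \<alpha> i q \<in> sharp_kernel B q \<and> e i q = action_class M B \<phi> q (\<alpha> i q))" if "i < r" for i
    using bspec[OF p, of i] that unfolding P_def U_def \<alpha>_def by simp
  have U: "\<And>i. i < r \<Longrightarrow> open (U i)" "\<And>i. i < r \<Longrightarrow> b \<in> U i" "\<And>i. i < r \<Longrightarrow> U i \<subseteq> V"
    and \<alpha>: "\<And>i. i < r \<Longrightarrow> smooth_one_form (atlas B) (U i) (\<alpha> i)"
    "\<And>i q. i < r \<Longrightarrow> q \<in> U i \<Longrightarrow> \<alpha> i q \<in> sharp_kernel B q"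
    "\<And>i q. i < r \<Longrightarrow> q \<in> U i \<Longrightarrow> e i q = action_class M B \<phi> q (\<alpha> i q)"
    using * by blast+
  \<comment> \<open>The factor \<open>V\<close> keeps the set inside \<open>V\<close> also for r =
    0, where the intersection over i is the whole space.\<close>
  let ?W = "V \<inter> (\<Inter>i\<in>{..<r}. U i)"
  show thesis
  proof (rule that[of ?W \<alpha>])
    show "open ?W" using U(1) V by (intro open_Int open_INT) auto
    show "b \<in> ?W" using b U(2) by auto
    show "?W \<subseteq> V" by blast
    fix i assume i: "i < r"
    then have WU: "?W \<subseteq> U i" by blast
    show "smooth_one_form (atlas B) ?W (\<alpha> i)"
      using \<alpha>(1)[OF i] WU unfolding smooth_one_form_def by (meson subset_trans)
    show "sharp B q (\<alpha> i q) = 0" if "q \<in> ?W" for q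
      using \<alpha>(2)[OF i, of q] that WU by (auto simp: sharp_kernel_def)
    show "act i m = sharp M m (pb m (\<alpha> i (\<phi> m)))" if "\<phi> m \<in> ?W" for m
    proof -
      have mU: "\<phi> m \<in> U i" using that WU by blast
      then have "act i m = action_vector M B \<phi> (action_class M B \<phi> (\<phi> m) (\<alpha> i (\<phi> m))) m"
        unfolding section_field_def using \<alpha>(3)[OF i mU] by simp
      also have "\<dots> = sharp M m (pb m (\<alpha> i (\<phi> m)))"
        by (rule action_vector_action_class[OF \<alpha>(2)[OF i mU]])
      finally show ?thesis .
    qed
  qed
qed

lemma act_vertical:
  assumes "i < r" "\<phi> m \<in> V"
  shows "dphi m (act i m) = 0"
proof (rule action_forms[OF assms(2)], goal_cases)
  case (1 U \<alpha>)
  have "act i m = sharp M m (pb m (\<alpha> i (\<phi> m)))" by (rule 1(6)[OF assms(1) 1(2)])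
  moreover have "sharp B (\<phi> m) (\<alpha> i (\<phi> m)) = 0" by (rule 1(5)[OF assms(1) 1(2)])
  ultimately show ?case by (simp add: dphi_sharp_pb)
qed

lemma d\<theta>_act: "i < r \<Longrightarrow> j < r \<Longrightarrow> \<phi> m \<in> V \<Longrightarrow> blinfun_apply (d\<theta> j m) (act i m) = (if i = j then 1 else 0)"
  and biv_d\<theta>: "i < r \<Longrightarrow> j < r \<Longrightarrow> \<phi> m \<in> V \<Longrightarrow> bivector M m (d\<theta> i m) (d\<theta> j m) = 0"
  and smooth_\<theta>: "i < r \<Longrightarrow> smooth_circle_fun (atlas M) (\<phi> -` V) (\<theta> i)"
  using angle by (auto simp: adapted_angle_variables_def)

text \<open>The kernel is spanned by r Hamiltonian vectors, and the r action vectors in it are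
  independent by duality with the angle differentials.\<close>

lemma vertical_span:
  assumes m: "\<phi> m \<in> V"
  shows "span ((\<lambda>i. act i m) ` {..<r}) = {v. dphi m v = 0}"
proof (rule first_integrals[of m], goal_cases)
  case (1 N f)
  have "span ((\<lambda>i. act i m) ` {..<r}) = span ((\<lambda>i. hamiltonian M (f i) m) ` {..<r})"
  proof (rule dual_family_span[where \<xi> = "\<lambda>j. blinfun_apply (d\<theta> j m)"])
    show "linear (blinfun_apply (d\<theta> j m))" for j
      by (rule bounded_linear.linear[OF blinfun.bounded_linear_right])
    show "act i m \<in> span ((\<lambda>i. hamiltonian M (f i) m) ` {..<r})" if "i < r" for i
      using act_vertical[OF that m] 1(4)[OF 1(2)] by simp
  qed (use d\<theta>_act m in auto)
  then show ?case using 1(4)[OF 1(2)] by simp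
qed

lemma linear_zero_vertical:
  assumes m: "\<phi> m \<in> V" and lin: "linear l" and zero: "\<And>i. i < r \<Longrightarrow> l (act i m) = 0" and v: "dphi m v = 0"
  shows "l v = 0"
proof -
  have "v \<in> span ((\<lambda>i. act i m) ` {..<r})" using vertical_span[OF m] v by simp
  then show ?thesis
    by (rule linear_eq_0_on_span[OF lin, rotated]) (use zero in auto)
qed

lemma lift:
  assumes "i < r" "\<phi> m \<in> V"
  obtains U f where "open U" "m \<in> U" "U \<subseteq> \<phi> -` V" "smooth_fun (atlas M) U f"
    "\<forall>q\<in>U. d\<theta> i q = differential (atlas M) f q"
  by (rule PM.smooth_circle_fun_lift[OF smooth_\<theta>[OF assms(1)], of m]) (use assms in blast)+

text \<open>The bracket of an angle variable with a function from the base. It is written with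
  differentials because the angle variable need not have a real lift on the whole domain; locally it
  is the bracket with a lift.\<close>

definition pairing :: "nat \<Rightarrow> ('b \<Rightarrow> real) \<Rightarrow> 'a \<Rightarrow> real" where
  "pairing i g m = bivector M m (d\<theta> i m) (differential (atlas M) (g \<circ> \<phi>) m)"

lemma pairing_lift:
  assumes "\<forall>q\<in>U. d\<theta> i q = differential (atlas M) f q" "q \<in> U"
  shows "pairing i g q = bracket M f (g \<circ> \<phi>) q"
  using assms by (simp add: pairing_def bracket_def)

lemma pairing_smooth:
  assumes i: "i < r" and W: "open W" "W \<subseteq> V" and g: "smooth_fun (atlas B) W g"
  shows "smooth_fun (atlas M) (\<phi> -` W) (pairing i g)"
proof (rule PM.smooth_fun_local[OF _ mm.open_vimage[OF W(1)]])
  fix m assume m: "m \<in> \<phi> -` W"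
  then have "\<phi> m \<in> V" using W by auto
  from lift[OF i this] obtain U f where U: "open U" "m \<in> U" "smooth_fun (atlas M) U f"
    and f: "\<forall>q\<in>U. d\<theta> i q = differential (atlas M) f q" by metis
  define S where "S = U \<inter> \<phi> -` W"
  have S: "open S" "m \<in> S" using U m mm.open_vimage[OF W(1)] by (auto simp: S_def)
  have "smooth_fun (atlas M) S (bracket M f (g \<circ> \<phi>))"
    by (intro PM.bracket_smooth S PM.smooth_fun_subset[OF U(3)] PM.smooth_fun_subset[OF mm.smooth_fun_compose[OF g W(1)]])
      (auto simp: S_def)
  then have "smooth_fun (atlas M) S (pairing i g)"
    by (rule PM.smooth_fun_cong[OF _ S(1)]) (simp add: pairing_lift[OF f] S_def)
  with S show "\<exists>U. open U \<and> m \<in> U \<and> smooth_fun (atlas M) U (pairing i g)" by blast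
qed

text \<open>With first integrals \<open>f\<^sub>k\<close> spanning the fibers and \<open>A\<^sub>j\<close> the action fields, \<open>A\<^sub>j\<close> commutes with \<open>{f\<^sub>k, \<cdot>}\<close>.
  Since \<open>A\<^sub>j \<theta>\<^sub>i\<close> is constant, \<open>u = {f\<^sub>k, \<theta>\<^sub>i}\<close> is constant along the fibers, so \<open>{f\<^sub>l, {f\<^sub>k, w}} = {f\<^sub>l, {u, g}} = 0\<close>
  for \<open>w = {\<theta>\<^sub>i, g}\<close>, and \<open>A\<^sub>j w\<close> is constant on each fiber. At a maximum of \<open>w\<close> on the compact fiber it vanishes.\<close>

lemma pairing_constant:
  assumes i: "i < r" and W: "open W" "W \<subseteq> V" and g: "smooth_fun (atlas B) W g"
    and xy: "\<phi> x \<in> W" "\<phi> x = \<phi> y"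
  shows "pairing i g x = pairing i g y"
proof -
  define b where "b = \<phi> x"
  have bV: "b \<in> V" "b \<in> W" using xy W by (auto simp: b_def)
  define w where "w = pairing i g"
  have smw: "smooth_fun (atlas M) (\<phi> -` W) w" unfolding w_def by (rule pairing_smooth[OF i W g])
  have oW: "open (\<phi> -` W)" by (rule mm.open_vimage[OF W(1)])
  show ?thesis
  proof (rule action_forms[OF bV(1)], goal_cases)
    case (1 U \<alpha>)
    note U = 1(1,2,3) and \<alpha> = 1(4,5,6)
    define d where "d = chart_at (atlas B) b"
    have d: "smooth_chart (atlas B) d" "b \<in> fst d" "open (fst d)"
      using PB.chart_at is_chart_open(1)[OF PB.is_chart_at] by (auto simp: d_def)
    define W1 where "W1 = W \<inter> U \<inter> fst d"
    have W1: "open W1" "b \<in> W1" "W1 \<subseteq> W" "W1 \<subseteq> U" "W1 \<subseteq> fst d" "W1 \<subseteq> V"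
      using W U d bV by (auto simp: W1_def)
    define S where "S = \<phi> -` W1"
    have S: "open S" "S \<subseteq> \<phi> -` W" unfolding S_def using mm.open_vimage[OF W1(1)] W1 by auto
    have SV: "\<phi> p \<in> V" "\<phi> p \<in> U" "\<phi> p \<in> fst d" "\<phi> p \<in> W1" if "p \<in> S" for p using that W1 by (auto simp: S_def)
    \<comment> \<open>The coefficients of the representing one-forms in base coordinates; both
      \<open>a\<close> and \<open>xc\<close> are functions on the base.\<close>
    define a where "a = (\<lambda>j l q. blinfun_apply (\<alpha> j q) (PB.coord_field d l q))"
    define xc where "xc = (\<lambda>l q. snd d q \<bullet> l)"
    have sma: "smooth_fun (atlas B) W1 (a j l)" if j: "j < r" for j l
      using \<alpha>(1)[OF j] W1 PB.smooth_vector_field_subset[OF PB.smooth_vector_field_coord[OF d(1)] W1(5), of l]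
      unfolding smooth_one_form_def a_def by blast
    have smx: "smooth_fun (atlas B) W1 (xc l)" for l
      unfolding xc_def by (rule PB.smooth_fun_subset[OF PB.smooth_fun_chart_component[OF d(1)] W1(5)])
    have smg: "smooth_fun (atlas B) W1 g" by (rule PB.smooth_fun_subset[OF g W1(3)])
    have pbS: "smooth_fun (atlas M) S (h \<circ> \<phi>)" if "smooth_fun (atlas B) W1 h" for h :: "'b \<Rightarrow> real"
      unfolding S_def by (rule mm.smooth_fun_compose[OF that W1(1)])
    \<comment> \<open>The derivative along an action field, as a combination of brackets with
      functions from the base, so that the Jacobi identity can be applied to it.\<close>
    define A where "A = (\<lambda>j h q. \<Sum>l\<in>Basis. (a j l \<circ> \<phi>) q * bracket M (xc l \<circ> \<phi>) h q)"
    have A_act: "A j h q = tangent_map (atlas M) h q (act j q)"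
      if j: "j < r" and h: "smooth_fun (atlas M) N h" "open N" "N \<subseteq> S" "q \<in> N" for j h N q
    proof -
      have qS: "q \<in> S" using h by auto
      have "\<alpha> j (\<phi> q) = (\<Sum>l\<in>Basis. a j l (\<phi> q) *\<^sub>R differential (atlas B) (xc l) (\<phi> q))"
        unfolding a_def xc_def by (rule PB.covector_eq_sum[OF d(1) SV(3)[OF qS]])
      then have "pb q (\<alpha> j (\<phi> q)) = (\<Sum>l\<in>Basis. a j l (\<phi> q) *\<^sub>R differential (atlas M) (xc l \<circ> \<phi>) q)"
        by (simp add: linear_sum[OF pb_linear] linear_scale[OF pb_linear] mm.pullback_differential[OF smx W1(1) SV(4)[OF qS]])
      then have "bivector M q (pb q (\<alpha> j (\<phi> q))) (differential (atlas M) h q) = A j h q"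
        by (simp add: A_def bracket_def linear_sum[OF PM.biv_linear(2)] linear_scale[OF PM.biv_linear(2)])
      then show ?thesis
        using \<alpha>(3)[OF j SV(2)[OF qS]] by (simp add: PM.sharp_apply flip: PM.differential_apply[OF h(1,2,4)])
    qed
    have A_smooth: "smooth_fun (atlas M) N (A j h)"
      if j: "j < r" and h: "smooth_fun (atlas M) N h" "open N" "N \<subseteq> S" for j h N
      unfolding A_def
      by (intro PM.smooth_fun_sum PM.smooth_fun_mult PM.bracket_smooth h
          PM.smooth_fun_subset[OF pbS[OF sma[OF j]] h(3)] PM.smooth_fun_subset[OF pbS[OF smx] h(3)])
    have vert: "tangent_map (atlas M) h q v = 0"
      if h: "smooth_fun (atlas M) N h" "open N" "N \<subseteq> S" "q \<in> N" and z: "\<And>j. j < r \<Longrightarrow> A j h q = 0" and v: "dphi q v = 0"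
      for h N q v
      by (rule linear_zero_vertical[OF SV(1) PM.tangent_map_linear[OF h(1,2,4)] _ v])
        (use h z A_act[OF _ h] in auto)
    have A_local: "tangent_map (atlas M) (A j w) m v = 0"
      if j: "j < r" and m: "m \<in> S" and v: "dphi m v = 0" for j m v
    proof (rule first_integrals[of m], goal_cases)
      case (1 N0 f)
      note N0 = 1(1,2) and f = 1(3) and ham = 1(4)
      show ?case
      proof (rule lift[OF i SV(1)[OF m]], goal_cases)
        case (1 N1 t)
        note N1 = 1(1,2) and t = 1(4,5)
        define N where "N = N0 \<inter> N1 \<inter> S"
        have N: "open N" "m \<in> N" "N \<subseteq> S" "N \<subseteq> N0" "N \<subseteq> N1" using N0 N1 S m by (auto simp: N_def)
        have smf: "smooth_fun (atlas M) N (f k)" if "k < r" for k by (rule PM.smooth_fun_subset[OF f[OF that] N(4)])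
        have smt: "smooth_fun (atlas M) N t" by (rule PM.smooth_fun_subset[OF t(1) N(5)])
        have smB: "smooth_fun (atlas M) N (h \<circ> \<phi>)" if "smooth_fun (atlas B) W1 h" for h :: "'b \<Rightarrow> real"
          by (rule PM.smooth_fun_subset[OF pbS[OF that] N(3)])
        \<comment> \<open>Vertical derivatives are tested in two ways, by the Hamiltonian fields of
          the \<open>f k\<close> and by the action fields, since both families span the kernel. The
          argument alternates between the two tests.\<close>
        have vertf: "bracket M (f k) h q = 0"
          if k: "k < r" and h: "smooth_fun (atlas M) N h" and q: "q \<in> N"
            and z: "\<And>v. dphi q v = 0 \<Longrightarrow> tangent_map (atlas M) h q v = 0" for k h q
        proof -
          have "hamiltonian M (f k) q \<in> span ((\<lambda>i. hamiltonian M (f i) q) ` {..<r})"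
            by (rule span_base) (use k in auto)
          then have "dphi q (hamiltonian M (f k) q) = 0" using ham[of q] q N(4) by auto
          from z[OF this] show ?thesis
            using PM.hamiltonian_apply[of "differential (atlas M) h q" "f k" q]
            by (simp add: PM.differential_apply[OF h N(1) q] bracket_def)
        qed
        have fvert: "tangent_map (atlas M) h q v = 0"
          if h: "smooth_fun (atlas M) N h" and q: "q \<in> N" and z: "\<And>k. k < r \<Longrightarrow> bracket M (f k) h q = 0"
            and v: "dphi q v = 0" for h q v
        proof -
          have v': "v \<in> span ((\<lambda>i. hamiltonian M (f i) q) ` {..<r})" using ham[of q] q N(4) v by auto
          show ?thesis
          proof (rule linear_eq_0_on_span[OF PM.tangent_map_linear[OF h N(1) q] _ v'])
            fix u assume "u \<in> (\<lambda>i. hamiltonian M (f i) q) ` {..<r}"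
            then obtain k where k: "k < r" "u = hamiltonian M (f k) q" by auto
            then show "tangent_map (atlas M) h q u = 0"
              using PM.hamiltonian_apply[of "differential (atlas M) h q" "f k" q] z[OF k(1)]
              by (simp add: PM.differential_apply[OF h N(1) q] bracket_def)
          qed
        qed
        have fB: "bracket M (f k) (h \<circ> \<phi>) q = 0" if k: "k < r" and h: "smooth_fun (atlas B) W1 h" and q: "q \<in> N" for k h q
        proof (rule vertf[OF k smB[OF h] q])
          fix v assume "dphi q v = 0"
          then show "tangent_map (atlas M) (h \<circ> \<phi>) q v = 0"
            using mm.tangent_map_compose[OF h W1(1) SV(4)[OF subsetD[OF N(3) q]], of v]
              linear_0[OF PB.tangent_map_linear[OF h W1(1) SV(4)[OF subsetD[OF N(3) q]]]] by simp
        qed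
        \<comment> \<open>Bracketing with \<open>f k\<close> annihilates functions from the base, so
          it passes over the coefficients and over the brackets with \<open>xc l\<close>.\<close>
        have fA: "bracket M (f k) (A j h) q = A j (bracket M (f k) h) q"
          if k: "k < r" and j: "j < r" and h: "smooth_fun (atlas M) N h" and q: "q \<in> N" for k j h q
        proof -
          have smbr: "smooth_fun (atlas M) N (bracket M (xc l \<circ> \<phi>) h)" for l
            by (rule PM.bracket_smooth[OF N(1) smB[OF smx] h])
          have "bracket M (f k) (A j h) q = (\<Sum>l\<in>Basis. bracket M (f k) (\<lambda>q. (a j l \<circ> \<phi>) q * bracket M (xc l \<circ> \<phi>) h q) q)"
            unfolding A_def
            by (rule PM.bracket_sum_right[OF PM.smooth_fun_mult[OF smB[OF sma[OF j]] smbr N(1)] N(1) q])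
          also have "\<dots> = (\<Sum>l\<in>Basis. (a j l \<circ> \<phi>) q * bracket M (xc l \<circ> \<phi>) (bracket M (f k) h) q)"
          proof (rule sum.cong[OF refl])
            fix l :: 'f
            have "bracket M (bracket M (f k) (xc l \<circ> \<phi>)) h q = 0"
              by (rule PM.bracket_locally_const(2)[OF N(1) q]) (rule fB[OF k smx])
            then have "bracket M (f k) (bracket M (xc l \<circ> \<phi>) h) q = bracket M (xc l \<circ> \<phi>) (bracket M (f k) h) q"
              using PM.bracket_jacobi[OF N(1) smf[OF k] smB[OF smx] h q] by simp
            then show "bracket M (f k) (\<lambda>q. (a j l \<circ> \<phi>) q * bracket M (xc l \<circ> \<phi>) h q) q =
                (a j l \<circ> \<phi>) q * bracket M (xc l \<circ> \<phi>) (bracket M (f k) h) q"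
              using PM.bracket_mult_right[OF smB[OF sma[OF j]] smbr N(1) q, where f = "f k"] fB[OF k sma[OF j] q]
              by simp
          qed
          finally show ?thesis by (simp add: A_def)
        qed
        have At: "A j t q = (if j = i then 1 else 0)" if j: "j < r" and q: "q \<in> N" for j q
        proof -
          have "A j t q = blinfun_apply (differential (atlas M) t q) (act j q)"
            using A_act[OF j smt N(1,3) q] PM.differential_apply[OF smt N(1) q] by simp
          also have "differential (atlas M) t q = d\<theta> i q" using t(2) q N(5) by auto
          also have "blinfun_apply (d\<theta> i q) (act j q) = (if j = i then 1 else 0)"
            by (rule d\<theta>_act[OF j i SV(1)[OF subsetD[OF N(3) q]]])
          finally show ?thesis .
        qed
        have smft: "smooth_fun (atlas M) N (bracket M (f k) t)" if "k < r" for k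
          by (rule PM.bracket_smooth[OF N(1) smf[OF that] smt])
        have Au: "A j (bracket M (f k) t) q = 0" if "k < r" "j < r" "q \<in> N" for k j q
        proof -
          have "A j (bracket M (f k) t) q = bracket M (f k) (A j t) q" by (rule fA[OF that(1,2) smt that(3), symmetric])
          also have "\<dots> = 0" by (rule PM.bracket_locally_const(1)[OF N(1) that(3)]) (rule At[OF that(2)])
          finally show ?thesis .
        qed
        \<comment> \<open>A function annihilated by all action fields is annihilated by every
          vertical vector, in particular by the Hamiltonian vector of \<open>f l\<close>.\<close>
        have ffu: "bracket M (f l) (bracket M (f k) t) q = 0" if k: "k < r" and l: "l < r" and q: "q \<in> N" for k l q
          by (rule vertf[OF l smft[OF k] q], rule vert[OF smft[OF k] N(1,3) q Au[OF k _ q]])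
        have smfu: "smooth_fun (atlas M) N (bracket M (bracket M (f k) t) (g \<circ> \<phi>))" if "k < r" for k
          by (rule PM.bracket_smooth[OF N(1) smft[OF that] smB[OF smg]])
        have w_eq: "w q = bracket M t (g \<circ> \<phi>) q" if "q \<in> N" for q
          unfolding w_def by (rule pairing_lift[OF t(2)]) (use that N(5) in auto)
        have smwN: "smooth_fun (atlas M) N w" by (rule PM.smooth_fun_subset[OF smw]) (use N(3) S(2) in auto)
        have fw: "bracket M (f k) w q = bracket M (bracket M (f k) t) (g \<circ> \<phi>) q" if k: "k < r" and q: "q \<in> N" for k q
        proof -
          have "bracket M (f k) w q = bracket M (f k) (bracket M t (g \<circ> \<phi>)) q"
            by (rule PM.bracket_cong_right[OF N(1) q w_eq])
          also have "\<dots> = bracket M (bracket M (f k) t) (g \<circ> \<phi>) q + bracket M t (bracket M (f k) (g \<circ> \<phi>)) q"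
            by (rule PM.bracket_jacobi[OF N(1) smf[OF k] smt smB[OF smg] q])
          also have "bracket M t (bracket M (f k) (g \<circ> \<phi>)) q = 0"
            by (rule PM.bracket_locally_const(1)[OF N(1) q]) (rule fB[OF k smg])
          finally show ?thesis unfolding add_0_right .
        qed
        have smfw: "smooth_fun (atlas M) N (bracket M (f k) w)" if "k < r" for k
          by (rule PM.bracket_smooth[OF N(1) smf[OF that] smwN])
        have ffw: "bracket M (f l) (bracket M (f k) w) q = 0" if k: "k < r" and l: "l < r" and q: "q \<in> N" for k l q
        proof -
          have "bracket M (f l) (bracket M (f k) w) q = bracket M (f l) (bracket M (bracket M (f k) t) (g \<circ> \<phi>)) q"
            by (rule PM.bracket_cong_right[OF N(1) q fw[OF k]])
          also have "\<dots> = bracket M (bracket M (f l) (bracket M (f k) t)) (g \<circ> \<phi>) q +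
              bracket M (bracket M (f k) t) (bracket M (f l) (g \<circ> \<phi>)) q"
            by (rule PM.bracket_jacobi[OF N(1) smf[OF l] smft[OF k] smB[OF smg] q])
          also have "bracket M (bracket M (f l) (bracket M (f k) t)) (g \<circ> \<phi>) q = 0"
            by (rule PM.bracket_locally_const(2)[OF N(1) q]) (rule ffu[OF k l])
          also have "bracket M (bracket M (f k) t) (bracket M (f l) (g \<circ> \<phi>)) q = 0"
            by (rule PM.bracket_locally_const(1)[OF N(1) q]) (rule fB[OF l smg])
          finally show ?thesis by simp
        qed
        have Afw: "A j (bracket M (f k) w) q = 0" if k: "k < r" and j: "j < r" and q: "q \<in> N" for k j q
          unfolding A_act[OF j smfw[OF k] N(1,3) q]
          by (rule fvert[OF smfw[OF k] q ffw[OF k _ q] act_vertical[OF j SV(1)[OF subsetD[OF N(3) q]]]])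
        show ?case
        \<comment> \<open>The test by the \<open>f k\<close> is used for \<open>A j w\<close>: the
          bracket with \<open>f k\<close> moves inside \<open>A j\<close>, and the result vanishes
          by \<open>Afw\<close>.\<close>
        proof (rule fvert[OF A_smooth[OF j smwN N(1,3)] N(2) _ v])
          fix k assume k: "k < r"
          show "bracket M (f k) (A j w) m = 0"
            using fA[OF k j smwN N(2)] Afw[OF k j N(2)] by simp
        qed
      qed
    qed
    have smwS: "smooth_fun (atlas M) S w" by (rule PM.smooth_fun_subset[OF smw S(2)])
    have fibS: "\<phi> -` {b} \<subseteq> S" using W1(2) by (auto simp: S_def)
    have A_const: "A j w p = A j w q" if j: "j < r" and pq: "\<phi> p = b" "\<phi> q = b" for j p q
      by (rule constant_on_fiber[OF A_smooth[OF j smwS S(1) order_refl] S(1) fibS _ pq])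
        (use A_local[OF j] fibS in auto)
    have "compact (\<phi> -` {b})" using compact by (simp add: compact_fibers_def)
    moreover have "\<phi> -` {b} \<noteq> {}" by (auto simp: b_def)
    moreover have "continuous_on (\<phi> -` {b}) w"
      by (rule continuous_on_subset[OF PM.smooth_fun_continuous[OF smwS S(1)] fibS])
    ultimately obtain m0 where m0: "\<phi> m0 = b" "\<And>q. \<phi> q = b \<Longrightarrow> w q \<le> w m0"
      using continuous_attains_sup[of "\<phi> -` {b}" w] by auto
    have m0S: "m0 \<in> S" using m0(1) fibS by auto
    have A0: "A j w m0 = 0" if j: "j < r" for j
      unfolding A_act[OF j smwS S(1) order_refl m0S]
      by (rule tangent_zero_at_fiber_max[OF smwS S(1) m0S _ act_vertical[OF j SV(1)[OF m0S]]]) (use m0 in auto)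
    have Aw: "A j w q = 0" if "j < r" "\<phi> q = b" for j q
      using A_const[OF that(1) that(2) m0(1)] A0[OF that(1)] by simp
    have "w x = w y"
    proof (rule constant_on_fiber[OF smwS S(1) fibS])
      show "tangent_map (atlas M) w m v = 0" if "\<phi> m = b" "dphi m v = 0" for m v
        by (rule vert[OF smwS S(1) order_refl _ _ that(2)]) (use that fibS Aw in auto)
    qed (use xy in \<open>auto simp: b_def\<close>)
    then show ?case by (simp add: w_def)
  qed
qed

section \<open>The projected fields on the base\<close>

abbreviation Y :: "nat \<Rightarrow> 'b \<Rightarrow> 'f" where "Y i \<equiv> angle_field M B \<phi> (\<theta> i)"

text \<open>The definite description in \<open>pushforward\<close> needs independence of the point
  of the fiber. Each coordinate of the projected vector is minus a pairing with a coordinate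
  function of the base, and pairings are constant on fibers.\<close>

lemma dphi_circle_hamiltonian:
  assumes i: "i < r" and m: "\<phi> m \<in> V"
  shows "dphi m (circle_hamiltonian M (\<theta> i) m) = Y i (\<phi> m)"
proof -
  have eq: "dphi x (circle_hamiltonian M (\<theta> i) x) = dphi y (circle_hamiltonian M (\<theta> i) y)"
    if "\<phi> x = \<phi> m" "\<phi> y = \<phi> m" for x y
  proof (rule euclidean_eqI)
    fix l :: 'f
    let ?d = "chart_at (atlas B) (\<phi> m)"
    define W where "W = fst ?d \<inter> V"
    have W: "open W" "\<phi> m \<in> W" "W \<subseteq> V" using V m PB.chart_at(2) is_chart_open(1)[OF PB.is_chart_at] by (auto simp: W_def)
    let ?x = "\<lambda>q. snd ?d q \<bullet> l"
    have smx: "smooth_fun (atlas B) W ?x"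
      by (rule PB.smooth_fun_subset[OF PB.smooth_fun_chart_component[OF PB.chart_at(3)]]) (simp add: W_def)
    have comp: "dphi z v \<bullet> l = blinfun_apply (differential (atlas M) (?x \<circ> \<phi>) z) v" if z: "\<phi> z = \<phi> m" for z v
    proof -
      have zW: "\<phi> z \<in> W" using z W by simp
      have "blinfun_apply (differential (atlas M) (?x \<circ> \<phi>) z) v = tangent_map (atlas B) ?x (\<phi> z) (dphi z v)"
        using PM.differential_apply[OF mm.smooth_fun_compose[OF smx W(1)] mm.open_vimage[OF W(1)], of z v] zW
          mm.tangent_map_compose[OF smx W(1) zW] by simp
      also have "\<dots> = dphi z v \<bullet> l"
        using PB.differential_chart_component[OF PB.chart_at(3,2), of "\<phi> m" l "dphi z v"]
          PB.differential_apply[OF smx W(1,2), of "dphi z v"] z by (simp add: PB.tangent_map_chart_at)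
      finally show ?thesis by simp
    qed
    have "dphi z (circle_hamiltonian M (\<theta> i) z) \<bullet> l = - pairing i ?x z" if z: "\<phi> z = \<phi> m" for z
      unfolding comp[OF z] by (simp add: PM.circle_hamiltonian_apply pairing_def)
    then show "dphi x (circle_hamiltonian M (\<theta> i) x) \<bullet> l = dphi y (circle_hamiltonian M (\<theta> i) y) \<bullet> l"
      using pairing_constant[OF i W(1,3) smx, of x y] that W(2) by simp
  qed
  show ?thesis
    unfolding angle_field_def pushforward_def
  proof (rule the_equality[symmetric])
    show "\<forall>x\<in>\<phi> -` {\<phi> m}. dphi x (circle_hamiltonian M (\<theta> i) x) = dphi m (circle_hamiltonian M (\<theta> i) m)"
    proof
      fix x assume "x \<in> \<phi> -` {\<phi> m}"
      then have "\<phi> x = \<phi> m" by simp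
      then show "dphi x (circle_hamiltonian M (\<theta> i) x) = dphi m (circle_hamiltonian M (\<theta> i) m)"
        by (rule eq[OF _ refl])
    qed
    fix y assume "\<forall>x\<in>\<phi> -` {\<phi> m}. dphi x (circle_hamiltonian M (\<theta> i) x) = y"
    from bspec[OF this, of m] show "y = dphi m (circle_hamiltonian M (\<theta> i) m)" by simp
  qed
qed

lemma tangent_Y:
  assumes i: "i < r" and W: "open W" "W \<subseteq> V" and g: "smooth_fun (atlas B) W g" and m: "\<phi> m \<in> W"
  shows "tangent_map (atlas B) g (\<phi> m) (Y i (\<phi> m)) = - pairing i g m"
proof -
  have "tangent_map (atlas B) g (\<phi> m) (Y i (\<phi> m)) = tangent_map (atlas M) (g \<circ> \<phi>) m (circle_hamiltonian M (\<theta> i) m)"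
    unfolding mm.tangent_map_compose[OF g W(1) m] dphi_circle_hamiltonian[OF i subsetD[OF W(2) m]] ..
  also have "\<dots> = blinfun_apply (differential (atlas M) (g \<circ> \<phi>) m) (circle_hamiltonian M (\<theta> i) m)"
    using PM.differential_apply[OF mm.smooth_fun_compose[OF g W(1)] mm.open_vimage[OF W(1)]] m by simp
  also have "\<dots> = - pairing i g m" by (simp add: PM.circle_hamiltonian_apply pairing_def)
  finally show ?thesis .
qed

text \<open>Composed with \<phi> the function is minus a pairing, which is smooth; smoothness then
  descends along the submersion.\<close>

lemma tangent_Y_smooth:
  assumes i: "i < r" and W: "open W" "W \<subseteq> V" and g: "smooth_fun (atlas B) W (g :: 'b \<Rightarrow> real)"
  shows "smooth_fun (atlas B) W (\<lambda>b. tangent_map (atlas B) g b (Y i b))"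
proof (rule mm.smooth_fun_descend[OF surj_phi surj_dphi W(1)])
  have "smooth_fun (atlas M) (\<phi> -` W) (\<lambda>m. - pairing i g m)"
    by (intro PM.smooth_fun_bounded_linear[where L = uminus] bounded_linear_minus bounded_linear_ident
        pairing_smooth[OF i W g] mm.open_vimage W)
  then show "smooth_fun (atlas M) (\<phi> -` W) ((\<lambda>b. tangent_map (atlas B) g b (Y i b)) \<circ> \<phi>)"
    by (rule PM.smooth_fun_cong[OF _ mm.open_vimage[OF W(1)]]) (simp add: tangent_Y[OF i W g])
qed

lemma smooth_Y: assumes i: "i < r" shows "smooth_vector_field (atlas B) V (Y i)"
  unfolding smooth_vector_field_def
proof (intro allI impI, elim conjE)
  fix W and g :: "'b \<Rightarrow> real" assume W: "open W" "W \<subseteq> V" and g: "smooth_fun (atlas B) W g"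
  show "smooth_fun (atlas B) W (\<lambda>p. blinfun_apply (differential (atlas B) g p) (Y i p))"
    by (rule PB.smooth_fun_cong[OF tangent_Y_smooth[OF i W g] W(1)])
      (simp add: PB.differential_apply[OF g W(1)])
qed

lemma independent_Y:
  assumes b: "b \<in> V"
  shows "inj_on (\<lambda>i. Y i b) {..<r}" "independent ((\<lambda>i. Y i b) ` {..<r})"
proof -
  obtain m where m: "\<phi> m = b" using surj_phi by (metis surjD)
  have "inj_on (\<lambda>i. Y i b) {..<r} \<and> independent ((\<lambda>i. Y i b) ` {..<r})"
  proof (rule action_forms[OF b], goal_cases)
    case (1 U \<alpha>)
    have lin: "linear (blinfun_apply (\<alpha> j b))" for j
      by (rule bounded_linear.linear[OF blinfun.bounded_linear_right])
    \<comment> \<open>Two signs cancel, one from the convention for Hamiltonian fields and one from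
      antisymmetry, so the value is that of \<open>d\<theta> i\<close> on
      \<open>act j\<close>.\<close>
    have dual: "blinfun_apply (\<alpha> j b) (Y i b) = (if i = j then 1 else 0)" if ij: "i < r" "j < r" for i j
    proof -
      have "blinfun_apply (\<alpha> j b) (Y i b) = blinfun_apply (pb m (\<alpha> j (\<phi> m))) (circle_hamiltonian M (\<theta> i) m)"
        using dphi_circle_hamiltonian[OF ij(1), of m] b by (simp add: mm.pullback_apply m)
      also have "\<dots> = bivector M m (pb m (\<alpha> j (\<phi> m))) (d\<theta> i m)"
        using PM.biv_antisym[of m "d\<theta> i m"] by (simp add: PM.circle_hamiltonian_apply)
      also have "\<dots> = blinfun_apply (d\<theta> i m) (act j m)"
        using 1(6)[OF ij(2), of m] 1(2) m by (simp add: PM.sharp_apply)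
      also have "\<dots> = (if i = j then 1 else 0)" using d\<theta>_act[OF ij(2,1), of m] b m by auto
      finally show ?thesis .
    qed
    from dual_family_independent[of r "\<lambda>j. blinfun_apply (\<alpha> j b)" "\<lambda>i. Y i b", OF lin dual]
    show ?case by blast
  qed
  then show "inj_on (\<lambda>i. Y i b) {..<r}" "independent ((\<lambda>i. Y i b) ` {..<r})" by blast+
qed

text \<open>With local lifts s and t of the two angle variables, the second derivatives are
  {t,{s,g}} and {s,{t,g}} with g pulled back to the total space, the signs cancelling in pairs. By
  the Jacobi identity they differ by {{s,t},g}, and {s,t} vanishes near the point.\<close>

lemma commuting_Y:
  assumes W: "open W" "W \<subseteq> V" and g: "smooth_fun (atlas B) W (g :: 'b \<Rightarrow> real)" and ij: "i < r" "j < r" and b: "b \<in> W"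
  shows "tangent_map (atlas B) (\<lambda>q. tangent_map (atlas B) g q (Y i q)) b (Y j b) =
    tangent_map (atlas B) (\<lambda>q. tangent_map (atlas B) g q (Y j q)) b (Y i b)"
proof -
  obtain m where m: "\<phi> m = b" using surj_phi by (metis surjD)
  have mV: "\<phi> m \<in> V" "\<phi> m \<in> W" using b W m by auto
  obtain U s where U: "open U" "m \<in> U" "smooth_fun (atlas M) U s" "\<forall>q\<in>U. d\<theta> i q = differential (atlas M) s q"
    using lift[OF ij(1) mV(1)] by metis
  obtain U' t where U': "open U'" "m \<in> U'" "smooth_fun (atlas M) U' t" "\<forall>q\<in>U'. d\<theta> j q = differential (atlas M) t q"
    using lift[OF ij(2) mV(1)] by metis
  define N where "N = U \<inter> U' \<inter> \<phi> -` W"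
  have N: "open N" "m \<in> N" "N \<subseteq> U" "N \<subseteq> U'" "N \<subseteq> \<phi> -` W"
    using U U' mm.open_vimage[OF W(1)] mV by (auto simp: N_def)
  have sm: "smooth_fun (atlas M) N s" "smooth_fun (atlas M) N t" "smooth_fun (atlas M) N (g \<circ> \<phi>)"
    using PM.smooth_fun_subset[OF U(3) N(3)] PM.smooth_fun_subset[OF U'(3) N(4)]
      PM.smooth_fun_subset[OF mm.smooth_fun_compose[OF g W(1)] N(5)] by auto
  have second: "tangent_map (atlas B) (\<lambda>q. tangent_map (atlas B) g q (Y k q)) b (Y l b) = bracket M v (bracket M u (g \<circ> \<phi>)) m"
    if kl: "k < r" "l < r" and u: "\<forall>q\<in>N. d\<theta> k q = differential (atlas M) u q" and v: "\<forall>q\<in>N. d\<theta> l q = differential (atlas M) v q"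
      and smu: "smooth_fun (atlas M) N u" for k l u v
  proof -
    let ?G = "\<lambda>q. tangent_map (atlas B) g q (Y k q)"
    have "tangent_map (atlas B) ?G b (Y l b) = - pairing l ?G m"
      using tangent_Y[OF kl(2) W tangent_Y_smooth[OF kl(1) W g] mV(2)] m by simp
    also have "pairing l ?G m = bracket M v (?G \<circ> \<phi>) m" by (rule pairing_lift[OF v N(2)])
    also have "bracket M v (?G \<circ> \<phi>) m = bracket M v (\<lambda>q. - bracket M u (g \<circ> \<phi>) q) m"
      by (rule PM.bracket_cong_right[OF N(1,2)])
        (use N(5) in \<open>auto simp: tangent_Y[OF kl(1) W g] pairing_lift[OF u]\<close>)
    also have "\<dots> = - bracket M v (bracket M u (g \<circ> \<phi>)) m"
      by (rule PM.bracket_minus_right[OF PM.bracket_smooth[OF N(1) smu sm(3)] N(1,2)])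
    finally show ?thesis by simp
  qed
  have ds: "\<forall>q\<in>N. d\<theta> i q = differential (atlas M) s q" "\<forall>q\<in>N. d\<theta> j q = differential (atlas M) t q"
    using U(4) U'(4) N by auto
  have "bracket M (bracket M s t) (g \<circ> \<phi>) m = 0"
  proof (rule PM.bracket_locally_const(2)[OF N(1,2)])
    fix q assume q: "q \<in> N"
    then have "\<phi> q \<in> V" using N(5) W by auto
    from biv_d\<theta>[OF ij this] show "bracket M s t q = 0" using ds q by (simp add: bracket_def)
  qed
  then show ?thesis
    using PM.bracket_jacobi[OF N(1) sm N(2)] second[OF ij ds sm(1)] second[OF ij(2,1) ds(2,1) sm(2)] by simp
qed

theorem integrable_angle_distribution:
  "integrable_distribution (atlas B) V r (angle_distribution M B \<phi> r \<theta>)"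
proof -
  have "integrable_distribution (atlas B) V r (\<lambda>p. span ((\<lambda>i. Y i p) ` {..<r}))"
    by (rule PB.commuting_fields_integrable[OF V smooth_Y]) (use independent_Y commuting_Y in blast)+
  then show ?thesis by (simp add: angle_distribution_def[abs_def])
qed

theorem angle_lattice_bundle:
  "lattice_bundle (atlas B) V r (angle_distribution M B \<phi> r \<theta>) (angle_lattice M B \<phi> r \<theta>)"
  unfolding lattice_bundle_def
proof (intro ballI)
  fix p assume "p \<in> V"
  then show "\<exists>U y. open U \<and> p \<in> U \<and> U \<subseteq> V \<and> (\<forall>i<r. smooth_vector_field (atlas B) U (y i)) \<and>
     (\<forall>q\<in>U. inj_on (\<lambda>i. y i q) {..<r} \<and> independent ((\<lambda>i. y i q) ` {..<r}) \<and>
        span ((\<lambda>i. y i q) ` {..<r}) = angle_distribution M B \<phi> r \<theta> q \<and>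
        angle_lattice M B \<phi> r \<theta> q = int_span r (\<lambda>i. y i q))"
    using V smooth_Y independent_Y
    by (intro exI[of _ V] exI[of _ Y]) (simp add: angle_distribution_def angle_lattice_def)
qed

end

section \<open>Independence of the angle variables\<close>

lemma int_span_subset_span: "int_span r y \<subseteq> span (y ` {..<r})"
proof
  fix x assume "x \<in> int_span r y"
  then obtain n :: "nat \<Rightarrow> int" where x: "x = (\<Sum>i<r. of_int (n i) *\<^sub>R y i)" by (auto simp: int_span_def)
  show "x \<in> span (y ` {..<r})" unfolding x by (intro span_sum span_scale span_base imageI)
qed

lemma int_span_mono:
  assumes "\<And>j. j < r \<Longrightarrow> y' j \<in> int_span r y"
  shows "int_span r y' \<subseteq> int_span r y"
proof
  have "\<forall>j\<in>{..<r}. \<exists>c :: nat \<Rightarrow> int. y' j = (\<Sum>i<r. of_int (c i) *\<^sub>R y i)"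
    using assms by (auto simp: int_span_def)
  then obtain c :: "nat \<Rightarrow> nat \<Rightarrow> int" where c: "\<forall>j\<in>{..<r}. y' j = (\<Sum>i<r. of_int (c j i) *\<^sub>R y i)"
    by (rule bchoice[elim_format]) blast
  fix x assume "x \<in> int_span r y'"
  then obtain n :: "nat \<Rightarrow> int" where "x = (\<Sum>j<r. of_int (n j) *\<^sub>R y' j)" by (auto simp: int_span_def)
  also have "\<dots> = (\<Sum>j<r. \<Sum>i<r. of_int (n j * c j i) *\<^sub>R y i)"
    by (rule sum.cong[OF refl]) (simp add: bspec[OF c] scaleR_sum_right)
  also have "\<dots> = (\<Sum>i<r. \<Sum>j<r. of_int (n j * c j i) *\<^sub>R y i)" by (rule sum.swap)
  also have "\<dots> = (\<Sum>i<r. of_int (\<Sum>j<r. n j * c j i) *\<^sub>R y i)" by (simp add: scaleR_sum_left)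
  finally show "x \<in> int_span r y"
    unfolding int_span_def by (intro CollectI exI[of _ "\<lambda>i. \<Sum>j<r. n j * c j i"] conjI TrueI)
qed

lemma sum_mult_delta:
  fixes a :: "nat \<Rightarrow> real"
  assumes "j < r"
  shows "(\<Sum>i<r. a i * (if i = j then 1 else 0)) = a j" "(\<Sum>i<r. a i * (if j = i then 1 else 0)) = a j"
proof -
  have *: "a i * (if i = j then 1 else 0) = (if i = j then a i else 0)" "(j = i) = (i = j)" for i by auto
  show "(\<Sum>i<r. a i * (if i = j then 1 else 0)) = a j" "(\<Sum>i<r. a i * (if j = i then 1 else 0)) = a j"
    unfolding * using assms by simp_all
qed

lemma level_foliation_constant:
  assumes "L \<in> level_foliation r W \<theta>" "p \<in> L" "q \<in> L" "i < r"
  shows "\<theta> i q = \<theta> i p"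
proof -
  obtain c where "L \<in> components {m \<in> W. \<forall>i<r. \<theta> i m = c i}" using assms(1) by (auto simp: level_foliation_def)
  from in_components_subset[OF this] have "p \<in> {m \<in> W. \<forall>i<r. \<theta> i m = c i}" "q \<in> {m \<in> W. \<forall>i<r. \<theta> i m = c i}"
    using assms(2,3) by blast+
  then show ?thesis using assms(4) by simp
qed

context manifold
begin

text \<open>Along a coordinate line in the plaque a real lift changes continuously and by integers
  only. So it is constant near the base point and its derivative vanishes.\<close>

lemma circle_differential_plaque:
  assumes c: "smooth_chart A c" "K \<subseteq> Basis" and p: "p \<in> fst c" and \<theta>: "smooth_circle_fun A W \<theta>" "p \<in> W"
    and const: "\<And>q. q \<in> plaque c K p \<Longrightarrow> \<theta> q = \<theta> p" and v: "tangent_map A (snd c) p v \<in> span K"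
  shows "blinfun_apply (circle_differential A \<theta> p) v = 0"
proof (rule smooth_circle_fun_lift[OF \<theta>], goal_cases)
  case (1 U f)
  note ic = smooth_chart_is_chart[OF c(1)]
  define w where "w = tangent_map A (snd c) p v"
  let ?\<gamma> = "chart_line c p w"
  have \<gamma>0: "?\<gamma> 0 = p" using chart_inv_chart[OF ic p] by (simp add: chart_line_def)
  have D: "((\<lambda>t. f (?\<gamma> t)) has_derivative (\<lambda>h. h *\<^sub>R tangent_map A f p v)) (at 0)"
  proof -
    have q0: "snd c p + 0 *\<^sub>R w \<in> snd c ` (fst c \<inter> U)" using p 1(2) by simp
    have v0: "tangent_map A (snd c) (?\<gamma> 0) v = w" unfolding \<gamma>0 by (rule w_def[symmetric])
    show ?thesis using chart_line_derivative[OF c(1) 1(4,1) q0 v0, of UNIV] unfolding \<gamma>0 .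
  qed
  let ?O = "snd c ` (fst c \<inter> U)"
  have "((\<lambda>t. snd c p + t *\<^sub>R w) \<longlongrightarrow> snd c p + 0 *\<^sub>R w) (at 0)" by (intro tendsto_intros)
  then have "\<forall>\<^sub>F t in at 0. snd c p + t *\<^sub>R w \<in> ?O"
    by (rule topological_tendstoD[OF _ open_chart_image[OF ic 1(1)]]) (use p 1(2) in auto)
  moreover have "(\<lambda>t. f (?\<gamma> t)) \<midarrow>0\<rightarrow> f (?\<gamma> 0)"
    using has_derivative_continuous[OF D] unfolding isCont_def .
  then have "\<forall>\<^sub>F t in at 0. dist (f (?\<gamma> t)) (f p) < 1" unfolding \<gamma>0 by (rule tendstoD) simp
  ultimately have ev: "\<forall>\<^sub>F t in at 0. f (?\<gamma> t) = f p"
  proof eventually_elim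
    case (elim t)
    then obtain q where q: "q \<in> fst c" "q \<in> U" "snd c q = snd c p + t *\<^sub>R w" by force
    then have \<gamma>t: "?\<gamma> t = q" using chart_inv_chart[OF ic q(1)] by (simp add: chart_line_def)
    have "q \<in> plaque c K p" using q v by (simp add: mem_plaque_iff[OF c(2)] w_def span_scale)
    from const[OF this] have "to_circle (f q) = to_circle (f p)" unfolding bspec[OF 1(5) q(2)] bspec[OF 1(5,2)] .
    then have "f q - f p \<in> \<int>" by (simp only: to_circle_eq_iff)
    moreover have "\<bar>f q - f p\<bar> < 1" using elim(2) by (simp add: \<gamma>t dist_real_def)
    ultimately have "f q - f p = 0" by (rule Ints_nonzero_abs_less1)
    then show ?case by (simp add: \<gamma>t)
  qed
  have "((\<lambda>t. f p) has_derivative (\<lambda>h. h *\<^sub>R tangent_map A f p v)) (at 0)"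
    by (rule has_derivative_transform_eventually[OF D ev]) (simp_all add: \<gamma>0)
  then have "(\<lambda>h. h *\<^sub>R tangent_map A f p v) = (\<lambda>h. 0)"
    by (rule has_derivative_unique[OF _ has_derivative_const])
  from fun_cong[OF this, of 1] show ?case
    using 1(2,6) by (simp add: differential_apply[OF 1(4,1,2)])
qed

end

section \<open>Integrality of the change of frame\<close>

context nci
begin

lemma pull_kernel_diff:
  assumes "\<xi> \<in> pull_kernel M B \<phi> b" "\<eta> \<in> pull_kernel M B \<phi> b"
  shows "\<xi> - \<eta> \<in> pull_kernel M B \<phi> b"
  using assms by (simp add: pull_kernel_def linear_diff[OF pb_linear] linear_diff[OF PM.sharp_linear])

lemma action_vector_fiber:
  assumes \<alpha>: "\<alpha> \<in> action_fiber M B \<phi> (\<phi> m)" and \<xi>: "\<xi> \<in> \<alpha>"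
  shows "action_vector M B \<phi> \<alpha> m = sharp M m (pb m \<xi>)"
proof (rule action_vector_class[OF \<xi>])
  obtain \<zeta> where \<zeta>: "\<alpha> = action_class M B \<phi> (\<phi> m) \<zeta>" using \<alpha> by (auto simp: action_fiber_def)
  have *: "\<eta> - \<zeta> \<in> pull_kernel M B \<phi> (\<phi> m)" if "\<eta> \<in> \<alpha>" for \<eta>
    using that unfolding \<zeta> action_class_def by blast
  fix \<eta> assume "\<eta> \<in> \<alpha>"
  from pull_kernel_diff[OF *[OF this] *[OF \<xi>]] show "\<eta> - \<xi> \<in> pull_kernel M B \<phi> (\<phi> m)" by simp
qed

end

context nci_angle
begin

lemma frame_action_lattice: "i < r \<Longrightarrow> b \<in> V \<Longrightarrow> e i b \<in> action_lattice M B \<phi> b"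
  using triv by (simp add: lattice_trivialization_def lattice_section_def)

text \<open>\<open>class_comb\<close> allows any representatives of the cosets. Pullback and sharp
  are linear, so one choice of representatives already gives an integral combination of the action
  vectors.\<close>

lemma lattice_action_vector:
  assumes m: "\<phi> m \<in> V" and \<alpha>: "\<alpha> \<in> action_lattice M B \<phi> (\<phi> m)"
  obtains n :: "nat \<Rightarrow> int" where "action_vector M B \<phi> \<alpha> m = (\<Sum>i<r. of_int (n i) *\<^sub>R act i m)"
proof -
  have fib: "\<alpha> \<in> action_fiber M B \<phi> (\<phi> m)" using \<alpha> by (simp add: action_lattice_def)
  then obtain \<xi> where "\<xi> \<in> sharp_kernel B (\<phi> m)" "\<alpha> = action_class M B \<phi> (\<phi> m) \<xi>" by (auto simp: action_fiber_def)
  then have \<xi>: "\<xi> \<in> \<alpha>" using zero_pull_kernel by (simp add: action_class_def)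
  have "\<forall>l\<in>action_lattice M B \<phi> (\<phi> m). \<exists>n. l = class_comb M B \<phi> (\<phi> m) r n (\<lambda>i. e i (\<phi> m))"
    using triv m by (simp add: lattice_trivialization_def)
  from bspec[OF this \<alpha>] obtain n where n: "\<alpha> = class_comb M B \<phi> (\<phi> m) r n (\<lambda>i. e i (\<phi> m))" ..
  from \<xi> obtain \<eta> where \<eta>: "\<forall>i<r. \<eta> i \<in> e i (\<phi> m)"
    and "\<xi> \<in> action_class M B \<phi> (\<phi> m) (\<Sum>i<r. of_int (n i) *\<^sub>R \<eta> i)"
    unfolding n class_comb_def by blast
  then have "sharp M m (pb m (\<xi> - (\<Sum>i<r. of_int (n i) *\<^sub>R \<eta> i))) = 0"
    by (simp add: action_class_def pull_kernel_def)
  then have "sharp M m (pb m \<xi>) = (\<Sum>i<r. of_int (n i) *\<^sub>R sharp M m (pb m (\<eta> i)))"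
    by (simp add: linear_diff[OF pb_linear] linear_diff[OF PM.sharp_linear] linear_sum[OF pb_linear]
        linear_sum[OF PM.sharp_linear] linear_scale[OF pb_linear] linear_scale[OF PM.sharp_linear])
  also have "\<dots> = (\<Sum>i<r. of_int (n i) *\<^sub>R act i m)"
  proof (rule sum.cong[OF refl])
    fix i assume "i \<in> {..<r}"
    then have i: "i < r" by simp
    have "e i (\<phi> m) \<in> action_fiber M B \<phi> (\<phi> m)" using frame_action_lattice[OF i m] by (simp add: action_lattice_def)
    from action_vector_fiber[OF this, of "\<eta> i"] show "of_int (n i) *\<^sub>R sharp M m (pb m (\<eta> i)) = of_int (n i) *\<^sub>R act i m"
      using \<eta> i by (simp add: section_field_def)
  qed
  finally show thesis
    using that[of n] unfolding action_vector_fiber[OF fib \<xi>] by simp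
qed

text \<open>Duality with the action frame reads off one of the integral coefficients.\<close>

lemma d\<theta>_lattice_Ints:
  assumes m: "\<phi> m \<in> V" and \<alpha>: "\<alpha> \<in> action_lattice M B \<phi> (\<phi> m)" and j: "j < r"
  shows "blinfun_apply (d\<theta> j m) (action_vector M B \<phi> \<alpha> m) \<in> \<int>"
proof (rule lattice_action_vector[OF m \<alpha>], goal_cases)
  case (1 n)
  have "blinfun_apply (d\<theta> j m) (action_vector M B \<phi> \<alpha> m) = (\<Sum>i<r. of_int (n i) * (if i = j then 1 else 0))"
    unfolding 1 blinfun.sum_right blinfun.scaleR_right
    by (rule sum.cong[OF refl]) (simp add: d\<theta>_act[OF _ j m])
  also have "\<dots> = of_int (n j)" by (rule sum_mult_delta(1)[OF j])
  finally show ?case by (rule ssubst) (rule Ints_of_int)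
qed

text \<open>A plaque lies in one leaf, and a leaf lies in a level set of the angle
  variables.\<close>

lemma d\<theta>_tangent:
  assumes F: "foliation (atlas M) (\<phi> -` V) k (level_foliation r (\<phi> -` V) \<theta>)" and m: "\<phi> m \<in> V" and i: "i < r"
    and v: "v \<in> foliation_tangent (atlas M) k (level_foliation r (\<phi> -` V) \<theta>) m"
  shows "blinfun_apply (d\<theta> i m) v = 0"
proof -
  let ?G = "level_foliation r (\<phi> -` V) \<theta>"
  obtain c K where c: "m \<in> fst c" "foliated_chart (atlas M) k ?G c K" and v': "tangent_map (atlas M) (snd c) m v \<in> span K"
    using v unfolding foliation_tangent_def by blast
  have "m \<in> \<Union>?G" using F m by (simp add: foliation_def partition_on_def)
  then obtain L where L: "L \<in> ?G" "m \<in> L" by blast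
  have "path_component_set (L \<inter> fst c) m = plaque c K m" using c L by (simp add: foliated_chart_def)
  then have sub: "plaque c K m \<subseteq> L" using path_component_subset[of "L \<inter> fst c" m] by blast
  show ?thesis
  proof (rule PM.circle_differential_plaque[OF _ _ c(1) smooth_\<theta>[OF i] _ _ v'])
    show "\<theta> i q = \<theta> i m" if "q \<in> plaque c K m" for q
      by (rule level_foliation_constant[OF L(1,2) subsetD[OF sub that] i])
  qed (use c m in \<open>auto simp: foliated_chart_def\<close>)
qed

text \<open>Both families of differentials vanish on the leaf directions of the common foliation, so
  \<open>d\<theta>'\<^sub>j = \<Sum>\<^sub>i d\<theta>'\<^sub>j(A\<^sub>i) d\<theta>\<^sub>i\<close> for the action fields \<open>A\<^sub>i\<close> of the frame \<open>e\<close>; the coefficients are integers,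
  because \<open>A\<^sub>i\<close> is an integral combination of the action fields of the frame \<open>e'\<close>.\<close>

lemma Y_int_span:
  assumes other: "nci_angle M B \<phi> r V e' \<theta>'" and G: "angle_foliation M B \<phi> V G"
    and level: "G = level_foliation r (\<phi> -` V) \<theta>" "G = level_foliation r (\<phi> -` V) \<theta>'"
    and j: "j < r" and b: "b \<in> V"
  shows "angle_field M B \<phi> (\<theta>' j) b \<in> int_span r (\<lambda>i. Y i b)"
proof -
  interpret o: nci_angle M B \<phi> r V e' \<theta>' by (rule other)
  obtain m where m: "\<phi> m = b" using surj_phi by (metis surjD)
  have mV: "\<phi> m \<in> V" "m \<in> \<phi> -` V" using b m by auto
  obtain k where F: "foliation (atlas M) (\<phi> -` V) k G"
    and compl: "\<forall>m\<in>\<phi> -` V. {v + w | v w. v \<in> foliation_tangent (atlas M) k G m \<and> dphi m w = 0} = UNIV"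
    using G unfolding angle_foliation_def by blast
  have split: "\<exists>t u. t \<in> foliation_tangent (atlas M) k G m \<and> dphi m u = 0 \<and> v = t + u" for v
  proof -
    have "v \<in> {v + w | v w. v \<in> foliation_tangent (atlas M) k G m \<and> dphi m w = 0}"
      unfolding bspec[OF compl mV(2)] by (rule UNIV_I)
    then show ?thesis by blast
  qed
  define d' where "d' = circle_differential (atlas M) (\<theta>' j) m"
  define a where "a = (\<lambda>i. blinfun_apply d' (act i m))"
  \<comment> \<open>The defect of the expansion. It vanishes on leaf directions together with all
    the differentials, and on the action vectors by the choice of \<open>a\<close>; by
    transversality these directions span the tangent space.\<close>
  define l where "l = d' - (\<Sum>i<r. a i *\<^sub>R d\<theta> i m)"
  have l_apply: "blinfun_apply l v = blinfun_apply d' v - (\<Sum>i<r. a i * blinfun_apply (d\<theta> i m) v)" for v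
    by (simp add: l_def blinfun.diff_left blinfun.sum_left blinfun.scaleR_left)
  have lin: "linear (blinfun_apply l)" by (rule bounded_linear.linear[OF blinfun.bounded_linear_right])
  have "blinfun_apply l v = 0" for v
  proof -
    obtain t u where tu: "t \<in> foliation_tangent (atlas M) k G m" "dphi m u = 0" "v = t + u" using split by blast
    have "blinfun_apply d' t = 0"
      unfolding d'_def by (rule o.d\<theta>_tangent[OF F[unfolded level(2)] mV(1) j tu(1)[unfolded level(2)]])
    moreover have "blinfun_apply (d\<theta> i m) t = 0" if "i < r" for i
      by (rule d\<theta>_tangent[OF F[unfolded level(1)] mV(1) that tu(1)[unfolded level(1)]])
    ultimately have "blinfun_apply l t = 0" by (simp add: l_apply)
    moreover have "blinfun_apply l u = 0"
    proof (rule linear_zero_vertical[OF mV(1) lin _ tu(2)])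
      fix i assume i: "i < r"
      have "(\<Sum>i'<r. a i' * blinfun_apply (d\<theta> i' m) (act i m)) = (\<Sum>i'<r. a i' * (if i = i' then 1 else 0))"
        by (rule sum.cong[OF refl]) (simp add: d\<theta>_act[OF i _ mV(1)])
      also have "\<dots> = blinfun_apply d' (act i m)" unfolding sum_mult_delta(2)[OF i] by (simp add: a_def)
      finally show "blinfun_apply l (act i m) = 0" unfolding l_apply by (rule iffD2[OF right_minus_eq sym])
    qed
    ultimately show ?thesis using tu(3) by (simp add: blinfun.add_right)
  qed
  then have "l = 0" by (intro blinfun_eqI) simp
  then have d': "d' = (\<Sum>i<r. a i *\<^sub>R d\<theta> i m)" by (simp add: l_def)
  have "a i \<in> \<int>" if "i < r" for i
    using o.d\<theta>_lattice_Ints[OF mV(1) frame_action_lattice[OF that mV(1)] j] unfolding a_def d'_def section_field_def .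
  then have "\<forall>i\<in>{..<r}. \<exists>n. a i = of_int n" by (auto elim: Ints_cases)
  then obtain n where n: "\<forall>i\<in>{..<r}. a i = of_int (n i)" by (rule bchoice[elim_format]) blast
  \<comment> \<open>Sharp and the differential of \<phi> are linear and carry the coefficients over
    to the projected fields, evaluated at one point \<open>m\<close> over \<open>b\<close>.\<close>
  have "circle_hamiltonian M (\<theta>' j) m = (\<Sum>i<r. a i *\<^sub>R circle_hamiltonian M (\<theta> i) m)"
    unfolding circle_hamiltonian_def d'_def[symmetric] d'
    by (simp add: linear_sum[OF PM.sharp_linear] linear_scale[OF PM.sharp_linear] sum_negf)
  then have "dphi m (circle_hamiltonian M (\<theta>' j) m) = (\<Sum>i<r. a i *\<^sub>R dphi m (circle_hamiltonian M (\<theta> i) m))"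
    by (simp add: linear_sum[OF dphi_linear] linear_scale[OF dphi_linear])
  then have "angle_field M B \<phi> (\<theta>' j) b = (\<Sum>i<r. a i *\<^sub>R dphi m (circle_hamiltonian M (\<theta> i) m))"
    unfolding o.dphi_circle_hamiltonian[OF j mV(1)] m .
  also have "\<dots> = (\<Sum>i<r. of_int (n i) *\<^sub>R Y i b)"
  proof (rule sum.cong[OF refl])
    fix i assume i: "i \<in> {..<r}"
    then have "dphi m (circle_hamiltonian M (\<theta> i) m) = Y i b" using dphi_circle_hamiltonian[OF _ mV(1), of i] m by simp
    then show "a i *\<^sub>R dphi m (circle_hamiltonian M (\<theta> i) m) = of_int (n i) *\<^sub>R Y i b" using bspec[OF n i] by simp
  qed
  finally show ?thesis unfolding int_span_def by blast
qed

text \<open>An inclusion is enough, since the roles of the two systems of angle variables can be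
  exchanged.\<close>

lemma angle_lattice_subset:
  assumes "nci_angle M B \<phi> r V e' \<theta>'" "angle_foliation M B \<phi> V G"
    and "G = level_foliation r (\<phi> -` V) \<theta>" "G = level_foliation r (\<phi> -` V) \<theta>'" and b: "b \<in> V"
  shows "angle_lattice M B \<phi> r \<theta>' b \<subseteq> angle_lattice M B \<phi> r \<theta> b"
    and "angle_distribution M B \<phi> r \<theta>' b \<subseteq> angle_distribution M B \<phi> r \<theta> b"
proof -
  have Y': "angle_field M B \<phi> (\<theta>' j) b \<in> int_span r (\<lambda>i. Y i b)" if "j < r" for j
    by (rule Y_int_span[OF assms(1-4) that b])
  then show "angle_lattice M B \<phi> r \<theta>' b \<subseteq> angle_lattice M B \<phi> r \<theta> b"
    unfolding angle_lattice_def by (rule int_span_mono)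
  show "angle_distribution M B \<phi> r \<theta>' b \<subseteq> angle_distribution M B \<phi> r \<theta> b"
    unfolding angle_distribution_def
    by (rule span_minimal) (use Y' int_span_subset_span[of r "\<lambda>i. Y i b"] in auto)
qed

text \<open>Integrability gives existence; uniqueness holds because leaves are recovered from their
  tangent spaces.\<close>

lemma tangent_foliation_unique:
  "\<exists>!T. foliation (atlas B) V r T \<and> (\<forall>b\<in>V. foliation_tangent (atlas B) r T b = angle_distribution M B \<phi> r \<theta> b)"
proof (rule PB.foliation_exists[OF V integrable_angle_distribution], goal_cases)
  case (1 T)
  show ?case
  proof (rule ex1I[of _ T])
    show "foliation (atlas B) V r T \<and> (\<forall>b\<in>V. foliation_tangent (atlas B) r T b = angle_distribution M B \<phi> r \<theta> b)"
      using 1 by blast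
    fix T' assume T': "foliation (atlas B) V r T' \<and> (\<forall>b\<in>V. foliation_tangent (atlas B) r T' b = angle_distribution M B \<phi> r \<theta> b)"
    show "T' = T"
      by (rule PB.foliation_unique[OF conjunct1[OF T'] 1(1)]) (use T' 1(2) in simp)
  qed
qed

end

theorem proposition4p9:
  fixes M :: "('a::{t2_space,second_countable_topology}, 'e::euclidean_space) poisson_manifold"
    and B :: "('b::{t2_space,second_countable_topology}, 'f::euclidean_space) poisson_manifold"
    and \<phi> :: "'a \<Rightarrow> 'b" and r :: nat and V :: "'b set"
    and G :: "'a set set" and \<theta> :: "nat \<Rightarrow> 'a \<Rightarrow> circle"
  assumes "nci_system M B \<phi> r"
    and "compact_fibers \<phi>"
    and "open V"
    and "angle_foliation M B \<phi> V G"
    and "local_angle_variables M B \<phi> r V \<theta>"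
    and "G = level_foliation r (\<phi> -` V) \<theta>"
  shows "integrable_distribution (atlas B) V r (angle_distribution M B \<phi> r \<theta>) \<and>
         (\<forall>\<theta>'. local_angle_variables M B \<phi> r V \<theta>' \<and> G = level_foliation r (\<phi> -` V) \<theta>' \<longrightarrow>
           (\<forall>b\<in>V. angle_distribution M B \<phi> r \<theta>' b = angle_distribution M B \<phi> r \<theta> b \<and>
                  angle_lattice M B \<phi> r \<theta>' b = angle_lattice M B \<phi> r \<theta> b)) \<and>
         (\<exists>!T. foliation (atlas B) V r T \<and>
           (\<forall>b\<in>V. foliation_tangent (atlas B) r T b = angle_distribution M B \<phi> r \<theta> b)) \<and>
         lattice_bundle (atlas B) V r (angle_distribution M B \<phi> r \<theta>) (angle_lattice M B \<phi> r \<theta>)"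
proof -
  have angle: "\<exists>e. nci_angle M B \<phi> r V e \<theta>'" if "local_angle_variables M B \<phi> r V \<theta>'" for \<theta>'
    using that assms(1-3) unfolding local_angle_variables_def
    by (blast intro: nci_angle.intro nci.intro nci_angle_axioms.intro)
  obtain e where e: "nci_angle M B \<phi> r V e \<theta>" using angle[OF assms(5)] ..
  show ?thesis
  proof (intro conjI allI impI ballI)
    show "integrable_distribution (atlas B) V r (angle_distribution M B \<phi> r \<theta>)"
      by (rule nci_angle.integrable_angle_distribution[OF e])
    show "lattice_bundle (atlas B) V r (angle_distribution M B \<phi> r \<theta>) (angle_lattice M B \<phi> r \<theta>)"
      by (rule nci_angle.angle_lattice_bundle[OF e])
    show "\<exists>!T. foliation (atlas B) V r T \<and>
        (\<forall>b\<in>V. foliation_tangent (atlas B) r T b = angle_distribution M B \<phi> r \<theta> b)"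
      by (rule nci_angle.tangent_foliation_unique[OF e])
    fix \<theta>' b assume \<theta>': "local_angle_variables M B \<phi> r V \<theta>' \<and> G = level_foliation r (\<phi> -` V) \<theta>'" and b: "b \<in> V"
    obtain e' where e': "nci_angle M B \<phi> r V e' \<theta>'" using angle[OF conjunct1[OF \<theta>']] ..
    note sub = nci_angle.angle_lattice_subset[OF e e' assms(4,6) conjunct2[OF \<theta>'] b]
      nci_angle.angle_lattice_subset[OF e' e assms(4) conjunct2[OF \<theta>'] assms(6) b]
    show "angle_lattice M B \<phi> r \<theta>' b = angle_lattice M B \<phi> r \<theta> b" by (rule equalityI[OF sub(1,3)])
    show "angle_distribution M B \<phi> r \<theta>' b = angle_distribution M B \<phi> r \<theta> b" by (rule equalityI[OF sub(2,4)])
  qed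
qed

end
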